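(* Let $\ell\in\{1,2\}$ and let $P\in\mathcal M^{\ast,\ell}_{S,\mathbf K(\Theta)}$. For $\rho\in\mathfrak M_+(D)$, a probability measure $Q$ on $\Sigma$, a function $\beta(x,\theta)=\gamma(x)+\alpha(\theta)$ in $\mathcal F^\ell_{P,\Theta}$ and $\xi\in\mathcal R_+(D)$ consider the conditions (A) $\gamma=\ln f$, where $f$ is a $P_{X_1}$-a.s. positive Radon–Nikodým derivative of $Q_{X_1}$ with respect to $P_{X_1}$; (B) $\xi$ is a Radon–Nikodým derivative of $Q_\Theta$ with respect to $P_\Theta$; (C) $\alpha(\Theta)=\ln\rho(\Theta)+\ln\mathbb E_P[W_1\mid\Theta]$ $P\restriction\sigma(\Theta)$-a.s.; (D) $Q(A)=\int_A M^{(\beta)}_t(\Theta)\,dP$ for all $0\le s\le t$ and $A\in\mathcal F_s$, where $$M^{(\beta)}_t(\Theta):=\xi(\Theta)\cdot\frac{e^{S^{(\gamma)}_t-\rho(\Theta)\cdot J_t}}{1-\mathbf K(\Theta)(J_t)}\cdot\prod_{j=1}^{N_t}\frac{d\mathbf{Exp}(\rho(\Theta))}{d\mathbf K(\Theta)}(W_j),\qquad J_t:=t-T_{N_t}.$$ Given $\beta$, let $V(\Theta):=\{V_t(\Theta)\}_{t\in\mathbb R_+}$ with $$V_t(\Theta):=S_t-t\cdot\frac{\mathbb E_P[X_1\cdot e^{\beta(X_1,\Theta)}\mid\Theta]}{\mathbb E_P[W_1\mid\Theta]}\quad(t\ge0).$$ Then the following hold. (i) For every pair $(\rho,Q)$ with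 $\rho\in\mathfrak M_+(D)$ and $Q\in\mathcal M^{\ast,\ell}_{S,\mathbf{Exp}(\rho(\Theta))}$ there exists an essentially unique pair $(\beta,\xi)\in\mathcal F^\ell_{P,\Theta}\times\mathcal R^{\ast,\ell}_+(D)$ satisfying (A), (B), (C) and (D), so that $Q$ is an $\ell$-martingale measure for the process $V(\Theta)$. (ii) Conversely, for every pair $(\beta,\xi)\in\mathcal F^\ell_{P,\Theta}\times\mathcal R^{\ast,\ell}_+(D)$ there exists a unique pair $(\rho,Q)$ with $\rho\in\mathfrak M_+(D)$ and $Q\in\mathcal M^{\ast,\ell}_{S,\mathbf{Exp}(\rho(\Theta))}$, determined by (C) and (D) and satisfying (A) and (B), so that $Q$ is an $\ell$-martingale measure for $V(\Theta)$. (iii) In both cases (i) and (ii) there exist an essentially unique regular conditional probability $\{Q_\theta\}_{\theta\in D}$ of $Q$ over $Q_\Theta$ consistent with $\Theta$ and a $P_\Theta$-null set $L\in\mathfrak B(D)$ such that for every $\theta\notin L$: $Q_\theta\in\mathcal M^{\ast,\ell}_{S,\mathbf{Exp}(\rho(\theta))}$; condition (A) holds; $\rho(\theta)=e^{\alpha(\theta)}/\mathbb E_{P_\theta}[W_1]$; $$Q_\theta(A)=\int_A\widetilde M^{(\beta)}_t(\theta)\,dP_\theta\quad\text{for all }0\le s\le t,\ A\in\mathcal F_s,$$ where $$\widetilde M^{(\beta)}_t(\theta):=\frac{e^{S^{(\gamma)}_t-\rho(\theta)\cdot J_t}}{1-\mathbf K(\theta)(J_t)}\cdot\prod_{j=1}^{N_t}\frac{d\mathbf{Exp}(\rho(\theta))}{d\mathbf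 K(\theta)}(W_j);$$ so that $Q_\theta$ is an $\ell$-martingale measure for the process $V(\theta):=\{V_t(\theta)\}_{t\in\mathbb R_+}$ with $V_t(\theta):=S_t-t\cdot\frac{\mathbb E_{P_\theta}[X_1\cdot e^{\beta(X_1,\theta)}]}{\mathbb E_{P_\theta}[W_1]}$ for $t\ge0$.
   Context: **Probability space.** $D\subseteq\mathbb R^d$ ($d\in\mathbb N$), $\mathfrak B(\cdot)$ denotes Borel $\sigma$-algebras, $\Omega:=(0,\infty)^{\mathbb N}\times(0,\infty)^{\mathbb N}\times D$, $\Sigma:=\mathfrak B(\Omega)$. $W=\{W_n\}_{n\in\mathbb N}$, $X=\{X_n\}_{n\in\mathbb N}$ are the coordinate processes of the first and second factor, $\Theta$ is the projection onto $D$. Given are a probability measure $\mu$ on $\mathfrak B(D)$, a probability measure $R$ on $\mathfrak B(0,\infty)$, and probability measures $\mathbf K(\theta)$ ($\theta\in D$) on $\mathfrak B(0,\infty)$ with $\theta\mapsto\mathbf K(\theta)(B)$ measurable for every Borel $B$. $P_\theta$ is the probability measure on $\Sigma$ under which the $W_n$ are i.i.d. with law $\mathbf K(\theta)$, the $X_n$ are i.i.d. with law $R$, $W$ and $X$ are independent, and $\Theta=\theta$ a.s.; $P(E):=\int_D P_\theta(E)\,\mu(d\theta)$. Thus $P_\Theta=\mu$ and $\{P_\theta\}_{\theta\in D}$ is a regular conditional probability of $P$ over $P_\Theta$ consistent with $\Theta$. For a random variable $Y$ and measure $Q$, $Q_Y$ is the law of $Y$ under $Q$. The same symbol $\mathbf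 K(\theta)$ denotes the law and its distribution function; $\mathbf K(\Theta)$ is $\mathbf K(\theta)$ evaluated at $\theta=\Theta(\omega)$. $\mathbf{Exp}(b)$ is the exponential law with rate $b$. $\frac{d\mathbf{Exp}(\cdot)}{d\mathbf K(\cdot)}$ denotes a Radon–Nikodým derivative. **Processes.** $T_0:=0$, $T_n:=\sum_{k=1}^nW_k$; $N_t:=\sum_{n\ge1}\mathbb 1_{\{T_n\le t\}}$; $S_t:=\sum_{k=1}^{N_t}X_k$. For real-valued Borel $\gamma$ on $(0,\infty)$ with $\mathbb E_P[e^{\gamma(X_1)}]=1$ put $S^{(\gamma)}_t:=\sum_{j=1}^{N_t}\gamma(X_j)$. $\mathcal F_t:=\sigma(\sigma(S_u:u\le t)\cup\sigma(\Theta))$, $\mathcal F:=\{\mathcal F_t\}_{t\ge0}$; one has $\Sigma=\mathcal F_\infty:=\sigma(\bigcup_t\mathcal F_t)$. **Regular conditional probabilities.** A family $\{Q_\theta\}_{\theta\in D}$ of probability measures on $\Sigma$ is a regular conditional probability (rcp) of $Q$ over $Q_\Theta$ if $\theta\mapsto Q_\theta(E)$ is $\mathfrak B(D)$-measurable and $\int Q_\theta(E)\,Q_\Theta(d\theta)=Q(E)$ for all $E\in\Sigma$; it is consistent with $\Theta$ if for each $B\in\mathfrak B(D)$, $Q_\theta(\Theta^{-1}(B))=1$ for $Q_\Theta$-a.e. $\theta\in B$; it is essentially unique if any two such families coincide outside a $Q_\Theta$-null set. An essentially unique pair $(\beta,\xi)$ means unique up to null sets ($\gamma$ up to $P_{X_1}$-null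 sets, $\alpha$ and $\xi$ up to $P_\Theta$-null sets). **Compound mixed renewal processes.** Under a probability measure $Q$, $S$ is a $Q$-CMRP$(\mathbf\Lambda(\rho(\Theta)),Q_{X_1})$ if $X$ is $Q$-i.i.d., $N$ and $X$ are $Q$-independent, $W$ is $Q$-conditionally independent given $\Theta$, and for every $n$ the conditional law of $W_n$ given $\Theta$ is $\mathbf\Lambda(\rho(\Theta))$, $Q\restriction\sigma(\Theta)$-a.s. $S$ is a $Q_\theta$-CRP$(\mathbf\Lambda(\rho(\theta)),(Q_\theta)_{X_1})$ if under $Q_\theta$ the $X_n$ are i.i.d., $N$ and $X$ are independent and the $W_n$ are i.i.d. with law $\mathbf\Lambda(\rho(\theta))$. Condition (a1): $W$ and $X$ are conditionally independent given $\Theta$. Condition (a2): $\Theta$ and $X$ are (unconditionally) independent. **Classes.** $\mathfrak M(D)$: real-valued $\mathfrak B(D)$-measurable functions on $D$; $\mathfrak M_+(D)$: its positive elements. - $\mathcal M^\ell_{S,\mathbf\Lambda(\rho(\Theta))}$: all probability measures $Q$ on $\Sigma$ satisfying (a1) and (a2), progressively equivalent to $P$ (i.e. $Q\restriction\mathcal F_t\sim P\restriction\mathcal F_t$ for all $t\ge0$), such that $S$ is a $Q$-CMRP$(\mathbf\Lambda(\rho(\Theta)),Q_{X_1})$ and $\mathbb E_Q[X_1^\ell]<\infty$. - $\mathcal M^{\ast,\ell}_{S,\mathbf\Lambda(\rho(\Theta))}$: all $Q\in\mathcal M^\ell_{S,\mathbf\Lambda(\rho(\Theta))}$ with $Q(\{\mathbb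 E_Q[W_1\mid\Theta]<\infty\})=1$ and $(1/\mathbb E_Q[W_1\mid\Theta])^\ell\in\mathcal L^1(Q)$. $\mathcal M^{\ast,\ell}_{S,\mathbf K(\Theta)}$ is the case $\mathbf\Lambda=\mathbf K$, $\rho=\mathrm{id}_D$. - For $\theta\in D$, $\mathcal M^{\ell}_{S,\mathbf\Lambda(\rho(\theta))}$: all probability measures $Q_\theta$ on $\Sigma$ with $Q_\theta\restriction\mathcal F_t\sim P_\theta\restriction\mathcal F_t$ for all $t\ge0$, such that $S$ is a $Q_\theta$-CRP$(\mathbf\Lambda(\rho(\theta)),(Q_\theta)_{X_1})$ and $\mathbb E_{Q_\theta}[X_1^\ell]<\infty$; $\mathcal M^{\ast,\ell}_{S,\mathbf\Lambda(\rho(\theta))}$: those $Q_\theta\in\mathcal M^{\ell}_{S,\mathbf\Lambda(\rho(\theta))}$ (members of the family $\{Q_\theta\}_{\theta\in D}$) for which $Q_\Theta(\{\mathbb E_{Q_\bullet}[W_1]<\infty\})=1$ and $(1/\mathbb E_{Q_\bullet}[W_1])^\ell\in\mathcal L^1(Q_\Theta)$. - $\mathcal F^\ell_{P,\Theta}$: all functions $\beta$ on $(0,\infty)\times D$ of the form $\beta(x,\theta)=\gamma(x)+\alpha(\theta)$ with $\alpha\in\mathfrak M(D)$ and $\gamma$ real-valued Borel on $(0,\infty)$, $\mathbb E_P[e^{\gamma(X_1)}]=1$, $\mathbb E_P[X_1^\ell e^{\gamma(X_1)}]<\infty$. - $\mathcal R_+(D)$: all $\xi\in\mathfrak M(D)$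 with $P_\Theta(\{\xi>0\})=1$ and $\mathbb E_P[\xi(\Theta)]=1$. - For given $\beta=\gamma+\alpha\in\mathcal F^\ell_{P,\Theta}$, $\mathcal R^{\ast,\ell}_+(D)$: all $\xi\in\mathcal R_+(D)$ with $\xi(\Theta)\cdot\big(e^{\alpha(\Theta)}/\mathbb E_P[W_1\mid\Theta]\big)^\ell\in\mathcal L^1(P)$. **Martingale measures.** A probability measure $Q$ on $\Sigma$ is an $\ell$-martingale measure for a process $Y=\{Y_t\}_{t\ge0}$ if $Y$ is an $\mathcal F$-adapted martingale under $Q$ with $Y_t\in\mathcal L^\ell(Q)$ for all $t$.
   Formalization: In (ii) it is additionally assumed that K(θ) is equivalent to the exponential laws for P_Θ-a.e. θ (for K(θ)=δ_1 no such Q exists; the condition is also necessary), and uniqueness of ρ is meant up to P_Θ-null sets. *)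

theory Defs
  imports "HOL-Probability.Probability"
begin

section \<open>The probability space\<close>

type_synonym 'd path = "(nat \<Rightarrow> real) \<times> (nat \<Rightarrow> real) \<times> (real ^ 'd)"

definition pos_borel :: "real measure" where
  "pos_borel = restrict_space borel {0<..}"

definition param_borel :: "(real ^ 'd::finite) set \<Rightarrow> (real ^ 'd) measure" where
  "param_borel D = restrict_space borel D"

text \<open>The measurable space \<open>(\<Omega>, \<Sigma>)\<close>. As \<open>\<Omega>\<close> is a countable product of second countable spaces,
  its Borel sigma-algebra is the product one; see \<open>sets_path_space_borel\<close>.\<close>

definition path_space :: "(real ^ 'd::finite) set \<Rightarrow> 'd path measure" where
  "path_space D =
     (\<Pi>\<^sub>M n\<in>UNIV. pos_borel) \<Otimes>\<^sub>M ((\<Pi>\<^sub>M n\<in>UNIV. pos_borel) \<Otimes>\<^sub>M param_borel D)"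

text \<open>Indices start at \<open>0\<close>: \<open>W n\<close> and \<open>X n\<close> are the \<open>(n+1)\<close>-st members of the processes.\<close>

definition W :: "nat \<Rightarrow> 'd path \<Rightarrow> real" where
  "W n \<omega> = fst \<omega> n"

definition X :: "nat \<Rightarrow> 'd path \<Rightarrow> real" where
  "X n \<omega> = fst (snd \<omega>) n"

definition Theta :: "'d path \<Rightarrow> real ^ 'd" where
  "Theta \<omega> = snd (snd \<omega>)"

lemma space_path_space:
  "space (path_space D) = {\<omega>. (\<forall>n. 0 < W n \<omega>) \<and> (\<forall>n. 0 < X n \<omega>) \<and> Theta \<omega> \<in> D}"
  by (auto simp: path_space_def space_pair_measure space_PiM pos_borel_def param_borel_def
      space_restrict_space W_def X_def Theta_def PiE_def Pi_def)

lemma sets_path_space_borel: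
  "sets (path_space D) = sets (restrict_space borel (space (path_space D)))"
proof
  let ?B = "restrict_space borel (space (path_space D))"
  have c: "continuous_on UNIV (\<lambda>f::nat \<Rightarrow> real. f n)" for n
    by (rule continuous_on_product_coordinates)
  have "W n \<in> borel_measurable borel" for n
    unfolding W_def
    by (intro borel_measurable_continuous_onI continuous_on_compose2[OF c] continuous_intros) auto
  then have W: "(\<lambda>\<omega>. W n \<omega>) \<in> ?B \<rightarrow>\<^sub>M pos_borel" for n
    unfolding pos_borel_def by (intro measurable_restrict_space2 measurable_restrict_space1)
      (auto simp: space_restrict_space space_path_space)
  have "X n \<in> borel_measurable borel" for n
    unfolding X_def
    by (intro borel_measurable_continuous_onI continuous_on_compose2[OF c] continuous_intros) auto
  then have X: "(\<lambda>\<omega>. X n \<omega>) \<in> ?B \<rightarrow>\<^sub>M pos_borel" for n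
    unfolding pos_borel_def by (intro measurable_restrict_space2 measurable_restrict_space1)
      (auto simp: space_restrict_space space_path_space)
  have "Theta \<in> borel_measurable borel"
    unfolding Theta_def by (intro borel_measurable_continuous_onI continuous_intros)
  then have Th: "(\<lambda>\<omega>. Theta \<omega>) \<in> ?B \<rightarrow>\<^sub>M param_borel D"
    unfolding param_borel_def by (intro measurable_restrict_space2 measurable_restrict_space1)
      (auto simp: space_restrict_space space_path_space)
  have "(\<lambda>\<omega>. (\<lambda>n. W n \<omega>, \<lambda>n. X n \<omega>, Theta \<omega>)) \<in> ?B \<rightarrow>\<^sub>M path_space D"
    by (subst (2) path_space_def, intro measurable_Pair measurable_PiM_single' W X Th)
      (use W X in \<open>auto dest: measurable_space\<close>)
  then have "(\<lambda>\<omega>. \<omega>) \<in> ?B \<rightarrow>\<^sub>M path_space D"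
    by (simp add: W_def X_def Theta_def)
  from measurable_sets[OF this] show "sets (path_space D) \<subseteq> sets ?B"
    using sets.sets_into_space by (fastforce simp: space_restrict_space Int_absorb2)
  have pos: "(\<lambda>x. x) \<in> pos_borel \<rightarrow>\<^sub>M borel"
    by (simp add: pos_borel_def measurable_restrict_space1)
  have "(\<lambda>f. f) \<in> (\<Pi>\<^sub>M n\<in>(UNIV::nat set). pos_borel) \<rightarrow>\<^sub>M (\<Pi>\<^sub>M n\<in>UNIV. borel)"
    by (intro measurable_PiM_single' measurable_compose[OF _ pos]) (auto simp: space_PiM)
  then have seq: "(\<lambda>f. f) \<in> (\<Pi>\<^sub>M n\<in>(UNIV::nat set). pos_borel) \<rightarrow>\<^sub>M borel"
    using measurable_cong_sets[OF refl sets_PiM_equal_borel] by blast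
  have par: "(\<lambda>x. x) \<in> param_borel D \<rightarrow>\<^sub>M borel"
    by (simp add: param_borel_def measurable_restrict_space1)
  have "(\<lambda>\<omega>. (fst \<omega>, fst (snd \<omega>), snd (snd \<omega>))) \<in> path_space D \<rightarrow>\<^sub>M borel"
    unfolding path_space_def borel_prod[symmetric]
    by (intro measurable_Pair measurable_compose[OF _ seq] measurable_compose[OF _ par]) simp_all
  then have "(\<lambda>\<omega>. \<omega>) \<in> path_space D \<rightarrow>\<^sub>M ?B"
    by (intro measurable_restrict_space2) auto
  from measurable_sets[OF this] show "sets ?B \<subseteq> sets (path_space D)"
    using sets.sets_into_space[of _ ?B] by (fastforce simp: space_restrict_space Int_absorb2)
qed

definition path_law ::
  "(real ^ 'd::finite) set \<Rightarrow> (real ^ 'd \<Rightarrow> real measure) \<Rightarrow> real measure \<Rightarrow> real ^ 'd \<Rightarrow> 'd path measure"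
where
  "path_law D K R \<theta> =
     (\<Pi>\<^sub>M n\<in>UNIV. K \<theta>) \<Otimes>\<^sub>M ((\<Pi>\<^sub>M n\<in>UNIV. R) \<Otimes>\<^sub>M return (param_borel D) \<theta>)"

definition mixed_law ::
  "(real ^ 'd::finite) set \<Rightarrow> (real ^ 'd) measure \<Rightarrow> (real ^ 'd \<Rightarrow> real measure) \<Rightarrow> real measure \<Rightarrow> 'd path measure"
where
  "mixed_law D \<mu> K R = \<mu> \<bind> path_law D K R"

definition Exp :: "real \<Rightarrow> real measure" where
  "Exp b = density (restrict_space lborel {0<..}) (\<lambda>x. ennreal (exponential_density b x))"

text \<open>Distribution function of a law on the positive half-line.\<close>

definition dist_fun :: "real measure \<Rightarrow> real \<Rightarrow> real" where
  "dist_fun M x = measure M {y \<in> space M. y \<le> x}"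


section \<open>The processes\<close>

definition T :: "nat \<Rightarrow> 'd path \<Rightarrow> real" where
  "T n \<omega> = (\<Sum>k<n. W k \<omega>)"

text \<open>On exploding paths, i.e. if \<open>T n \<omega> \<le> t\<close> for all \<open>n\<close>, this is \<open>0\<close> instead of infinity. Such paths
  have probability \<open>0\<close> whenever the \<open>W n\<close> are (conditionally) i.i.d. and positive, and the
  convention does not change the filtration below.\<close>

definition N :: "real \<Rightarrow> 'd path \<Rightarrow> nat" where
  "N t \<omega> = card {n. 1 \<le> n \<and> T n \<omega> \<le> t}"

definition S :: "real \<Rightarrow> 'd path \<Rightarrow> real" where
  "S t \<omega> = (\<Sum>k<N t \<omega>. X k \<omega>)"

definition S_gamma :: "(real \<Rightarrow> real) \<Rightarrow> real \<Rightarrow> 'd path \<Rightarrow> real" where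
  "S_gamma \<gamma> t \<omega> = (\<Sum>k<N t \<omega>. \<gamma> (X k \<omega>))"

definition J :: "real \<Rightarrow> 'd path \<Rightarrow> real" where
  "J t \<omega> = t - T (N t \<omega>) \<omega>"

definition sigma_Theta :: "(real ^ 'd::finite) set \<Rightarrow> 'd path measure" where
  "sigma_Theta D = vimage_algebra (space (path_space D)) Theta (param_borel D)"

definition sigma_W :: "(real ^ 'd::finite) set \<Rightarrow> 'd path measure" where
  "sigma_W D = vimage_algebra (space (path_space D)) (\<lambda>\<omega> n. W n \<omega>) (\<Pi>\<^sub>M n\<in>UNIV. pos_borel)"

definition sigma_X :: "(real ^ 'd::finite) set \<Rightarrow> 'd path measure" where
  "sigma_X D = vimage_algebra (space (path_space D)) (\<lambda>\<omega> n. X n \<omega>) (\<Pi>\<^sub>M n\<in>UNIV. pos_borel)"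

definition sigma_N :: "(real ^ 'd::finite) set \<Rightarrow> 'd path measure" where
  "sigma_N D = vimage_algebra (space (path_space D)) (\<lambda>\<omega>. \<lambda>t\<in>{0..}. N t \<omega>)
     (\<Pi>\<^sub>M t\<in>{0..}. count_space UNIV)"

definition Filt :: "(real ^ 'd::finite) set \<Rightarrow> real \<Rightarrow> 'd path measure" where
  "Filt D t = sigma (space (path_space D))
     ({S u -` B \<inter> space (path_space D) | u B. 0 \<le> u \<and> u \<le> t \<and> B \<in> sets borel} \<union> sets (sigma_Theta D))"


section \<open>Probabilistic notions\<close>

definition prob_on :: "'a measure \<Rightarrow> 'a measure set" where
  "prob_on M = {Q. prob_space Q \<and> sets Q = sets M}"

definition equiv_measure :: "'a measure \<Rightarrow> 'a measure \<Rightarrow> bool" where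
  "equiv_measure M M' \<longleftrightarrow>
     sets M = sets M' \<and> absolutely_continuous M M' \<and> absolutely_continuous M' M"

text \<open>\<open>g\<close> is a real-valued version of the Radon-Nikodym derivative of \<open>M'\<close> with respect to \<open>M\<close>.\<close>

definition rn_density :: "'a measure \<Rightarrow> 'a measure \<Rightarrow> ('a \<Rightarrow> real) \<Rightarrow> bool" where
  "rn_density M M' g \<longleftrightarrow> g \<in> borel_measurable M \<and> (AE x in M. 0 \<le> g x) \<and>
     M' = density M (\<lambda>x. ennreal (g x))"

definition cprob :: "'a measure \<Rightarrow> 'a measure \<Rightarrow> 'a set \<Rightarrow> 'a \<Rightarrow> real" where
  "cprob Q G A = real_cond_exp Q G (indicator A)"

text \<open>Conditional counterpart of \<^const>\<open>prob_space.indep_sets\<close>.\<close>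

definition cond_indep_sets :: "'a measure \<Rightarrow> 'a measure \<Rightarrow> ('i \<Rightarrow> 'a set set) \<Rightarrow> 'i set \<Rightarrow> bool" where
  "cond_indep_sets Q G F I \<longleftrightarrow> (\<forall>i\<in>I. F i \<subseteq> sets Q) \<and>
     (\<forall>L\<subseteq>I. L \<noteq> {} \<longrightarrow> finite L \<longrightarrow> (\<forall>A\<in>Pi L F.
        AE \<omega> in Q. cprob Q G (\<Inter>j\<in>L. A j) \<omega> = (\<Prod>j\<in>L. cprob Q G (A j) \<omega>)))"

definition prog_equiv :: "(real ^ 'd::finite) set \<Rightarrow> 'd path measure \<Rightarrow> 'd path measure \<Rightarrow> bool" where
  "prog_equiv D Q P \<longleftrightarrow>
     (\<forall>t\<ge>0. equiv_measure (restr_to_subalg Q (Filt D t)) (restr_to_subalg P (Filt D t)))"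

definition iid :: "'a measure \<Rightarrow> (nat \<Rightarrow> 'a \<Rightarrow> real) \<Rightarrow> bool" where
  "iid Q Y \<longleftrightarrow> prob_space.indep_vars Q (\<lambda>_. pos_borel) Y UNIV \<and>
     (\<forall>n. distr Q pos_borel (Y n) = distr Q pos_borel (Y 0))"

text \<open>In \<open>CMRP\<close> and in the classes below, \<open>Lam\<close> stands for the map \<open>\<theta> \<mapsto> \<Lambda>(\<rho>(\<theta>))\<close>.\<close>

definition CMRP :: "(real ^ 'd::finite) set \<Rightarrow> 'd path measure \<Rightarrow> (real ^ 'd \<Rightarrow> real measure) \<Rightarrow> bool" where
  "CMRP D Q Lam \<longleftrightarrow>
     iid Q X \<and>
     prob_space.indep_set Q (sets (sigma_N D)) (sets (sigma_X D)) \<and>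
     cond_indep_sets Q (sigma_Theta D)
       (\<lambda>n. {W n -` B \<inter> space Q | B. B \<in> sets pos_borel}) UNIV \<and>
     (\<forall>n. \<forall>B\<in>sets pos_borel. AE \<omega> in restr_to_subalg Q (sigma_Theta D).
        cprob Q (sigma_Theta D) (W n -` B \<inter> space Q) \<omega> = measure (Lam (Theta \<omega>)) B)"

definition CRP :: "(real ^ 'd::finite) set \<Rightarrow> 'd path measure \<Rightarrow> real measure \<Rightarrow> bool" where
  "CRP D Q law \<longleftrightarrow>
     iid Q X \<and>
     prob_space.indep_set Q (sets (sigma_N D)) (sets (sigma_X D)) \<and>
     iid Q W \<and> distr Q pos_borel (W 0) = law"

definition rcp :: "(real ^ 'd::finite) set \<Rightarrow> 'd path measure \<Rightarrow> (real ^ 'd \<Rightarrow> 'd path measure) \<Rightarrow> bool" where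
  "rcp D Q Qf \<longleftrightarrow>
     (\<forall>\<theta>\<in>D. Qf \<theta> \<in> prob_on (path_space D)) \<and>
     (\<forall>E\<in>sets (path_space D).
        (\<lambda>\<theta>. emeasure (Qf \<theta>) E) \<in> borel_measurable (param_borel D) \<and>
        (\<integral>\<^sup>+\<theta>. emeasure (Qf \<theta>) E \<partial>distr Q (param_borel D) Theta) = emeasure Q E)"

definition consistent :: "(real ^ 'd::finite) set \<Rightarrow> 'd path measure \<Rightarrow> (real ^ 'd \<Rightarrow> 'd path measure) \<Rightarrow> bool" where
  "consistent D Q Qf \<longleftrightarrow>
     (\<forall>B\<in>sets (param_borel D). AE \<theta> in distr Q (param_borel D) Theta.
        \<theta> \<in> B \<longrightarrow> emeasure (Qf \<theta>) (Theta -` B \<inter> space (path_space D)) = 1)"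

definition martingale_measure ::
  "nat \<Rightarrow> (real ^ 'd::finite) set \<Rightarrow> 'd path measure \<Rightarrow> (real \<Rightarrow> 'd path \<Rightarrow> real) \<Rightarrow> bool"
where
  "martingale_measure l D Q Y \<longleftrightarrow>
     (\<forall>t\<ge>0. Y t \<in> borel_measurable (Filt D t) \<and> integrable Q (Y t) \<and>
        integrable Q (\<lambda>\<omega>. \<bar>Y t \<omega>\<bar> ^ l)) \<and>
     (\<forall>s t. 0 \<le> s \<and> s \<le> t \<longrightarrow> (AE \<omega> in Q. real_cond_exp Q (Filt D s) (Y t) \<omega> = Y s \<omega>))"


section \<open>The classes\<close>

text \<open>\<open>E\<^sub>Q[W\<^sub>1 | \<Theta>]\<close>, with values in \<open>[0, \<infinity>]\<close>.\<close>

definition cexp_W :: "(real ^ 'd::finite) set \<Rightarrow> 'd path measure \<Rightarrow> 'd path \<Rightarrow> ennreal" where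
  "cexp_W D Q = nn_cond_exp Q (sigma_Theta D) (\<lambda>\<omega>. ennreal (W 0 \<omega>))"

definition M_class ::
  "nat \<Rightarrow> (real ^ 'd::finite) set \<Rightarrow> 'd path measure \<Rightarrow> (real ^ 'd \<Rightarrow> real measure) \<Rightarrow> 'd path measure set"
where
  "M_class l D P Lam = {Q \<in> prob_on (path_space D).
     cond_indep_sets Q (sigma_Theta D) (case_bool (sets (sigma_W D)) (sets (sigma_X D))) UNIV \<and>
     prob_space.indep_set Q (sets (sigma_Theta D)) (sets (sigma_X D)) \<and>
     prog_equiv D Q P \<and> CMRP D Q Lam \<and> integrable Q (\<lambda>\<omega>. X 0 \<omega> ^ l)}"

definition M_star ::
  "nat \<Rightarrow> (real ^ 'd::finite) set \<Rightarrow> 'd path measure \<Rightarrow> (real ^ 'd \<Rightarrow> real measure) \<Rightarrow> 'd path measure set"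
where
  "M_star l D P Lam = {Q \<in> M_class l D P Lam.
     (AE \<omega> in Q. cexp_W D Q \<omega> < \<infinity>) \<and>
     integrable Q (\<lambda>\<omega>. (1 / enn2real (cexp_W D Q \<omega>)) ^ l)}"

definition M_class_at ::
  "nat \<Rightarrow> (real ^ 'd::finite) set \<Rightarrow> 'd path measure \<Rightarrow> real measure \<Rightarrow> 'd path measure set"
where
  "M_class_at l D Pt law = {Q \<in> prob_on (path_space D).
     prog_equiv D Q Pt \<and> CRP D Q law \<and> integrable Q (\<lambda>\<omega>. X 0 \<omega> ^ l)}"

text \<open>\<open>QT\<close> is the law of \<open>\<Theta>\<close> under \<open>Q\<close>; the last two conditions concern the family \<open>Qf\<close> as a whole.\<close>

definition M_star_at ::
  "nat \<Rightarrow> (real ^ 'd::finite) set \<Rightarrow> (real ^ 'd) measure \<Rightarrow> (real ^ 'd \<Rightarrow> 'd path measure) \<Rightarrow>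
     'd path measure \<Rightarrow> real measure \<Rightarrow> 'd path measure set"
where
  "M_star_at l D QT Qf Pt law = {Q \<in> M_class_at l D Pt law. Q \<in> Qf ` D \<and>
     (AE \<theta> in QT. (\<integral>\<^sup>+\<omega>. ennreal (W 0 \<omega>) \<partial>Qf \<theta>) < \<infinity>) \<and>
     integrable QT (\<lambda>\<theta>. (1 / enn2real (\<integral>\<^sup>+\<omega>. ennreal (W 0 \<omega>) \<partial>Qf \<theta>)) ^ l)}"

definition M_plus :: "(real ^ 'd::finite) set \<Rightarrow> (real ^ 'd \<Rightarrow> real) set" where
  "M_plus D = {\<rho> \<in> borel_measurable (param_borel D). \<forall>\<theta>\<in>D. 0 < \<rho> \<theta>}"

text \<open>A function \<open>\<beta>(x,\<theta>) = \<gamma>(x) + \<alpha>(\<theta>)\<close> is represented by the pair \<open>(\<gamma>, \<alpha>)\<close>. On the relevant domain,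
  \<open>\<beta>\<close> determines \<open>\<gamma>\<close> and \<open>\<alpha>\<close>, since the normalization of \<open>\<gamma>\<close> excludes a shift by a constant.\<close>

definition F_class ::
  "nat \<Rightarrow> (real ^ 'd::finite) set \<Rightarrow> 'd path measure \<Rightarrow> ((real \<Rightarrow> real) \<times> (real ^ 'd \<Rightarrow> real)) set"
where
  "F_class l D P = {(\<gamma>, \<alpha>).
     \<gamma> \<in> borel_measurable pos_borel \<and> \<alpha> \<in> borel_measurable (param_borel D) \<and>
     integrable P (\<lambda>\<omega>. exp (\<gamma> (X 0 \<omega>))) \<and> (\<integral>\<omega>. exp (\<gamma> (X 0 \<omega>)) \<partial>P) = 1 \<and>
     integrable P (\<lambda>\<omega>. X 0 \<omega> ^ l * exp (\<gamma> (X 0 \<omega>)))}"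

definition R_plus :: "(real ^ 'd::finite) set \<Rightarrow> 'd path measure \<Rightarrow> (real ^ 'd \<Rightarrow> real) set" where
  "R_plus D P = {\<xi> \<in> borel_measurable (param_borel D).
     (AE \<theta> in distr P (param_borel D) Theta. 0 < \<xi> \<theta>) \<and>
     integrable P (\<lambda>\<omega>. \<xi> (Theta \<omega>)) \<and> (\<integral>\<omega>. \<xi> (Theta \<omega>) \<partial>P) = 1}"

definition R_star ::
  "nat \<Rightarrow> (real ^ 'd::finite) set \<Rightarrow> 'd path measure \<Rightarrow> (real ^ 'd \<Rightarrow> real) \<Rightarrow> (real ^ 'd \<Rightarrow> real) set"
where
  "R_star l D P \<alpha> = {\<xi> \<in> R_plus D P.
     integrable P (\<lambda>\<omega>. \<xi> (Theta \<omega>) * (exp (\<alpha> (Theta \<omega>)) / enn2real (cexp_W D P \<omega>)) ^ l)}"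


section \<open>The conditions (A)--(D) and the process V\<close>

text \<open>As \<open>f\<close> is only almost surely positive, \<open>\<gamma> = ln f\<close> is an almost sure identity.\<close>

definition cond_A :: "'d::finite path measure \<Rightarrow> 'd path measure \<Rightarrow> (real \<Rightarrow> real) \<Rightarrow> bool" where
  "cond_A P Q \<gamma> \<longleftrightarrow>
     (\<exists>f. rn_density (distr P pos_borel (X 0)) (distr Q pos_borel (X 0)) f \<and>
        (AE x in distr P pos_borel (X 0). 0 < f x) \<and>
        (AE x in distr P pos_borel (X 0). \<gamma> x = ln (f x)))"

definition cond_B ::
  "(real ^ 'd::finite) set \<Rightarrow> 'd path measure \<Rightarrow> 'd path measure \<Rightarrow> (real ^ 'd \<Rightarrow> real) \<Rightarrow> bool"
where
  "cond_B D P Q \<xi> \<longleftrightarrow>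
     rn_density (distr P (param_borel D) Theta) (distr Q (param_borel D) Theta) \<xi>"

definition cond_C ::
  "(real ^ 'd::finite) set \<Rightarrow> 'd path measure \<Rightarrow> (real ^ 'd \<Rightarrow> real) \<Rightarrow> (real ^ 'd \<Rightarrow> real) \<Rightarrow> bool"
where
  "cond_C D P \<rho> \<alpha> \<longleftrightarrow> (AE \<omega> in restr_to_subalg P (sigma_Theta D).
     \<alpha> (Theta \<omega>) = ln (\<rho> (Theta \<omega>)) + ln (enn2real (cexp_W D P \<omega>)))"

text \<open>\<open>Kt\<close>, \<open>b\<close> and \<open>g\<close> stand for \<open>K(\<theta>)\<close>, \<open>\<rho>(\<theta>)\<close> and a version of \<open>dExp(\<rho>(\<theta>))/dK(\<theta>)\<close>.\<close>

definition M_tilde ::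
  "real measure \<Rightarrow> real \<Rightarrow> (real \<Rightarrow> real) \<Rightarrow> (real \<Rightarrow> real) \<Rightarrow> real \<Rightarrow> 'd path \<Rightarrow> real"
where
  "M_tilde Kt b \<gamma> g t \<omega> =
     exp (S_gamma \<gamma> t \<omega> - b * J t \<omega>) / (1 - dist_fun Kt (J t \<omega>)) * (\<Prod>j<N t \<omega>. g (W j \<omega>))"

definition M_beta ::
  "(real ^ 'd \<Rightarrow> real measure) \<Rightarrow> (real ^ 'd \<Rightarrow> real) \<Rightarrow> (real \<Rightarrow> real) \<Rightarrow> (real ^ 'd \<Rightarrow> real) \<Rightarrow>
     (real ^ 'd \<Rightarrow> real \<Rightarrow> real) \<Rightarrow> real \<Rightarrow> 'd path \<Rightarrow> real"
where
  "M_beta K \<rho> \<gamma> \<xi> r t \<omega> =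
     \<xi> (Theta \<omega>) * M_tilde (K (Theta \<omega>)) (\<rho> (Theta \<omega>)) \<gamma> (r (Theta \<omega>)) t \<omega>"

text \<open>The derivatives \<open>r \<theta>\<close> of \<open>Exp(\<rho>(\<theta>))\<close> with respect to \<open>K(\<theta>)\<close> have to be chosen measurably
  in \<open>(\<theta>, w)\<close>; a separate choice for each \<open>\<theta>\<close>, such as \<^const>\<open>RN_deriv\<close>, need not make
  \<open>M_beta\<close> a random variable.\<close>

definition cond_D ::
  "(real ^ 'd::finite) set \<Rightarrow> (real ^ 'd \<Rightarrow> real measure) \<Rightarrow> 'd path measure \<Rightarrow> 'd path measure \<Rightarrow>
     (real ^ 'd \<Rightarrow> real) \<Rightarrow> (real \<Rightarrow> real) \<Rightarrow> (real ^ 'd \<Rightarrow> real) \<Rightarrow> bool"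
where
  "cond_D D K P Q \<rho> \<gamma> \<xi> \<longleftrightarrow>
     (\<exists>r. (\<lambda>(\<theta>, w). r \<theta> w) \<in> borel_measurable (param_borel D \<Otimes>\<^sub>M pos_borel) \<and>
        (AE \<theta> in distr P (param_borel D) Theta. rn_density (K \<theta>) (Exp (\<rho> \<theta>)) (r \<theta>)) \<and>
        (\<forall>s t. 0 \<le> s \<and> s \<le> t \<longrightarrow> (\<forall>A\<in>sets (Filt D s).
           measure Q A = (LINT \<omega>:A|P. M_beta K \<rho> \<gamma> \<xi> r t \<omega>))))"

definition cond_D_at ::
  "(real ^ 'd::finite) set \<Rightarrow> real measure \<Rightarrow> 'd path measure \<Rightarrow> 'd path measure \<Rightarrow>
     real \<Rightarrow> (real \<Rightarrow> real) \<Rightarrow> bool"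
where
  "cond_D_at D Kt Pt Qt b \<gamma> \<longleftrightarrow>
     (\<exists>g. rn_density Kt (Exp b) g \<and>
        (\<forall>s t. 0 \<le> s \<and> s \<le> t \<longrightarrow> (\<forall>A\<in>sets (Filt D s).
           measure Qt A = (LINT \<omega>:A|Pt. M_tilde Kt b \<gamma> g t \<omega>))))"

definition V ::
  "(real ^ 'd::finite) set \<Rightarrow> 'd path measure \<Rightarrow> (real \<Rightarrow> real) \<Rightarrow> (real ^ 'd \<Rightarrow> real) \<Rightarrow>
     real \<Rightarrow> 'd path \<Rightarrow> real"
where
  "V D P \<gamma> \<alpha> t \<omega> = S t \<omega> - t *
     (enn2real (nn_cond_exp P (sigma_Theta D)
        (\<lambda>\<omega>'. ennreal (X 0 \<omega>' * exp (\<gamma> (X 0 \<omega>') + \<alpha> (Theta \<omega>')))) \<omega>)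
      / enn2real (cexp_W D P \<omega>))"

definition V_at ::
  "'d::finite path measure \<Rightarrow> (real \<Rightarrow> real) \<Rightarrow> (real ^ 'd \<Rightarrow> real) \<Rightarrow> real ^ 'd \<Rightarrow>
     real \<Rightarrow> 'd path \<Rightarrow> real"
where
  "V_at Pt \<gamma> \<alpha> \<theta> t \<omega> = S t \<omega> - t *
     ((\<integral>\<omega>'. X 0 \<omega>' * exp (\<gamma> (X 0 \<omega>') + \<alpha> \<theta>) \<partial>Pt) / (\<integral>\<omega>'. W 0 \<omega>' \<partial>Pt))"

end

theory Submission
  imports Defs
begin

text \<open>
  Everything rests on one picture of the laws involved. For a kernel \<open>K\<close>, a jump law \<open>R\<close> and a point
  \<open>\<theta>\<close>, the renewal law \<open>path_law D K R \<theta>\<close> is a product measure, and mixing it over a law \<open>\<nu>\<close> of the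
  parameter gives \<open>mixed_law D \<nu> K R\<close>. A probability measure with the conditional structure demanded
  in the classes is always such a mixture, because that structure fixes the probability of every
  finite-dimensional rectangle (\<open>mixed_law_unique\<close>). The theorem therefore compares two mixtures, with
  data \<open>(\<mu>, K, R)\<close> and \<open>(\<nu>, Exp \<circ> \<rho>, R')\<close>, on the sigma-algebras of the filtration.

  From data to measures. On the event that exactly \<open>n\<close> claims have occurred by time \<open>t\<close>, an event of
  the filtration at time \<open>t\<close> depends only on the parameter and on the first \<open>n\<close> interarrival times and
  claim sizes (\<open>truncate_Filt\<close>). Replacing the data multiplies the integral over these coordinates by
  the product of the densities (\<open>nn_integral_PL_change\<close>). The interarrival time in progress enters only
  through the probability that it outlasts \<open>J t\<close>, which is the tail \<open>1 - dist_fun (K \<theta>) (J t)\<close>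
  under the old law and \<open>exp (- \<rho> \<theta> * J t)\<close> under the new one. Summation over \<open>n\<close> produces the density
  \<open>M_tilde\<close> (\<open>emeasure_PL_Filt\<close>), and mixing produces \<open>M_beta\<close> (\<open>emeasure_mixed_Filt\<close>). Where the
  densities of the data are positive, so are these, and the two laws are equivalent up to every time.

  From measures to data. Conversely, equivalence up to every time is inherited by the data
  (\<open>filtration_ac_imp_data_ac\<close>): the parameter is known at time \<open>0\<close>, the first claim size is \<open>S t\<close> on
  the event \<open>N t = 1\<close>, and the first interarrival time, capped at \<open>k\<close>, is known at time \<open>k\<close>. Here it
  matters that claim sizes are positive, so that \<open>S\<close> reveals \<open>N\<close>. The densities obtained
  are \<open>\<xi>\<close>, \<open>exp \<circ> \<gamma>\<close> and, from the joint law of parameter and first interarrival time, a jointly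
  measurable version of the derivatives of \<open>Exp (\<rho> \<theta>)\<close> with respect to \<open>K \<theta>\<close> (\<open>kernel_density\<close>).

  The martingale property. Given \<open>\<theta>\<close>, exponential interarrival times make \<open>S\<close> a compound Poisson
  process, with drift \<open>\<rho> \<theta>\<close> times the mean claim size. This is proved without independence of
  increments: redrawing the \<open>(n+1)\<close>-st interarrival time alone shows that the corresponding jump
  occurs with intensity \<open>\<rho> \<theta>\<close> while \<open>N = n\<close> (\<open>compensator\<close>). Summing over \<open>n\<close> yields the conditional
  mean of the increments and a bound for the second moment, which the case \<open>l = 2\<close> needs. Condition
  (C) states that this drift is the one subtracted in \<open>V\<close>.

  Uniqueness. The filtration generates the whole sigma-algebra (\<open>sets_path_space_Filt\<close>), so the
  density formula determines the measure. The functions \<open>\<gamma>\<close> and \<open>\<xi>\<close> are determined as densities of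
  the data, and (C) determines each of \<open>\<alpha>\<close> and \<open>\<rho>\<close> from the other. Regular conditional probabilities are determined up to null sets because the path
  space has a countably generated sigma-algebra (\<open>kernel_AE_eq\<close>). In the last part the
  conditional laws are the renewal laws with data \<open>(Exp \<circ> \<rho>, R')\<close> themselves. Each of them is a mixture
  over a point mass, which makes the results for mixtures available for every single \<open>\<theta>\<close>.
\<close>

section \<open>Path space and coordinate processes\<close>

lemma space_pos_borel [simp]: "space pos_borel = {0<..}"
  by (simp add: pos_borel_def space_restrict_space)

lemma measurable_pos_borel_iff:
  "f \<in> M \<rightarrow>\<^sub>M pos_borel \<longleftrightarrow> f \<in> borel_measurable M \<and> (\<forall>x\<in>space M. 0 < f x)"
  unfolding pos_borel_def measurable_restrict_space2_iff by auto

lemma measurable_ident_pos_borel [measurable]: "(\<lambda>x. x) \<in> borel_measurable pos_borel"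
  using measurable_pos_borel_iff[of "\<lambda>x. x" pos_borel] by simp

lemma measurable_pos_borel_borel: "f \<in> M \<rightarrow>\<^sub>M pos_borel \<Longrightarrow> f \<in> borel_measurable M"
  by (simp add: measurable_pos_borel_iff)

lemma space_param_borel [simp]: "space (param_borel D) = D"
  by (simp add: param_borel_def space_restrict_space)

lemma measurable_W [measurable]: "W n \<in> path_space D \<rightarrow>\<^sub>M pos_borel"
  unfolding path_space_def W_def by measurable

lemma measurable_X [measurable]: "X n \<in> path_space D \<rightarrow>\<^sub>M pos_borel"
  unfolding path_space_def X_def by measurable

lemma measurable_Theta [measurable]: "Theta \<in> path_space D \<rightarrow>\<^sub>M param_borel D"
  unfolding path_space_def Theta_def by measurable

lemma measurable_path_spaceI:
  assumes "\<And>n. (\<lambda>x. W n (f x)) \<in> M \<rightarrow>\<^sub>M pos_borel"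
    and "\<And>n. (\<lambda>x. X n (f x)) \<in> M \<rightarrow>\<^sub>M pos_borel"
    and "(\<lambda>x. Theta (f x)) \<in> M \<rightarrow>\<^sub>M param_borel D"
  shows "f \<in> M \<rightarrow>\<^sub>M path_space D"
proof -
  have "(\<lambda>x. (\<lambda>n. W n (f x), \<lambda>n. X n (f x), Theta (f x))) \<in> M \<rightarrow>\<^sub>M path_space D"
    unfolding path_space_def
    by (intro measurable_Pair measurable_PiM_single' assms)
      (use assms in \<open>auto simp: measurable_pos_borel_iff\<close>)
  then show ?thesis by (simp add: W_def X_def Theta_def)
qed

lemma path_eqI:
  assumes "\<And>n. W n \<omega> = W n \<omega>'" "\<And>n. X n \<omega> = X n \<omega>'" "Theta \<omega> = Theta \<omega>'"
  shows "\<omega> = \<omega>'"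
  using assms by (auto simp: W_def X_def Theta_def prod_eq_iff)

lemma path_space_pos:
  assumes "\<omega> \<in> space (path_space D)"
  shows "0 < W n \<omega>" "0 < X n \<omega>" "Theta \<omega> \<in> D"
  using assms by (auto simp: space_path_space)

subsection \<open>Jump times and counting process\<close>

definition explodes :: "real \<Rightarrow> 'd path \<Rightarrow> bool" where
  "explodes t \<omega> \<longleftrightarrow> (\<forall>n. T n \<omega> \<le> t)"

lemma T_0 [simp]: "T 0 \<omega> = 0" and T_Suc: "T (Suc n) \<omega> = T n \<omega> + W n \<omega>"
  by (simp_all add: T_def)

lemma explodes_mono: "explodes s \<omega> \<Longrightarrow> s \<le> t \<Longrightarrow> explodes t \<omega>"
  unfolding explodes_def by (meson order_trans)

lemma N_explodes: "explodes t \<omega> \<Longrightarrow> N t \<omega> = 0"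
proof -
  assume "explodes t \<omega>"
  then have "{n. 1 \<le> n \<and> T n \<omega> \<le> t} = {1..}" by (auto simp: explodes_def)
  then show ?thesis by (simp add: N_def infinite_Ici)
qed

context
  fixes \<omega> :: "'d path"
  assumes pos: "\<And>n. 0 < W n \<omega>"
begin

lemma T_strict_mono: "strict_mono (\<lambda>n. T n \<omega>)"
  by (rule strict_mono_Suc_iff[THEN iffD2]) (simp add: T_Suc pos)

lemma T_less_iff: "T m \<omega> < T n \<omega> \<longleftrightarrow> m < n"
  using strict_mono_less[OF T_strict_mono] by simp

lemma T_le_iff: "T m \<omega> \<le> T n \<omega> \<longleftrightarrow> m \<le> n"
  using strict_mono_less_eq[OF T_strict_mono] by simp

lemma T_nonneg: "0 \<le> T n \<omega>"
  using T_le_iff[of 0 n] by simp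

lemma N_eq:
  assumes "T n \<omega> \<le> t" "t < T (Suc n) \<omega>"
  shows "N t \<omega> = n"
proof -
  have "T m \<omega> \<le> t \<longleftrightarrow> m \<le> n" for m
  proof
    assume "T m \<omega> \<le> t"
    with assms have "T m \<omega> < T (Suc n) \<omega>" by linarith
    then show "m \<le> n" by (simp only: T_less_iff less_Suc_eq_le)
  next
    assume "m \<le> n"
    then have "T m \<omega> \<le> T n \<omega>" by (simp only: T_le_iff)
    with assms show "T m \<omega> \<le> t" by linarith
  qed
  then have "{m. 1 \<le> m \<and> T m \<omega> \<le> t} = {1..n}" by (simp only: atLeastAtMost_def atLeast_def atMost_def Collect_conj_eq)
  then show ?thesis by (simp add: N_def)
qed

lemma T_N:
  assumes "0 \<le> t" "\<not> explodes t \<omega>"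
  shows "T (N t \<omega>) \<omega> \<le> t" "t < T (Suc (N t \<omega>)) \<omega>"
proof -
  define n where "n = (LEAST n. t < T n \<omega>)"
  have ex: "\<exists>n. t < T n \<omega>" using assms by (auto simp: explodes_def not_le)
  have 1: "t < T n \<omega>" unfolding n_def using ex by (rule LeastI_ex)
  then obtain m where m: "n = Suc m" using assms by (cases n) auto
  have "\<not> t < T m \<omega>" using not_less_Least[of m "\<lambda>n. t < T n \<omega>"]
    unfolding n_def[symmetric] m by simp
  with 1 m have m': "T m \<omega> \<le> t" "t < T (Suc m) \<omega>" by (simp_all add: not_less)
  moreover have "N t \<omega> = m" by (rule N_eq[OF m'])
  ultimately show "T (N t \<omega>) \<omega> \<le> t" "t < T (Suc (N t \<omega>)) \<omega>" by (simp_all only: m')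
qed

lemma N_ge_iff:
  assumes "0 \<le> t" "\<not> explodes t \<omega>"
  shows "n \<le> N t \<omega> \<longleftrightarrow> T n \<omega> \<le> t"
proof
  assume "n \<le> N t \<omega>"
  then have "T n \<omega> \<le> T (N t \<omega>) \<omega>" by (simp only: T_le_iff)
  with T_N[OF assms] show "T n \<omega> \<le> t" by linarith
next
  assume "T n \<omega> \<le> t"
  with T_N[OF assms] have "T n \<omega> < T (Suc (N t \<omega>)) \<omega>" by linarith
  then show "n \<le> N t \<omega>" by (simp only: T_less_iff less_Suc_eq_le)
qed

lemma N_eq_iff:
  assumes "0 \<le> t" "\<not> explodes t \<omega>"
  shows "N t \<omega> = n \<longleftrightarrow> T n \<omega> \<le> t \<and> t < T (Suc n) \<omega>"
  using T_N[OF assms] N_eq[of n t] by blast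

lemma T_le_iff_N:
  assumes "0 \<le> t"
  shows "T n \<omega> \<le> t \<longleftrightarrow> explodes t \<omega> \<or> n \<le> N t \<omega>"
  using assms N_ge_iff[of t n] by (auto simp: explodes_def)

lemma N_mono:
  assumes "0 \<le> s" "s \<le> t" "\<not> explodes t \<omega>"
  shows "N s \<omega> \<le> N t \<omega>"
proof -
  have "T (N s \<omega>) \<omega> \<le> s" using assms explodes_mono[of s \<omega> t] by (intro T_N) auto
  then show ?thesis using assms by (subst N_ge_iff) auto
qed

text \<open>The second disjunct reflects the convention that \<open>N t\<close> is the cardinality of an infinite set, hence
  \<open>0\<close>, on exploding paths. Written in this way, \<open>N t\<close> is measurable without exceptional sets.\<close>

lemma N_iff_T:
  assumes "0 \<le> t"
  shows "N t \<omega> = n \<longleftrightarrow>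
    (T n \<omega> \<le> t \<and> t < T (Suc n) \<omega>) \<or> (n = 0 \<and> explodes t \<omega>)"
proof (cases "explodes t \<omega>")
  case True
  then have "\<not> t < T (Suc n) \<omega>" by (auto simp: explodes_def not_less)
  with True show ?thesis using N_explodes[OF True] by blast
next
  case False
  then show ?thesis using N_eq_iff[OF assms False] by blast
qed

end

lemma sum_X_less_iff:
  assumes "\<And>n. 0 < X n \<omega>"
  shows "(\<Sum>k<m. X k \<omega>) < (\<Sum>k<n. X k \<omega>) \<longleftrightarrow> m < n"
  using strict_mono_less[of "\<lambda>n. \<Sum>k<n. X k \<omega>" m n]
  by (simp add: strict_mono_Suc_iff assms)

lemma S_less_iff:
  assumes "\<omega> \<in> space (path_space D)"
  shows "S s \<omega> < S t \<omega> \<longleftrightarrow> N s \<omega> < N t \<omega>"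
  unfolding S_def by (rule sum_X_less_iff) (rule path_space_pos[OF assms])

lemma measurable_T:
  assumes [measurable]: "\<And>n. W n \<in> borel_measurable M"
  shows "T n \<in> borel_measurable M"
  unfolding T_def[abs_def] by measurable

lemma measurable_N:
  assumes W: "\<And>n. W n \<in> borel_measurable M" and sp: "\<And>\<omega> n. \<omega> \<in> space M \<Longrightarrow> 0 < W n \<omega>"
    and t: "0 \<le> t"
  shows "N t \<in> M \<rightarrow>\<^sub>M count_space UNIV"
proof -
  note [measurable] = measurable_T[OF W]
  have NT: "N t \<omega> = n \<longleftrightarrow> (T n \<omega> \<le> t \<and> t < T (Suc n) \<omega>) \<or> (n = 0 \<and> explodes t \<omega>)"
    if "\<omega> \<in> space M" for \<omega> n
    by (rule N_iff_T[OF sp[OF that] t])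
  have "{\<omega> \<in> space M. N t \<omega> = n} \<in> sets M" for n
  proof -
    have "{\<omega> \<in> space M. N t \<omega> = n} = {\<omega> \<in> space M. (T n \<omega> \<le> t \<and> t < T (Suc n) \<omega>) \<or>
       (n = 0 \<and> (\<forall>m. T m \<omega> \<le> t))}"
      by (rule Collect_cong) (simp add: NT explodes_def cong: conj_cong)
    then show ?thesis by simp
  qed
  moreover have "N t -` {n} \<inter> space M = {\<omega> \<in> space M. N t \<omega> = n}" for n by auto
  ultimately show ?thesis
    by (simp add: measurable_count_space_eq2_countable)
qed

lemma borel_measurable_T [measurable]: "T n \<in> borel_measurable (path_space D)"
  by (rule measurable_T) measurable

lemma measurable_N_path [measurable]:
  "0 \<le> t \<Longrightarrow> N t \<in> path_space D \<rightarrow>\<^sub>M count_space UNIV"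
  by (rule measurable_N) (auto simp: space_path_space)

lemma measurable_N_compose:
  assumes "0 \<le> t" "\<And>n. f n \<in> path_space D \<rightarrow>\<^sub>M M"
  shows "(\<lambda>\<omega>. f (N t \<omega>) \<omega>) \<in> path_space D \<rightarrow>\<^sub>M M"
  by (rule measurable_compose_countable[where f=f and g="N t"]) (use assms in auto)

lemma borel_measurable_S [measurable]: "0 \<le> t \<Longrightarrow> S t \<in> borel_measurable (path_space D)"
  unfolding S_def[abs_def]
  by (rule measurable_N_compose[where f="\<lambda>n \<omega>. \<Sum>k<n. X k \<omega>"]) auto

lemma pred_explodes [measurable]: "Measurable.pred (path_space D) (explodes t)"
  unfolding explodes_def[abs_def] by measurable

lemma pred_countable_Bex:
  assumes "countable I" and "\<And>i. i \<in> I \<Longrightarrow> Measurable.pred M (P i)"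
  shows "Measurable.pred M (\<lambda>x. \<exists>i\<in>I. P i x)"
proof -
  have "{x \<in> space M. \<exists>i\<in>I. P i x} = (\<Union>i\<in>I. {x \<in> space M. P i x})" by auto
  also have "\<dots> \<in> sets M" using assms by (intro sets.countable_UN') (auto simp: pred_def)
  finally show ?thesis by (simp add: pred_def)
qed

lemma pred_countable_Ball:
  assumes "countable I" and "\<And>i. i \<in> I \<Longrightarrow> Measurable.pred M (P i)"
  shows "Measurable.pred M (\<lambda>x. \<forall>i\<in>I. P i x)"
proof -
  have "Measurable.pred M (\<lambda>x. \<not> (\<exists>i\<in>I. \<not> P i x))"
    using assms by (intro pred_intros_logic(2) pred_countable_Bex) auto
  then show ?thesis by simp
qed

subsection \<open>The filtration\<close>

text \<open>On exploding paths \<open>S\<close> falls back to \<open>0\<close> after having been positive, whereas it is nondecreasing on all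
  other paths. A violation of monotonicity is visible at rational times and at \<open>t\<close>, so that explosion
  is detected by countably many values of \<open>S\<close>.\<close>

lemma explodes_iff_S:
  assumes \<omega>: "\<omega> \<in> space (path_space D)" and t: "0 \<le> t"
  shows "explodes t \<omega> \<longleftrightarrow>
    \<not> (\<forall>u\<in>insert t (\<rat> \<inter> {0..t}). \<forall>v\<in>insert t (\<rat> \<inter> {0..t}). u \<le> v \<longrightarrow> S u \<omega> \<le> S v \<omega>)"
proof -
  note pos = path_space_pos[OF \<omega>]
  have ex: "\<exists>u\<in>\<rat> \<inter> {0..t}. S t \<omega> < S u \<omega>" if e: "explodes t \<omega>"
  proof -
    have "T 1 \<omega> < T 2 \<omega>" using T_less_iff[OF pos(1)] by simp
    then obtain u where u: "u \<in> \<rat>" "T 1 \<omega> < u" "u < T 2 \<omega>"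
      using Rats_dense_in_real by blast
    have "T 2 \<omega> \<le> t" "0 \<le> T 1 \<omega>" using e T_nonneg[OF pos(1)] by (auto simp: explodes_def)
    with u have u': "u \<in> \<rat> \<inter> {0..t}" by auto
    have "N u \<omega> = 1" using u by (intro N_eq[OF pos(1)]) (auto simp: numeral_2_eq_2)
    then have "S t \<omega> < S u \<omega>" using N_explodes[OF e] by (simp add: S_less_iff[OF \<omega>])
    with u' show ?thesis by blast
  qed
  have mono: "S u \<omega> \<le> S v \<omega>" if "\<not> explodes t \<omega>" "0 \<le> u" "u \<le> v" "v \<le> t" for u v
    using N_mono[OF pos(1), of u v] that explodes_mono[of v \<omega> t] S_less_iff[OF \<omega>, of v u] by (metis not_less)
  show ?thesis
  proof (cases "explodes t \<omega>")
    case True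
    with ex obtain u where u: "u \<in> \<rat> \<inter> {0..t}" "S t \<omega> < S u \<omega>" by blast
    then have "u \<le> t" "\<not> S u \<omega> \<le> S t \<omega>" by auto
    with u True show ?thesis by blast
  next
    case False
    have "S u \<omega> \<le> S v \<omega>" if "u \<in> insert t (\<rat> \<inter> {0..t})" "v \<in> insert t (\<rat> \<inter> {0..t})" "u \<le> v" for u v
      using that t by (intro mono False) auto
    with False show ?thesis by blast
  qed
qed

text \<open>Claims being positive, \<open>S\<close> increases exactly when \<open>N\<close> does. This turns the event \<open>n + 1 \<le> N t\<close> into one
  about \<open>S\<close> and the event \<open>n \<le> N u\<close> at earlier rational times \<open>u\<close>, which is the step of an induction
  showing that \<open>N\<close> is adapted.\<close>

lemma N_Suc_iff_S:
  assumes \<omega>: "\<omega> \<in> space (path_space D)" and t: "0 \<le> t"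
  shows "Suc n \<le> N t \<omega> \<longleftrightarrow> \<not> explodes t \<omega> \<and> (\<exists>u\<in>\<rat> \<inter> {0..<t}. n \<le> N u \<omega> \<and> S u \<omega> < S t \<omega>)"
proof
  note pos = path_space_pos[OF \<omega>]
  assume n: "Suc n \<le> N t \<omega>"
  then have e: "\<not> explodes t \<omega>" using N_explodes[of t \<omega>] by auto
  with n have "T (Suc n) \<omega> \<le> t" using N_ge_iff[OF pos(1) t] by simp
  moreover have "T n \<omega> < T (Suc n) \<omega>" using T_less_iff[OF pos(1)] by simp
  then obtain u where u: "u \<in> \<rat>" "T n \<omega> < u" "u < T (Suc n) \<omega>"
    using Rats_dense_in_real by blast
  moreover have "0 \<le> T n \<omega>" using T_nonneg[OF pos(1)] .
  moreover have "N u \<omega> = n" using u by (intro N_eq[OF pos(1)]) auto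
  ultimately have "u \<in> \<rat> \<inter> {0..<t}" "n \<le> N u \<omega>" "S u \<omega> < S t \<omega>"
    using n by (simp_all add: S_less_iff[OF \<omega>])
  with e show "\<not> explodes t \<omega> \<and> (\<exists>u\<in>\<rat> \<inter> {0..<t}. n \<le> N u \<omega> \<and> S u \<omega> < S t \<omega>)"
    by blast
next
  assume "\<not> explodes t \<omega> \<and> (\<exists>u\<in>\<rat> \<inter> {0..<t}. n \<le> N u \<omega> \<and> S u \<omega> < S t \<omega>)"
  then obtain u where "n \<le> N u \<omega>" "S u \<omega> < S t \<omega>" by blast
  then have "n \<le> N u \<omega>" "N u \<omega> < N t \<omega>" by (simp_all add: S_less_iff[OF \<omega>])
  then show "Suc n \<le> N t \<omega>" by linarith
qed

lemma space_Filt [simp]: "space (Filt D t) = space (path_space D)"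
  by (simp add: Filt_def space_measure_of_conv)

lemma space_sigma_Theta [simp]: "space (sigma_Theta D) = space (path_space D)"
  by (simp add: sigma_Theta_def)

lemma sets_sigma_Theta: "sets (sigma_Theta D) = {Theta -` B \<inter> space (path_space D) | B. B \<in> sets (param_borel D)}"
  unfolding sigma_Theta_def by (subst sets_vimage_algebra2) (auto simp: space_path_space)

lemma Filt_generators:
  "{S u -` B \<inter> space (path_space D) | u B. 0 \<le> u \<and> u \<le> t \<and> B \<in> sets borel} \<union> sets (sigma_Theta D)
     \<subseteq> Pow (space (path_space D))"
  using sets.sets_into_space[of _ "sigma_Theta D"] by auto

lemma sets_Filt:
  "sets (Filt D t) = sigma_sets (space (path_space D))
     ({S u -` B \<inter> space (path_space D) | u B. 0 \<le> u \<and> u \<le> t \<and> B \<in> sets borel} \<union> sets (sigma_Theta D))"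
  unfolding Filt_def by (rule sets_measure_of[OF Filt_generators])

lemma sigma_Theta_subset_path: "sets (sigma_Theta D) \<subseteq> sets (path_space D)"
  by (auto simp: sets_sigma_Theta)

lemma sigma_Theta_subset_Filt: "sets (sigma_Theta D) \<subseteq> sets (Filt D t)"
  unfolding sets_Filt by (auto intro: sigma_sets.Basic)

lemma Filt_subset_path: "sets (Filt D t) \<subseteq> sets (path_space D)"
  unfolding sets_Filt
  by (rule sets.sigma_sets_subset) (use sigma_Theta_subset_path in \<open>auto intro!: measurable_sets\<close>)

lemma Filt_mono: "s \<le> t \<Longrightarrow> sets (Filt D s) \<subseteq> sets (Filt D t)"
  unfolding sets_Filt by (rule sigma_sets_mono') (auto 0 3 intro: order_trans)

lemma measurable_Filt_mono: "s \<le> t \<Longrightarrow> f \<in> Filt D s \<rightarrow>\<^sub>M M \<Longrightarrow> f \<in> Filt D t \<rightarrow>\<^sub>M M"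
  using Filt_mono[of s t D] by (auto simp: measurable_def)

lemma measurable_Filt_path: "f \<in> Filt D t \<rightarrow>\<^sub>M M \<Longrightarrow> f \<in> path_space D \<rightarrow>\<^sub>M M"
  using Filt_subset_path[of D t] by (auto simp: measurable_def)

lemma measurable_sigma_Theta_Filt: "f \<in> sigma_Theta D \<rightarrow>\<^sub>M M \<Longrightarrow> f \<in> Filt D t \<rightarrow>\<^sub>M M"
  using sigma_Theta_subset_Filt[of D t] by (auto simp: measurable_def)

lemma measurable_Theta_sigma_Theta [measurable]: "Theta \<in> sigma_Theta D \<rightarrow>\<^sub>M param_borel D"
  unfolding sigma_Theta_def by (rule measurable_vimage_algebra1) (auto simp: space_path_space)

lemma measurable_Theta_Filt: "Theta \<in> Filt D t \<rightarrow>\<^sub>M param_borel D"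
  by (rule measurable_sigma_Theta_Filt) simp

lemma measurable_S_Filt: "0 \<le> u \<Longrightarrow> u \<le> t \<Longrightarrow> S u \<in> borel_measurable (Filt D t)"
  by (rule measurableI) (auto intro!: sigma_sets.Basic UnI1 simp: sets_Filt)

lemma pred_explodes_Filt:
  assumes t: "0 \<le> t"
  shows "Measurable.pred (Filt D t) (explodes t)"
proof -
  have [measurable]: "S u \<in> borel_measurable (Filt D t)" if "u \<in> insert t (\<rat> \<inter> {0..t})" for u
    using that t by (intro measurable_S_Filt) auto
  have c: "countable (insert t (\<rat> \<inter> {0..t}))" using countable_rat by auto
  have "Measurable.pred (Filt D t) (\<lambda>\<omega>. \<not> (\<forall>u\<in>insert t (\<rat> \<inter> {0..t}).
      \<forall>v\<in>insert t (\<rat> \<inter> {0..t}). u \<le> v \<longrightarrow> S u \<omega> \<le> S v \<omega>))"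
    by (intro pred_intros_logic(2) pred_countable_Ball c) measurable
  then show ?thesis
    by (rule measurable_cong[THEN iffD1, rotated]) (simp add: explodes_iff_S[OF _ t])
qed

lemma pred_N_ge_Filt:
  "0 \<le> t \<Longrightarrow> Measurable.pred (Filt D t) (\<lambda>\<omega>. n \<le> N t \<omega>)"
proof (induction n arbitrary: t)
  case (Suc n)
  note t = \<open>0 \<le> t\<close>
  have [measurable]: "Measurable.pred (Filt D t) (\<lambda>\<omega>. n \<le> N u \<omega>)" if "u \<in> \<rat> \<inter> {0..<t}" for u
    using that by (intro measurable_Filt_mono[OF _ Suc.IH]) auto
  have [measurable]: "S u \<in> borel_measurable (Filt D t)" if "u \<in> \<rat> \<inter> {0..<t}" for u
    using that t by (intro measurable_S_Filt) auto
  have [measurable]: "S t \<in> borel_measurable (Filt D t)" using t by (intro measurable_S_Filt) auto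
  note [measurable] = pred_explodes_Filt[OF t]
  have c: "countable (\<rat> \<inter> {0..<t})" using countable_rat by auto
  have "Measurable.pred (Filt D t) (\<lambda>\<omega>. \<not> explodes t \<omega> \<and>
      (\<exists>u\<in>\<rat> \<inter> {0..<t}. n \<le> N u \<omega> \<and> S u \<omega> < S t \<omega>))"
    by (intro pred_intros_logic(3) pred_countable_Bex c) measurable
  then show ?case
    by (rule measurable_cong[THEN iffD1, rotated]) (rule N_Suc_iff_S[OF _ t, symmetric], simp)
qed simp

lemma measurable_N_Filt:
  assumes t: "0 \<le> t"
  shows "N t \<in> Filt D t \<rightarrow>\<^sub>M count_space UNIV"
proof -
  note [measurable] = pred_N_ge_Filt[OF t]
  have "N t -` {n} \<inter> space (Filt D t) = {\<omega> \<in> space (Filt D t). n \<le> N t \<omega> \<and> \<not> Suc n \<le> N t \<omega>}" for n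
    by auto
  also have "\<dots> n \<in> sets (Filt D t)" for n by measurable
  finally show ?thesis by (simp add: measurable_count_space_eq2_countable)
qed

lemma pred_T_le_Filt:
  assumes t: "0 \<le> t"
  shows "Measurable.pred (Filt D t) (\<lambda>\<omega>. T n \<omega> \<le> t)"
proof -
  note [measurable] = pred_N_ge_Filt[OF t] pred_explodes_Filt[OF t]
  have "Measurable.pred (Filt D t) (\<lambda>\<omega>. explodes t \<omega> \<or> n \<le> N t \<omega>)" by measurable
  then show ?thesis
    by (rule measurable_cong[THEN iffD1, rotated]) (use T_le_iff_N[OF _ t] in \<open>auto simp: space_path_space\<close>)
qed

text \<open>All coordinates can be read off the aggregate process: the arrival times from \<open>N\<close>, and the partial sums
  of claims as the values of \<open>S\<close> between consecutive arrivals. This holds on exploding paths too,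
  because every arrival precedes the next one strictly.\<close>

lemma sets_path_space_Filt:
  "sets (path_space D) = sigma_sets (space (path_space D)) (\<Union>t\<in>{0..}. sets (Filt D t))"
proof
  let ?\<Omega> = "space (path_space D)" and ?E = "\<Union>t\<in>{0..}. sets (Filt D t)"
  define F where "F = sigma ?\<Omega> ?E"
  have E: "?E \<subseteq> Pow ?\<Omega>" using Filt_subset_path sets.sets_into_space[of _ "path_space D"] by blast
  have sF: "sets F = sigma_sets ?\<Omega> ?E" and [simp]: "space F = ?\<Omega>"
    unfolding F_def using E by (auto simp: space_measure_of_conv)
  have sub: "sets (Filt D t) \<subseteq> sets F" if "0 \<le> t" for t
    unfolding sF using that by (auto intro: sigma_sets.Basic)
  have meas: "f \<in> F \<rightarrow>\<^sub>M M" if "f \<in> Filt D t \<rightarrow>\<^sub>M M" "0 \<le> t" for f t and M :: "'b measure"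
    using that sub[of t] by (auto simp: measurable_def)
  have [measurable]: "Measurable.pred F (\<lambda>\<omega>. T n \<omega> \<le> a)" for n a
  proof (cases "0 \<le> a")
    case False
    have "Measurable.pred F (\<lambda>\<omega>. False)" by simp
    then show ?thesis
    proof (rule measurable_cong[THEN iffD1, rotated])
      fix \<omega> assume "\<omega> \<in> space F"
      then show "False = (T n \<omega> \<le> a)" using T_nonneg[of \<omega> n] False by (auto simp: space_path_space)
    qed
  qed (use meas[OF pred_T_le_Filt] in auto)
  then have T[measurable]: "T n \<in> borel_measurable F" for n
    unfolding borel_measurable_iff_le by (simp add: pred_def)
  have [measurable]: "S u \<in> borel_measurable F" if "0 \<le> u" for u
    using meas[OF measurable_S_Filt] that by blast
  have Y: "(\<lambda>\<omega>. \<Sum>k<n. X k \<omega>) \<in> borel_measurable F" for n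
  proof (intro borel_measurable_iff_le[THEN iffD2] allI)
    fix c
    \<comment> \<open>Between the arrivals \<open>T n\<close> and \<open>T (Suc n)\<close> the aggregate process equals the sum of the first \<open>n\<close> claims.\<close>
    let ?P = "\<lambda>\<omega>. \<exists>u\<in>\<rat> \<inter> {0..}. T n \<omega> \<le> u \<and> \<not> T (Suc n) \<omega> \<le> u \<and> S u \<omega> \<le> c"
    have "Measurable.pred F ?P"
      using countable_rat by (intro pred_countable_Bex countable_Int1) measurable
    moreover have "?P \<omega> \<longleftrightarrow> (\<Sum>k<n. X k \<omega>) \<le> c" if \<omega>: "\<omega> \<in> ?\<Omega>" for \<omega>
    proof -
      note pos = path_space_pos(1)[OF \<omega>]
      have "T n \<omega> < T (Suc n) \<omega>" using T_less_iff[OF pos] by simp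
      then obtain u where u: "u \<in> \<rat>" "T n \<omega> < u" "u < T (Suc n) \<omega>"
        using Rats_dense_in_real by blast
      then have "\<exists>u\<in>\<rat> \<inter> {0..}. T n \<omega> \<le> u \<and> \<not> T (Suc n) \<omega> \<le> u"
        using T_nonneg[OF pos, of n] by (intro bexI[of _ u]) auto
      moreover have "S u \<omega> = (\<Sum>k<n. X k \<omega>)" if "T n \<omega> \<le> u" "\<not> T (Suc n) \<omega> \<le> u" for u
        using N_eq[OF pos, of n u] that by (simp add: S_def)
      ultimately show ?thesis by metis
    qed
    ultimately have "Measurable.pred F (\<lambda>\<omega>. (\<Sum>k<n. X k \<omega>) \<le> c)"
      by (subst (asm) measurable_cong[where g="\<lambda>\<omega>. (\<Sum>k<n. X k \<omega>) \<le> c"]) simp_all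
    then show "{\<omega> \<in> space F. (\<Sum>k<n. X k \<omega>) \<le> c} \<in> sets F" by (simp only: pred_def)
  qed
  have "W n \<in> borel_measurable F" for n
  proof -
    have "(\<lambda>\<omega>. T (Suc n) \<omega> - T n \<omega>) \<in> borel_measurable F" by measurable
    then show ?thesis by (simp add: T_Suc[abs_def])
  qed
  moreover have "X n \<in> borel_measurable F" for n
  proof -
    have "(\<lambda>\<omega>. (\<Sum>k<Suc n. X k \<omega>) - (\<Sum>k<n. X k \<omega>)) \<in> borel_measurable F"
      by (intro borel_measurable_diff Y)
    then show ?thesis by simp
  qed
  moreover have "Theta \<in> F \<rightarrow>\<^sub>M param_borel D"
    using meas[OF measurable_Theta_Filt, of 0] by simp
  ultimately have "(\<lambda>\<omega>. \<omega>) \<in> F \<rightarrow>\<^sub>M path_space D"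
    by (intro measurable_path_spaceI) (auto simp: measurable_pos_borel_iff space_path_space)
  from measurable_sets[OF this] show "sets (path_space D) \<subseteq> sigma_sets ?\<Omega> ?E"
    unfolding sF[symmetric] using sets.sets_into_space[of _ "path_space D"]
    by (fastforce simp: Int_absorb2)
qed (rule sets.sigma_sets_subset, use Filt_subset_path in blast)

text \<open>A set that is generated by \<open>S\<close> up to time \<open>t\<close> and by \<open>Theta\<close> cannot separate two paths that agree in
  these respects.\<close>

lemma Filt_cong:
  assumes A: "A \<in> sets (Filt D t)" and \<omega>: "\<omega> \<in> space (path_space D)" "\<omega>' \<in> space (path_space D)"
    and S: "\<And>u. 0 \<le> u \<Longrightarrow> u \<le> t \<Longrightarrow> S u \<omega> = S u \<omega>'" and Th: "Theta \<omega> = Theta \<omega>'"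
  shows "\<omega> \<in> A \<longleftrightarrow> \<omega>' \<in> A"
  using A unfolding sets_Filt
proof (induction rule: sigma_sets.induct)
  case (Basic a)
  then show ?case using S Th \<omega> by (auto simp: sets_sigma_Theta)
qed (use \<omega> in auto)

text \<open>The path that forgets all but the first \<open>n\<close> claims; the constant \<open>t + 1\<close> puts the next arrival after
  time \<open>t\<close>.\<close>

definition truncate :: "nat \<Rightarrow> real \<Rightarrow> 'd::finite path \<Rightarrow> 'd path" where
  "truncate n t \<omega> = (\<lambda>j. if j < n then W j \<omega> else t + 1, \<lambda>j. if j < n then X j \<omega> else 1, Theta \<omega>)"

lemma truncate_simps [simp]:
  "W j (truncate n t \<omega>) = (if j < n then W j \<omega> else t + 1)"
  "X j (truncate n t \<omega>) = (if j < n then X j \<omega> else 1)"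
  "Theta (truncate n t \<omega>) = Theta \<omega>"
  by (simp_all add: truncate_def W_def X_def Theta_def)

lemma measurable_truncate [measurable]: "0 \<le> t \<Longrightarrow> truncate n t \<in> path_space D \<rightarrow>\<^sub>M path_space D"
  by (rule measurable_path_spaceI) (auto simp: if_distrib)

text \<open>If the \<open>(n+1)\<close>-st claim arrives after \<open>t\<close>, then the path and its truncation have the same aggregate
  process up to time \<open>t\<close>. On such paths the indicator of an event of the filtration may thus be
  replaced by a function of the parameter and the first \<open>n\<close> claims.\<close>

lemma truncate_Filt:
  assumes A: "A \<in> sets (Filt D t)" and \<omega>: "\<omega> \<in> space (path_space D)" and t: "0 \<le> t" "t < T (Suc n) \<omega>"
  shows "truncate n t \<omega> \<in> A \<longleftrightarrow> \<omega> \<in> A"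
proof (rule Filt_cong[OF A _ \<omega>])
  let ?v = "truncate n t \<omega>"
  note pos = path_space_pos[OF \<omega>]
  show v: "?v \<in> space (path_space D)"
    using measurable_space[OF measurable_truncate[OF t(1)] \<omega>] .
  note vpos = path_space_pos(1)[OF v]
  have Tv: "T j ?v = T j \<omega>" if "j \<le> n" for j
    unfolding T_def using that by (intro sum.cong) auto
  fix u assume u: "0 \<le> u" "u \<le> t"
  define k where "k = N u \<omega>"
  have "\<not> explodes u \<omega>" using u t by (auto simp: explodes_def not_le intro!: exI[of _ "Suc n"])
  then have k: "T k \<omega> \<le> u" "u < T (Suc k) \<omega>"
    using T_N[OF pos(1) u(1)] by (auto simp: k_def)
  have kn: "k \<le> n"
  proof (rule ccontr)
    assume "\<not> k \<le> n"
    then have "T (Suc n) \<omega> \<le> T k \<omega>" using T_le_iff[OF pos(1)] by simp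
    with k u t show False by simp
  qed
  have "u < T (Suc k) ?v"
  proof (cases "k = n")
    case True
    have "0 \<le> T n \<omega>" using T_nonneg[OF pos(1)] .
    with True u show ?thesis by (simp add: T_Suc Tv)
  qed (use k kn in \<open>simp add: Tv\<close>)
  then have "N u ?v = k" using k kn by (intro N_eq[OF vpos]) (auto simp: Tv)
  then show "S u ?v = S u \<omega>"
    using kn unfolding S_def k_def by (intro sum.cong) auto
qed simp

section \<open>Renewal kernels and their mixtures\<close>

abbreviation seqs :: "(nat \<Rightarrow> real) measure" where
  "seqs \<equiv> \<Pi>\<^sub>M n\<in>UNIV. pos_borel"

lemma prob_algebraD:
  assumes "M \<in> space (prob_algebra L)"
  shows "prob_space M" "sets M = sets L" "space M = space L"
  using assms sets_eq_imp_space_eq[of M L] by (auto simp: space_prob_algebra)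

text \<open>Finite-dimensional rectangles form a generator stable under intersection on which a renewal law is an
  explicit product. Laws on the path space are compared on them.\<close>

definition rect :: "(real ^ 'd::finite) set \<Rightarrow> nat \<Rightarrow> (nat \<Rightarrow> real set) \<Rightarrow> (nat \<Rightarrow> real set) \<Rightarrow>
    (real ^ 'd) set \<Rightarrow> 'd path set" where
  "rect D n A B C = {\<omega> \<in> space (path_space D). (\<forall>j\<le>n. W j \<omega> \<in> A j \<and> X j \<omega> \<in> B j) \<and> Theta \<omega> \<in> C}"

definition rects :: "(real ^ 'd::finite) set \<Rightarrow> 'd path set set" where
  "rects D = {rect D n A B C | n A B C.
     (\<forall>j. A j \<in> sets pos_borel) \<and> (\<forall>j. B j \<in> sets pos_borel) \<and> C \<in> sets (param_borel D)}"

lemma rect_in_sets: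
  assumes [measurable]: "\<And>j. A j \<in> sets pos_borel" "\<And>j. B j \<in> sets pos_borel" "C \<in> sets (param_borel D)"
  shows "rect D n A B C \<in> sets (path_space D)"
  unfolding rect_def by measurable

lemma rects_subset: "rects D \<subseteq> Pow (space (path_space D))"
  by (auto simp: rects_def rect_def)

lemma pos_in_sets [simp, measurable]: "{0<..} \<in> sets pos_borel"
  using sets.top[of pos_borel] by simp

lemma D_in_sets [simp, measurable]: "D \<in> sets (param_borel D)"
  using sets.top[of "param_borel D"] by simp

lemma Int_stable_rects: "Int_stable (rects D)"
proof (rule Int_stableI)
  fix a b assume "a \<in> rects D" "b \<in> rects D"
  then obtain n A B C n' A' B' C' where
    a: "a = rect D n A B C" and b: "b = rect D n' A' B' C'"
    and s: "\<And>j. A j \<in> sets pos_borel" "\<And>j. B j \<in> sets pos_borel" "C \<in> sets (param_borel D)"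
      "\<And>j. A' j \<in> sets pos_borel" "\<And>j. B' j \<in> sets pos_borel" "C' \<in> sets (param_borel D)"
    unfolding rects_def by blast
  let ?c = "\<lambda>n (A :: nat \<Rightarrow> real set) j. if j \<le> n then A j else {0<..}"
  have "a \<inter> b = rect D (max n n') (\<lambda>j. ?c n A j \<inter> ?c n' A' j) (\<lambda>j. ?c n B j \<inter> ?c n' B' j) (C \<inter> C')"
    unfolding a b rect_def by (intro set_eqI) (simp add: space_path_space le_max_iff_disj, blast)
  moreover have "?c n A j \<inter> ?c n' A' j \<in> sets pos_borel" "?c n B j \<inter> ?c n' B' j \<in> sets pos_borel" for j
    using s by auto
  ultimately show "a \<inter> b \<in> rects D"
    unfolding rects_def using s by blast
qed

lemma sets_path_space_rects: "sets (path_space D) = sigma_sets (space (path_space D)) (rects D)"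
proof
  define F where "F = sigma (space (path_space D)) (rects D)"
  have sF: "sets F = sigma_sets (space (path_space D)) (rects D)" and [simp]: "space F = space (path_space D)"
    unfolding F_def using rects_subset[of D] by (auto simp: space_measure_of_conv)
  have r: "rect D n A B C \<in> sets F"
    if "\<And>j. A j \<in> sets pos_borel" "\<And>j. B j \<in> sets pos_borel" "C \<in> sets (param_borel D)" for n A B C
    unfolding sF rects_def using that by (intro sigma_sets.Basic) blast
  have "(\<lambda>\<omega>. \<omega>) \<in> F \<rightarrow>\<^sub>M path_space D"
  proof (rule measurable_path_spaceI)
    show "(\<lambda>\<omega>. W n \<omega>) \<in> F \<rightarrow>\<^sub>M pos_borel" for n
    proof (rule measurableI)
      fix A assume A: "A \<in> sets pos_borel"
      have "W n -` A \<inter> space F = rect D n (\<lambda>j. if j = n then A else {0<..}) (\<lambda>_. {0<..}) D"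
        by (rule set_eqI) (auto simp: rect_def space_path_space split: if_splits)
      also have "\<dots> \<in> sets F" using A by (intro r) auto
      finally show "(\<lambda>\<omega>. W n \<omega>) -` A \<inter> space F \<in> sets F" .
    qed (auto simp: space_path_space)
    show "(\<lambda>\<omega>. X n \<omega>) \<in> F \<rightarrow>\<^sub>M pos_borel" for n
    proof (rule measurableI)
      fix A assume A: "A \<in> sets pos_borel"
      have "X n -` A \<inter> space F = rect D n (\<lambda>_. {0<..}) (\<lambda>j. if j = n then A else {0<..}) D"
        by (rule set_eqI) (auto simp: rect_def space_path_space split: if_splits)
      also have "\<dots> \<in> sets F" using A by (intro r) auto
      finally show "(\<lambda>\<omega>. X n \<omega>) -` A \<inter> space F \<in> sets F" .
    qed (auto simp: space_path_space)
    show "(\<lambda>\<omega>. Theta \<omega>) \<in> F \<rightarrow>\<^sub>M param_borel D"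
    proof (rule measurableI)
      fix A assume A: "A \<in> sets (param_borel D)"
      have "Theta -` A \<inter> space F = rect D 0 (\<lambda>_. {0<..}) (\<lambda>_. {0<..}) A"
        by (rule set_eqI) (auto simp: rect_def space_path_space)
      also have "\<dots> \<in> sets F" using A by (intro r) auto
      finally show "(\<lambda>\<omega>. Theta \<omega>) -` A \<inter> space F \<in> sets F" .
    qed (auto simp: space_path_space)
  qed
  from measurable_sets[OF this] show "sets (path_space D) \<subseteq> sigma_sets (space (path_space D)) (rects D)"
    unfolding sF[symmetric] using sets.sets_into_space[of _ "path_space D"]
    by (fastforce simp: Int_absorb2)
next
  show "sigma_sets (space (path_space D)) (rects D) \<subseteq> sets (path_space D)"
    by (rule sets.sigma_sets_subset) (auto simp: rects_def intro!: rect_in_sets)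
qed

lemma space_in_rects: "space (path_space D) \<in> rects D"
proof -
  have "space (path_space D) = rect D 0 (\<lambda>_. {0<..}) (\<lambda>_. {0<..}) D"
    by (rule set_eqI) (auto simp: rect_def space_path_space)
  then show ?thesis unfolding rects_def using pos_in_sets D_in_sets by blast
qed

lemma path_measure_eqI:
  assumes M: "sets M = sets (path_space D)" and M': "sets M' = sets (path_space D)" and fin: "finite_measure M"
    and eq: "\<And>n A B C. (\<And>j. A j \<in> sets pos_borel) \<Longrightarrow> (\<And>j. B j \<in> sets pos_borel) \<Longrightarrow>
      C \<in> sets (param_borel D) \<Longrightarrow> emeasure M (rect D n A B C) = emeasure M' (rect D n A B C)"
  shows "M = M'"
proof (rule measure_eqI_generator_eq[where E="rects D" and \<Omega>="space (path_space D)" and A="\<lambda>_. space (path_space D)"])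
  show "emeasure M E = emeasure M' E" if "E \<in> rects D" for E
    using that eq by (auto simp: rects_def)
  show "emeasure M (space (path_space D)) \<noteq> \<infinity>"
    using finite_measure.emeasure_finite[OF fin] by simp
qed (simp_all only: M M' sets_path_space_rects rects_subset Int_stable_rects space_in_rects image_subset_iff UN_constant UNIV_not_empty if_False simp_thms ball_UNIV)

locale renewal_kernel =
  fixes D :: "(real ^ 'd::finite) set" and K :: "real ^ 'd \<Rightarrow> real measure" and R :: "real measure"
  assumes K: "K \<in> param_borel D \<rightarrow>\<^sub>M prob_algebra pos_borel"
    and R: "R \<in> space (prob_algebra pos_borel)"
begin

abbreviation "PL \<equiv> path_law D K R"

lemma K_in: "\<theta> \<in> D \<Longrightarrow> K \<theta> \<in> space (prob_algebra pos_borel)"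
  using measurable_space[OF K] by simp

lemmas prob_K = prob_algebraD(1)[OF K_in] and sets_K = prob_algebraD(2)[OF K_in]
  and space_K = prob_algebraD(3)[OF K_in]
lemmas prob_R = prob_algebraD(1)[OF R] and sets_R = prob_algebraD(2)[OF R] and space_R = prob_algebraD(3)[OF R]

lemma measurable_emeasure_K: "A \<in> sets pos_borel \<Longrightarrow> (\<lambda>\<theta>. emeasure (K \<theta>) A) \<in> borel_measurable (param_borel D)"
  using measurable_compose[OF measurable_prob_algebraD[OF K] measurable_emeasure_subprob_algebra] by simp

lemma sets_PiK: "\<theta> \<in> D \<Longrightarrow> sets (\<Pi>\<^sub>M n\<in>UNIV. K \<theta>) = sets seqs"
  by (intro sets_PiM_cong) (simp_all add: sets_K)

lemma sets_PiR: "sets (\<Pi>\<^sub>M n\<in>UNIV. R) = sets seqs"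
  by (intro sets_PiM_cong) (simp_all add: sets_R)

lemma prob_PiK: "\<theta> \<in> D \<Longrightarrow> prob_space (\<Pi>\<^sub>M n\<in>(UNIV :: nat set). K \<theta>)"
  by (intro prob_space_PiM prob_K)

lemma prob_PiR: "prob_space (\<Pi>\<^sub>M n\<in>(UNIV :: nat set). R)"
  by (intro prob_space_PiM prob_R)

lemma sets_PL: "\<theta> \<in> D \<Longrightarrow> sets (PL \<theta>) = sets (path_space D)"
  unfolding path_law_def path_space_def
  by (intro sets_pair_measure_cong) (simp_all add: sets_PiK sets_PiR)

lemma space_PL: "\<theta> \<in> D \<Longrightarrow> space (PL \<theta>) = space (path_space D)"
  by (rule sets_eq_imp_space_eq) (rule sets_PL)

lemma prob_PL: "\<theta> \<in> D \<Longrightarrow> prob_space (PL \<theta>)"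
  unfolding path_law_def
  by (intro prob_space_pair prob_PiK prob_PiR prob_space_return) simp_all

lemma emeasure_PL_Times:
  assumes \<theta>: "\<theta> \<in> D" and A: "A \<in> sets seqs" and B: "B \<in> sets seqs" and C: "C \<in> sets (param_borel D)"
  shows "emeasure (PL \<theta>) (A \<times> B \<times> C) =
    emeasure (\<Pi>\<^sub>M n\<in>UNIV. K \<theta>) A * (emeasure (\<Pi>\<^sub>M n\<in>UNIV. R) B * indicator C \<theta>)"
proof -
  interpret r: prob_space "return (param_borel D) \<theta>" using \<theta> by (intro prob_space_return) simp
  interpret R: prob_space "\<Pi>\<^sub>M n\<in>(UNIV :: nat set). R" by (rule prob_PiR)
  interpret RR: prob_space "(\<Pi>\<^sub>M n\<in>(UNIV :: nat set). R) \<Otimes>\<^sub>M return (param_borel D) \<theta>"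
    by (intro prob_space_pair R.prob_space_axioms r.prob_space_axioms)
  have B': "B \<in> sets (\<Pi>\<^sub>M n\<in>UNIV. R)" using B sets_PiR by simp
  have A': "A \<in> sets (\<Pi>\<^sub>M n\<in>UNIV. K \<theta>)" using A sets_PiK[OF \<theta>] by simp
  have C': "C \<in> sets (return (param_borel D) \<theta>)" using C by simp
  show ?thesis
    unfolding path_law_def
    using A' B' C' C by (simp add: RR.emeasure_pair_measure_Times r.emeasure_pair_measure_Times)
qed

lemma emeasure_PL_rect:
  assumes \<theta>: "\<theta> \<in> D" and A: "\<And>j. A j \<in> sets pos_borel" and B: "\<And>j. B j \<in> sets pos_borel"
    and C: "C \<in> sets (param_borel D)"
  shows "emeasure (PL \<theta>) (rect D n A B C) =
    (\<Prod>j\<le>n. emeasure (K \<theta>) (A j)) * ((\<Prod>j\<le>n. emeasure R (B j)) * indicator C \<theta>)"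
proof -
  interpret k: prob_space "K \<theta>" by (rule prob_K[OF \<theta>])
  interpret r: prob_space R by (rule prob_R)
  interpret pk: product_prob_space "\<lambda>_. K \<theta>" "UNIV :: nat set" by unfold_locales
  interpret pr: product_prob_space "\<lambda>_. R" "UNIV :: nat set" by unfold_locales
  let ?A = "{w \<in> space (\<Pi>\<^sub>M n\<in>(UNIV :: nat set). K \<theta>). \<forall>j\<in>{..n}. w j \<in> A j}"
  let ?B = "{w \<in> space (\<Pi>\<^sub>M n\<in>(UNIV :: nat set). R). \<forall>j\<in>{..n}. w j \<in> B j}"
  have CD: "C \<subseteq> D" using sets.sets_into_space[OF C] by simp
  have "rect D n A B C = ?A \<times> ?B \<times> C"
    unfolding rect_def using CD
    by (intro set_eqI) (auto simp: space_path_space space_PiM space_K[OF \<theta>] space_R W_def X_def Theta_def PiE_def Pi_def)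
  moreover have "emeasure (\<Pi>\<^sub>M n\<in>(UNIV :: nat set). K \<theta>) ?A = (\<Prod>j\<le>n. emeasure (K \<theta>) (A j))"
    by (rule pk.emeasure_PiM_Collect) (use A sets_K[OF \<theta>] in auto)
  moreover have "emeasure (\<Pi>\<^sub>M n\<in>(UNIV :: nat set). R) ?B = (\<Prod>j\<le>n. emeasure R (B j))"
    by (rule pr.emeasure_PiM_Collect) (use B sets_R in auto)
  moreover have "?A \<in> sets seqs"
    unfolding sets_PiK[OF \<theta>, symmetric]
    by (intro sets.sets_Collect_finite_All sets_Collect_single) (use A sets_K[OF \<theta>] in auto)
  moreover have "?B \<in> sets seqs"
    unfolding sets_PiR[symmetric]
    by (intro sets.sets_Collect_finite_All sets_Collect_single) (use B sets_R in auto)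
  ultimately show ?thesis
    using emeasure_PL_Times[OF \<theta> _ _ C, of ?A ?B] by simp
qed

lemma measurable_PL: "PL \<in> param_borel D \<rightarrow>\<^sub>M prob_algebra (path_space D)"
proof (rule measurable_prob_algebra_generated[OF sets_path_space_rects Int_stable_rects rects_subset])
  fix E assume "E \<in> rects D"
  then obtain n A B C where E: "E = rect D n A B C" and
    s: "\<And>j. A j \<in> sets pos_borel" "\<And>j. B j \<in> sets pos_borel" "C \<in> sets (param_borel D)"
    unfolding rects_def by blast
  have [measurable]: "(\<lambda>\<theta>. emeasure (K \<theta>) (A j)) \<in> borel_measurable (param_borel D)" for j
    by (rule measurable_emeasure_K[OF s(1)])
  note [measurable] = s(3)
  have "(\<lambda>\<theta>. (\<Prod>j\<le>n. emeasure (K \<theta>) (A j)) * ((\<Prod>j\<le>n. emeasure R (B j)) * indicator C \<theta>))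
      \<in> borel_measurable (param_borel D)"
    by measurable
  then show "(\<lambda>\<theta>. emeasure (PL \<theta>) E) \<in> borel_measurable (param_borel D)"
    by (rule measurable_cong[THEN iffD1, rotated]) (simp add: E emeasure_PL_rect s)
qed (use prob_PL sets_PL in auto)

lemma measurable_PL_subprob: "PL \<in> param_borel D \<rightarrow>\<^sub>M subprob_algebra (path_space D)"
  by (rule measurable_prob_algebraD[OF measurable_PL])

lemma borel_measurable_PL:
  assumes f: "f \<in> borel_measurable M" and M: "sets M = sets (path_space D)" and \<theta>: "\<theta> \<in> D"
  shows "f \<in> borel_measurable (PL \<theta>)"
  using f measurable_cong_sets[of M "PL \<theta>" borel borel] sets_PL[OF \<theta>] M by simp

text \<open>The last factor is a point mass and singletons are measurable. The parameter may therefore be replaced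
  by \<open>\<theta>\<close> under the integral sign.\<close>

lemma AE_PL_Theta:
  assumes \<theta>: "\<theta> \<in> D"
  shows "AE \<omega> in PL \<theta>. Theta \<omega> = \<theta>"
proof -
  interpret prob_space "PL \<theta>" by (rule prob_PL[OF \<theta>])
  have C: "{\<theta>} \<in> sets (param_borel D)"
    using \<theta> by (auto simp: param_borel_def sets_restrict_space intro!: image_eqI[of _ _ "{\<theta>}"])
  have m: "rect D 0 (\<lambda>_. {0<..}) (\<lambda>_. {0<..}) {\<theta>} \<in> events"
    using C by (simp add: sets_PL[OF \<theta>] rect_in_sets)
  interpret k: prob_space "K \<theta>" by (rule prob_K[OF \<theta>])
  interpret r: prob_space R by (rule prob_R)
  have "emeasure (PL \<theta>) (rect D 0 (\<lambda>_. {0<..}) (\<lambda>_. {0<..}) {\<theta>}) = 1"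
    using C k.emeasure_space_1 r.emeasure_space_1
    by (simp add: emeasure_PL_rect[OF \<theta>] space_K[OF \<theta>] space_R)
  then have "AE \<omega> in PL \<theta>. \<omega> \<in> rect D 0 (\<lambda>_. {0<..}) (\<lambda>_. {0<..}) {\<theta>}"
    using m by (intro AE_prob_1) (simp add: emeasure_eq_measure)
  then show ?thesis by eventually_elim (simp add: rect_def)
qed

lemma nn_integral_PL_Theta:
  assumes \<theta>: "\<theta> \<in> D"
  shows "(\<integral>\<^sup>+\<omega>. f (Theta \<omega>) \<omega> \<partial>PL \<theta>) = (\<integral>\<^sup>+\<omega>. f \<theta> \<omega> \<partial>PL \<theta>)"
  using AE_PL_Theta[OF \<theta>] by (intro nn_integral_cong_AE) auto

lemma nn_integral_PL_Theta_const:
  assumes \<theta>: "\<theta> \<in> D"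
  shows "(\<integral>\<^sup>+\<omega>. f (Theta \<omega>) \<partial>PL \<theta>) = f \<theta>"
  using nn_integral_PL_Theta[OF \<theta>, of "\<lambda>\<theta> \<omega>. f \<theta>"] prob_space.emeasure_space_1[OF prob_PL[OF \<theta>]]
  by simp

end

locale mixed_renewal = renewal_kernel D K R
  for D :: "(real ^ 'd::finite) set" and K :: "real ^ 'd \<Rightarrow> real measure" and R :: "real measure" +
  fixes \<nu> :: "(real ^ 'd) measure"
  assumes \<nu>: "\<nu> \<in> space (prob_algebra (param_borel D))"
begin

abbreviation "Q \<equiv> mixed_law D \<nu> K R"

lemmas prob_\<nu> = prob_algebraD(1)[OF \<nu>] and sets_\<nu> = prob_algebraD(2)[OF \<nu>]

lemma space_\<nu>: "space \<nu> = D"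
  using prob_algebraD(3)[OF \<nu>] by simp

lemma measurable_\<nu>: "borel_measurable \<nu> = borel_measurable (param_borel D)"
  using measurable_cong_sets[OF sets_\<nu> refl] by blast

lemma measurable_PL_\<nu>: "PL \<in> \<nu> \<rightarrow>\<^sub>M subprob_algebra (path_space D)"
  using measurable_PL_subprob measurable_cong_sets[OF sets_\<nu> refl] by blast

lemma sets_Q: "sets Q = sets (path_space D)"
  unfolding mixed_law_def by (rule sets_bind'[OF \<nu> measurable_PL])

lemma space_Q: "space Q = space (path_space D)"
  by (rule sets_eq_imp_space_eq[OF sets_Q])

lemma prob_Q: "prob_space Q"
  unfolding mixed_law_def by (rule prob_space_bind'[OF \<nu> measurable_PL])

lemma measurable_Q: "measurable Q M = measurable (path_space D) M"
  using measurable_cong_sets[OF sets_Q refl] by blast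

lemma nn_integral_Q:
  assumes "f \<in> borel_measurable (path_space D)"
  shows "(\<integral>\<^sup>+\<omega>. f \<omega> \<partial>Q) = (\<integral>\<^sup>+\<theta>. (\<integral>\<^sup>+\<omega>. f \<omega> \<partial>PL \<theta>) \<partial>\<nu>)"
  unfolding mixed_law_def by (rule nn_integral_bind[OF assms measurable_PL_\<nu>])

lemma emeasure_Q:
  assumes "E \<in> sets (path_space D)"
  shows "emeasure Q E = (\<integral>\<^sup>+\<theta>. emeasure (PL \<theta>) E \<partial>\<nu>)"
  unfolding mixed_law_def by (rule emeasure_bind_prob_algebra[OF \<nu> measurable_PL assms])

lemma AE_Q:
  assumes "Measurable.pred (path_space D) P"
  shows "(AE \<omega> in Q. P \<omega>) \<longleftrightarrow> (AE \<theta> in \<nu>. AE \<omega> in PL \<theta>. P \<omega>)"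
  unfolding mixed_law_def by (rule AE_bind[OF measurable_PL_\<nu> assms])

lemma measurable_nn_integral_PL:
  assumes "f \<in> borel_measurable (path_space D)"
  shows "(\<lambda>\<theta>. \<integral>\<^sup>+\<omega>. f \<omega> \<partial>PL \<theta>) \<in> borel_measurable (param_borel D)"
  using measurable_compose[OF measurable_PL_subprob nn_integral_measurable_subprob_algebra[OF assms]] by simp

lemma nn_integral_Q_Theta:
  assumes f: "f \<in> borel_measurable (param_borel D)"
  shows "(\<integral>\<^sup>+\<omega>. f (Theta \<omega>) \<partial>Q) = (\<integral>\<^sup>+\<theta>. f \<theta> \<partial>\<nu>)"
proof -
  have [measurable]: "(\<lambda>\<omega>. f (Theta \<omega>)) \<in> borel_measurable (path_space D)"
    by (rule measurable_compose[OF measurable_Theta f])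
  have "(\<integral>\<^sup>+\<omega>. f (Theta \<omega>) \<partial>Q) = (\<integral>\<^sup>+\<theta>. (\<integral>\<^sup>+\<omega>. f (Theta \<omega>) \<partial>PL \<theta>) \<partial>\<nu>)"
    by (rule nn_integral_Q) simp
  also have "\<dots> = (\<integral>\<^sup>+\<theta>. f \<theta> \<partial>\<nu>)"
    by (intro nn_integral_cong nn_integral_PL_Theta_const) (simp add: space_\<nu>)
  finally show ?thesis .
qed

lemma nn_integral_Q_Theta_mult:
  assumes f: "f \<in> borel_measurable (param_borel D)" and [measurable]: "g \<in> borel_measurable (path_space D)"
  shows "(\<integral>\<^sup>+\<omega>. f (Theta \<omega>) * g \<omega> \<partial>Q) = (\<integral>\<^sup>+\<theta>. f \<theta> * (\<integral>\<^sup>+\<omega>. g \<omega> \<partial>PL \<theta>) \<partial>\<nu>)"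
proof -
  have [measurable]: "(\<lambda>\<omega>. f (Theta \<omega>)) \<in> borel_measurable (path_space D)"
    by (rule measurable_compose[OF measurable_Theta f])
  have "(\<integral>\<^sup>+\<omega>. f (Theta \<omega>) * g \<omega> \<partial>Q) = (\<integral>\<^sup>+\<theta>. (\<integral>\<^sup>+\<omega>. f (Theta \<omega>) * g \<omega> \<partial>PL \<theta>) \<partial>\<nu>)"
    by (rule nn_integral_Q) simp
  also have "\<dots> = (\<integral>\<^sup>+\<theta>. f \<theta> * (\<integral>\<^sup>+\<omega>. g \<omega> \<partial>PL \<theta>) \<partial>\<nu>)"
  proof (intro nn_integral_cong)
    fix \<theta> assume "\<theta> \<in> space \<nu>"
    then have \<theta>: "\<theta> \<in> D" by (simp add: space_\<nu>)
    have "(\<integral>\<^sup>+\<omega>. f (Theta \<omega>) * g \<omega> \<partial>PL \<theta>) = (\<integral>\<^sup>+\<omega>. f \<theta> * g \<omega> \<partial>PL \<theta>)"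
      by (rule nn_integral_PL_Theta[OF \<theta>, of "\<lambda>\<theta> \<omega>. f \<theta> * g \<omega>"])
    also have "\<dots> = f \<theta> * (\<integral>\<^sup>+\<omega>. g \<omega> \<partial>PL \<theta>)"
      by (intro nn_integral_cmult borel_measurable_PL[OF _ _ \<theta>, of _ "path_space D"]) simp_all
    finally show "(\<integral>\<^sup>+\<omega>. f (Theta \<omega>) * g \<omega> \<partial>PL \<theta>) = f \<theta> * (\<integral>\<^sup>+\<omega>. g \<omega> \<partial>PL \<theta>)" .
  qed
  finally show ?thesis .
qed

lemma distr_Q_Theta: "distr Q (param_borel D) Theta = \<nu>"
proof (rule measure_eqI)
  fix C assume "C \<in> sets (distr Q (param_borel D) Theta)"
  then have C: "C \<in> sets (param_borel D)" by simp
  have "emeasure (distr Q (param_borel D) Theta) C = (\<integral>\<^sup>+\<theta>. indicator C \<theta> \<partial>distr Q (param_borel D) Theta)"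
    using C by simp
  also have "\<dots> = (\<integral>\<^sup>+\<omega>. indicator C (Theta \<omega>) \<partial>Q)"
    using C by (intro nn_integral_distr) (simp_all add: measurable_Q)
  also have "\<dots> = (\<integral>\<^sup>+\<theta>. indicator C \<theta> \<partial>\<nu>)"
    using C by (intro nn_integral_Q_Theta) simp
  finally show "emeasure (distr Q (param_borel D) Theta) C = emeasure \<nu> C"
    using C sets_\<nu> by simp
qed (simp add: sets_\<nu>)

lemma AE_\<nu>_Q:
  assumes "Measurable.pred (param_borel D) P"
  shows "(AE \<omega> in Q. P (Theta \<omega>)) \<longleftrightarrow> (AE \<theta> in \<nu>. P \<theta>)"
  using AE_distr_iff[of Theta Q "param_borel D" P] assms
  unfolding distr_Q_Theta by (simp add: measurable_Q pred_def)

lemma AE_Q_of_\<nu>: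
  assumes "AE \<theta> in \<nu>. P \<theta>"
  shows "AE \<omega> in Q. P (Theta \<omega>)"
  using assms AE_distrD[of Theta Q "param_borel D" P] unfolding distr_Q_Theta by (simp add: measurable_Q)

end

text \<open>A renewal law is a mixture over a point mass. In this way statements about mixtures apply to the
  conditional laws given the parameter.\<close>

lemma (in renewal_kernel) mixed_return:
  assumes "\<theta> \<in> D"
  shows "mixed_law D (return (param_borel D) \<theta>) K R = PL \<theta>"
  unfolding mixed_law_def by (rule bind_return[OF measurable_PL_subprob]) (simp add: assms)

lemma (in renewal_kernel) mixed_renewal_return:
  assumes "\<theta> \<in> D"
  shows "mixed_renewal D K R (return (param_borel D) \<theta>)"
  using assms by unfold_locales (auto simp: space_prob_algebra intro!: prob_space_return)

section \<open>Conditioning on the mixing parameter\<close>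

lemma subalgebra_sigma_Theta:
  "sets M = sets (path_space D) \<Longrightarrow> subalgebra M (sigma_Theta D)"
  using sigma_Theta_subset_path[of D] sets_eq_imp_space_eq[of M "path_space D"]
  by (simp add: subalgebra_def)

lemma subalgebra_Filt:
  "sets M = sets (path_space D) \<Longrightarrow> subalgebra M (Filt D t)"
  using Filt_subset_path[of D] sets_eq_imp_space_eq[of M "path_space D"]
  by (simp add: subalgebra_def)

lemma finite_measure_subalgebraI:
  "prob_space M \<Longrightarrow> subalgebra M F \<Longrightarrow> finite_measure_subalgebra M F"
  by (simp add: finite_measure_subalgebra_def finite_measure_subalgebra_axioms_def prob_space.finite_measure)

lemma measurable_fst_seqs [measurable]: "fst \<in> path_space D \<rightarrow>\<^sub>M seqs"
  unfolding path_space_def by measurable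

lemma measurable_snd_seqs [measurable]: "(\<lambda>\<omega>. fst (snd \<omega>)) \<in> path_space D \<rightarrow>\<^sub>M seqs"
  unfolding path_space_def by measurable

lemma fst_in_seqs: "\<omega> \<in> space (path_space D) \<Longrightarrow> fst \<omega> \<in> space seqs \<and> fst (snd \<omega>) \<in> space seqs"
  by (simp add: path_space_def space_pair_measure mem_Times_iff)

lemma sets_sigma_W: "sets (sigma_W D) = {{\<omega> \<in> space (path_space D). fst \<omega> \<in> A} | A. A \<in> sets seqs}"
proof -
  have eq: "(\<lambda>\<omega> n. W n \<omega>) = fst" by (intro ext) (simp add: W_def)
  have "fst \<in> space (path_space D) \<rightarrow> space seqs" using fst_in_seqs[of _ D] by blast
  then show ?thesis unfolding sigma_W_def eq
    by (subst sets_vimage_algebra2) (simp_all add: vimage_def Int_def conj_commute)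
qed

lemma sets_sigma_X: "sets (sigma_X D) = {{\<omega> \<in> space (path_space D). fst (snd \<omega>) \<in> A} | A. A \<in> sets seqs}"
proof -
  have eq: "(\<lambda>\<omega> n. X n \<omega>) = (\<lambda>\<omega>. fst (snd \<omega>))" by (intro ext) (simp add: X_def)
  have "(\<lambda>\<omega>. fst (snd \<omega>)) \<in> space (path_space D) \<rightarrow> space seqs" using fst_in_seqs[of _ D] by blast
  then show ?thesis unfolding sigma_X_def eq
    by (subst sets_vimage_algebra2) (simp_all add: vimage_def Int_def conj_commute)
qed

lemma sigma_W_subset_path: "sets (sigma_W D) \<subseteq> sets (path_space D)"
  unfolding sets_sigma_W by auto

lemma sigma_X_subset_path: "sets (sigma_X D) \<subseteq> sets (path_space D)"
  unfolding sets_sigma_X by auto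

lemma measurable_N_sigma_W:
  assumes "0 \<le> t"
  shows "N t \<in> sigma_W D \<rightarrow>\<^sub>M count_space UNIV"
proof -
  have W: "W n \<in> borel_measurable (sigma_W D)" for n
  proof -
    have "(\<lambda>\<omega> n. W n \<omega>) \<in> sigma_W D \<rightarrow>\<^sub>M seqs"
      unfolding sigma_W_def
      by (rule measurable_vimage_algebra1) (auto simp: space_path_space space_PiM PiE_def)
    from measurable_compose[OF this measurable_component_singleton[of n UNIV "\<lambda>_. pos_borel"]]
    show ?thesis by (simp add: measurable_pos_borel_borel)
  qed
  show ?thesis
    by (rule measurable_N[OF W _ assms]) (simp add: sigma_W_def space_path_space)
qed

text \<open>The counting process is a function of the interarrival times, so independence of \<open>W\<close> and \<open>X\<close> passes to
  \<open>N\<close> and \<open>X\<close>.\<close>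

lemma sets_sigma_N_subset: "sets (sigma_N D) \<subseteq> sets (sigma_W D)"
proof -
  have m: "(\<lambda>\<omega>. \<lambda>t\<in>{0..}. N t \<omega>) \<in> sigma_W D \<rightarrow>\<^sub>M (\<Pi>\<^sub>M t\<in>{0..}. count_space UNIV)"
    by (rule measurable_restrict) (auto intro: measurable_N_sigma_W)
  have sp: "space (sigma_W D) = space (path_space D)" by (simp add: sigma_W_def)
  show ?thesis
    unfolding sigma_N_def
    by (subst sets_vimage_algebra2) (use measurable_sets[OF m] sp in \<open>auto simp: space_PiM\<close>)
qed

lemma iidI:
  assumes M: "prob_space M" and Y: "\<And>n. Y n \<in> M \<rightarrow>\<^sub>M pos_borel" and L: "L \<in> space (prob_algebra pos_borel)"
    and eq: "\<And>B. B \<in> sets seqs \<Longrightarrow>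
      emeasure M {\<omega> \<in> space M. (\<lambda>n. Y n \<omega>) \<in> B} = emeasure (\<Pi>\<^sub>M n\<in>UNIV. L) B"
  shows "iid M Y" "distr M pos_borel (Y n) = L"
proof -
  interpret prob_space M by (rule M)
  interpret L: prob_space L by (rule prob_algebraD(1)[OF L])
  have sL: "sets L = sets pos_borel" by (rule prob_algebraD(2)[OF L])
  interpret pL: product_prob_space "\<lambda>_. L" "UNIV :: nat set" by unfold_locales
  have sPL: "sets (\<Pi>\<^sub>M n\<in>(UNIV :: nat set). L) = sets seqs" by (intro sets_PiM_cong) (simp_all add: sL)
  note spPL = sets_eq_imp_space_eq[OF sPL]
  have YY: "(\<lambda>\<omega> n. Y n \<omega>) \<in> M \<rightarrow>\<^sub>M seqs"
    using measurable_space[OF Y] by (intro measurable_PiM_single' Y) auto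
  have d: "distr M pos_borel (Y n) = L" for n
  proof (rule measure_eqI)
    fix A assume "A \<in> sets (distr M pos_borel (Y n))"
    then have A: "A \<in> sets pos_borel" by simp
    let ?B = "{w \<in> space (\<Pi>\<^sub>M n\<in>(UNIV :: nat set). L). w n \<in> A}"
    have B: "?B \<in> sets seqs" unfolding sPL[symmetric] by (rule sets_Collect_single) (use A sL in auto)
    have "emeasure (distr M pos_borel (Y n)) A = emeasure M {\<omega> \<in> space M. (\<lambda>n. Y n \<omega>) \<in> ?B}"
      using A Y measurable_space[OF YY] unfolding spPL
      by (subst emeasure_distr) (auto intro!: arg_cong[where f="emeasure M"])
    also have "\<dots> = emeasure L A"
      unfolding eq[OF B] by (rule pL.emeasure_PiM_Collect_single) (use A sL in auto)
    finally show "emeasure (distr M pos_borel (Y n)) A = emeasure L A" .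
  qed (simp add: sL)
  show "distr M pos_borel (Y n) = L" by (rule d)
  have "distr M seqs (\<lambda>\<omega>. \<lambda>n\<in>UNIV. Y n \<omega>) = (\<Pi>\<^sub>M n\<in>UNIV. distr M pos_borel (Y n))"
    unfolding d
  proof (rule measure_eqI)
    fix B assume "B \<in> sets (distr M seqs (\<lambda>\<omega>. \<lambda>n\<in>UNIV. Y n \<omega>))"
    then have B: "B \<in> sets seqs" by simp
    show "emeasure (distr M seqs (\<lambda>\<omega>. \<lambda>n\<in>UNIV. Y n \<omega>)) B = emeasure (\<Pi>\<^sub>M n\<in>UNIV. L) B"
      using eq[OF B] YY B by (simp add: emeasure_distr vimage_def Int_def conj_commute restrict_def)
  qed (simp add: sPL)
  then have "indep_vars (\<lambda>_. pos_borel) Y UNIV"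
    by (subst indep_vars_iff_distr_eq_PiM') (use Y in auto)
  then show "iid M Y" unfolding iid_def using d by auto
qed

context renewal_kernel
begin

lemma emeasure_PL_WX:
  assumes "\<theta> \<in> D" "A \<in> sets seqs" "B \<in> sets seqs"
  shows "emeasure (PL \<theta>) {\<omega> \<in> space (path_space D). fst \<omega> \<in> A \<and> fst (snd \<omega>) \<in> B} =
    emeasure (\<Pi>\<^sub>M n\<in>UNIV. K \<theta>) A * emeasure (\<Pi>\<^sub>M n\<in>UNIV. R) B"
proof -
  have "A \<subseteq> space seqs" "B \<subseteq> space seqs" using assms sets.sets_into_space by blast+
  then have "{\<omega> \<in> space (path_space D). fst \<omega> \<in> A \<and> fst (snd \<omega>) \<in> B} = A \<times> B \<times> D"
    by (auto simp: path_space_def space_pair_measure)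
  then show ?thesis using emeasure_PL_Times[OF assms D_in_sets] assms by simp
qed

lemma emeasure_PL_W:
  assumes "\<theta> \<in> D" "A \<in> sets seqs"
  shows "emeasure (PL \<theta>) {\<omega> \<in> space (path_space D). fst \<omega> \<in> A} = emeasure (\<Pi>\<^sub>M n\<in>UNIV. K \<theta>) A"
proof -
  have "{\<omega> \<in> space (path_space D). fst \<omega> \<in> A} = {\<omega> \<in> space (path_space D). fst \<omega> \<in> A \<and> fst (snd \<omega>) \<in> space seqs}"
    using fst_in_seqs[of _ D] by blast
  then show ?thesis
    using emeasure_PL_WX[OF assms, of "space seqs"] prob_space.emeasure_space_1[OF prob_PiR]
    by (simp add: sets_eq_imp_space_eq[OF sets_PiR])
qed

lemma emeasure_PL_X:
  assumes "\<theta> \<in> D" "B \<in> sets seqs"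
  shows "emeasure (PL \<theta>) {\<omega> \<in> space (path_space D). fst (snd \<omega>) \<in> B} = emeasure (\<Pi>\<^sub>M n\<in>UNIV. R) B"
proof -
  have "{\<omega> \<in> space (path_space D). fst (snd \<omega>) \<in> B} = {\<omega> \<in> space (path_space D). fst \<omega> \<in> space seqs \<and> fst (snd \<omega>) \<in> B}"
    using fst_in_seqs[of _ D] by blast
  then show ?thesis
    using emeasure_PL_WX[OF assms(1) sets.top assms(2)] prob_space.emeasure_space_1[OF prob_PiK[OF assms(1)]]
    by (simp add: sets_eq_imp_space_eq[OF sets_PiK[OF assms(1)]])
qed

lemma emeasure_PL_indep:
  assumes "\<theta> \<in> D" "A \<in> sets (sigma_W D)" "B \<in> sets (sigma_X D)"
  shows "emeasure (PL \<theta>) (A \<inter> B) = emeasure (PL \<theta>) A * emeasure (PL \<theta>) B"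
proof -
  from assms(2) obtain A' where A: "A = {\<omega> \<in> space (path_space D). fst \<omega> \<in> A'}" "A' \<in> sets seqs"
    unfolding sets_sigma_W by blast
  from assms(3) obtain B' where B: "B = {\<omega> \<in> space (path_space D). fst (snd \<omega>) \<in> B'}" "B' \<in> sets seqs"
    unfolding sets_sigma_X by blast
  have "A \<inter> B = {\<omega> \<in> space (path_space D). fst \<omega> \<in> A' \<and> fst (snd \<omega>) \<in> B'}"
    unfolding A B by blast
  then show ?thesis
    using emeasure_PL_WX[OF assms(1) A(2) B(2)] emeasure_PL_W[OF assms(1) A(2)] emeasure_PL_X[OF assms(1) B(2)]
    by (simp only: A(1)[symmetric] B(1)[symmetric])
qed

lemma iid_PL_W:
  assumes \<theta>: "\<theta> \<in> D"
  shows "iid (PL \<theta>) W" "distr (PL \<theta>) pos_borel (W n) = K \<theta>"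
proof -
  have m: "\<And>n. W n \<in> PL \<theta> \<rightarrow>\<^sub>M pos_borel"
    using measurable_W measurable_cong_sets[OF sets_PL[OF \<theta>] refl] by blast
  have e: "emeasure (PL \<theta>) {\<omega> \<in> space (PL \<theta>). (\<lambda>n. W n \<omega>) \<in> B} = emeasure (\<Pi>\<^sub>M n\<in>UNIV. K \<theta>) B"
    if "B \<in> sets seqs" for B
    using emeasure_PL_W[OF \<theta> that] by (simp add: space_PL[OF \<theta>] W_def)
  show "iid (PL \<theta>) W" "distr (PL \<theta>) pos_borel (W n) = K \<theta>"
    by (rule iidI[OF prob_PL[OF \<theta>] m K_in[OF \<theta>] e]; assumption)+
qed

lemma iid_PL_X:
  assumes \<theta>: "\<theta> \<in> D"
  shows "iid (PL \<theta>) X" "distr (PL \<theta>) pos_borel (X n) = R"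
proof -
  have m: "\<And>n. X n \<in> PL \<theta> \<rightarrow>\<^sub>M pos_borel"
    using measurable_X measurable_cong_sets[OF sets_PL[OF \<theta>] refl] by blast
  have e: "emeasure (PL \<theta>) {\<omega> \<in> space (PL \<theta>). (\<lambda>n. X n \<omega>) \<in> B} = emeasure (\<Pi>\<^sub>M n\<in>UNIV. R) B"
    if "B \<in> sets seqs" for B
    using emeasure_PL_X[OF \<theta> that] by (simp add: space_PL[OF \<theta>] X_def)
  show "iid (PL \<theta>) X" "distr (PL \<theta>) pos_borel (X n) = R"
    by (rule iidI[OF prob_PL[OF \<theta>] m R e]; assumption)+
qed

lemma nn_integral_PL_W:
  assumes \<theta>: "\<theta> \<in> D" and f: "f \<in> borel_measurable pos_borel"
  shows "(\<integral>\<^sup>+\<omega>. f (W n \<omega>) \<partial>PL \<theta>) = (\<integral>\<^sup>+w. f w \<partial>K \<theta>)"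
proof -
  have m: "W n \<in> PL \<theta> \<rightarrow>\<^sub>M pos_borel"
    using measurable_W measurable_cong_sets[OF sets_PL[OF \<theta>] refl] by blast
  have "(\<integral>\<^sup>+x. f x \<partial>distr (PL \<theta>) pos_borel (W n)) = (\<integral>\<^sup>+\<omega>. f (W n \<omega>) \<partial>PL \<theta>)"
    by (rule nn_integral_distr[OF m]) (use f in simp)
  then show ?thesis by (simp only: iid_PL_W(2)[OF \<theta>])
qed

lemma nn_integral_PL_X:
  assumes \<theta>: "\<theta> \<in> D" and f: "f \<in> borel_measurable pos_borel"
  shows "(\<integral>\<^sup>+\<omega>. f (X n \<omega>) \<partial>PL \<theta>) = (\<integral>\<^sup>+x. f x \<partial>R)"
proof -
  have m: "X n \<in> PL \<theta> \<rightarrow>\<^sub>M pos_borel"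
    using measurable_X measurable_cong_sets[OF sets_PL[OF \<theta>] refl] by blast
  have "(\<integral>\<^sup>+x. f x \<partial>distr (PL \<theta>) pos_borel (X n)) = (\<integral>\<^sup>+\<omega>. f (X n \<omega>) \<partial>PL \<theta>)"
    by (rule nn_integral_distr[OF m]) (use f in simp)
  then show ?thesis by (simp only: iid_PL_X(2)[OF \<theta>])
qed

lemma CRP_PL:
  assumes \<theta>: "\<theta> \<in> D"
  shows "CRP D (PL \<theta>) (K \<theta>)"
proof -
  interpret prob_space "PL \<theta>" by (rule prob_PL[OF \<theta>])
  have "indep_set (sets (sigma_N D)) (sets (sigma_X D))"
    unfolding indep_sets2_eq
  proof (intro conjI ballI)
    show "sets (sigma_N D) \<subseteq> events" "sets (sigma_X D) \<subseteq> events"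
      using sets_sigma_N_subset[of D] sigma_W_subset_path[of D] sigma_X_subset_path[of D] sets_PL[OF \<theta>] by auto
    fix a b assume "a \<in> sets (sigma_N D)" "b \<in> sets (sigma_X D)"
    then have "emeasure (PL \<theta>) (a \<inter> b) = emeasure (PL \<theta>) a * emeasure (PL \<theta>) b"
      using sets_sigma_N_subset[of D] by (intro emeasure_PL_indep \<theta>) auto
    then show "prob (a \<inter> b) = prob a * prob b"
      by (simp add: emeasure_eq_measure ennreal_mult''[symmetric])
  qed
  then show ?thesis
    unfolding CRP_def using iid_PL_X[OF \<theta>] iid_PL_W[OF \<theta>] by simp
qed

end

lemma case_bool_subset: "A \<subseteq> C \<Longrightarrow> B \<subseteq> C \<Longrightarrow> case_bool A B i \<subseteq> C"
  by (cases i) simp_all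

context mixed_renewal
begin

lemma emeasure_Q_X:
  assumes "B \<in> sets seqs"
  shows "emeasure Q {\<omega> \<in> space (path_space D). fst (snd \<omega>) \<in> B} = emeasure (\<Pi>\<^sub>M n\<in>UNIV. R) B"
proof -
  have "emeasure Q {\<omega> \<in> space (path_space D). fst (snd \<omega>) \<in> B} =
      (\<integral>\<^sup>+\<theta>. emeasure (PL \<theta>) {\<omega> \<in> space (path_space D). fst (snd \<omega>) \<in> B} \<partial>\<nu>)"
    using assms by (intro emeasure_Q) simp
  also have "\<dots> = (\<integral>\<^sup>+\<theta>. emeasure (\<Pi>\<^sub>M n\<in>UNIV. R) B \<partial>\<nu>)"
    by (intro nn_integral_cong emeasure_PL_X assms) (simp add: space_\<nu>)
  also have "\<dots> = emeasure (\<Pi>\<^sub>M n\<in>UNIV. R) B"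
    by (simp add: prob_space.emeasure_space_1[OF prob_\<nu>])
  finally show ?thesis .
qed

lemma iid_Q_X: "iid Q X" "distr Q pos_borel (X n) = R"
proof -
  have m: "\<And>n. X n \<in> Q \<rightarrow>\<^sub>M pos_borel" by (simp add: measurable_Q)
  have e: "emeasure Q {\<omega> \<in> space Q. (\<lambda>n. X n \<omega>) \<in> B} = emeasure (\<Pi>\<^sub>M n\<in>UNIV. R) B"
    if "B \<in> sets seqs" for B
    using emeasure_Q_X[OF that] by (simp add: space_Q X_def)
  show "iid Q X" "distr Q pos_borel (X n) = R"
    by (rule iidI[OF prob_Q m R e]; assumption)+
qed

lemma nn_integral_Q_X:
  assumes f: "f \<in> borel_measurable pos_borel"
  shows "(\<integral>\<^sup>+\<omega>. f (X n \<omega>) \<partial>Q) = (\<integral>\<^sup>+x. f x \<partial>R)"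
proof -
  have m: "X n \<in> Q \<rightarrow>\<^sub>M pos_borel" by (simp add: measurable_Q)
  have "(\<integral>\<^sup>+x. f x \<partial>distr (Q) pos_borel (X n)) = (\<integral>\<^sup>+\<omega>. f (X n \<omega>) \<partial>Q)"
    by (rule nn_integral_distr[OF m]) (use f in simp)
  then show ?thesis by (simp only: iid_Q_X(2))
qed

text \<open>Independence of \<open>X\<close> survives mixing although independence in general does not: the law of \<open>X\<close> is the
  same under every component, and can be taken out of the integral over the parameter.\<close>

lemma emeasure_Q_Int_X:
  assumes A: "A \<in> sets (path_space D)" and B: "B \<in> sets (sigma_X D)"
    and indep: "\<And>\<theta>. \<theta> \<in> D \<Longrightarrow> emeasure (PL \<theta>) (A \<inter> B) = emeasure (PL \<theta>) A * emeasure (PL \<theta>) B"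
  shows "emeasure Q (A \<inter> B) = emeasure Q A * emeasure Q B"
proof -
  from B obtain B' where B': "B = {\<omega> \<in> space (path_space D). fst (snd \<omega>) \<in> B'}" "B' \<in> sets seqs"
    unfolding sets_sigma_X by blast
  have Bp: "B \<in> sets (path_space D)" using B sigma_X_subset_path by blast
  have [measurable]: "(\<lambda>\<theta>. emeasure (PL \<theta>) A) \<in> borel_measurable \<nu>"
    using measurable_nn_integral_PL[of "indicator A"] A
      measurable_cong[of "param_borel D" "\<lambda>\<theta>. \<integral>\<^sup>+\<omega>. indicator A \<omega> \<partial>PL \<theta>" "\<lambda>\<theta>. emeasure (PL \<theta>) A" borel]
    by (simp add: sets_PL measurable_\<nu>)
  have "emeasure Q (A \<inter> B) = (\<integral>\<^sup>+\<theta>. emeasure (PL \<theta>) A * emeasure Q B \<partial>\<nu>)"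
  proof -
    have "emeasure (PL \<theta>) B = emeasure Q B" if "\<theta> \<in> D" for \<theta>
      using emeasure_PL_X[OF that B'(2)] emeasure_Q_X[OF B'(2)] by (simp only: B'(1))
    then show ?thesis
      using A Bp by (subst emeasure_Q) (auto intro!: nn_integral_cong simp: indep space_\<nu>)
  qed
  also have "\<dots> = emeasure Q A * emeasure Q B"
    by (subst nn_integral_multc) (simp_all add: emeasure_Q[OF A])
  finally show ?thesis .
qed

lemma indep_set_Q_X:
  assumes G: "G \<subseteq> sets (path_space D)"
    and indep: "\<And>A B \<theta>. A \<in> G \<Longrightarrow> B \<in> sets (sigma_X D) \<Longrightarrow> \<theta> \<in> D \<Longrightarrow>
      emeasure (PL \<theta>) (A \<inter> B) = emeasure (PL \<theta>) A * emeasure (PL \<theta>) B"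
  shows "prob_space.indep_set Q G (sets (sigma_X D))"
proof -
  interpret prob_space Q by (rule prob_Q)
  show ?thesis
    unfolding indep_sets2_eq
  proof (intro conjI ballI)
    show "G \<subseteq> events" "sets (sigma_X D) \<subseteq> events"
      using G sigma_X_subset_path by (auto simp: sets_Q)
    fix a b assume ab: "a \<in> G" "b \<in> sets (sigma_X D)"
    then have "emeasure Q (a \<inter> b) = emeasure Q a * emeasure Q b"
      using G by (intro emeasure_Q_Int_X indep) auto
    then show "prob (a \<inter> b) = prob a * prob b"
      by (simp add: emeasure_eq_measure ennreal_mult''[symmetric])
  qed
qed

lemma indep_N_X: "prob_space.indep_set Q (sets (sigma_N D)) (sets (sigma_X D))"
  using sets_sigma_N_subset[of D] sigma_W_subset_path[of D]
  by (intro indep_set_Q_X emeasure_PL_indep) auto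

lemma indep_Theta_X: "prob_space.indep_set Q (sets (sigma_Theta D)) (sets (sigma_X D))"
proof (intro indep_set_Q_X sigma_Theta_subset_path)
  fix A B \<theta> assume A: "A \<in> sets (sigma_Theta D)" and B: "B \<in> sets (sigma_X D)" and \<theta>: "\<theta> \<in> D"
  interpret prob_space "PL \<theta>" by (rule prob_PL[OF \<theta>])
  from A obtain C where C: "A = Theta -` C \<inter> space (path_space D)" "C \<in> sets (param_borel D)"
    unfolding sets_sigma_Theta by blast
  have m: "A \<in> events" "B \<in> events"
    using A B sigma_Theta_subset_path sigma_X_subset_path by (auto simp: sets_PL[OF \<theta>])
  have ae: "AE \<omega> in PL \<theta>. \<omega> \<in> A \<longleftrightarrow> \<theta> \<in> C"
    using AE_PL_Theta[OF \<theta>] AE_space by eventually_elim (simp add: C space_PL[OF \<theta>])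
  show "emeasure (PL \<theta>) (A \<inter> B) = emeasure (PL \<theta>) A * emeasure (PL \<theta>) B"
  proof (cases "\<theta> \<in> C")
    case True
    have "emeasure (PL \<theta>) (A \<inter> B) = emeasure (PL \<theta>) B"
      using ae m True by (intro emeasure_eq_AE) auto
    moreover have "emeasure (PL \<theta>) A = 1"
      using ae m True by (subst emeasure_eq_1_AE) auto
    ultimately show ?thesis by simp
  next
    case False
    have "emeasure (PL \<theta>) (A \<inter> B) = emeasure (PL \<theta>) {}"
      by (rule emeasure_eq_AE) (use ae m False in auto)
    moreover have "emeasure (PL \<theta>) A = emeasure (PL \<theta>) {}"
      by (rule emeasure_eq_AE) (use ae m False in auto)
    ultimately show ?thesis by simp
  qed
qed

lemma finite_measure_subalgebra_Q: "finite_measure_subalgebra Q (sigma_Theta D)"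
  by (intro finite_measure_subalgebraI prob_Q subalgebra_sigma_Theta sets_Q)

text \<open>The components of the mixture are the conditional laws given the parameter, because the parameter is
  constant under each of them.\<close>

lemma nn_cond_exp_Q:
  assumes g: "g \<in> borel_measurable (path_space D)"
  shows "AE \<omega> in Q. nn_cond_exp Q (sigma_Theta D) g \<omega> = (\<integral>\<^sup>+\<omega>'. g \<omega>' \<partial>PL (Theta \<omega>))"
proof -
  interpret finite_measure_subalgebra Q "sigma_Theta D" by (rule finite_measure_subalgebra_Q)
  let ?g = "\<lambda>\<theta>. \<integral>\<^sup>+\<omega>'. g \<omega>' \<partial>PL \<theta>"
  have m: "?g \<in> borel_measurable (param_borel D)" by (rule measurable_nn_integral_PL[OF g])
  have "AE \<omega> in Q. ?g (Theta \<omega>) = nn_cond_exp Q (sigma_Theta D) g \<omega>"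
  proof (rule nn_cond_exp_charact)
    fix A assume "A \<in> sets (sigma_Theta D)"
    then obtain C where C: "A = Theta -` C \<inter> space (path_space D)" "C \<in> sets (param_borel D)"
      unfolding sets_sigma_Theta by blast
    have "(\<integral>\<^sup>+\<omega>\<in>A. g \<omega> \<partial>Q) = (\<integral>\<^sup>+\<omega>. indicator C (Theta \<omega>) * g \<omega> \<partial>Q)"
      by (intro nn_integral_cong) (simp add: C(1) space_Q indicator_def)
    also have "\<dots> = (\<integral>\<^sup>+\<theta>. indicator C \<theta> * ?g \<theta> \<partial>\<nu>)"
      using C by (intro nn_integral_Q_Theta_mult g) simp
    also have "\<dots> = (\<integral>\<^sup>+\<omega>. indicator C (Theta \<omega>) * ?g (Theta \<omega>) \<partial>Q)"
      using C m by (intro nn_integral_Q_Theta[symmetric]) simp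
    also have "\<dots> = (\<integral>\<^sup>+\<omega>\<in>A. ?g (Theta \<omega>) \<partial>Q)"
      by (intro nn_integral_cong) (simp add: C(1) space_Q indicator_def)
    finally show "(\<integral>\<^sup>+\<omega>\<in>A. g \<omega> \<partial>Q) = (\<integral>\<^sup>+\<omega>\<in>A. ?g (Theta \<omega>) \<partial>Q)" .
  qed (use g m in \<open>auto simp: measurable_Q intro: measurable_compose[OF measurable_Theta_sigma_Theta]\<close>)
  then show ?thesis by eventually_elim simp
qed

lemma cprob_Q:
  assumes E: "E \<in> sets (path_space D)"
  shows "AE \<omega> in Q. cprob Q (sigma_Theta D) E \<omega> = measure (PL (Theta \<omega>)) E"
proof -
  have e: "(\<lambda>\<omega>. ennreal (indicator E \<omega>)) = indicator E" "(\<lambda>\<omega>. ennreal (- indicator E \<omega>)) = (\<lambda>\<omega>. 0)"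
    by (auto simp: indicator_def fun_eq_iff ennreal_neg)
  have 1: "AE \<omega> in Q. nn_cond_exp Q (sigma_Theta D) (indicator E) \<omega> = (\<integral>\<^sup>+\<omega>'. indicator E \<omega>' \<partial>PL (Theta \<omega>))"
    by (rule nn_cond_exp_Q) (use E in simp)
  have 2: "AE \<omega> in Q. nn_cond_exp Q (sigma_Theta D) (\<lambda>_. 0) \<omega> = (\<integral>\<^sup>+\<omega>'. 0 \<partial>PL (Theta \<omega>))"
    by (rule nn_cond_exp_Q) simp
  from 1 2 AE_space show ?thesis
  proof eventually_elim
    case (elim \<omega>)
    then have "Theta \<omega> \<in> D" by (simp add: space_Q path_space_pos)
    with elim E show ?case
      by (simp add: cprob_def real_cond_exp_def e sets_PL measure_def)
  qed
qed

lemma AE_restr_eq: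
  assumes "AE \<omega> in Q. f \<omega> = g \<omega>" and [measurable]: "f \<in> borel_measurable (sigma_Theta D)" "g \<in> borel_measurable (sigma_Theta D)"
  shows "AE \<omega> in restr_to_subalg Q (sigma_Theta D). (f \<omega> :: real) = g \<omega>"
  by (rule AE_restr_to_subalg2[OF subalgebra_sigma_Theta[OF sets_Q] assms(1)]) measurable

lemma cond_indep_W_X:
  "cond_indep_sets Q (sigma_Theta D) (case_bool (sets (sigma_W D)) (sets (sigma_X D))) UNIV"
  unfolding cond_indep_sets_def
proof (intro conjI ballI allI impI)
  fix i :: bool show "case_bool (sets (sigma_W D)) (sets (sigma_X D)) i \<subseteq> sets Q"
    unfolding sets_Q by (rule case_bool_subset[OF sigma_W_subset_path sigma_X_subset_path])
next
  fix L :: "bool set" and A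
  assume L: "L \<subseteq> UNIV" "L \<noteq> {}" "finite L" and A: "A \<in> Pi L (case_bool (sets (sigma_W D)) (sets (sigma_X D)))"
  have "L = {True} \<or> L = {False} \<or> L = {True, False}"
  proof -
    have "L \<in> Pow {True, False}" by auto
    then have "L = {} \<or> L = {False} \<or> L = {True} \<or> L = {True, False}"
      unfolding Pow_insert Pow_empty by blast
    with L(2) show ?thesis by blast
  qed
  then consider "L = {True}" | "L = {False}" | "L = {True, False}" by blast
  then show "AE \<omega> in Q. cprob Q (sigma_Theta D) (\<Inter>j\<in>L. A j) \<omega> = (\<Prod>j\<in>L. cprob Q (sigma_Theta D) (A j) \<omega>)"
  proof cases
    case 3
    with A have A: "A True \<in> sets (sigma_W D)" "A False \<in> sets (sigma_X D)" by (auto simp: Pi_iff)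
    then have m: "A True \<in> sets (path_space D)" "A False \<in> sets (path_space D)"
      using sigma_W_subset_path sigma_X_subset_path by auto
    from cprob_Q[OF m(1)] cprob_Q[OF m(2)] cprob_Q[OF sets.Int[OF m]] AE_space show ?thesis
    proof eventually_elim
      case (elim \<omega>)
      then have \<theta>: "Theta \<omega> \<in> D" by (simp add: space_Q path_space_pos)
      interpret prob_space "PL (Theta \<omega>)" by (rule prob_PL[OF \<theta>])
      show ?case
        using elim emeasure_PL_indep[OF \<theta> A] 3
        by (simp add: emeasure_eq_measure ennreal_mult''[symmetric])
    qed
  qed simp_all
qed

lemma emeasure_PL_W_Inter:
  assumes \<theta>: "\<theta> \<in> D" and L: "finite L" and A: "\<And>j. j \<in> L \<Longrightarrow> A j \<in> sets pos_borel"
  shows "emeasure (PL \<theta>) {\<omega> \<in> space (path_space D). \<forall>j\<in>L. W j \<omega> \<in> A j} = (\<Prod>j\<in>L. emeasure (K \<theta>) (A j))"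
proof -
  interpret k: prob_space "K \<theta>" by (rule prob_K[OF \<theta>])
  interpret pk: product_prob_space "\<lambda>_. K \<theta>" "UNIV :: nat set" by unfold_locales
  let ?A = "{w \<in> space (\<Pi>\<^sub>M n\<in>(UNIV :: nat set). K \<theta>). \<forall>j\<in>L. w j \<in> A j}"
  have s: "?A \<in> sets seqs"
    unfolding sets_PiK[OF \<theta>, symmetric]
    by (intro sets.sets_Collect_finite_All sets_Collect_single L) (use A sets_K[OF \<theta>] in auto)
  have "{\<omega> \<in> space (path_space D). \<forall>j\<in>L. W j \<omega> \<in> A j} = {\<omega> \<in> space (path_space D). fst \<omega> \<in> ?A}"
    using fst_in_seqs[of _ D] by (auto simp: W_def sets_eq_imp_space_eq[OF sets_PiK[OF \<theta>]])
  then show ?thesis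
    using emeasure_PL_W[OF \<theta> s] pk.emeasure_PiM_Collect[of L A] A L sets_K[OF \<theta>] by simp
qed

lemma CMRP_Q: "CMRP D Q K"
  unfolding CMRP_def
proof (intro conjI allI ballI iid_Q_X indep_N_X)
  let ?c = "cprob Q (sigma_Theta D)"
  have one: "AE \<omega> in Q. ?c (W n -` B \<inter> space Q) \<omega> = measure (K (Theta \<omega>)) B"
    if B: "B \<in> sets pos_borel" for n B
  proof -
    have e: "W n -` B \<inter> space Q = {\<omega> \<in> space (path_space D). \<forall>j\<in>{n}. W j \<omega> \<in> B}" by (auto simp: space_Q)
    have m: "{\<omega> \<in> space (path_space D). \<forall>j\<in>{n}. W j \<omega> \<in> B} \<in> sets (path_space D)" using B by simp
    show ?thesis unfolding e using cprob_Q[OF m] AE_space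
    proof eventually_elim
      case (elim \<omega>)
      then have \<theta>: "Theta \<omega> \<in> D" by (simp add: space_Q path_space_pos)
      from elim(1) show ?case
        using emeasure_PL_W_Inter[OF \<theta>, of "{n}" "\<lambda>_. B"] B by (simp add: measure_def)
    qed
  qed
  show "cond_indep_sets Q (sigma_Theta D) (\<lambda>n. {W n -` B \<inter> space Q | B. B \<in> sets pos_borel}) UNIV"
    unfolding cond_indep_sets_def
  proof (intro conjI ballI allI impI)
    fix n show "{W n -` B \<inter> space Q | B. B \<in> sets pos_borel} \<subseteq> sets Q"
      using measurable_sets[OF measurable_W] by (auto simp: sets_Q space_Q)
  next
    fix L :: "nat set" and A
    assume L: "L \<subseteq> UNIV" "L \<noteq> {}" "finite L" and A: "A \<in> Pi L (\<lambda>n. {W n -` B \<inter> space Q | B. B \<in> sets pos_borel})"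
    have "\<forall>n. \<exists>B. n \<in> L \<longrightarrow> A n = W n -` B \<inter> space Q \<and> B \<in> sets pos_borel" using A by auto
    then obtain B where B: "\<And>n. n \<in> L \<Longrightarrow> A n = W n -` B n \<inter> space Q \<and> B n \<in> sets pos_borel" by metis
    have I: "(\<Inter>j\<in>L. A j) = {\<omega> \<in> space (path_space D). \<forall>j\<in>L. W j \<omega> \<in> B j}"
      using L(2) B by (auto simp: space_Q)
    have m: "{\<omega> \<in> space (path_space D). \<forall>j\<in>L. W j \<omega> \<in> B j} \<in> sets (path_space D)"
    proof (intro sets.sets_Collect_finite_All L(3))
      fix j assume "j \<in> L"
      then have [measurable]: "B j \<in> sets pos_borel" using B by blast
      show "{\<omega> \<in> space (path_space D). W j \<omega> \<in> B j} \<in> sets (path_space D)" by measurable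
    qed
    have "AE \<omega> in Q. \<forall>j\<in>L. ?c (A j) \<omega> = measure (K (Theta \<omega>)) (B j)"
      using L(3) B one by (intro AE_finite_allI) auto
    with cprob_Q[OF m] AE_space
    show "AE \<omega> in Q. ?c (\<Inter>j\<in>L. A j) \<omega> = (\<Prod>j\<in>L. ?c (A j) \<omega>)"
    proof eventually_elim
      case (elim \<omega>)
      then have \<theta>: "Theta \<omega> \<in> D" by (simp add: space_Q path_space_pos)
      interpret k: prob_space "K (Theta \<omega>)" by (rule prob_K[OF \<theta>])
      interpret prob_space "PL (Theta \<omega>)" by (rule prob_PL[OF \<theta>])
      have "measure (PL (Theta \<omega>)) {\<omega> \<in> space (path_space D). \<forall>j\<in>L. W j \<omega> \<in> B j} = (\<Prod>j\<in>L. measure (K (Theta \<omega>)) (B j))"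
        using emeasure_PL_W_Inter[OF \<theta> L(3), of B] B
        by (simp add: emeasure_eq_measure k.emeasure_eq_measure prod_ennreal prod_nonneg)
      with elim show ?case by (simp add: I)
    qed
  qed
  fix n B assume B: "B \<in> sets pos_borel"
  have [measurable]: "(\<lambda>\<theta>. measure (K \<theta>) B) \<in> borel_measurable (param_borel D)"
    using measurable_emeasure_K[OF B] by (simp add: measure_def)
  show "AE \<omega> in restr_to_subalg Q (sigma_Theta D). ?c (W n -` B \<inter> space Q) \<omega> = measure (K (Theta \<omega>)) B"
    by (rule AE_restr_eq[OF one[OF B]]) (simp_all add: cprob_def)
qed

end

section \<open>The law is determined by its conditional structure\<close>

text \<open>Conditionally on the parameter, a rectangle factors into a part in \<open>W\<close> and a part in
  \<open>X\<close> by (a1). The first one is a product of values of the kernel, as the process is a compound mixed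
  renewal process. The second one is constant by (a2) and a product as \<open>X\<close> is i.i.d. Integrating over the
  parameter gives the value of the mixture.\<close>

lemma mixed_law_unique:
  fixes D :: "(real ^ 'd::finite) set"
  assumes Qm: "Qm \<in> prob_on (path_space D)" and Lam: "Lam \<in> param_borel D \<rightarrow>\<^sub>M prob_algebra pos_borel"
    and a1: "cond_indep_sets Qm (sigma_Theta D) (case_bool (sets (sigma_W D)) (sets (sigma_X D))) UNIV"
    and a2: "prob_space.indep_set Qm (sets (sigma_Theta D)) (sets (sigma_X D))"
    and cmrp: "CMRP D Qm Lam"
  shows "mixed_renewal D Lam (distr Qm pos_borel (X 0)) (distr Qm (param_borel D) Theta)"
    and "Qm = mixed_law D (distr Qm (param_borel D) Theta) Lam (distr Qm pos_borel (X 0))"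
proof -
  have sQ: "sets Qm = sets (path_space D)" using Qm by (simp add: prob_on_def)
  note spQ = sets_eq_imp_space_eq[OF sQ]
  interpret prob_space Qm using Qm by (simp add: prob_on_def)
  let ?\<Omega> = "space (path_space D)" and ?\<nu> = "distr Qm (param_borel D) Theta" and ?R = "distr Qm pos_borel (X 0)"
  have mQ: "measurable Qm M = measurable (path_space D) M" for M :: "'b measure"
    using measurable_cong_sets[OF sQ refl] by blast
  have mTh[measurable]: "Theta \<in> Qm \<rightarrow>\<^sub>M param_borel D"
    using measurable_Theta measurable_cong_sets[OF sQ refl] by blast
  have mX[measurable]: "X n \<in> Qm \<rightarrow>\<^sub>M pos_borel" for n
    using measurable_X measurable_cong_sets[OF sQ refl] by blast
  interpret m: mixed_renewal D Lam ?R ?\<nu>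
    by unfold_locales (use Lam in \<open>auto simp: space_prob_algebra intro!: prob_space_distr\<close>)
  show "mixed_renewal D Lam ?R ?\<nu>" by (rule m.mixed_renewal_axioms)
  interpret F: finite_measure_subalgebra Qm "sigma_Theta D"
    by (intro finite_measure_subalgebraI prob_space_axioms subalgebra_sigma_Theta sQ)
  show "Qm = mixed_law D ?\<nu> Lam ?R"
  proof (rule path_measure_eqI[OF sQ m.sets_Q finite_measure_axioms])
    fix n and A B :: "nat \<Rightarrow> real set" and C :: "(real ^ 'd) set"
    assume A: "\<And>j. A j \<in> sets pos_borel" and B: "\<And>j. B j \<in> sets pos_borel" and C: "C \<in> sets (param_borel D)"
    note [measurable] = A B C
    \<comment> \<open>The rectangle is an intersection of events about \<open>W\<close>, \<open>X\<close> and \<open>Theta\<close>.\<close>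
    define WE where "WE = {\<omega> \<in> ?\<Omega>. \<forall>j\<in>{..n}. W j \<omega> \<in> A j}"
    define XE where "XE = {\<omega> \<in> ?\<Omega>. \<forall>j\<in>{..n}. X j \<omega> \<in> B j}"
    define TE where "TE = Theta -` C \<inter> ?\<Omega>"
    have rect: "rect D n A B C = TE \<inter> (WE \<inter> XE)"
      by (auto simp: rect_def WE_def XE_def TE_def)
    have WE: "WE \<in> sets (sigma_W D)"
    proof -
      have "WE = {\<omega> \<in> ?\<Omega>. fst \<omega> \<in> {w \<in> space seqs. \<forall>j\<in>{..n}. w j \<in> A j}}"
        using fst_in_seqs[of _ D] by (auto simp: WE_def W_def)
      moreover have "{w \<in> space seqs. \<forall>j\<in>{..n}. w j \<in> A j} \<in> sets seqs" by measurable
      ultimately show ?thesis unfolding sets_sigma_W by blast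
    qed
    have XE: "XE \<in> sets (sigma_X D)"
    proof -
      have "XE = {\<omega> \<in> ?\<Omega>. fst (snd \<omega>) \<in> {w \<in> space seqs. \<forall>j\<in>{..n}. w j \<in> B j}}"
        using fst_in_seqs[of _ D] by (auto simp: XE_def X_def)
      moreover have "{w \<in> space seqs. \<forall>j\<in>{..n}. w j \<in> B j} \<in> sets seqs" by measurable
      ultimately show ?thesis unfolding sets_sigma_X by blast
    qed
    have TE: "TE \<in> sets (sigma_Theta D)" unfolding sets_sigma_Theta TE_def using C by blast
    have ev[measurable]: "WE \<in> events" "XE \<in> events" "TE \<in> events"
      using subsetD[OF sigma_W_subset_path WE] subsetD[OF sigma_X_subset_path XE]
        subsetD[OF sigma_Theta_subset_path TE] by (simp_all only: sQ)
    have int_ind: "integrable Qm (indicat_real G)" if "G \<in> events" for G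
      using that by (intro integrable_real_indicator) (simp_all add: emeasure_eq_measure)
    let ?c = "cprob Qm (sigma_Theta D)"
    have cX: "AE \<omega> in Qm. ?c XE \<omega> = prob XE"
      unfolding cprob_def
    proof (rule F.real_cond_exp_charact)
      fix G assume G: "G \<in> sets (sigma_Theta D)"
      then have [measurable]: "G \<in> events"
        using subsetD[OF sigma_Theta_subset_path] by (simp only: sQ)
      have "(\<integral>\<omega>\<in>G. indicator XE \<omega> \<partial>Qm) = prob (G \<inter> XE)"
        by (simp add: set_lebesgue_integral_def indicator_inter_arith[symmetric])
      also have "\<dots> = prob G * prob XE" using a2[unfolded indep_sets2_eq] G XE by blast
      finally show "(\<integral>\<omega>\<in>G. indicator XE \<omega> \<partial>Qm) = (\<integral>\<omega>\<in>G. prob XE \<partial>Qm)"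
        by (simp add: set_lebesgue_integral_def)
    qed (simp_all add: int_ind)
    have cW: "AE \<omega> in Qm. ?c WE \<omega> = (\<Prod>j\<le>n. measure (Lam (Theta \<omega>)) (A j))"
    proof -
      let ?A = "\<lambda>j. W j -` A j \<inter> space Qm"
      have 1: "AE \<omega> in Qm. ?c (\<Inter>j\<in>{..n}. ?A j) \<omega> = (\<Prod>j\<in>{..n}. ?c (?A j) \<omega>)"
      proof -
        have ci: "cond_indep_sets Qm (sigma_Theta D) (\<lambda>n. {W n -` B \<inter> space Qm | B. B \<in> sets pos_borel}) UNIV"
          using cmrp by (simp add: CMRP_def)
        have "?A \<in> Pi {..n} (\<lambda>n. {W n -` B \<inter> space Qm | B. B \<in> sets pos_borel})" using A by blast
        then show ?thesis
          by (intro ci[unfolded cond_indep_sets_def, THEN conjunct2, rule_format]) auto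
      qed
      have 2: "(\<Inter>j\<in>{..n}. ?A j) = WE" by (auto simp: WE_def spQ)
      have "AE \<omega> in Qm. \<forall>j\<in>{..n}. ?c (?A j) \<omega> = measure (Lam (Theta \<omega>)) (A j)"
      proof (intro AE_finite_allI)
        fix j
        have "AE \<omega> in restr_to_subalg Qm (sigma_Theta D). ?c (?A j) \<omega> = measure (Lam (Theta \<omega>)) (A j)"
          using cmrp A[of j] unfolding CMRP_def by blast
        then show "AE \<omega> in Qm. ?c (?A j) \<omega> = measure (Lam (Theta \<omega>)) (A j)"
          by (rule AE_restr_to_subalg[OF subalgebra_sigma_Theta[OF sQ]])
      qed simp
      with 1 show ?thesis unfolding 2 by eventually_elim simp
    qed
    have cWX: "AE \<omega> in Qm. ?c (WE \<inter> XE) \<omega> = ?c WE \<omega> * ?c XE \<omega>"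
    proof -
      have "case_bool WE XE \<in> Pi UNIV (case_bool (sets (sigma_W D)) (sets (sigma_X D)))"
        using WE XE by (auto split: bool.split)
      moreover have "finite (UNIV :: bool set)" "(UNIV :: bool set) \<noteq> {}" "(UNIV :: bool set) \<subseteq> UNIV" by auto
      ultimately have "AE \<omega> in Qm. ?c (\<Inter>j\<in>UNIV. case_bool WE XE j) \<omega> = (\<Prod>j\<in>UNIV. ?c (case_bool WE XE j) \<omega>)"
        using a1 unfolding cond_indep_sets_def by blast
      then show ?thesis by (simp add: UNIV_bool Int_commute mult.commute)
    qed
    have pX: "prob XE = (\<Prod>j\<le>n. measure ?R (B j))"
    proof -
      have iv: "indep_vars (\<lambda>_. pos_borel) X UNIV" and d: "distr Qm pos_borel (X j) = ?R" for j
        using cmrp by (auto simp: CMRP_def iid_def)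
      have "XE = (\<Inter>j\<in>{..n}. X j -` B j \<inter> space Qm)" by (auto simp: XE_def spQ)
      also have "prob \<dots> = (\<Prod>j\<in>{..n}. prob (X j -` B j \<inter> space Qm))"
        by (rule indep_varsD[OF iv]) (use B in auto)
      also have "\<dots> = (\<Prod>j\<le>n. measure ?R (B j))"
      proof (intro prod.cong refl)
        fix j
        have "prob (X j -` B j \<inter> space Qm) = measure (distr Qm pos_borel (X j)) (B j)"
          using B by (simp add: measure_distr)
        then show "prob (X j -` B j \<inter> space Qm) = measure ?R (B j)" by (simp only: d[of j])
      qed
      finally show ?thesis .
    qed
    have mL[measurable]: "(\<lambda>\<theta>. measure (Lam \<theta>) (A j)) \<in> borel_measurable (param_borel D)" for j
      using m.measurable_emeasure_K[OF A[of j]] by (simp add: measure_def)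
    let ?g = "\<lambda>\<theta>. (\<Prod>j\<le>n. measure (Lam \<theta>) (A j)) * prob XE"
    have g01: "0 \<le> ?g \<theta> \<and> ?g \<theta> \<le> 1" if "\<theta> \<in> D" for \<theta>
    proof -
      interpret L: prob_space "Lam \<theta>" by (rule m.prob_K[OF that])
      have "(\<Prod>j\<le>n. measure (Lam \<theta>) (A j)) \<le> 1" by (intro prod_le_1) auto
      then show ?thesis by (intro conjI mult_nonneg_nonneg prod_nonneg mult_le_one) simp_all
    qed
    have "prob (rect D n A B C) = (\<integral>\<omega>\<in>TE. indicator (WE \<inter> XE) \<omega> \<partial>Qm)"
      unfolding rect by (simp add: set_lebesgue_integral_def indicator_inter_arith[symmetric])
    also have "\<dots> = (\<integral>\<omega>\<in>TE. ?c (WE \<inter> XE) \<omega> \<partial>Qm)"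
      unfolding cprob_def by (rule F.real_cond_exp_intA[OF _ TE]) (simp add: int_ind)
    also have "\<dots> = (\<integral>\<omega>. indicator TE \<omega> * ?g (Theta \<omega>) \<partial>Qm)"
      unfolding set_lebesgue_integral_def
    proof (rule integral_cong_AE)
      show "AE \<omega> in Qm. indicator TE \<omega> *\<^sub>R ?c (WE \<inter> XE) \<omega> = indicator TE \<omega> * ?g (Theta \<omega>)"
        using cX cW cWX by eventually_elim simp
    qed (simp_all add: cprob_def)
    finally have "emeasure Qm (rect D n A B C) = ennreal (\<integral>\<omega>. indicator TE \<omega> * ?g (Theta \<omega>) \<partial>Qm)"
      by (simp add: emeasure_eq_measure)
    also have "\<dots> = (\<integral>\<^sup>+\<omega>. ennreal (indicator TE \<omega> * ?g (Theta \<omega>)) \<partial>Qm)"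
    proof (rule nn_integral_eq_integral[symmetric])
      have "AE \<omega> in Qm. norm (indicator TE \<omega> * ?g (Theta \<omega>)) \<le> 1"
        using AE_space
      proof eventually_elim
        case (elim \<omega>)
        then have "Theta \<omega> \<in> D" by (simp add: spQ path_space_pos)
        from g01[OF this] show ?case by (simp add: indicator_def)
      qed
      then show "integrable Qm (\<lambda>\<omega>. indicator TE \<omega> * ?g (Theta \<omega>))"
        by (intro integrable_const_bound[where B=1]) measurable
      show "AE \<omega> in Qm. 0 \<le> indicator TE \<omega> * ?g (Theta \<omega>)"
        by (intro AE_I2 mult_nonneg_nonneg prod_nonneg) simp_all
    qed
    also have "\<dots> = (\<integral>\<^sup>+\<omega>. indicator C (Theta \<omega>) * ennreal (?g (Theta \<omega>)) \<partial>Qm)"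
      by (intro nn_integral_cong) (simp add: TE_def spQ indicator_def)
    also have "\<dots> = (\<integral>\<^sup>+\<theta>. indicator C \<theta> * ennreal (?g \<theta>) \<partial>?\<nu>)"
      by (rule nn_integral_distr[symmetric]) measurable
    also have "\<dots> = (\<integral>\<^sup>+\<theta>. emeasure (path_law D Lam ?R \<theta>) (rect D n A B C) \<partial>?\<nu>)"
    proof (intro nn_integral_cong)
      fix \<theta> assume "\<theta> \<in> space ?\<nu>"
      then have \<theta>: "\<theta> \<in> D" by simp
      interpret L: prob_space "Lam \<theta>" by (rule m.prob_K[OF \<theta>])
      interpret R: prob_space ?R by (rule m.prob_R)
      show "indicator C \<theta> * ennreal (?g \<theta>) = emeasure (path_law D Lam ?R \<theta>) (rect D n A B C)"
        unfolding m.emeasure_PL_rect[OF \<theta> A B C] pX L.emeasure_eq_measure R.emeasure_eq_measure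
        by (simp add: prod_ennreal ennreal_mult'' prod_nonneg mult_ac)
    qed
    also have "\<dots> = emeasure (mixed_law D ?\<nu> Lam ?R) (rect D n A B C)"
      by (rule m.emeasure_Q[symmetric]) (rule rect_in_sets[OF A B C])
    finally show "emeasure Qm (rect D n A B C) = emeasure (mixed_law D ?\<nu> Lam ?R) (rect D n A B C)" .
  qed
qed

section \<open>Uniqueness of kernels and joint densities\<close>

text \<open>Finite intersections of members of a countable basis.\<close>

lemma countable_generator_restrict_borel:
  fixes \<Omega> :: "'a::second_countable_topology set"
  obtains G where "countable G" "Int_stable G" "G \<subseteq> Pow \<Omega>" "\<Omega> \<in> G"
    "sets (restrict_space borel \<Omega>) = sigma_sets \<Omega> G"
proof -
  obtain B :: "'a set set" where B: "countable B" "topological_basis B" using ex_countable_basis by blast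
  define G where "G = (\<lambda>F. \<Omega> \<inter> \<Inter>F) ` {F. finite F \<and> F \<subseteq> B}"
  have GP: "G \<subseteq> Pow \<Omega>" by (auto simp: G_def)
  have I: "Int_stable G"
  proof (rule Int_stableI)
    fix a b assume "a \<in> G" "b \<in> G"
    then obtain F F' where F: "a = \<Omega> \<inter> \<Inter>F" "finite F" "F \<subseteq> B" "b = \<Omega> \<inter> \<Inter>F'" "finite F'" "F' \<subseteq> B"
      by (auto simp: G_def)
    then have e: "a \<inter> b = \<Omega> \<inter> \<Inter>(F \<union> F')" by auto
    show "a \<inter> b \<in> G" unfolding G_def e by (rule imageI) (use F in simp)
  qed
  have "\<Omega> \<inter> \<Inter>{} \<in> G" unfolding G_def by (rule imageI) simp
  then have S: "\<Omega> \<in> G" by simp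
  have "sets (restrict_space borel \<Omega>) \<subseteq> sigma_sets \<Omega> G"
  proof
    have "(\<lambda>x. x) \<in> sigma \<Omega> G \<rightarrow>\<^sub>M borel"
    proof (rule measurable_sigma_sets[of borel UNIV B])
      show "sets borel = sigma_sets UNIV B"
        unfolding borel_eq_countable_basis[OF B] by simp
      fix b assume "b \<in> B"
      then have "\<Omega> \<inter> \<Inter>{b} \<in> G" unfolding G_def by (intro imageI) simp
      then show "(\<lambda>x. x) -` b \<inter> space (sigma \<Omega> G) \<in> sets (sigma \<Omega> G)"
        using GP by (simp add: Int_commute space_measure_of_conv)
    qed auto
    note m = measurable_sets[OF this]
    fix a assume "a \<in> sets (restrict_space borel \<Omega>)"
    then obtain b where "b \<in> sets borel" "a = \<Omega> \<inter> b" by (auto simp: sets_restrict_space)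
    with m[of b] GP show "a \<in> sigma_sets \<Omega> G" by (simp add: Int_commute space_measure_of_conv)
  qed
  moreover have "sigma_sets \<Omega> G \<subseteq> sets (restrict_space borel \<Omega>)"
  proof -
    have "G \<subseteq> sets (restrict_space borel \<Omega>)"
    proof
      fix g assume "g \<in> G"
      then obtain F where F: "g = \<Omega> \<inter> \<Inter>F" "finite F" "F \<subseteq> B" by (auto simp: G_def)
      then have "open (\<Inter>F)" using topological_basis_open[OF B(2)] by (intro open_Inter) auto
      then show "g \<in> sets (restrict_space borel \<Omega>)" using F by (auto simp: sets_restrict_space)
    qed
    from sets.sigma_sets_subset[OF this] show ?thesis by (simp add: space_restrict_space)
  qed
  moreover have "countable G" unfolding G_def by (intro countable_image countable_Collect_finite_subset B)
  ultimately show ?thesis using that I GP S by blast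
qed

text \<open>For each set the two kernels agree outside a null set, as both are densities of the same measure. Null
  sets for uncountably many sets cannot be united, but a countable generator stable under intersection
  suffices for equality of measures.\<close>

lemma kernel_AE_eq:
  fixes \<Omega> :: "'b::second_countable_topology set"
  assumes \<nu>: "finite_measure \<nu>"
    and k1: "\<And>\<theta>. \<theta> \<in> space \<nu> \<Longrightarrow> prob_space (k1 \<theta>) \<and> sets (k1 \<theta>) = sets (restrict_space borel \<Omega>)"
    and k2: "\<And>\<theta>. \<theta> \<in> space \<nu> \<Longrightarrow> sets (k2 \<theta>) = sets (restrict_space borel \<Omega>)"
    and m1: "\<And>E. E \<in> sets (restrict_space borel \<Omega>) \<Longrightarrow> (\<lambda>\<theta>. emeasure (k1 \<theta>) E) \<in> borel_measurable \<nu>"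
    and m2: "\<And>E. E \<in> sets (restrict_space borel \<Omega>) \<Longrightarrow> (\<lambda>\<theta>. emeasure (k2 \<theta>) E) \<in> borel_measurable \<nu>"
    and eq: "\<And>E C. E \<in> sets (restrict_space borel \<Omega>) \<Longrightarrow> C \<in> sets \<nu> \<Longrightarrow>
      (\<integral>\<^sup>+\<theta>. emeasure (k1 \<theta>) E * indicator C \<theta> \<partial>\<nu>) = (\<integral>\<^sup>+\<theta>. emeasure (k2 \<theta>) E * indicator C \<theta> \<partial>\<nu>)"
  shows "AE \<theta> in \<nu>. k1 \<theta> = k2 \<theta>"
proof -
  interpret finite_measure \<nu> by (rule \<nu>)
  obtain G where G: "countable G" "Int_stable G" "G \<subseteq> Pow \<Omega>" "\<Omega> \<in> G"
    "sets (restrict_space borel \<Omega>) = sigma_sets \<Omega> G"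
    by (rule countable_generator_restrict_borel)
  have "AE \<theta> in \<nu>. emeasure (k1 \<theta>) E = emeasure (k2 \<theta>) E" if "E \<in> G" for E
  proof -
    have "E \<in> sets (restrict_space borel \<Omega>)" using that G(5) by auto
    then show ?thesis
      by (intro density_unique_finite_measure m1 m2 eq) auto
  qed
  then have "AE \<theta> in \<nu>. \<forall>E\<in>G. emeasure (k1 \<theta>) E = emeasure (k2 \<theta>) E"
    by (rule AE_ball_countable'[OF _ G(1)])
  then show ?thesis using AE_space
  proof eventually_elim
    case (elim \<theta>)
    have p: "prob_space (k1 \<theta>)" and s: "sets (k1 \<theta>) = sigma_sets \<Omega> G" "sets (k2 \<theta>) = sigma_sets \<Omega> G"
      using k1[OF elim(2)] k2[OF elim(2)] by (simp_all only: G(5))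
    show ?case
    proof (rule measure_eqI_generator_eq[OF G(2,3) _ s, where A="\<lambda>_. \<Omega>"])
      show "emeasure (k1 \<theta>) \<Omega> \<noteq> \<infinity>"
        using finite_measure.emeasure_finite[OF prob_space.finite_measure[OF p]] by simp
      show "emeasure (k1 \<theta>) E = emeasure (k2 \<theta>) E" if "E \<in> G" for E using elim(1) that by (rule bspec)
    qed (use G(4) in simp_all)
  qed
qed

context mixed_renewal
begin

lemma nn_integral_Q_Theta_W:
  assumes f: "f \<in> borel_measurable (param_borel D \<Otimes>\<^sub>M pos_borel)"
  shows "(\<integral>\<^sup>+\<omega>. f (Theta \<omega>, W n \<omega>) \<partial>Q) = (\<integral>\<^sup>+\<theta>. (\<integral>\<^sup>+w. f (\<theta>, w) \<partial>K \<theta>) \<partial>\<nu>)"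
proof -
  note [measurable] = f
  have "(\<integral>\<^sup>+\<omega>. f (Theta \<omega>, W n \<omega>) \<partial>Q) = (\<integral>\<^sup>+\<theta>. (\<integral>\<^sup>+\<omega>. f (Theta \<omega>, W n \<omega>) \<partial>PL \<theta>) \<partial>\<nu>)"
    by (intro nn_integral_Q measurable_compose[OF _ f] measurable_Pair measurable_Theta measurable_W)
  also have "\<dots> = (\<integral>\<^sup>+\<theta>. (\<integral>\<^sup>+w. f (\<theta>, w) \<partial>K \<theta>) \<partial>\<nu>)"
  proof (intro nn_integral_cong)
    fix \<theta> assume "\<theta> \<in> space \<nu>"
    then have \<theta>: "\<theta> \<in> D" by (simp add: space_\<nu>)
    have "(\<integral>\<^sup>+\<omega>. f (Theta \<omega>, W n \<omega>) \<partial>PL \<theta>) = (\<integral>\<^sup>+\<omega>. f (\<theta>, W n \<omega>) \<partial>PL \<theta>)"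
      by (rule nn_integral_PL_Theta[OF \<theta>, of "\<lambda>\<theta> \<omega>. f (\<theta>, W n \<omega>)"])
    also have "\<dots> = (\<integral>\<^sup>+w. f (\<theta>, w) \<partial>K \<theta>)"
      using measurable_compose[OF measurable_Pair1'[of \<theta> "param_borel D" pos_borel] f] \<theta>
      by (intro nn_integral_PL_W[OF \<theta>]) simp
    finally show "(\<integral>\<^sup>+\<omega>. f (Theta \<omega>, W n \<omega>) \<partial>PL \<theta>) = (\<integral>\<^sup>+w. f (\<theta>, w) \<partial>K \<theta>)" .
  qed
  finally show ?thesis .
qed

lemma measurable_nn_integral_K:
  assumes f: "f \<in> borel_measurable (param_borel D \<Otimes>\<^sub>M pos_borel)"
  shows "(\<lambda>\<theta>. \<integral>\<^sup>+w. f (\<theta>, w) \<partial>K \<theta>) \<in> borel_measurable (param_borel D)"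
  using nn_integral_measurable_subprob_algebra2[OF _ measurable_prob_algebraD[OF K], of "\<lambda>\<theta> w. f (\<theta>, w)"] f
  by simp

text \<open>The joint law of the parameter and one interarrival time is the semidirect product of mixing law and
  kernel. It carries the whole kernel, up to null sets of parameters, in a single measure.\<close>

lemma emeasure_Q_Theta_W:
  assumes [measurable]: "C \<in> sets (param_borel D \<Otimes>\<^sub>M pos_borel)"
  shows "emeasure Q {\<omega> \<in> space (path_space D). (Theta \<omega>, W n \<omega>) \<in> C} =
    (\<integral>\<^sup>+\<theta>. emeasure (K \<theta>) {w \<in> {0<..}. (\<theta>, w) \<in> C} \<partial>\<nu>)"
proof -
  have "emeasure Q {\<omega> \<in> space (path_space D). (Theta \<omega>, W n \<omega>) \<in> C} =
      (\<integral>\<^sup>+\<omega>. indicator {\<omega> \<in> space (path_space D). (Theta \<omega>, W n \<omega>) \<in> C} \<omega> \<partial>Q)"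
    by (rule nn_integral_indicator[symmetric]) (simp add: sets_Q)
  also have "\<dots> = (\<integral>\<^sup>+\<omega>. indicator C (Theta \<omega>, W n \<omega>) \<partial>Q)"
    by (intro nn_integral_cong) (simp add: space_Q indicator_def)
  also have "\<dots> = (\<integral>\<^sup>+\<theta>. (\<integral>\<^sup>+w. indicator C (\<theta>, w) \<partial>K \<theta>) \<partial>\<nu>)"
    by (rule nn_integral_Q_Theta_W) simp
  also have "\<dots> = (\<integral>\<^sup>+\<theta>. emeasure (K \<theta>) {w \<in> {0<..}. (\<theta>, w) \<in> C} \<partial>\<nu>)"
  proof (intro nn_integral_cong)
    fix \<theta> assume "\<theta> \<in> space \<nu>"
    then have \<theta>: "\<theta> \<in> D" by (simp add: space_\<nu>)
    have "Pair \<theta> -` C \<inter> space pos_borel \<in> sets pos_borel"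
      by (rule measurable_sets[OF measurable_Pair1' assms]) (use \<theta> in simp)
    moreover have "Pair \<theta> -` C \<inter> space pos_borel = {w \<in> {0<..}. (\<theta>, w) \<in> C}" by auto
    ultimately have s: "{w \<in> {0<..}. (\<theta>, w) \<in> C} \<in> sets (K \<theta>)" by (simp only: sets_K[OF \<theta>])
    have "(\<integral>\<^sup>+w. indicator C (\<theta>, w) \<partial>K \<theta>) = (\<integral>\<^sup>+w. indicator {w \<in> {0<..}. (\<theta>, w) \<in> C} w \<partial>K \<theta>)"
      by (intro nn_integral_cong) (simp add: space_K[OF \<theta>] indicator_def)
    with s show "(\<integral>\<^sup>+w. indicator C (\<theta>, w) \<partial>K \<theta>) = emeasure (K \<theta>) {w \<in> {0<..}. (\<theta>, w) \<in> C}" by simp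
  qed
  finally show ?thesis .
qed

lemma measurable_emeasure_K_section:
  assumes [measurable]: "C \<in> sets (param_borel D \<Otimes>\<^sub>M pos_borel)"
  shows "(\<lambda>\<theta>. emeasure (K \<theta>) {w \<in> {0<..}. (\<theta>, w) \<in> C}) \<in> borel_measurable (param_borel D)"
proof (rule emeasure_measurable_subprob_algebra2[OF _ measurable_prob_algebraD[OF K]])
  have "C \<subseteq> D \<times> {0<..}" using sets.sets_into_space[OF assms] by (simp add: space_pair_measure)
  then have "(SIGMA \<theta>:space (param_borel D). {w \<in> {0<..}. (\<theta>, w) \<in> C}) = C" by auto
  with assms show "(SIGMA \<theta>:space (param_borel D). {w \<in> {0<..}. (\<theta>, w) \<in> C}) \<in> sets (param_borel D \<Otimes>\<^sub>M pos_borel)"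
    by simp
qed

end

text \<open>A derivative chosen separately for every \<open>\<theta>\<close> need not be measurable in \<open>\<theta>\<close>. Instead the joint laws of
  the parameter and the first interarrival time are differentiated; the sections of that derivative
  are densities of the kernels for almost every parameter by uniqueness of kernels.\<close>

lemma kernel_density:
  fixes D :: "(real ^ 'd::finite) set"
  assumes "mixed_renewal D K1 R \<mu>" and "mixed_renewal D K2 R \<mu>"
    and ac: "\<And>C. C \<in> sets (param_borel D \<Otimes>\<^sub>M pos_borel) \<Longrightarrow>
      AE \<theta> in \<mu>. emeasure (K1 \<theta>) {w \<in> {0<..}. (\<theta>, w) \<in> C} = 0 \<Longrightarrow>
      AE \<theta> in \<mu>. emeasure (K2 \<theta>) {w \<in> {0<..}. (\<theta>, w) \<in> C} = 0"
  obtains r :: "real ^ 'd \<Rightarrow> real \<Rightarrow> real"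
    where "(\<lambda>(\<theta>, w). r \<theta> w) \<in> borel_measurable (param_borel D \<Otimes>\<^sub>M pos_borel)"
      "AE \<theta> in \<mu>. rn_density (K1 \<theta>) (K2 \<theta>) (r \<theta>)"
proof -
  interpret m1: mixed_renewal D K1 R \<mu> by (rule assms(1))
  interpret m2: mixed_renewal D K2 R \<mu> by (rule assms(2))
  let ?DP = "param_borel D \<Otimes>\<^sub>M pos_borel" and ?f = "\<lambda>\<omega> :: 'd path. (Theta \<omega>, W 0 \<omega>)"
  define j1 where "j1 = distr m1.Q ?DP ?f"
  define j2 where "j2 = distr m2.Q ?DP ?f"
  have f1: "?f \<in> m1.Q \<rightarrow>\<^sub>M ?DP" unfolding m1.measurable_Q by measurable
  have f2: "?f \<in> m2.Q \<rightarrow>\<^sub>M ?DP" unfolding m2.measurable_Q by measurable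
  interpret j1: prob_space j1 unfolding j1_def by (rule prob_space.prob_space_distr[OF m1.prob_Q f1])
  interpret j2: prob_space j2 unfolding j2_def by (rule prob_space.prob_space_distr[OF m2.prob_Q f2])
  have s1[simp, measurable_cong]: "sets j1 = sets ?DP" and s2[simp, measurable_cong]: "sets j2 = sets ?DP"
    by (simp_all add: j1_def j2_def)
  have i1: "(\<integral>\<^sup>+z. h z \<partial>j1) = (\<integral>\<^sup>+\<theta>. (\<integral>\<^sup>+w. h (\<theta>, w) \<partial>K1 \<theta>) \<partial>\<mu>)" if "h \<in> borel_measurable ?DP" for h
    unfolding j1_def using that by (simp add: nn_integral_distr[OF f1] m1.nn_integral_Q_Theta_W)
  have i2: "(\<integral>\<^sup>+z. h z \<partial>j2) = (\<integral>\<^sup>+\<theta>. (\<integral>\<^sup>+w. h (\<theta>, w) \<partial>K2 \<theta>) \<partial>\<mu>)" if "h \<in> borel_measurable ?DP" for h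
    unfolding j2_def using that by (simp add: nn_integral_distr[OF f2] m2.nn_integral_Q_Theta_W)
  have acj: "absolutely_continuous j1 j2"
    unfolding absolutely_continuous_def
  proof
    fix C assume C: "C \<in> null_sets j1"
    then have Cs: "C \<in> sets ?DP" by auto
    have e1: "emeasure j1 C = (\<integral>\<^sup>+\<theta>. emeasure (K1 \<theta>) {w \<in> {0<..}. (\<theta>, w) \<in> C} \<partial>\<mu>)"
      unfolding j1_def m1.emeasure_Q_Theta_W[OF Cs, of 0, symmetric]
      by (subst emeasure_distr[OF f1 Cs]) (auto intro!: arg_cong[where f="emeasure m1.Q"] simp: m1.space_Q)
    have e2: "emeasure j2 C = (\<integral>\<^sup>+\<theta>. emeasure (K2 \<theta>) {w \<in> {0<..}. (\<theta>, w) \<in> C} \<partial>\<mu>)"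
      unfolding j2_def m2.emeasure_Q_Theta_W[OF Cs, of 0, symmetric]
      by (subst emeasure_distr[OF f2 Cs]) (auto intro!: arg_cong[where f="emeasure m2.Q"] simp: m2.space_Q)
    have "AE \<theta> in \<mu>. emeasure (K1 \<theta>) {w \<in> {0<..}. (\<theta>, w) \<in> C} = 0"
      using C e1 m1.measurable_emeasure_K_section[OF Cs] by (simp add: nn_integral_0_iff_AE m1.measurable_\<nu> null_sets_def)
    from ac[OF Cs this] have "emeasure j2 C = 0"
      unfolding e2 using m2.measurable_emeasure_K_section[OF Cs] by (simp add: nn_integral_0_iff_AE m1.measurable_\<nu>)
    then show "C \<in> null_sets j2" using Cs by auto
  qed
  define g where "g = RN_deriv j1 j2"
  have g[measurable]: "g \<in> borel_measurable ?DP"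
    using borel_measurable_RN_deriv[of j1 j2] unfolding g_def by simp
  have gd: "density j1 g = j2" unfolding g_def by (rule j1.density_RN_deriv[OF acj]) simp
  have gf: "AE z in j1. g z \<noteq> \<infinity>"
    unfolding g_def by (rule j1.RN_deriv_finite[OF _ acj]) (simp_all add: j2.sigma_finite_measure_axioms)
  define r where "r = (\<lambda>\<theta> w. enn2real (g (\<theta>, w)))"
  have r[measurable]: "(\<lambda>(\<theta>, w). r \<theta> w) \<in> borel_measurable ?DP" unfolding r_def by measurable
  have rK: "r \<theta> \<in> borel_measurable (K1 \<theta>)" if "\<theta> \<in> D" for \<theta>
  proof -
    have "(\<lambda>w. (\<lambda>(\<theta>, w). r \<theta> w) (\<theta>, w)) \<in> borel_measurable pos_borel"
      by (rule measurable_compose[OF measurable_Pair1' r]) (use that in simp)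
    then show ?thesis by (simp only: measurable_cong_sets[OF m1.sets_K[OF that] refl] prod.case)
  qed
  have em: "emeasure (density (K1 \<theta>) (\<lambda>w. ennreal (r \<theta> w))) E = (\<integral>\<^sup>+w. ennreal (r \<theta> w) * indicator E w \<partial>K1 \<theta>)"
    if "\<theta> \<in> D" "E \<in> sets pos_borel" for \<theta> E
    using rK[OF that(1)] that m1.sets_K by (subst emeasure_density) auto
  have "AE \<theta> in \<mu>. K2 \<theta> = density (K1 \<theta>) (\<lambda>w. ennreal (r \<theta> w))"
  proof (rule kernel_AE_eq[where \<Omega>="{0<..}"])
    show "finite_measure \<mu>" using m1.prob_\<nu> by (rule prob_space.finite_measure)
  next
    fix \<theta> assume "\<theta> \<in> space \<mu>"
    then have \<theta>: "\<theta> \<in> D" by (simp add: m1.space_\<nu>)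
    show "prob_space (K2 \<theta>) \<and> sets (K2 \<theta>) = sets (restrict_space borel {0<..})"
      using m2.prob_K[OF \<theta>] m2.sets_K[OF \<theta>] by (simp add: pos_borel_def)
    show "sets (density (K1 \<theta>) (\<lambda>w. ennreal (r \<theta> w))) = sets (restrict_space borel {0<..})"
      using m1.sets_K[OF \<theta>] by (simp add: pos_borel_def)
  next
    fix E :: "real set" assume "E \<in> sets (restrict_space borel {0<..})"
    then have E[measurable]: "E \<in> sets pos_borel" by (simp add: pos_borel_def)
    show "(\<lambda>\<theta>. emeasure (K2 \<theta>) E) \<in> borel_measurable \<mu>"
      using m2.measurable_emeasure_K[OF E] by (simp add: m1.measurable_\<nu>)
    have "(\<lambda>z. ennreal (case z of (\<theta>, w) \<Rightarrow> r \<theta> w) * indicator E (snd z)) \<in> borel_measurable ?DP" by measurable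
    from m1.measurable_nn_integral_K[OF this]
    show m: "(\<lambda>\<theta>. emeasure (density (K1 \<theta>) (\<lambda>w. ennreal (r \<theta> w))) E) \<in> borel_measurable \<mu>"
      unfolding m1.measurable_\<nu>
      by (rule measurable_cong[THEN iffD1, rotated]) (simp add: em[OF _ E])
    fix C assume "C \<in> sets \<mu>"
    then have C[measurable]: "C \<in> sets (param_borel D)" by (simp add: m1.sets_\<nu>)
    have "(\<integral>\<^sup>+\<theta>. emeasure (K2 \<theta>) E * indicator C \<theta> \<partial>\<mu>) = (\<integral>\<^sup>+\<theta>. (\<integral>\<^sup>+w. indicator C \<theta> * indicator E w \<partial>K2 \<theta>) \<partial>\<mu>)"
    proof (intro nn_integral_cong)
      fix \<theta> assume "\<theta> \<in> space \<mu>"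
      then have "E \<in> sets (K2 \<theta>)" using E by (simp add: m1.space_\<nu> m2.sets_K)
      then show "emeasure (K2 \<theta>) E * indicator C \<theta> = (\<integral>\<^sup>+w. indicator C \<theta> * indicator E w \<partial>K2 \<theta>)"
        by (simp add: nn_integral_cmult mult.commute[of "emeasure (K2 \<theta>) E"])
    qed
    also have "\<dots> = (\<integral>\<^sup>+z. indicator C (fst z) * indicator E (snd z) \<partial>j2)"
      by (subst i2) simp_all
    also have "\<dots> = (\<integral>\<^sup>+z. g z * (indicator C (fst z) * indicator E (snd z)) \<partial>j1)"
      unfolding gd[symmetric] by (rule nn_integral_density) simp_all
    also have "\<dots> = (\<integral>\<^sup>+z. ennreal (r (fst z) (snd z)) * (indicator C (fst z) * indicator E (snd z)) \<partial>j1)"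
      using gf by (intro nn_integral_cong_AE) (auto elim!: eventually_mono simp: r_def less_top ennreal_enn2real)
    also have "\<dots> = (\<integral>\<^sup>+\<theta>. (\<integral>\<^sup>+w. ennreal (r \<theta> w) * (indicator C \<theta> * indicator E w) \<partial>K1 \<theta>) \<partial>\<mu>)"
      using r by (subst i1) (simp_all add: case_prod_unfold)
    also have "\<dots> = (\<integral>\<^sup>+\<theta>. emeasure (density (K1 \<theta>) (\<lambda>w. ennreal (r \<theta> w))) E * indicator C \<theta> \<partial>\<mu>)"
    proof (intro nn_integral_cong)
      fix \<theta> assume "\<theta> \<in> space \<mu>"
      then have \<theta>: "\<theta> \<in> D" by (simp add: m1.space_\<nu>)
      have [measurable]: "E \<in> sets (K1 \<theta>)" using E by (simp add: m1.sets_K[OF \<theta>])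
      note [measurable] = rK[OF \<theta>]
      have "(\<integral>\<^sup>+w. ennreal (r \<theta> w) * (indicator C \<theta> * indicator E w) \<partial>K1 \<theta>) =
          (\<integral>\<^sup>+w. indicator C \<theta> * (ennreal (r \<theta> w) * indicator E w) \<partial>K1 \<theta>)" by (simp add: mult_ac)
      also have "\<dots> = indicator C \<theta> * (\<integral>\<^sup>+w. ennreal (r \<theta> w) * indicator E w \<partial>K1 \<theta>)"
        by (rule nn_integral_cmult) measurable
      finally show "(\<integral>\<^sup>+w. ennreal (r \<theta> w) * (indicator C \<theta> * indicator E w) \<partial>K1 \<theta>) =
          emeasure (density (K1 \<theta>) (\<lambda>w. ennreal (r \<theta> w))) E * indicator C \<theta>"
        by (simp add: em[OF \<theta> E] mult.commute)
    qed
    finally show "(\<integral>\<^sup>+\<theta>. emeasure (K2 \<theta>) E * indicator C \<theta> \<partial>\<mu>) =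
      (\<integral>\<^sup>+\<theta>. emeasure (density (K1 \<theta>) (\<lambda>w. ennreal (r \<theta> w))) E * indicator C \<theta> \<partial>\<mu>)" .
  qed
  then have "AE \<theta> in \<mu>. rn_density (K1 \<theta>) (K2 \<theta>) (r \<theta>)"
    using AE_space
  proof eventually_elim
    case (elim \<theta>)
    then have "\<theta> \<in> D" by (simp add: m1.space_\<nu>)
    from rK[OF this] elim show ?case by (simp add: rn_density_def r_def)
  qed
  with r show ?thesis by (rule that)
qed

section \<open>Absolute continuity along the filtration\<close>

text \<open>At time \<open>k\<close> it is known whether the first claim has arrived, and when.\<close>

lemma measurable_min_W_Filt:
  assumes k: "0 < k"
  shows "(\<lambda>\<omega>. min (W 0 \<omega>) k) \<in> Filt D k \<rightarrow>\<^sub>M pos_borel"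
  unfolding measurable_pos_borel_iff
proof (intro conjI ballI)
  show "(\<lambda>\<omega>. min (W 0 \<omega>) k) \<in> borel_measurable (Filt D k)"
  proof (intro borel_measurable_iff_le[THEN iffD2] allI)
    fix a
    show "{\<omega> \<in> space (Filt D k). min (W 0 \<omega>) k \<le> a} \<in> sets (Filt D k)"
    proof (cases "k \<le> a")
      case False
      show ?thesis
      proof (cases "0 \<le> a")
        case True
        have "Measurable.pred (Filt D k) (\<lambda>\<omega>. T 1 \<omega> \<le> a)"
          by (rule measurable_Filt_mono[OF _ pred_T_le_Filt[OF True]]) (use False in simp)
        then have "{\<omega> \<in> space (Filt D k). T 1 \<omega> \<le> a} \<in> sets (Filt D k)" by (simp only: pred_def)
        also have "{\<omega> \<in> space (Filt D k). T 1 \<omega> \<le> a} = {\<omega> \<in> space (Filt D k). min (W 0 \<omega>) k \<le> a}"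
          using False by (intro Collect_cong) (simp add: T_def min_le_iff_disj)
        finally show ?thesis .
      next
        case a: False
        have "{\<omega> \<in> space (Filt D k). min (W 0 \<omega>) k \<le> a} = {}"
          using a k path_space_pos(1)[of _ D 0] by (force simp: min_le_iff_disj)
        then show ?thesis by (simp only: sets.empty_sets)
      qed
    next
      case True
      then have "{\<omega> \<in> space (Filt D k). min (W 0 \<omega>) k \<le> a} = space (Filt D k)"
        by (intro set_eqI) (simp add: min_le_iff_disj)
      then show ?thesis by (simp only: sets.top)
    qed
  qed
  fix \<omega> assume "\<omega> \<in> space (Filt D k)"
  then show "0 < min (W 0 \<omega>) k" using k path_space_pos(1)[of \<omega> D 0] by simp
qed

text \<open>Every path has exactly one claim at some rational time, namely between its first two arrivals;
  countably many null events cannot cover all of them.\<close>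

lemma (in mixed_renewal) ex_N_eq_1: "\<exists>t\<ge>0. emeasure Q {\<omega> \<in> space (path_space D). N t \<omega> = 1} \<noteq> 0"
proof (rule ccontr)
  assume "\<not> ?thesis"
  then have z: "emeasure Q {\<omega> \<in> space (path_space D). N t \<omega> = 1} = 0" if "0 \<le> t" for t using that by blast
  have "AE \<omega> in Q. N t \<omega> \<noteq> 1" if "t \<in> \<rat> \<inter> {0..}" for t
    using that z[of t] by (intro AE_I'[of "{\<omega> \<in> space (path_space D). N t \<omega> = 1}"])
      (auto simp: null_sets_def sets_Q space_Q)
  then have "AE \<omega> in Q. \<forall>t\<in>\<rat> \<inter> {0..}. N t \<omega> \<noteq> 1"
    using countable_rat by (subst AE_ball_countable) auto
  then have "AE \<omega> in Q. False" using AE_space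
  proof eventually_elim
    case (elim \<omega>)
    then have \<omega>: "\<omega> \<in> space (path_space D)" by (simp add: space_Q)
    note pos = path_space_pos(1)[OF \<omega>]
    have "T 1 \<omega> < T 2 \<omega>" using T_less_iff[OF pos] by simp
    then obtain u where u: "u \<in> \<rat>" "T 1 \<omega> < u" "u < T 2 \<omega>" using Rats_dense_in_real by blast
    have "0 \<le> T 1 \<omega>" by (rule T_nonneg[OF pos])
    then have "u \<in> \<rat> \<inter> {0..}" using u by simp
    moreover have "N u \<omega> = 1" using u by (intro N_eq[OF pos]) (auto simp: numeral_2_eq_2)
    ultimately show ?case using elim(1) by blast
  qed
  then show False using prob_space.AE_False[OF prob_Q] by simp
qed

text \<open>The three data of a mixture are visible in the filtration, each through events at one fixed time:
  the mixing law through events at time \<open>0\<close>, the claim law through \<open>S t\<close> on \<open>N t = 1\<close>, and the kernel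
  through the first interarrival time. The last one is unbounded, so a null set of the joint law is
  exhausted by its parts with first arrival before \<open>k\<close>, for \<open>k = 1, 2, ...\<close>\<close>

lemma filtration_ac_imp_data_ac:
  fixes D :: "(real ^ 'd::finite) set"
  assumes m1: "mixed_renewal D K1 R1 \<nu>1" and m2: "mixed_renewal D K2 R2 \<nu>2"
    and ac: "\<And>t A. 0 \<le> t \<Longrightarrow> A \<in> sets (Filt D t) \<Longrightarrow> emeasure (mixed_law D \<nu>1 K1 R1) A = 0 \<Longrightarrow>
      emeasure (mixed_law D \<nu>2 K2 R2) A = 0"
  shows "absolutely_continuous \<nu>1 \<nu>2" and "absolutely_continuous R1 R2"
    and "C \<in> sets (param_borel D \<Otimes>\<^sub>M pos_borel) \<Longrightarrow>
      AE \<theta> in \<nu>1. emeasure (K1 \<theta>) {w \<in> {0<..}. (\<theta>, w) \<in> C} = 0 \<Longrightarrow>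
      AE \<theta> in \<nu>2. emeasure (K2 \<theta>) {w \<in> {0<..}. (\<theta>, w) \<in> C} = 0"
proof -
  interpret m1: mixed_renewal D K1 R1 \<nu>1 by (rule m1)
  interpret m2: mixed_renewal D K2 R2 \<nu>2 by (rule m2)
  let ?\<Omega> = "space (path_space D)"
  show "absolutely_continuous \<nu>1 \<nu>2"
    unfolding absolutely_continuous_def
  proof
    fix C assume C: "C \<in> null_sets \<nu>1"
    then have s: "C \<in> sets (param_borel D)" by (auto simp: m1.sets_\<nu>)
    have F: "Theta -` C \<inter> ?\<Omega> \<in> sets (Filt D 0)"
      using measurable_sets[OF measurable_Theta_Filt s, of 0] by simp
    have "emeasure m1.Q (Theta -` C \<inter> ?\<Omega>) = emeasure (distr m1.Q (param_borel D) Theta) C"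
      using s by (subst emeasure_distr) (simp_all add: m1.measurable_Q m1.space_Q)
    also have "\<dots> = 0" using C unfolding m1.distr_Q_Theta by auto
    finally have "emeasure m2.Q (Theta -` C \<inter> ?\<Omega>) = 0" by (intro ac[OF _ F]) simp
    also have "emeasure m2.Q (Theta -` C \<inter> ?\<Omega>) = emeasure (distr m2.Q (param_borel D) Theta) C"
      using s by (subst emeasure_distr) (simp_all add: m2.measurable_Q m2.space_Q)
    finally show "C \<in> null_sets \<nu>2" using s unfolding m2.distr_Q_Theta by (auto simp: m2.sets_\<nu>)
  qed
  show "absolutely_continuous R1 R2"
    unfolding absolutely_continuous_def
  proof
    fix B assume B: "B \<in> null_sets R1"
    then have s[measurable]: "B \<in> sets pos_borel" by (auto simp: m1.sets_R)
    \<comment> \<open>A time at which one claim is seen with positive probability, so that the factor belonging to \<open>N t = 1\<close>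
    can be cancelled under the second law.\<close>
    obtain t where t: "0 \<le> t" "emeasure m2.Q {\<omega> \<in> ?\<Omega>. N t \<omega> = 1} \<noteq> 0" using m2.ex_N_eq_1 by blast
    let ?E = "{\<omega> \<in> ?\<Omega>. N t \<omega> = 1 \<and> S t \<omega> \<in> B}"
    let ?N1 = "{\<omega> \<in> ?\<Omega>. N t \<omega> = 1}" and ?XB = "X 0 -` B \<inter> ?\<Omega>"
    obtain B' where B': "B' \<in> sets borel" "B = B' \<inter> {0<..}"
      using s by (auto simp: pos_borel_def sets_restrict_space)
    have Bb[measurable]: "B \<in> sets borel" using B' by simp
    have F: "?E \<in> sets (Filt D t)"
    proof -
      note [measurable] = measurable_N_Filt[OF t(1), of D] measurable_S_Filt[OF t(1) order_refl, of D]
      have "{\<omega> \<in> space (Filt D t). N t \<omega> = 1 \<and> S t \<omega> \<in> B} \<in> sets (Filt D t)" by measurable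
      then show ?thesis by simp
    qed
    have E: "?E = ?N1 \<inter> ?XB"
      by (intro set_eqI) (auto simp: S_def)
    have N1: "?N1 \<in> sets (sigma_W D)"
    proof -
      note [measurable] = measurable_N_sigma_W[OF t(1), of D]
      have "{\<omega> \<in> space (sigma_W D). N t \<omega> = 1} \<in> sets (sigma_W D)" by measurable
      then show ?thesis by (simp add: sigma_W_def)
    qed
    have XB: "?XB \<in> sets (sigma_X D)"
    proof -
      have "?XB = {\<omega> \<in> ?\<Omega>. fst (snd \<omega>) \<in> {w \<in> space seqs. w 0 \<in> B}}"
        using fst_in_seqs[of _ D] by (auto simp: X_def)
      moreover have "{w \<in> space seqs. w 0 \<in> B} \<in> sets seqs" by measurable
      ultimately show ?thesis unfolding sets_sigma_X by blast
    qed
    have N1p: "?N1 \<in> sets (path_space D)" using N1 sigma_W_subset_path by blast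
    have p1: "emeasure m1.Q ?E = emeasure m1.Q ?N1 * emeasure R1 B"
    proof -
      have "emeasure m1.Q ?XB = emeasure (distr m1.Q pos_borel (X 0)) B"
        by (subst emeasure_distr) (simp_all add: m1.measurable_Q m1.space_Q)
      then show ?thesis unfolding E m1.iid_Q_X(2)
        using m1.emeasure_Q_Int_X[OF N1p XB m1.emeasure_PL_indep[OF _ N1 XB]] by simp
    qed
    have p2: "emeasure m2.Q ?E = emeasure m2.Q ?N1 * emeasure R2 B"
    proof -
      have "emeasure m2.Q ?XB = emeasure (distr m2.Q pos_borel (X 0)) B"
        by (subst emeasure_distr) (simp_all add: m2.measurable_Q m2.space_Q)
      then show ?thesis unfolding E m2.iid_Q_X(2)
        using m2.emeasure_Q_Int_X[OF N1p XB m2.emeasure_PL_indep[OF _ N1 XB]] by simp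
    qed
    have "emeasure m1.Q ?E = 0" using p1 B by auto
    from ac[OF t(1) F this] p2 t(2) have "emeasure R2 B = 0" by auto
    then show "B \<in> null_sets R2" using s by (auto simp: m2.sets_R)
  qed
  assume C: "C \<in> sets (param_borel D \<Otimes>\<^sub>M pos_borel)"
    and z: "AE \<theta> in \<nu>1. emeasure (K1 \<theta>) {w \<in> {0<..}. (\<theta>, w) \<in> C} = 0"
  let ?C = "{\<omega> \<in> ?\<Omega>. (Theta \<omega>, W 0 \<omega>) \<in> C}"
  have Cp[measurable]: "?C \<in> sets (path_space D)" using C by measurable
  have "emeasure m1.Q ?C = 0"
    unfolding m1.emeasure_Q_Theta_W[OF C] using z m1.measurable_emeasure_K_section[OF C]
    by (simp add: nn_integral_0_iff_AE m1.measurable_\<nu>)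
  have "emeasure m2.Q (?C \<inter> {\<omega> \<in> ?\<Omega>. W 0 \<omega> \<le> real (Suc k)}) = 0" (is "emeasure _ ?E = 0") for k
  proof -
    let ?k = "real (Suc k)"
    have k: "0 < ?k" by simp
    note [measurable] = measurable_min_W_Filt[OF k, where D=D] measurable_Theta_Filt[where D=D and t="?k"] pred_T_le_Filt[where t="?k" and D=D and n=1] C
    have "{\<omega> \<in> space (Filt D ?k). T 1 \<omega> \<le> ?k \<and> (Theta \<omega>, min (W 0 \<omega>) ?k) \<in> C} \<in> sets (Filt D ?k)" by measurable
    also have "{\<omega> \<in> space (Filt D ?k). T 1 \<omega> \<le> ?k \<and> (Theta \<omega>, min (W 0 \<omega>) ?k) \<in> C} = ?E"
      by (intro set_eqI) (auto simp: T_def min_def)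
    finally have F: "?E \<in> sets (Filt D ?k)" .
    have "emeasure m1.Q ?E \<le> emeasure m1.Q ?C" by (intro emeasure_mono) (simp_all add: m1.sets_Q)
    with \<open>emeasure m1.Q ?C = 0\<close> have "emeasure m1.Q ?E = 0" by simp
    then show ?thesis by (intro ac[OF _ F]) simp_all
  qed
  then have nu: "(\<Union>k. ?C \<inter> {\<omega> \<in> ?\<Omega>. W 0 \<omega> \<le> real (Suc k)}) \<in> null_sets m2.Q"
    by (intro null_sets_UN null_setsI) (simp_all add: m2.sets_Q)
  have "(\<Union>k. ?C \<inter> {\<omega> \<in> ?\<Omega>. W 0 \<omega> \<le> real (Suc k)}) = ?C"
  proof -
    have "\<omega> \<in> (\<Union>k. ?C \<inter> {\<omega> \<in> ?\<Omega>. W 0 \<omega> \<le> real (Suc k)})" if "\<omega> \<in> ?C" for \<omega>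
    proof -
      obtain k where "W 0 \<omega> \<le> real k" using real_arch_simple by blast
      then have "W 0 \<omega> \<le> real (Suc k)" by simp
      with that show ?thesis by (intro UN_I[of k]) simp_all
    qed
    then show ?thesis by (intro equalityI subsetI) simp_all
  qed
  with nu have "emeasure m2.Q ?C = 0" by auto
  then show "AE \<theta> in \<nu>2. emeasure (K2 \<theta>) {w \<in> {0<..}. (\<theta>, w) \<in> C} = 0"
    unfolding m2.emeasure_Q_Theta_W[OF C] using m2.measurable_emeasure_K_section[OF C]
    by (simp add: nn_integral_0_iff_AE m2.measurable_\<nu>)
qed

section \<open>Exponential laws\<close>

lemma sets_Exp [simp]: "sets (Exp b) = sets pos_borel"
  unfolding Exp_def pos_borel_def by (simp cong: sets_restrict_space_cong)

lemma space_Exp [simp]: "space (Exp b) = {0<..}"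
  using sets_eq_imp_space_eq[OF sets_Exp] by simp

lemma pos_borel_borel: "E \<in> sets pos_borel \<Longrightarrow> E \<in> sets borel"
  unfolding pos_borel_def by (auto simp: sets_restrict_space)

lemma nn_integral_Exp:
  assumes f[measurable]: "f \<in> borel_measurable borel"
  shows "(\<integral>\<^sup>+v. f v \<partial>Exp b) = (\<integral>\<^sup>+v. ennreal (exponential_density b v) * f v * indicator {0<..} v \<partial>lborel)"
proof -
  have "(\<integral>\<^sup>+v. f v \<partial>Exp b) =
      (\<integral>\<^sup>+v. ennreal (exponential_density b v) * f v \<partial>restrict_space lborel {0<..})"
    unfolding Exp_def
  proof (rule nn_integral_density)
    show "(\<lambda>v. ennreal (exponential_density b v)) \<in> borel_measurable (restrict_space lborel {0<..})"
      by (rule measurable_restrict_space1) simp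
    show "f \<in> borel_measurable (restrict_space lborel {0<..})"
      by (rule measurable_restrict_space1) (use f in simp)
  qed
  also have "\<dots> = (\<integral>\<^sup>+v. ennreal (exponential_density b v) * f v * indicator {0<..} v \<partial>lborel)"
    by (rule nn_integral_restrict_space) simp
  finally show ?thesis .
qed

lemma emeasure_Exp:
  assumes "E \<in> sets pos_borel"
  shows "emeasure (Exp b) E = (\<integral>\<^sup>+v. ennreal (exponential_density b v) * indicator E v \<partial>lborel)"
proof -
  have E: "E \<in> sets borel" "E \<subseteq> {0<..}"
    using pos_borel_borel[OF assms] sets.sets_into_space[OF assms] by simp_all
  have "emeasure (Exp b) E = (\<integral>\<^sup>+v. indicator E v \<partial>Exp b)"
    using assms by simp
  also have "\<dots> = (\<integral>\<^sup>+v. ennreal (exponential_density b v) * indicator E v * indicator {0<..} v \<partial>lborel)"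
    using E by (intro nn_integral_Exp) simp
  also have "\<dots> = (\<integral>\<^sup>+v. ennreal (exponential_density b v) * indicator E v \<partial>lborel)"
    using E(2) by (intro nn_integral_cong) (auto simp: indicator_def)
  finally show ?thesis .
qed

lemma emeasure_Exp_gt:
  assumes b: "0 < b" and a: "0 \<le> a"
  shows "emeasure (Exp b) {v \<in> {0<..}. a < v} = ennreal (exp (- b * a))"
proof -
  let ?M = "density lborel (\<lambda>v. ennreal (exponential_density b v))"
  interpret prob_space ?M by (rule prob_space_exponential_density[OF b])
  have D: "distributed ?M lborel (\<lambda>v. v) (\<lambda>v. ennreal (exponential_density b v))"
    unfolding distributed_def by (simp add: distr_id2)
  have e: "{v \<in> {0<..}. a < v} = {a<..}" using a by auto
  have s: "{a<..} \<in> sets pos_borel"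
    using a by (auto simp: pos_borel_def sets_restrict_space intro!: image_eqI[of _ _ "{a<..}"])
  have "emeasure (Exp b) {a<..} = emeasure ?M {a<..}"
    unfolding emeasure_Exp[OF s] by (simp add: emeasure_density)
  also have "\<dots> = ennreal (measure ?M {v \<in> space ?M. a < v})"
    by (simp add: emeasure_eq_measure greaterThan_def)
  also have "measure ?M {v \<in> space ?M. a < v} = exp (- a * b)"
    by (rule exponential_distributedD_gt[OF D a b])
  finally show ?thesis unfolding e by (simp add: mult.commute)
qed

lemma prob_space_Exp: "0 < b \<Longrightarrow> prob_space (Exp b)"
proof (rule prob_spaceI)
  assume b: "0 < b"
  have "{v \<in> {0<..}. 0 < v} = {0::real<..}" by auto
  with emeasure_Exp_gt[OF b order_refl] show "emeasure (Exp b) (space (Exp b)) = 1" by simp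
qed

lemma nn_integral_Exp_ident:
  assumes b: "0 < b"
  shows "(\<integral>\<^sup>+v. ennreal v \<partial>Exp b) = ennreal (1 / b)"
proof -
  have "(\<integral>\<^sup>+v. ennreal v \<partial>Exp b) =
      (\<integral>\<^sup>+v. ennreal (exponential_density b v) * ennreal v * indicator {0<..} v \<partial>lborel)"
    by (rule nn_integral_Exp) simp
  also have "\<dots> = (\<integral>\<^sup>+v. ennreal (erlang_density 0 b v * v ^ 1) \<partial>lborel)"
  proof (intro nn_integral_cong)
    fix v :: real
    show "ennreal (exponential_density b v) * ennreal v * indicator {0<..} v = ennreal (erlang_density 0 b v * v ^ 1)"
      using b by (cases "0 < v") (auto simp: ennreal_mult' exponential_density_def ennreal_neg mult_nonneg_nonpos)
  qed
  also have "\<dots> = fact (0 + 1) / (fact 0 * b ^ 1)"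
    by (rule nn_integral_erlang_ith_moment[OF b])
  finally show ?thesis by simp
qed

text \<open>The law of \<open>a + v\<close> for an exponential variable \<open>v\<close>, with its density written as the rate \<open>b\<close> times the
  probability that \<open>v\<close> exceeds \<open>u - a\<close>. The proportionality of density and tail probability
  is what makes the intensity of the jumps constant.\<close>

lemma emeasure_Exp_shift:
  assumes b: "0 < b" and a: "0 \<le> a"
  shows "emeasure (Exp b) {v \<in> {0<..}. s < a + v \<and> a + v \<le> t} =
    (\<integral>\<^sup>+u. indicator {s<..t} u * (ennreal b * (indicator {a..} u * ennreal (exp (- b * (u - a))))) \<partial>lborel)"
proof -
  let ?E = "{v \<in> {0<..}. s < a + v \<and> a + v \<le> t}"
  have s: "?E \<in> sets pos_borel"
    by (auto simp: pos_borel_def sets_restrict_space intro!: image_eqI[of _ _ "{v. s < a + v \<and> a + v \<le> t}"])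
  have "emeasure (Exp b) ?E = (\<integral>\<^sup>+v. ennreal (exponential_density b v) * indicator ?E v \<partial>lborel)"
    by (rule emeasure_Exp[OF s])
  also have "\<dots> = (\<integral>\<^sup>+u. ennreal (exponential_density b (u - a)) * indicator ?E (u - a) \<partial>lborel)"
    using nn_integral_real_affine[of "\<lambda>v. ennreal (exponential_density b v) * indicator ?E v" 1 "- a"]
      pos_borel_borel[OF s] by simp
  also have "\<dots> = (\<integral>\<^sup>+u. indicator {s<..t} u * (ennreal b * (indicator {a..} u * ennreal (exp (- b * (u - a))))) \<partial>lborel)"
  proof (rule nn_integral_cong_AE)
    show "AE u in lborel. ennreal (exponential_density b (u - a)) * indicator ?E (u - a) =
        indicator {s<..t} u * (ennreal b * (indicator {a..} u * ennreal (exp (- b * (u - a)))))"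
      \<comment> \<open>At \<open>u = a\<close> the two sides differ, since \<open>a + v = a\<close> would need \<open>v = 0\<close>.\<close>
      using AE_lborel_singleton[of a]
    proof eventually_elim
      case (elim u)
      then show ?case using b
        by (cases "a < u") (simp_all add: indicator_def exponential_density_def ennreal_mult' algebra_simps)
    qed
  qed
  finally show ?thesis .
qed

lemma measurable_Exp:
  assumes [measurable]: "\<rho> \<in> borel_measurable M" and pos: "\<And>\<theta>. \<theta> \<in> space M \<Longrightarrow> 0 < \<rho> \<theta>"
  shows "(\<lambda>\<theta>. Exp (\<rho> \<theta>)) \<in> M \<rightarrow>\<^sub>M prob_algebra pos_borel"
proof (rule measurable_prob_algebraI)
  show "(\<lambda>\<theta>. Exp (\<rho> \<theta>)) \<in> M \<rightarrow>\<^sub>M subprob_algebra pos_borel"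
  proof (rule measurable_subprob_algebra)
    fix A assume A: "A \<in> sets pos_borel"
    note [measurable] = pos_borel_borel[OF A]
    show "(\<lambda>\<theta>. emeasure (Exp (\<rho> \<theta>)) A) \<in> borel_measurable M"
      unfolding emeasure_Exp[OF A] exponential_density_def by measurable
  qed (simp_all add: prob_space_imp_subprob_space prob_space_Exp pos)
qed (simp add: prob_space_Exp pos)

section \<open>Resampling one coordinate\<close>

text \<open>In a product measure a single coordinate may be redrawn independently without changing the law.
  Integrals over paths can thereby be evaluated one coordinate at a time without splitting the
  infinite product.\<close>

definition set_W :: "nat \<Rightarrow> real \<Rightarrow> 'd::finite path \<Rightarrow> 'd path" where
  "set_W n v \<omega> = ((fst \<omega>)(n := v), snd \<omega>)"

definition set_X :: "nat \<Rightarrow> real \<Rightarrow> 'd::finite path \<Rightarrow> 'd path" where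
  "set_X n v \<omega> = (fst \<omega>, (fst (snd \<omega>))(n := v), snd (snd \<omega>))"

lemma set_W_simps [simp]:
  "W j (set_W n v \<omega>) = (if j = n then v else W j \<omega>)" "X j (set_W n v \<omega>) = X j \<omega>" "Theta (set_W n v \<omega>) = Theta \<omega>"
  by (simp_all add: set_W_def W_def X_def Theta_def)

lemma set_X_simps [simp]:
  "X j (set_X n v \<omega>) = (if j = n then v else X j \<omega>)" "W j (set_X n v \<omega>) = W j \<omega>" "Theta (set_X n v \<omega>) = Theta \<omega>"
  by (simp_all add: set_X_def W_def X_def Theta_def)

lemma measurable_set_W [measurable (raw)]:
  assumes "f \<in> M \<rightarrow>\<^sub>M pos_borel" "g \<in> M \<rightarrow>\<^sub>M path_space D"
  shows "(\<lambda>x. set_W n (f x) (g x)) \<in> M \<rightarrow>\<^sub>M path_space D"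
proof (rule measurable_path_spaceI)
  show "(\<lambda>x. W j (set_W n (f x) (g x))) \<in> M \<rightarrow>\<^sub>M pos_borel" for j
    using assms(1) measurable_compose[OF assms(2) measurable_W] by (cases "j = n") simp_all
qed (use measurable_compose[OF assms(2) measurable_X] measurable_compose[OF assms(2) measurable_Theta] in simp_all)

lemma measurable_set_X [measurable (raw)]:
  assumes "f \<in> M \<rightarrow>\<^sub>M pos_borel" "g \<in> M \<rightarrow>\<^sub>M path_space D"
  shows "(\<lambda>x. set_X n (f x) (g x)) \<in> M \<rightarrow>\<^sub>M path_space D"
proof (rule measurable_path_spaceI)
  show "(\<lambda>x. X j (set_X n (f x) (g x))) \<in> M \<rightarrow>\<^sub>M pos_borel" for j
    using assms(1) measurable_compose[OF assms(2) measurable_X] by (cases "j = n") simp_all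
qed (use measurable_compose[OF assms(2) measurable_W] measurable_compose[OF assms(2) measurable_Theta] in simp_all)

definition depends_on_first :: "nat \<Rightarrow> ('d::finite path \<Rightarrow> 'b) \<Rightarrow> bool" where
  "depends_on_first n f \<longleftrightarrow> (\<forall>\<omega> \<omega>'. (\<forall>j<n. W j \<omega> = W j \<omega>' \<and> X j \<omega> = X j \<omega>') \<longrightarrow> Theta \<omega> = Theta \<omega>' \<longrightarrow> f \<omega> = f \<omega>')"

lemma depends_on_firstD:
  "depends_on_first n f \<Longrightarrow> (\<And>j. j < n \<Longrightarrow> W j \<omega> = W j \<omega>') \<Longrightarrow> (\<And>j. j < n \<Longrightarrow> X j \<omega> = X j \<omega>') \<Longrightarrow>
    Theta \<omega> = Theta \<omega>' \<Longrightarrow> f \<omega> = f \<omega>'"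
  unfolding depends_on_first_def by blast

lemma depends_on_first_set:
  assumes "depends_on_first n f" "n \<le> m"
  shows "f (set_W m v \<omega>) = f \<omega>" "f (set_X m v \<omega>) = f \<omega>"
  using assms(2) by (intro depends_on_firstD[OF assms(1)]; simp)+

lemma depends_on_first_T: "j \<le> n \<Longrightarrow> depends_on_first n (T j)"
  unfolding depends_on_first_def T_def by (intro allI impI sum.cong) auto

lemma depends_on_first_truncate: "depends_on_first n (truncate n t)"
  unfolding depends_on_first_def
  by (intro allI impI path_eqI) simp_all

context renewal_kernel
begin

context
  fixes \<theta> assumes \<theta>: "\<theta> \<in> D"
begin

lemma sets_PL' [measurable_cong, simp]: "sets (PL \<theta>) = sets (path_space D)"
  by (rule sets_PL[OF \<theta>])

lemma sets_K' [measurable_cong, simp]: "sets (K \<theta>) = sets pos_borel"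
  by (rule sets_K[OF \<theta>])

lemma sets_R' [measurable_cong, simp]: "sets R = sets pos_borel"
  by (rule sets_R)

lemma resample_W_distr: "distr (K \<theta> \<Otimes>\<^sub>M PL \<theta>) (path_space D) (\<lambda>(v, \<omega>). set_W n v \<omega>) = PL \<theta>"
proof (rule path_measure_eqI[symmetric])
  interpret k: prob_space "K \<theta>" by (rule prob_K[OF \<theta>])
  interpret p: prob_space "PL \<theta>" by (rule prob_PL[OF \<theta>])
  show "finite_measure (PL \<theta>)" by (rule p.finite_measure_axioms)
  fix m :: nat and A B :: "nat \<Rightarrow> real set" and C :: "(real ^ 'd) set"
  assume A: "\<And>j. A j \<in> sets pos_borel" and B: "\<And>j. B j \<in> sets pos_borel" and C: "C \<in> sets (param_borel D)"
  let ?A = "if n \<le> m then A n else {0<..}"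
  have A': "(A(n := {0<..})) j \<in> sets pos_borel" for j using A by simp
  have sub: "A j \<subseteq> {0<..}" for j using sets.sets_into_space[OF A] by simp
  have m: "(\<lambda>(v, \<omega>). set_W n v \<omega>) \<in> K \<theta> \<Otimes>\<^sub>M PL \<theta> \<rightarrow>\<^sub>M path_space D" by measurable
  have pos: "set_W n v \<omega> \<in> space (path_space D) \<longleftrightarrow> \<omega> \<in> space (path_space D)" if "0 < v" "0 < W n \<omega>" for v \<omega>
    using that by (simp add: space_path_space) metis
  have "(\<lambda>(v, \<omega>). set_W n v \<omega>) -` rect D m A B C \<inter> space (K \<theta> \<Otimes>\<^sub>M PL \<theta>) = ?A \<times> rect D m (A(n := {0<..})) B C"
  proof (rule set_eqI)
    fix z :: "real \<times> 'd path"
    obtain v \<omega> where z: "z = (v, \<omega>)" by (rule prod.exhaust)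
    show "z \<in> (\<lambda>(v, \<omega>). set_W n v \<omega>) -` rect D m A B C \<inter> space (K \<theta> \<Otimes>\<^sub>M PL \<theta>) \<longleftrightarrow>
        z \<in> ?A \<times> rect D m (A(n := {0<..})) B C"
      unfolding z using sub[of n]
      by (auto simp: rect_def space_pair_measure space_K[OF \<theta>] space_PL[OF \<theta>] space_path_space subset_iff
        simp del: split_paired_All split_paired_Ex)
  qed
  then have "emeasure (distr (K \<theta> \<Otimes>\<^sub>M PL \<theta>) (path_space D) (\<lambda>(v, \<omega>). set_W n v \<omega>)) (rect D m A B C) =
      emeasure (K \<theta>) ?A * emeasure (PL \<theta>) (rect D m (A(n := {0<..})) B C)"
    using A by (subst emeasure_distr[OF m rect_in_sets[OF A B C]])
      (simp add: p.emeasure_pair_measure_Times rect_in_sets[OF A' B C])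
  also have "\<dots> = emeasure (PL \<theta>) (rect D m A B C)"
  proof -
    have "emeasure (K \<theta>) ?A * (\<Prod>j\<le>m. emeasure (K \<theta>) ((A(n := {0<..})) j)) = (\<Prod>j\<le>m. emeasure (K \<theta>) (A j))"
    proof (cases "n \<le> m")
      case True
      have one: "emeasure (K \<theta>) {0<..} = 1" using k.emeasure_space_1 by (simp add: space_K[OF \<theta>])
      have "(\<Prod>j\<le>m. emeasure (K \<theta>) ((A(n := {0<..})) j)) =
          emeasure (K \<theta>) ((A(n := {0<..})) n) * (\<Prod>j\<in>{..m} - {n}. emeasure (K \<theta>) ((A(n := {0<..})) j))"
        using True by (intro prod.remove) simp_all
      also have "\<dots> = (\<Prod>j\<in>{..m} - {n}. emeasure (K \<theta>) (A j))"
        using one by simp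
      finally show ?thesis using True by (simp add: prod.remove[of "{..m}" n])
    next
      case False
      then show ?thesis using k.emeasure_space_1 by (simp add: space_K[OF \<theta>])
    qed
    then show ?thesis
      by (simp only: emeasure_PL_rect[OF \<theta> A B C] emeasure_PL_rect[OF \<theta> A' B C] mult.assoc[symmetric])
  qed
  finally show "emeasure (PL \<theta>) (rect D m A B C) =
    emeasure (distr (K \<theta> \<Otimes>\<^sub>M PL \<theta>) (path_space D) (\<lambda>(v, \<omega>). set_W n v \<omega>)) (rect D m A B C)" ..
qed simp_all

lemma resample_X_distr: "distr (R \<Otimes>\<^sub>M PL \<theta>) (path_space D) (\<lambda>(v, \<omega>). set_X n v \<omega>) = PL \<theta>"
proof (rule path_measure_eqI[symmetric])
  interpret k: prob_space R by (rule prob_R)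
  interpret p: prob_space "PL \<theta>" by (rule prob_PL[OF \<theta>])
  show "finite_measure (PL \<theta>)" by (rule p.finite_measure_axioms)
  fix m :: nat and A B :: "nat \<Rightarrow> real set" and C :: "(real ^ 'd) set"
  assume A: "\<And>j. A j \<in> sets pos_borel" and B: "\<And>j. B j \<in> sets pos_borel" and C: "C \<in> sets (param_borel D)"
  let ?B = "if n \<le> m then B n else {0<..}"
  have B': "(B(n := {0<..})) j \<in> sets pos_borel" for j using B by simp
  have sub: "B j \<subseteq> {0<..}" for j using sets.sets_into_space[OF B] by simp
  have m: "(\<lambda>(v, \<omega>). set_X n v \<omega>) \<in> R \<Otimes>\<^sub>M PL \<theta> \<rightarrow>\<^sub>M path_space D" by measurable
  have "(\<lambda>(v, \<omega>). set_X n v \<omega>) -` rect D m A B C \<inter> space (R \<Otimes>\<^sub>M PL \<theta>) = ?B \<times> rect D m A (B(n := {0<..})) C"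
  proof (rule set_eqI)
    fix z :: "real \<times> 'd path"
    obtain v \<omega> where z: "z = (v, \<omega>)" by (rule prod.exhaust)
    show "z \<in> (\<lambda>(v, \<omega>). set_X n v \<omega>) -` rect D m A B C \<inter> space (R \<Otimes>\<^sub>M PL \<theta>) \<longleftrightarrow>
        z \<in> ?B \<times> rect D m A (B(n := {0<..})) C"
      unfolding z using sub[of n]
      by (auto simp: rect_def space_pair_measure space_R space_PL[OF \<theta>] space_path_space subset_iff
        simp del: split_paired_All split_paired_Ex)
  qed
  then have "emeasure (distr (R \<Otimes>\<^sub>M PL \<theta>) (path_space D) (\<lambda>(v, \<omega>). set_X n v \<omega>)) (rect D m A B C) =
      emeasure R ?B * emeasure (PL \<theta>) (rect D m A (B(n := {0<..})) C)"
    using B by (subst emeasure_distr[OF m rect_in_sets[OF A B C]])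
      (simp add: p.emeasure_pair_measure_Times rect_in_sets[OF A B' C])
  also have "\<dots> = emeasure (PL \<theta>) (rect D m A B C)"
  proof -
    have "emeasure R ?B * (\<Prod>j\<le>m. emeasure R ((B(n := {0<..})) j)) = (\<Prod>j\<le>m. emeasure R (B j))"
    proof (cases "n \<le> m")
      case True
      have one: "emeasure R {0<..} = 1" using k.emeasure_space_1 by (simp add: space_R)
      have "(\<Prod>j\<le>m. emeasure R ((B(n := {0<..})) j)) =
          emeasure R ((B(n := {0<..})) n) * (\<Prod>j\<in>{..m} - {n}. emeasure R ((B(n := {0<..})) j))"
        using True by (intro prod.remove) simp_all
      also have "\<dots> = (\<Prod>j\<in>{..m} - {n}. emeasure R (B j))"
        using one by simp
      finally show ?thesis using True by (simp add: prod.remove[of "{..m}" n])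
    next
      case False
      then show ?thesis using k.emeasure_space_1 by (simp add: space_R)
    qed
    then have "(\<Prod>j\<le>m. emeasure (K \<theta>) (A j)) * ((emeasure R ?B * (\<Prod>j\<le>m. emeasure R ((B(n := {0<..})) j))) * indicator C \<theta>)
        = emeasure (PL \<theta>) (rect D m A B C)"
      by (simp only: emeasure_PL_rect[OF \<theta> A B C])
    then show ?thesis
      by (simp only: emeasure_PL_rect[OF \<theta> A B' C] mult_ac)
  qed
  finally show "emeasure (PL \<theta>) (rect D m A B C) =
    emeasure (distr (R \<Otimes>\<^sub>M PL \<theta>) (path_space D) (\<lambda>(v, \<omega>). set_X n v \<omega>)) (rect D m A B C)" ..
qed simp_all

lemma nn_integral_resample_W:
  assumes f[measurable]: "f \<in> borel_measurable (path_space D)"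
  shows "(\<integral>\<^sup>+\<omega>. f \<omega> \<partial>PL \<theta>) = (\<integral>\<^sup>+\<omega>. (\<integral>\<^sup>+v. f (set_W n v \<omega>) \<partial>K \<theta>) \<partial>PL \<theta>)"
proof -
  interpret k: prob_space "K \<theta>" by (rule prob_K[OF \<theta>])
  interpret p: prob_space "PL \<theta>" by (rule prob_PL[OF \<theta>])
  interpret pair_sigma_finite "K \<theta>" "PL \<theta>" ..
  have m: "(\<lambda>(v, \<omega>). set_W n v \<omega>) \<in> K \<theta> \<Otimes>\<^sub>M PL \<theta> \<rightarrow>\<^sub>M path_space D" by measurable
  have "(\<integral>\<^sup>+\<omega>. f \<omega> \<partial>PL \<theta>) = (\<integral>\<^sup>+\<omega>. f \<omega> \<partial>distr (K \<theta> \<Otimes>\<^sub>M PL \<theta>) (path_space D) (\<lambda>(v, \<omega>). set_W n v \<omega>))"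
    by (simp only: resample_W_distr)
  also have "\<dots> = (\<integral>\<^sup>+z. f (case z of (v, \<omega>) \<Rightarrow> set_W n v \<omega>) \<partial>(K \<theta> \<Otimes>\<^sub>M PL \<theta>))"
    by (rule nn_integral_distr[OF m]) (use f in simp)
  also have "\<dots> = (\<integral>\<^sup>+\<omega>. (\<integral>\<^sup>+v. f (case (v, \<omega>) of (v, \<omega>) \<Rightarrow> set_W n v \<omega>) \<partial>K \<theta>) \<partial>PL \<theta>)"
    by (rule nn_integral_snd[symmetric]) (rule measurable_compose[OF m f])
  finally show ?thesis by simp
qed

lemma nn_integral_resample_X:
  assumes f[measurable]: "f \<in> borel_measurable (path_space D)"
  shows "(\<integral>\<^sup>+\<omega>. f \<omega> \<partial>PL \<theta>) = (\<integral>\<^sup>+\<omega>. (\<integral>\<^sup>+v. f (set_X n v \<omega>) \<partial>R) \<partial>PL \<theta>)"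
proof -
  interpret k: prob_space R by (rule prob_R)
  interpret p: prob_space "PL \<theta>" by (rule prob_PL[OF \<theta>])
  interpret pair_sigma_finite R "PL \<theta>" ..
  have m: "(\<lambda>(v, \<omega>). set_X n v \<omega>) \<in> R \<Otimes>\<^sub>M PL \<theta> \<rightarrow>\<^sub>M path_space D" by measurable
  have "(\<integral>\<^sup>+\<omega>. f \<omega> \<partial>PL \<theta>) = (\<integral>\<^sup>+\<omega>. f \<omega> \<partial>distr (R \<Otimes>\<^sub>M PL \<theta>) (path_space D) (\<lambda>(v, \<omega>). set_X n v \<omega>))"
    by (simp only: resample_X_distr)
  also have "\<dots> = (\<integral>\<^sup>+z. f (case z of (v, \<omega>) \<Rightarrow> set_X n v \<omega>) \<partial>(R \<Otimes>\<^sub>M PL \<theta>))"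
    by (rule nn_integral_distr[OF m]) (use f in simp)
  also have "\<dots> = (\<integral>\<^sup>+\<omega>. (\<integral>\<^sup>+v. f (case (v, \<omega>) of (v, \<omega>) \<Rightarrow> set_X n v \<omega>) \<partial>R) \<partial>PL \<theta>)"
    by (rule nn_integral_snd[symmetric]) (rule measurable_compose[OF m f])
  finally show ?thesis by simp
qed

lemma nn_integral_exp_T: "(\<integral>\<^sup>+\<omega>. ennreal (exp (- T n \<omega>)) \<partial>PL \<theta>) = (\<integral>\<^sup>+w. ennreal (exp (- w)) \<partial>K \<theta>) ^ n"
proof (induction n)
  case 0
  then show ?case using prob_space.emeasure_space_1[OF prob_PL[OF \<theta>]] by simp
next
  case (Suc n)
  have "(\<integral>\<^sup>+\<omega>. ennreal (exp (- T (Suc n) \<omega>)) \<partial>PL \<theta>) =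
      (\<integral>\<^sup>+\<omega>. (\<integral>\<^sup>+v. ennreal (exp (- T (Suc n) (set_W n v \<omega>))) \<partial>K \<theta>) \<partial>PL \<theta>)"
    by (rule nn_integral_resample_W) measurable
  also have "\<dots> = (\<integral>\<^sup>+\<omega>. (\<integral>\<^sup>+v. ennreal (exp (- T n \<omega>)) * ennreal (exp (- v)) \<partial>K \<theta>) \<partial>PL \<theta>)"
    by (intro nn_integral_cong)
      (simp add: T_Suc depends_on_first_set[OF depends_on_first_T[OF order_refl]] ennreal_mult'[symmetric] exp_add[symmetric])
  also have "\<dots> = (\<integral>\<^sup>+\<omega>. ennreal (exp (- T n \<omega>)) * (\<integral>\<^sup>+v. ennreal (exp (- v)) \<partial>K \<theta>) \<partial>PL \<theta>)"
    by (intro nn_integral_cong nn_integral_cmult) measurable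
  also have "\<dots> = (\<integral>\<^sup>+\<omega>. ennreal (exp (- T n \<omega>)) \<partial>PL \<theta>) * (\<integral>\<^sup>+v. ennreal (exp (- v)) \<partial>K \<theta>)"
    by (rule nn_integral_multc) measurable
  finally show ?case by (simp only: Suc.IH power_Suc2)
qed

text \<open>On an explosion before time \<open>k\<close> all arrival times are at most \<open>k\<close>. By Markov's inequality for
  \<open>exp (- T n)\<close> the probability is at most \<open>exp k * q ^ n\<close> for every \<open>n\<close>, where \<open>q < 1\<close> is the Laplace
  transform of the interarrival law at \<open>1\<close>.\<close>

lemma AE_not_explodes: "AE \<omega> in PL \<theta>. \<forall>t. \<not> explodes t \<omega>"
proof -
  interpret k: prob_space "K \<theta>" by (rule prob_K[OF \<theta>])
  interpret p: prob_space "PL \<theta>" by (rule prob_PL[OF \<theta>])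
  \<comment> \<open>\<open>q < 1\<close> because interarrival times are positive.\<close>
  define q where "q = (\<integral>w. exp (- w) \<partial>K \<theta>)"
  have bound: "AE w in K \<theta>. norm (exp (- w)) \<le> 1"
    using AE_space by eventually_elim (simp add: space_K[OF \<theta>])
  have int: "integrable (K \<theta>) (\<lambda>w. exp (- w))"
    by (rule k.integrable_const_bound[OF bound]) measurable
  have q0: "0 \<le> q" unfolding q_def by (rule integral_nonneg_AE) simp
  have "q < (\<integral>w. 1 \<partial>K \<theta>)" unfolding q_def
  proof (rule k.integral_less_AE_space[OF int])
    show "AE w in K \<theta>. exp (- w) < 1" using AE_space by eventually_elim (simp add: space_K[OF \<theta>])
  qed (simp_all add: k.emeasure_space_1)
  then have q1: "q < 1" by (simp add: k.prob_space)
  have qe: "(\<integral>\<^sup>+w. ennreal (exp (- w)) \<partial>K \<theta>) = ennreal q"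
    unfolding q_def by (rule nn_integral_eq_integral[OF int]) simp
  have "AE \<omega> in PL \<theta>. \<not> explodes (real k) \<omega>" for k
  proof -
    let ?E = "{\<omega> \<in> space (path_space D). explodes (real k) \<omega>}"
    have E: "?E \<in> p.events" by simp
    have le: "measure (PL \<theta>) ?E \<le> exp (real k) * q ^ n" for n
    proof -
      have "emeasure (PL \<theta>) ?E = (\<integral>\<^sup>+\<omega>. indicator ?E \<omega> \<partial>PL \<theta>)" using E by simp
      also have "\<dots> \<le> (\<integral>\<^sup>+\<omega>. ennreal (exp (real k)) * ennreal (exp (- T n \<omega>)) \<partial>PL \<theta>)"
      proof (intro nn_integral_mono)
        fix \<omega>
        show "indicator ?E \<omega> \<le> ennreal (exp (real k)) * ennreal (exp (- T n \<omega>))"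
          by (cases "\<omega> \<in> ?E") (simp_all add: explodes_def ennreal_mult'[symmetric] exp_add[symmetric])
      qed
      also have "\<dots> = ennreal (exp (real k)) * ennreal q ^ n"
        by (subst nn_integral_cmult) (simp_all add: nn_integral_exp_T qe)
      also have "\<dots> = ennreal (exp (real k) * q ^ n)"
        by (simp add: ennreal_power ennreal_mult' q0)
      finally show ?thesis
        using q0 by (simp add: p.emeasure_eq_measure)
    qed
    have "(\<lambda>n. exp (real k) * q ^ n) \<longlonglongrightarrow> exp (real k) * 0"
      using q0 q1 by (intro tendsto_mult tendsto_const LIMSEQ_power_zero) simp
    then have "measure (PL \<theta>) ?E \<le> 0"
      using le by (intro LIMSEQ_le_const[where X="\<lambda>n. exp (real k) * q ^ n"]) simp_all
    then have "emeasure (PL \<theta>) ?E = 0"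
      by (simp add: p.emeasure_eq_measure ennreal_neg)
    then have "?E \<in> null_sets (PL \<theta>)" using E by (rule null_setsI)
    then show ?thesis
      by (rule AE_I') (simp add: space_PL[OF \<theta>])
  qed
  then have "AE \<omega> in PL \<theta>. \<forall>k. \<not> explodes (real k) \<omega>" by (simp add: AE_all_countable)
  then show ?thesis
  proof eventually_elim
    case (elim \<omega>)
    show ?case
    proof (intro allI notI)
      fix t assume "explodes t \<omega>"
      obtain k where "t \<le> real k" using real_arch_simple by blast
      with explodes_mono[OF \<open>explodes t \<omega>\<close>] have "explodes (real k) \<omega>" by blast
      with elim show False by blast
    qed
  qed
qed

end

end

text \<open>Induction on the number of relevant coordinates: the last pair of coordinates is redrawn under the new
  laws, the density rule trades these for the old laws, and redrawing is undone under the old law.\<close>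

lemma nn_integral_PL_change:
  fixes f :: "'d::finite path \<Rightarrow> ennreal"
  assumes P: "renewal_kernel D K R" and Q: "renewal_kernel D K' R'" and \<theta>: "\<theta> \<in> D"
    and K': "K' \<theta> = density (K \<theta>) g" and R': "R' = density R h"
    and g[measurable]: "g \<in> borel_measurable pos_borel" and h[measurable]: "h \<in> borel_measurable pos_borel"
  shows "f \<in> borel_measurable (path_space D) \<Longrightarrow> depends_on_first n f \<Longrightarrow>
    (\<integral>\<^sup>+\<omega>. f \<omega> \<partial>path_law D K' R' \<theta>) = (\<integral>\<^sup>+\<omega>. f \<omega> * (\<Prod>j<n. h (X j \<omega>) * g (W j \<omega>)) \<partial>path_law D K R \<theta>)"
proof -
  interpret P: renewal_kernel D K R by (rule P)
  interpret Q: renewal_kernel D K' R' by (rule Q)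
  note [measurable_cong] = P.sets_PL[OF \<theta>] Q.sets_PL[OF \<theta>] P.sets_K[OF \<theta>] Q.sets_K[OF \<theta>] P.sets_R Q.sets_R
  interpret Kp: prob_space "K \<theta>" by (rule P.prob_K[OF \<theta>])
  interpret Rp: prob_space R by (rule P.prob_R)
  interpret Kq: prob_space "K' \<theta>" by (rule Q.prob_K[OF \<theta>])
  interpret Rq: prob_space R' by (rule Q.prob_R)
  show "f \<in> borel_measurable (path_space D) \<Longrightarrow> depends_on_first n f \<Longrightarrow> ?thesis"
  proof (induction n arbitrary: f)
    case 0
    \<comment> \<open>Without relevant coordinates \<open>f\<close> is a function of the parameter alone; the values \<open>1\<close> are arbitrary.\<close>
    define c where "c = f (\<lambda>_. 1, \<lambda>_. 1, \<theta>)"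
    have c: "f \<omega> = c" if "Theta \<omega> = \<theta>" for \<omega>
      unfolding c_def by (rule depends_on_firstD[OF 0(2)]) (simp_all add: that, simp add: Theta_def)
    have "(\<integral>\<^sup>+\<omega>. f \<omega> \<partial>Q.PL \<theta>) = (\<integral>\<^sup>+\<omega>. c \<partial>Q.PL \<theta>)"
      using Q.AE_PL_Theta[OF \<theta>] by (intro nn_integral_cong_AE) (auto elim!: eventually_mono simp: c simp del: split_paired_All)
    also have "\<dots> = (\<integral>\<^sup>+\<omega>. c \<partial>P.PL \<theta>)"
      using prob_space.emeasure_space_1[OF P.prob_PL[OF \<theta>]] prob_space.emeasure_space_1[OF Q.prob_PL[OF \<theta>]] by simp
    also have "\<dots> = (\<integral>\<^sup>+\<omega>. f \<omega> \<partial>P.PL \<theta>)"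
      using P.AE_PL_Theta[OF \<theta>] by (intro nn_integral_cong_AE) (auto elim!: eventually_mono simp: c simp del: split_paired_All)
    finally show ?case by simp
  next
    case (Suc n)
    note [measurable] = Suc.prems(1)
    let ?L = "\<lambda>n \<omega>. \<Prod>j<n. h (X j \<omega>) * g (W j \<omega>)"
    \<comment> \<open>The pair of coordinates with index \<open>n\<close> is integrated out under the new laws.\<close>
    define F where "F = (\<lambda>\<omega>. \<integral>\<^sup>+x. (\<integral>\<^sup>+v. f (set_W n v (set_X n x \<omega>)) \<partial>K' \<theta>) \<partial>R')"
    have F[measurable]: "F \<in> borel_measurable (path_space D)" unfolding F_def by measurable
    have dF: "depends_on_first n F"
      unfolding depends_on_first_def
    proof (intro allI impI)
      fix \<omega> \<omega>' :: "'d path"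
      assume a: "\<forall>j<n. W j \<omega> = W j \<omega>' \<and> X j \<omega> = X j \<omega>'" "Theta \<omega> = Theta \<omega>'"
      have "f (set_W n v (set_X n x \<omega>)) = f (set_W n v (set_X n x \<omega>'))" for v x
        by (rule depends_on_firstD[OF Suc.prems(2)]) (use a in \<open>auto simp: less_Suc_eq simp del: split_paired_All\<close>)
      then show "F \<omega> = F \<omega>'" unfolding F_def by simp
    qed
    have "(\<integral>\<^sup>+\<omega>. f \<omega> \<partial>Q.PL \<theta>) = (\<integral>\<^sup>+\<omega>. (\<integral>\<^sup>+v. f (set_W n v \<omega>) \<partial>K' \<theta>) \<partial>Q.PL \<theta>)"
      by (rule Q.nn_integral_resample_W[OF \<theta>]) measurable
    also have "\<dots> = (\<integral>\<^sup>+\<omega>. F \<omega> \<partial>Q.PL \<theta>)"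
      unfolding F_def by (rule Q.nn_integral_resample_X[OF \<theta>]) measurable
    also have "\<dots> = (\<integral>\<^sup>+\<omega>. F \<omega> * ?L n \<omega> \<partial>P.PL \<theta>)"
      by (rule Suc.IH[OF F dF])
    also have "\<dots> = (\<integral>\<^sup>+\<omega>. (\<integral>\<^sup>+x. (\<integral>\<^sup>+v. f (set_W n v (set_X n x \<omega>)) * ?L (Suc n) (set_W n v (set_X n x \<omega>)) \<partial>K \<theta>) \<partial>R) \<partial>P.PL \<theta>)"
    proof (intro nn_integral_cong)
      fix \<omega> assume "\<omega> \<in> space (P.PL \<theta>)"
      then have [measurable]: "\<omega> \<in> space (path_space D)" by (simp add: P.space_PL[OF \<theta>])
      have "(\<integral>\<^sup>+v. f (set_W n v (set_X n x \<omega>)) \<partial>K' \<theta>) = (\<integral>\<^sup>+v. g v * f (set_W n v (set_X n x \<omega>)) \<partial>K \<theta>)"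
        if "x \<in> space pos_borel" for x
        unfolding K' using that by (intro nn_integral_density) measurable
      then have "F \<omega> = (\<integral>\<^sup>+x. (\<integral>\<^sup>+v. g v * f (set_W n v (set_X n x \<omega>)) \<partial>K \<theta>) \<partial>R')"
        unfolding F_def by (intro nn_integral_cong) (simp add: Q.space_R)
      also have "\<dots> = (\<integral>\<^sup>+x. h x * (\<integral>\<^sup>+v. g v * f (set_W n v (set_X n x \<omega>)) \<partial>K \<theta>) \<partial>R)"
        unfolding R' by (intro nn_integral_density) measurable
      finally have "F \<omega> * ?L n \<omega> = (\<integral>\<^sup>+x. h x * (\<integral>\<^sup>+v. g v * f (set_W n v (set_X n x \<omega>)) \<partial>K \<theta>) * ?L n \<omega> \<partial>R)"
        by (simp add: nn_integral_multc)
      also have "\<dots> = (\<integral>\<^sup>+x. (\<integral>\<^sup>+v. f (set_W n v (set_X n x \<omega>)) * ?L (Suc n) (set_W n v (set_X n x \<omega>)) \<partial>K \<theta>) \<partial>R)"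
      proof (intro nn_integral_cong)
        fix x assume "x \<in> space R"
        then have x: "x \<in> space pos_borel" by (simp add: P.space_R)
        have m: "(\<lambda>v. g v * f (set_W n v (set_X n x \<omega>))) \<in> borel_measurable (K \<theta>)" using x by measurable
        have "h x * (\<integral>\<^sup>+v. g v * f (set_W n v (set_X n x \<omega>)) \<partial>K \<theta>) * ?L n \<omega> =
            (\<integral>\<^sup>+v. (h x * ?L n \<omega>) * (g v * f (set_W n v (set_X n x \<omega>))) \<partial>K \<theta>)"
          unfolding nn_integral_cmult[OF m] by (simp only: mult_ac)
        also have "\<dots> = (\<integral>\<^sup>+v. f (set_W n v (set_X n x \<omega>)) * ?L (Suc n) (set_W n v (set_X n x \<omega>)) \<partial>K \<theta>)"
          by (intro nn_integral_cong) (simp add: mult_ac)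
        finally show "h x * (\<integral>\<^sup>+v. g v * f (set_W n v (set_X n x \<omega>)) \<partial>K \<theta>) * ?L n \<omega> =
          (\<integral>\<^sup>+v. f (set_W n v (set_X n x \<omega>)) * ?L (Suc n) (set_W n v (set_X n x \<omega>)) \<partial>K \<theta>)" .
      qed
      finally show "F \<omega> * ?L n \<omega> =
        (\<integral>\<^sup>+x. (\<integral>\<^sup>+v. f (set_W n v (set_X n x \<omega>)) * ?L (Suc n) (set_W n v (set_X n x \<omega>)) \<partial>K \<theta>) \<partial>R)" .
    qed
    also have "\<dots> = (\<integral>\<^sup>+\<omega>. (\<integral>\<^sup>+v. f (set_W n v \<omega>) * ?L (Suc n) (set_W n v \<omega>) \<partial>K \<theta>) \<partial>P.PL \<theta>)"
      by (rule P.nn_integral_resample_X[OF \<theta>, symmetric]) measurable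
    also have "\<dots> = (\<integral>\<^sup>+\<omega>. f \<omega> * ?L (Suc n) \<omega> \<partial>P.PL \<theta>)"
      by (rule P.nn_integral_resample_W[OF \<theta>, symmetric]) measurable
    finally show ?case .
  qed
qed

section \<open>Likelihood ratio of renewal laws on the filtration\<close>

text \<open>The indicator that exactly \<open>n\<close> claims have arrived by time \<open>t\<close>. Unlike \<open>N t = n\<close> it is \<open>0\<close> for all \<open>n\<close> on
  exploding paths.\<close>

definition stage :: "nat \<Rightarrow> real \<Rightarrow> 'd::finite path \<Rightarrow> ennreal" where
  "stage n t \<omega> = (if T n \<omega> \<le> t \<and> t < T (Suc n) \<omega> then 1 else 0)"

lemma measurable_stage [measurable]: "stage n t \<in> borel_measurable (path_space D)"
  unfolding stage_def[abs_def] by measurable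

lemma suminf_stage:
  fixes c :: ennreal
  assumes "\<omega> \<in> space (path_space D)" "0 \<le> t" "\<not> explodes t \<omega>"
  shows "(\<Sum>n. c * stage n t \<omega>) = c"
proof -
  have "T n \<omega> \<le> t \<and> t < T (Suc n) \<omega> \<longleftrightarrow> n = N t \<omega>" for n
    using N_eq_iff[OF path_space_pos(1)[OF assms(1)] assms(2,3), of n] by blast
  then have "c * stage n t \<omega> = (if n = N t \<omega> then c else 0)" for n
    unfolding stage_def by simp
  then have "(\<lambda>n. c * stage n t \<omega>) = (\<lambda>n. if n = N t \<omega> then c else 0)" by (intro ext)
  then show ?thesis using sums_unique[OF sums_single[of "N t \<omega>" "\<lambda>_. c"]] by simp
qed

context renewal_kernel
begin

lemma measurable_dist_fun [measurable (raw)]: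
  assumes f[measurable]: "f \<in> M \<rightarrow>\<^sub>M param_borel D" and h[measurable]: "h \<in> borel_measurable M"
  shows "(\<lambda>x. dist_fun (K (f x)) (h x)) \<in> borel_measurable M"
proof -
  have "(\<lambda>x. measure (K (f x)) {y \<in> {0<..}. y \<le> h x}) \<in> borel_measurable M"
  proof (rule measure_measurable_subprob_algebra2)
    show "(\<lambda>x. K (f x)) \<in> M \<rightarrow>\<^sub>M subprob_algebra pos_borel"
      by (rule measurable_compose[OF f measurable_prob_algebraD[OF K]])
    have "{z \<in> space (M \<Otimes>\<^sub>M pos_borel). snd z \<le> h (fst z)} \<in> sets (M \<Otimes>\<^sub>M pos_borel)"
      using measurable_compose[OF measurable_snd[of M pos_borel] measurable_ident_pos_borel] by measurable
    also have "{z \<in> space (M \<Otimes>\<^sub>M pos_borel). snd z \<le> h (fst z)} = (SIGMA x:space M. {y \<in> {0<..}. y \<le> h x})"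
      by (auto simp: space_pair_measure)
    finally show "(SIGMA x:space M. {y \<in> {0<..}. y \<le> h x}) \<in> sets (M \<Otimes>\<^sub>M pos_borel)" .
  qed
  then show ?thesis
    by (rule measurable_cong[THEN iffD1, rotated])
      (use measurable_space[OF f] in \<open>simp add: dist_fun_def space_K\<close>)
qed

context
  fixes \<theta> assumes \<theta>: "\<theta> \<in> D"
begin

lemmas [measurable_cong] = sets_PL[OF \<theta>] sets_K[OF \<theta>] sets_R

lemma nn_integral_stages:
  assumes f[measurable]: "f \<in> borel_measurable (path_space D)" and t: "0 \<le> t"
  shows "(\<integral>\<^sup>+\<omega>. f \<omega> \<partial>PL \<theta>) = (\<Sum>n. \<integral>\<^sup>+\<omega>. f \<omega> * stage n t \<omega> \<partial>PL \<theta>)"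
proof -
  have "(\<integral>\<^sup>+\<omega>. f \<omega> \<partial>PL \<theta>) = (\<integral>\<^sup>+\<omega>. (\<Sum>n. f \<omega> * stage n t \<omega>) \<partial>PL \<theta>)"
  proof (rule nn_integral_cong_AE)
    show "AE \<omega> in PL \<theta>. f \<omega> = (\<Sum>n. f \<omega> * stage n t \<omega>)"
      using AE_not_explodes[OF \<theta>] AE_space
    proof eventually_elim
      case (elim \<omega>)
      then have "\<omega> \<in> space (path_space D)" "\<not> explodes t \<omega>" by (simp_all add: space_PL[OF \<theta>])
      from suminf_stage[OF this(1) t this(2)] show ?case ..
    qed
  qed
  also have "\<dots> = (\<Sum>n. \<integral>\<^sup>+\<omega>. f \<omega> * stage n t \<omega> \<partial>PL \<theta>)"
    by (rule nn_integral_suminf) measurable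
  finally show ?thesis .
qed

text \<open>The interarrival time in progress is redrawn; \<open>H\<close> does not depend on it.\<close>

lemma nn_integral_survival:
  assumes H[measurable]: "H \<in> borel_measurable (path_space D)" and dep: "depends_on_first n H"
  shows "(\<integral>\<^sup>+\<omega>. H \<omega> * (if t < T (Suc n) \<omega> then 1 else 0) \<partial>PL \<theta>) =
    (\<integral>\<^sup>+\<omega>. H \<omega> * emeasure (K \<theta>) {v \<in> {0<..}. t - T n \<omega> < v} \<partial>PL \<theta>)"
proof -
  have "(\<integral>\<^sup>+\<omega>. H \<omega> * (if t < T (Suc n) \<omega> then 1 else 0) \<partial>PL \<theta>) =
      (\<integral>\<^sup>+\<omega>. (\<integral>\<^sup>+v. H (set_W n v \<omega>) * (if t < T (Suc n) (set_W n v \<omega>) then 1 else 0) \<partial>K \<theta>) \<partial>PL \<theta>)"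
    by (rule nn_integral_resample_W[OF \<theta>]) measurable
  also have "\<dots> = (\<integral>\<^sup>+\<omega>. H \<omega> * emeasure (K \<theta>) {v \<in> {0<..}. t - T n \<omega> < v} \<partial>PL \<theta>)"
  proof (intro nn_integral_cong)
    fix \<omega> :: "'d path"
    have s: "{v \<in> {0<..}. t - T n \<omega> < v} \<in> sets (K \<theta>)"
      by (auto simp: sets_K[OF \<theta>] pos_borel_def sets_restrict_space intro!: image_eqI[of _ _ "{t - T n \<omega><..}"])
    have "(\<integral>\<^sup>+v. H (set_W n v \<omega>) * (if t < T (Suc n) (set_W n v \<omega>) then 1 else 0) \<partial>K \<theta>) =
        (\<integral>\<^sup>+v. H \<omega> * indicator {v \<in> {0<..}. t - T n \<omega> < v} v \<partial>K \<theta>)"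
      by (intro nn_integral_cong)
        (simp add: T_Suc depends_on_first_set[OF dep order_refl]
          depends_on_first_set[OF depends_on_first_T[OF order_refl] order_refl] space_K[OF \<theta>] indicator_def field_simps)
    also have "\<dots> = H \<omega> * emeasure (K \<theta>) {v \<in> {0<..}. t - T n \<omega> < v}"
      using s by (simp add: nn_integral_cmult)
    finally show "(\<integral>\<^sup>+v. H (set_W n v \<omega>) * (if t < T (Suc n) (set_W n v \<omega>) then 1 else 0) \<partial>K \<theta>) =
      H \<omega> * emeasure (K \<theta>) {v \<in> {0<..}. t - T n \<omega> < v}" .
  qed
  finally show ?thesis .
qed

text \<open>The size and the interarrival time of the \<open>(n+1)\<close>-st claim are redrawn in turn, which separates the
  factor in the claim size from the one in the arrival time.\<close>

lemma nn_integral_jump: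
  assumes H[measurable]: "H \<in> borel_measurable (path_space D)" and dep: "depends_on_first n H"
    and \<phi>[measurable]: "\<phi> \<in> borel_measurable pos_borel"
  shows "(\<integral>\<^sup>+\<omega>. H \<omega> * \<phi> (X n \<omega>) * (if s < T (Suc n) \<omega> \<and> T (Suc n) \<omega> \<le> t then 1 else 0) \<partial>PL \<theta>) =
    (\<integral>\<^sup>+x. \<phi> x \<partial>R) * (\<integral>\<^sup>+\<omega>. H \<omega> * emeasure (K \<theta>) {v \<in> {0<..}. s < T n \<omega> + v \<and> T n \<omega> + v \<le> t} \<partial>PL \<theta>)"
proof -
  let ?i = "\<lambda>\<omega>. (if s < T (Suc n) \<omega> \<and> T (Suc n) \<omega> \<le> t then 1 else 0) :: ennreal"
  have TX: "T m (set_X n x \<omega>) = T m \<omega>" for m x and \<omega> :: "'d path" by (simp add: T_def)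
  have "(\<integral>\<^sup>+\<omega>. H \<omega> * \<phi> (X n \<omega>) * ?i \<omega> \<partial>PL \<theta>) =
      (\<integral>\<^sup>+\<omega>. (\<integral>\<^sup>+x. H (set_X n x \<omega>) * \<phi> (X n (set_X n x \<omega>)) * ?i (set_X n x \<omega>) \<partial>R) \<partial>PL \<theta>)"
    by (rule nn_integral_resample_X[OF \<theta>]) measurable
  also have "\<dots> = (\<integral>\<^sup>+\<omega>. (\<integral>\<^sup>+x. \<phi> x * (H \<omega> * ?i \<omega>) \<partial>R) \<partial>PL \<theta>)"
    by (intro nn_integral_cong) (simp add: depends_on_first_set[OF dep order_refl] TX mult_ac)
  also have "\<dots> = (\<integral>\<^sup>+\<omega>. (\<integral>\<^sup>+x. \<phi> x \<partial>R) * (H \<omega> * ?i \<omega>) \<partial>PL \<theta>)"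
    by (intro nn_integral_cong nn_integral_multc) measurable
  also have "\<dots> = (\<integral>\<^sup>+x. \<phi> x \<partial>R) * (\<integral>\<^sup>+\<omega>. H \<omega> * ?i \<omega> \<partial>PL \<theta>)"
    by (rule nn_integral_cmult) measurable
  also have "(\<integral>\<^sup>+\<omega>. H \<omega> * ?i \<omega> \<partial>PL \<theta>) = (\<integral>\<^sup>+\<omega>. (\<integral>\<^sup>+v. H (set_W n v \<omega>) * ?i (set_W n v \<omega>) \<partial>K \<theta>) \<partial>PL \<theta>)"
    by (rule nn_integral_resample_W[OF \<theta>]) measurable
  also have "\<dots> = (\<integral>\<^sup>+\<omega>. H \<omega> * emeasure (K \<theta>) {v \<in> {0<..}. s < T n \<omega> + v \<and> T n \<omega> + v \<le> t} \<partial>PL \<theta>)"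
  proof (intro nn_integral_cong)
    fix \<omega> :: "'d path"
    let ?E = "{v \<in> {0<..}. s < T n \<omega> + v \<and> T n \<omega> + v \<le> t}"
    have E: "?E \<in> sets (K \<theta>)"
      by (auto simp: sets_K[OF \<theta>] pos_borel_def sets_restrict_space
        intro!: image_eqI[of _ _ "{v. s < T n \<omega> + v \<and> T n \<omega> + v \<le> t}"])
    have "(\<integral>\<^sup>+v. H (set_W n v \<omega>) * ?i (set_W n v \<omega>) \<partial>K \<theta>) = (\<integral>\<^sup>+v. H \<omega> * indicator ?E v \<partial>K \<theta>)"
      by (intro nn_integral_cong)
        (simp add: T_Suc depends_on_first_set[OF dep order_refl]
          depends_on_first_set[OF depends_on_first_T[OF order_refl] order_refl] space_K[OF \<theta>] indicator_def)
    also have "\<dots> = H \<omega> * emeasure (K \<theta>) ?E" using E by (simp add: nn_integral_cmult)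
    finally show "(\<integral>\<^sup>+v. H (set_W n v \<omega>) * ?i (set_W n v \<omega>) \<partial>K \<theta>) = H \<omega> * emeasure (K \<theta>) ?E" .
  qed
  finally show ?thesis .
qed

lemma AE_PL_W:
  assumes "AE w in K \<theta>. P w"
  shows "AE \<omega> in PL \<theta>. \<forall>j. P (W j \<omega>)"
proof -
  have "AE \<omega> in PL \<theta>. P (W j \<omega>)" for j
  proof (rule AE_distrD[of "W j" "PL \<theta>" pos_borel])
    show "W j \<in> PL \<theta> \<rightarrow>\<^sub>M pos_borel" by measurable
    show "AE w in distr (PL \<theta>) pos_borel (W j). P w" using assms by (simp only: iid_PL_W(2)[OF \<theta>])
  qed
  then show ?thesis by (simp add: AE_all_countable)
qed

end

end

text \<open>An exponential law charges every half-line, so a law that dominates it does as well. Hence the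
  denominator in the likelihood ratio never vanishes.\<close>

lemma tail_Exp_density:
  assumes k: "prob_space k" "sets k = sets pos_borel" and rn: "rn_density k (Exp b) g" and b: "0 < b" and s: "0 \<le> s"
  shows "emeasure k {v \<in> {0<..}. s < v} = ennreal (1 - dist_fun k s)" "dist_fun k s < 1"
proof -
  interpret prob_space k by (rule k)
  have sp: "space k = {0<..}" using sets_eq_imp_space_eq[OF k(2)] by simp
  have m: "{v \<in> {0<..}. s < v} \<in> events"
    by (auto simp: k(2) pos_borel_def sets_restrict_space intro!: image_eqI[of _ _ "{s<..}"])
  have m': "{y \<in> space k. y \<le> s} \<in> events"
    by (auto simp: k(2) sp pos_borel_def sets_restrict_space intro!: image_eqI[of _ _ "{..s}"])
  have "{v \<in> {0<..}. s < v} = space k - {y \<in> space k. y \<le> s}" by (auto simp: sp)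
  then have p: "prob {v \<in> {0<..}. s < v} = 1 - dist_fun k s"
    using prob_compl[OF m'] by (simp add: dist_fun_def)
  then show "emeasure k {v \<in> {0<..}. s < v} = ennreal (1 - dist_fun k s)" by (simp add: emeasure_eq_measure)
  have "prob {v \<in> {0<..}. s < v} \<noteq> 0"
  proof
    assume "prob {v \<in> {0<..}. s < v} = 0"
    then have "{v \<in> {0<..}. s < v} \<in> null_sets k" using m by (auto simp: emeasure_eq_measure)
    moreover have "absolutely_continuous k (Exp b)"
    proof -
      have e: "Exp b = density k (\<lambda>x. ennreal (g x))" and [measurable]: "g \<in> borel_measurable k"
        using rn by (simp_all add: rn_density_def)
      show ?thesis unfolding e by (rule absolutely_continuousI_density) measurable
    qed
    ultimately have "{v \<in> {0<..}. s < v} \<in> null_sets (Exp b)" by (auto simp: absolutely_continuous_def)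
    then show False using emeasure_Exp_gt[OF b s] by auto
  qed
  then show "dist_fun k s < 1" using p measure_nonneg[of k "{v \<in> {0<..}. s < v}"] by linarith
qed

lemma M_tilde_stage:
  assumes "N t \<omega> = n"
  shows "M_tilde k b \<gamma> g t \<omega> =
    exp (- b * (t - T n \<omega>)) / (1 - dist_fun k (t - T n \<omega>)) * (\<Prod>j<n. exp (\<gamma> (X j \<omega>)) * g (W j \<omega>))"
  unfolding M_tilde_def S_gamma_def J_def assms
proof -
  have "exp (x - b * y) = exp (- b * y) * exp x" for x y :: real
    by (simp add: exp_add[symmetric])
  then show "exp ((\<Sum>k<n. \<gamma> (X k \<omega>)) - b * (t - T n \<omega>)) / (1 - dist_fun k (t - T n \<omega>)) * (\<Prod>j<n. g (W j \<omega>)) =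
    exp (- b * (t - T n \<omega>)) / (1 - dist_fun k (t - T n \<omega>)) * (\<Prod>j<n. exp (\<gamma> (X j \<omega>)) * g (W j \<omega>))"
    by (simp only: exp_sum[OF finite_lessThan] prod.distrib times_divide_eq_left mult.assoc)
qed

lemma (in renewal_kernel) measurable_M_tilde:
  assumes \<theta>: "\<theta> \<in> D" and [measurable]: "g \<in> borel_measurable pos_borel" "\<gamma> \<in> borel_measurable pos_borel"
    and t: "0 \<le> t"
  shows "M_tilde (K \<theta>) b \<gamma> g t \<in> borel_measurable (path_space D)"
proof -
  have thc: "(\<lambda>\<omega>. \<theta>) \<in> path_space D \<rightarrow>\<^sub>M param_borel D" using \<theta> by simp
  have "(\<lambda>\<omega>. (\<lambda>n \<omega>. exp (- b * (t - T n \<omega>)) / (1 - dist_fun (K \<theta>) (t - T n \<omega>)) *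
      (\<Prod>j<n. exp (\<gamma> (X j \<omega>)) * g (W j \<omega>))) (N t \<omega>) \<omega>) \<in> borel_measurable (path_space D)"
  proof (rule measurable_N_compose[OF t])
    fix n
    have [measurable]: "(\<lambda>\<omega>. dist_fun (K \<theta>) (t - T n \<omega>)) \<in> borel_measurable (path_space D)"
      by (rule measurable_dist_fun[OF thc]) measurable
    show "(\<lambda>\<omega>. exp (- b * (t - T n \<omega>)) / (1 - dist_fun (K \<theta>) (t - T n \<omega>)) *
      (\<Prod>j<n. exp (\<gamma> (X j \<omega>)) * g (W j \<omega>))) \<in> borel_measurable (path_space D)" by measurable
  qed
  then show ?thesis unfolding M_tilde_stage[OF refl] .
qed

text \<open>The law is changed separately on each event \<open>N t = n\<close>. The interarrival time in progress is first
  integrated out under the new law, which leaves a function of the first \<open>n\<close> coordinates; their law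
  is changed by the product density; finally the survival probability of the old law is split off and
  turned back into the condition that the next arrival comes after \<open>t\<close>.\<close>

lemma emeasure_PL_Filt:
  fixes D :: "(real ^ 'd::finite) set"
  assumes P: "renewal_kernel D K R" and Q: "renewal_kernel D K' R'" and \<theta>: "\<theta> \<in> D" and b: "0 < b"
    and K': "K' \<theta> = Exp b" and rn: "rn_density (K \<theta>) (Exp b) g"
    and \<gamma>[measurable]: "\<gamma> \<in> borel_measurable pos_borel" and R': "R' = density R (\<lambda>x. ennreal (exp (\<gamma> x)))"
    and t: "0 \<le> t" and A: "A \<in> sets (Filt D t)"
  shows "emeasure (path_law D K' R' \<theta>) A = (\<integral>\<^sup>+\<omega>. indicator A \<omega> * ennreal (M_tilde (K \<theta>) b \<gamma> g t \<omega>) \<partial>path_law D K R \<theta>)"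
proof -
  interpret P: renewal_kernel D K R by (rule P)
  interpret Q: renewal_kernel D K' R' by (rule Q)
  note [measurable_cong] = P.sets_PL[OF \<theta>] Q.sets_PL[OF \<theta>] P.sets_K[OF \<theta>] Q.sets_K[OF \<theta>] P.sets_R Q.sets_R
  let ?\<Omega> = "space (path_space D)"
  have g[measurable]: "g \<in> borel_measurable pos_borel"
    using rn measurable_cong_sets[OF P.sets_K[OF \<theta>] refl] by (auto simp: rn_density_def)
  have Ap[measurable]: "A \<in> sets (path_space D)" using A Filt_subset_path by blast
  have thc[measurable]: "(\<lambda>\<omega>. \<theta>) \<in> path_space D \<rightarrow>\<^sub>M param_borel D" using \<theta> by simp
  have Mt[measurable]: "M_tilde (K \<theta>) b \<gamma> g t \<in> borel_measurable (path_space D)"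
    by (rule P.measurable_M_tilde[OF \<theta> g \<gamma> t])
  have gnn: "AE \<omega> in P.PL \<theta>. \<forall>j. 0 \<le> g (W j \<omega>)"
    by (rule P.AE_PL_W[OF \<theta>]) (use rn in \<open>simp add: rn_density_def\<close>)
  have st: "(\<integral>\<^sup>+\<omega>. indicator A \<omega> * stage n t \<omega> \<partial>Q.PL \<theta>) =
      (\<integral>\<^sup>+\<omega>. (indicator A \<omega> * ennreal (M_tilde (K \<theta>) b \<gamma> g t \<omega>)) * stage n t \<omega> \<partial>P.PL \<theta>)" for n
  proof -
    \<comment> \<open>\<open>h\<close> is the event in terms of the first \<open>n\<close> coordinates, \<open>L\<close> the product density, \<open>E\<close> the new survival
      probability, and \<open>c\<close> the ratio of the new to the old survival probability.\<close>
    define h where "h = (\<lambda>\<omega> :: 'd path. indicator A (truncate n t \<omega>) * (if T n \<omega> \<le> t then 1 else 0) :: ennreal)"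
    define L where "L = (\<lambda>\<omega> :: 'd path. \<Prod>j<n. ennreal (exp (\<gamma> (X j \<omega>))) * ennreal (g (W j \<omega>)))"
    define E where "E = (\<lambda>\<omega> :: 'd path. ennreal (exp (- b * (t - T n \<omega>))))"
    define c where "c = (\<lambda>\<omega> :: 'd path. ennreal (exp (- b * (t - T n \<omega>)) / (1 - dist_fun (K \<theta>) (t - T n \<omega>))))"
    have [measurable]: "(\<lambda>\<omega>. dist_fun (K \<theta>) (t - T n \<omega>)) \<in> borel_measurable (path_space D)"
      by (rule P.measurable_dist_fun[OF thc]) measurable
    note [measurable] = measurable_truncate[OF t, of n D]
    have h[measurable]: "h \<in> borel_measurable (path_space D)" unfolding h_def by measurable
    have L[measurable]: "L \<in> borel_measurable (path_space D)" unfolding L_def by measurable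
    have E[measurable]: "E \<in> borel_measurable (path_space D)" unfolding E_def by measurable
    have c[measurable]: "c \<in> borel_measurable (path_space D)" unfolding c_def by measurable
    note Tn = depends_on_first_T[OF order_refl, of n]
    have dh: "h \<omega> = h \<omega>'" "E \<omega> = E \<omega>'" "c \<omega> = c \<omega>'" "L \<omega> = L \<omega>'"
      if "\<And>j. j < n \<Longrightarrow> W j \<omega> = W j \<omega>'" "\<And>j. j < n \<Longrightarrow> X j \<omega> = X j \<omega>'" "Theta \<omega> = Theta \<omega>'" for \<omega> \<omega>'
      using depends_on_firstD[OF depends_on_first_truncate[of n t] that] depends_on_firstD[OF Tn that] that
      by (simp_all add: h_def E_def c_def L_def)
    have dep1: "depends_on_first n (\<lambda>\<omega>. h \<omega>)" and dep2: "depends_on_first n (\<lambda>\<omega>. h \<omega> * E \<omega>)"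
      and dep3: "depends_on_first n (\<lambda>\<omega>. h \<omega> * c \<omega> * L \<omega>)"
      unfolding depends_on_first_def using dh by metis+
    have hs: "indicator A \<omega> * stage n t \<omega> = h \<omega> * (if t < T (Suc n) \<omega> then 1 else 0)" if "\<omega> \<in> ?\<Omega>" for \<omega>
      using truncate_Filt[OF A that t, of n] by (simp add: h_def stage_def indicator_def)
    have "(\<integral>\<^sup>+\<omega>. indicator A \<omega> * stage n t \<omega> \<partial>Q.PL \<theta>) =
        (\<integral>\<^sup>+\<omega>. h \<omega> * (if t < T (Suc n) \<omega> then 1 else 0) \<partial>Q.PL \<theta>)"
      by (intro nn_integral_cong hs) (simp add: Q.space_PL[OF \<theta>])
    also have "\<dots> = (\<integral>\<^sup>+\<omega>. h \<omega> * emeasure (K' \<theta>) {v \<in> {0<..}. t - T n \<omega> < v} \<partial>Q.PL \<theta>)"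
      by (rule Q.nn_integral_survival[OF \<theta> h dep1])
    also have "\<dots> = (\<integral>\<^sup>+\<omega>. h \<omega> * E \<omega> \<partial>Q.PL \<theta>)"
    proof (intro nn_integral_cong)
      fix \<omega>
      show "h \<omega> * emeasure (K' \<theta>) {v \<in> {0<..}. t - T n \<omega> < v} = h \<omega> * E \<omega>"
      proof (cases "T n \<omega> \<le> t")
        case True
        then show ?thesis unfolding K' E_def by (subst emeasure_Exp_gt[OF b]) simp_all
      qed (simp add: h_def)
    qed
    also have "\<dots> = (\<integral>\<^sup>+\<omega>. h \<omega> * E \<omega> * L \<omega> \<partial>P.PL \<theta>)"
      unfolding L_def
    proof (rule nn_integral_PL_change[OF P Q \<theta> _ R' _ _ _ dep2])
      show "K' \<theta> = density (K \<theta>) (\<lambda>w. ennreal (g w))" using rn K' by (simp add: rn_density_def)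
    qed measurable
    also have "\<dots> = (\<integral>\<^sup>+\<omega>. (h \<omega> * c \<omega> * L \<omega>) * emeasure (K \<theta>) {v \<in> {0<..}. t - T n \<omega> < v} \<partial>P.PL \<theta>)"
    proof (intro nn_integral_cong)
      fix \<omega>
      show "h \<omega> * E \<omega> * L \<omega> = (h \<omega> * c \<omega> * L \<omega>) * emeasure (K \<theta>) {v \<in> {0<..}. t - T n \<omega> < v}"
      proof (cases "T n \<omega> \<le> t")
        case True
        then have s: "0 \<le> t - T n \<omega>" by simp
        note tl = tail_Exp_density[OF P.prob_K[OF \<theta>] P.sets_K[OF \<theta>] rn b s]
        have "c \<omega> * emeasure (K \<theta>) {v \<in> {0<..}. t - T n \<omega> < v} = E \<omega>"
          unfolding tl(1) c_def E_def using tl(2) by (simp add: ennreal_mult'[symmetric])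
        then show ?thesis by (metis mult.assoc mult.commute)
      qed (simp add: h_def)
    qed
    also have "\<dots> = (\<integral>\<^sup>+\<omega>. (h \<omega> * c \<omega> * L \<omega>) * (if t < T (Suc n) \<omega> then 1 else 0) \<partial>P.PL \<theta>)"
      by (rule P.nn_integral_survival[OF \<theta> _ dep3, symmetric]) measurable
    also have "\<dots> = (\<integral>\<^sup>+\<omega>. (indicator A \<omega> * ennreal (M_tilde (K \<theta>) b \<gamma> g t \<omega>)) * stage n t \<omega> \<partial>P.PL \<theta>)"
    proof (rule nn_integral_cong_AE)
      show "AE \<omega> in P.PL \<theta>. (h \<omega> * c \<omega> * L \<omega>) * (if t < T (Suc n) \<omega> then 1 else 0) =
          (indicator A \<omega> * ennreal (M_tilde (K \<theta>) b \<gamma> g t \<omega>)) * stage n t \<omega>"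
        using gnn AE_space
      proof eventually_elim
        case (elim \<omega>)
        then have \<omega>: "\<omega> \<in> ?\<Omega>" by (simp add: P.space_PL[OF \<theta>])
        show ?case
        proof (cases "T n \<omega> \<le> t \<and> t < T (Suc n) \<omega>")
          case True
          then have n: "N t \<omega> = n" by (intro N_eq[OF path_space_pos(1)[OF \<omega>]]) auto
          have s: "0 \<le> t - T n \<omega>" using True by simp
          note tl = tail_Exp_density[OF P.prob_K[OF \<theta>] P.sets_K[OF \<theta>] rn b s]
          have "ennreal (M_tilde (K \<theta>) b \<gamma> g t \<omega>) = c \<omega> * ennreal (\<Prod>j<n. exp (\<gamma> (X j \<omega>)) * g (W j \<omega>))"
            unfolding M_tilde_stage[OF n] c_def using tl(2) by (intro ennreal_mult') simp
          also have "ennreal (\<Prod>j<n. exp (\<gamma> (X j \<omega>)) * g (W j \<omega>)) = L \<omega>"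
            unfolding L_def using elim(1) by (subst prod_ennreal[symmetric]) (simp_all add: ennreal_mult')
          finally have "ennreal (M_tilde (K \<theta>) b \<gamma> g t \<omega>) = c \<omega> * L \<omega>" .
          then show ?thesis using True truncate_Filt[OF A \<omega> t, of n]
            by (simp add: h_def stage_def indicator_def)
        next
          case False
          then show ?thesis by (auto simp: h_def stage_def simp del: split_paired_All)
        qed
      qed
    qed
    finally show ?thesis .
  qed
  have "emeasure (Q.PL \<theta>) A = (\<integral>\<^sup>+\<omega>. indicator A \<omega> \<partial>Q.PL \<theta>)" by simp
  also have "\<dots> = (\<Sum>n. \<integral>\<^sup>+\<omega>. indicator A \<omega> * stage n t \<omega> \<partial>Q.PL \<theta>)"
    by (rule Q.nn_integral_stages[OF \<theta> _ t]) simp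
  also have "\<dots> = (\<Sum>n. \<integral>\<^sup>+\<omega>. (indicator A \<omega> * ennreal (M_tilde (K \<theta>) b \<gamma> g t \<omega>)) * stage n t \<omega> \<partial>P.PL \<theta>)"
    by (simp only: st)
  also have "\<dots> = (\<integral>\<^sup>+\<omega>. indicator A \<omega> * ennreal (M_tilde (K \<theta>) b \<gamma> g t \<omega>) \<partial>P.PL \<theta>)"
    by (rule P.nn_integral_stages[OF \<theta> _ t, symmetric]) measurable
  finally show ?thesis .
qed

section \<open>Compensator of the jumps under exponential interarrival times\<close>

context renewal_kernel
begin

context
  fixes \<theta> b assumes \<theta>: "\<theta> \<in> D" and b: "0 < b" and Kb: "K \<theta> = Exp b"
begin

lemmas [measurable_cong] = sets_PL[OF \<theta>] sets_R

text \<open>The \<open>(n+1)\<close>-st jump occurs at time \<open>u\<close> with intensity \<open>b\<close> on the event that exactly \<open>n\<close> claims have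
  arrived by time \<open>u\<close>. On the left the next interarrival time is redrawn and its density appears, which
  is \<open>b\<close> times the tail probability; on the right the tail probability is the chance that the current
  interarrival time is still in progress.\<close>

lemma compensator:
  assumes H[measurable]: "H \<in> borel_measurable (path_space D)" and dep: "depends_on_first n H"
    and \<phi>[measurable]: "\<phi> \<in> borel_measurable pos_borel"
  shows "(\<integral>\<^sup>+\<omega>. H \<omega> * \<phi> (X n \<omega>) * (if s < T (Suc n) \<omega> \<and> T (Suc n) \<omega> \<le> t then 1 else 0) \<partial>PL \<theta>) =
    (\<integral>\<^sup>+x. \<phi> x \<partial>R) * (\<integral>\<^sup>+u. indicator {s<..t} u * (ennreal b * (\<integral>\<^sup>+\<omega>. H \<omega> * stage n u \<omega> \<partial>PL \<theta>)) \<partial>lborel)"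
proof -
  interpret p: prob_space "PL \<theta>" by (rule prob_PL[OF \<theta>])
  interpret pair_sigma_finite lborel "PL \<theta>" ..
  \<comment> \<open>The probability that the interarrival time that starts at \<open>T n\<close> is still in progress at time \<open>u\<close>.\<close>
  let ?d = "\<lambda>u \<omega>. (if T n \<omega> \<le> u then 1 else 0) * ennreal (exp (- b * (u - T n \<omega>))) :: ennreal"
  have "(\<integral>\<^sup>+\<omega>. H \<omega> * emeasure (K \<theta>) {v \<in> {0<..}. s < T n \<omega> + v \<and> T n \<omega> + v \<le> t} \<partial>PL \<theta>) =
      (\<integral>\<^sup>+\<omega>. (\<integral>\<^sup>+u. H \<omega> * (indicator {s<..t} u * (ennreal b * ?d u \<omega>)) \<partial>lborel) \<partial>PL \<theta>)"
  proof (intro nn_integral_cong)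
    fix \<omega> assume "\<omega> \<in> space (PL \<theta>)"
    then have \<omega>: "\<omega> \<in> space (path_space D)" by (simp add: space_PL[OF \<theta>])
    have T0: "0 \<le> T n \<omega>" by (rule T_nonneg[OF path_space_pos(1)[OF \<omega>]])
    have "emeasure (K \<theta>) {v \<in> {0<..}. s < T n \<omega> + v \<and> T n \<omega> + v \<le> t} =
        (\<integral>\<^sup>+u. indicator {s<..t} u * (ennreal b * ?d u \<omega>) \<partial>lborel)"
      unfolding Kb emeasure_Exp_shift[OF b T0] by (intro nn_integral_cong) (simp add: indicator_def)
    then show "H \<omega> * emeasure (K \<theta>) {v \<in> {0<..}. s < T n \<omega> + v \<and> T n \<omega> + v \<le> t} =
        (\<integral>\<^sup>+u. H \<omega> * (indicator {s<..t} u * (ennreal b * ?d u \<omega>)) \<partial>lborel)"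
      by (simp add: nn_integral_cmult)
  qed
  also have "\<dots> = (\<integral>\<^sup>+u. (\<integral>\<^sup>+\<omega>. H \<omega> * (indicator {s<..t} u * (ennreal b * ?d u \<omega>)) \<partial>PL \<theta>) \<partial>lborel)"
    by (rule Fubini') measurable
  also have "\<dots> = (\<integral>\<^sup>+u. indicator {s<..t} u * (ennreal b * (\<integral>\<^sup>+\<omega>. H \<omega> * stage n u \<omega> \<partial>PL \<theta>)) \<partial>lborel)"
  proof (intro nn_integral_cong)
    fix u :: real
    let ?H = "\<lambda>\<omega>. H \<omega> * (if T n \<omega> \<le> u then 1 else 0)"
    have dH: "depends_on_first n ?H"
      unfolding depends_on_first_def
    proof (intro allI impI)
      fix \<omega> \<omega>' :: "'d path"
      assume a: "\<forall>j<n. W j \<omega> = W j \<omega>' \<and> X j \<omega> = X j \<omega>'" "Theta \<omega> = Theta \<omega>'"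
      have "H \<omega> = H \<omega>'" by (rule depends_on_firstD[OF dep]) (use a in auto)
      moreover have "T n \<omega> = T n \<omega>'" by (rule depends_on_firstD[OF depends_on_first_T[OF order_refl]]) (use a in auto)
      ultimately show "?H \<omega> = ?H \<omega>'" by simp
    qed
    have "(\<integral>\<^sup>+\<omega>. H \<omega> * stage n u \<omega> \<partial>PL \<theta>) = (\<integral>\<^sup>+\<omega>. ?H \<omega> * (if u < T (Suc n) \<omega> then 1 else 0) \<partial>PL \<theta>)"
      by (intro nn_integral_cong) (simp add: stage_def)
    also have "\<dots> = (\<integral>\<^sup>+\<omega>. ?H \<omega> * emeasure (K \<theta>) {v \<in> {0<..}. u - T n \<omega> < v} \<partial>PL \<theta>)"
      by (rule nn_integral_survival[OF \<theta> _ dH]) measurable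
    also have "\<dots> = (\<integral>\<^sup>+\<omega>. H \<omega> * ?d u \<omega> \<partial>PL \<theta>)"
    proof (intro nn_integral_cong)
      fix \<omega>
      show "?H \<omega> * emeasure (K \<theta>) {v \<in> {0<..}. u - T n \<omega> < v} = H \<omega> * ?d u \<omega>"
      proof (cases "T n \<omega> \<le> u")
        case True
        then show ?thesis unfolding Kb by (subst emeasure_Exp_gt[OF b]) simp_all
      qed simp
    qed
    finally have e: "(\<integral>\<^sup>+\<omega>. H \<omega> * stage n u \<omega> \<partial>PL \<theta>) = (\<integral>\<^sup>+\<omega>. H \<omega> * ?d u \<omega> \<partial>PL \<theta>)" .
    have "(\<integral>\<^sup>+\<omega>. H \<omega> * (indicator {s<..t} u * (ennreal b * ?d u \<omega>)) \<partial>PL \<theta>) =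
        (\<integral>\<^sup>+\<omega>. (indicator {s<..t} u * ennreal b) * (H \<omega> * ?d u \<omega>) \<partial>PL \<theta>)"
      by (intro nn_integral_cong) (simp only: mult_ac)
    also have "\<dots> = (indicator {s<..t} u * ennreal b) * (\<integral>\<^sup>+\<omega>. H \<omega> * ?d u \<omega> \<partial>PL \<theta>)"
      by (rule nn_integral_cmult) measurable
    finally show "(\<integral>\<^sup>+\<omega>. H \<omega> * (indicator {s<..t} u * (ennreal b * ?d u \<omega>)) \<partial>PL \<theta>) =
        indicator {s<..t} u * (ennreal b * (\<integral>\<^sup>+\<omega>. H \<omega> * stage n u \<omega> \<partial>PL \<theta>))"
      unfolding e by (simp only: mult.assoc)
  qed
  finally show ?thesis unfolding nn_integral_jump[OF \<theta> H dep \<phi>] by simp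
qed

text \<open>A family \<open>H n\<close> of functions of the first \<open>n\<close> claims that agrees with \<open>Z u\<close> as long as exactly \<open>n\<close> claims
  have arrived consists of the values of \<open>Z\<close> just before the jumps. Summing over \<open>n\<close> removes the
  indicators because almost surely some finite number of claims has arrived.\<close>

lemma compensator_suminf:
  assumes H[measurable]: "\<And>n. H n \<in> borel_measurable (path_space D)" and dep: "\<And>n. depends_on_first n (H n)"
    and \<phi>[measurable]: "\<phi> \<in> borel_measurable pos_borel" and s: "0 \<le> s"
    and Z[measurable]: "\<And>u. s < u \<Longrightarrow> u \<le> t \<Longrightarrow> Z u \<in> borel_measurable (path_space D)"
    and HZ: "\<And>n u \<omega>. s < u \<Longrightarrow> u \<le> t \<Longrightarrow> \<omega> \<in> space (path_space D) \<Longrightarrow> H n \<omega> * stage n u \<omega> = Z u \<omega> * stage n u \<omega>"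
  shows "(\<Sum>n. \<integral>\<^sup>+\<omega>. H n \<omega> * \<phi> (X n \<omega>) * (if s < T (Suc n) \<omega> \<and> T (Suc n) \<omega> \<le> t then 1 else 0) \<partial>PL \<theta>) =
    (\<integral>\<^sup>+x. \<phi> x \<partial>R) * (\<integral>\<^sup>+u. indicator {s<..t} u * (ennreal b * (\<integral>\<^sup>+\<omega>. Z u \<omega> \<partial>PL \<theta>)) \<partial>lborel)"
proof -
  interpret p: prob_space "PL \<theta>" by (rule prob_PL[OF \<theta>])
  let ?I = "\<lambda>n u. indicator {s<..t} u * (ennreal b * (\<integral>\<^sup>+\<omega>. H n \<omega> * stage n u \<omega> \<partial>PL \<theta>))"
  have mI: "?I n \<in> borel_measurable lborel" for n
    unfolding stage_def by measurable
  have "(\<Sum>n. \<integral>\<^sup>+\<omega>. H n \<omega> * \<phi> (X n \<omega>) * (if s < T (Suc n) \<omega> \<and> T (Suc n) \<omega> \<le> t then 1 else 0) \<partial>PL \<theta>) =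
      (\<Sum>n. (\<integral>\<^sup>+x. \<phi> x \<partial>R) * (\<integral>\<^sup>+u. ?I n u \<partial>lborel))"
    by (simp only: compensator[OF H dep \<phi>])
  also have "\<dots> = (\<integral>\<^sup>+x. \<phi> x \<partial>R) * (\<Sum>n. \<integral>\<^sup>+u. ?I n u \<partial>lborel)" by simp
  also have "(\<Sum>n. \<integral>\<^sup>+u. ?I n u \<partial>lborel) = (\<integral>\<^sup>+u. (\<Sum>n. ?I n u) \<partial>lborel)"
    by (rule nn_integral_suminf[symmetric]) (rule mI)
  also have "\<dots> = (\<integral>\<^sup>+u. indicator {s<..t} u * (ennreal b * (\<integral>\<^sup>+\<omega>. Z u \<omega> \<partial>PL \<theta>)) \<partial>lborel)"
  proof (intro nn_integral_cong)
    fix u :: real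
    show "(\<Sum>n. ?I n u) = indicator {s<..t} u * (ennreal b * (\<integral>\<^sup>+\<omega>. Z u \<omega> \<partial>PL \<theta>))"
    proof (cases "u \<in> {s<..t}")
      case True
      then have u: "s < u" "u \<le> t" by auto
      have "(\<integral>\<^sup>+\<omega>. H n \<omega> * stage n u \<omega> \<partial>PL \<theta>) = (\<integral>\<^sup>+\<omega>. Z u \<omega> * stage n u \<omega> \<partial>PL \<theta>)" for n
        by (intro nn_integral_cong HZ u) (simp add: space_PL[OF \<theta>])
      then show ?thesis using True s u by (simp add: nn_integral_stages[OF \<theta> Z[OF u], of u])
    qed simp
  qed
  finally show ?thesis .
qed

end

end

section \<open>Positivity and mixing of the likelihood ratio\<close>

lemma prog_equiv_iff:
  assumes "sets Q = sets (path_space D)" "sets P = sets (path_space D)"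
  shows "prog_equiv D Q P \<longleftrightarrow> (\<forall>t\<ge>0. \<forall>A\<in>sets (Filt D t). emeasure Q A = 0 \<longleftrightarrow> emeasure P A = 0)"
proof -
  have sQ: "subalgebra Q (Filt D t)" and sP: "subalgebra P (Filt D t)" for t
    using assms by (simp_all add: subalgebra_Filt)
  have sub: "A \<in> sets (Filt D t) \<Longrightarrow> A \<in> sets Q \<and> A \<in> sets P" for A t
    using Filt_subset_path[of D t] assms by auto
  have "equiv_measure (restr_to_subalg Q (Filt D t)) (restr_to_subalg P (Filt D t)) \<longleftrightarrow>
      (\<forall>A\<in>sets (Filt D t). emeasure Q A = 0 \<longleftrightarrow> emeasure P A = 0)" for t
    unfolding equiv_measure_def absolutely_continuous_def sets_restr_to_subalg[OF sQ] sets_restr_to_subalg[OF sP]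
      null_sets_restr_to_subalg[OF sQ] null_sets_restr_to_subalg[OF sP]
    using sub[of _ t] by (auto simp: null_sets_def simp del: split_paired_All)
  then show ?thesis unfolding prog_equiv_def by simp
qed

lemma emeasure_density_null_iff:
  assumes "emeasure M' A = (\<integral>\<^sup>+\<omega>. indicator A \<omega> * ennreal (f \<omega>) \<partial>M)"
    and [measurable]: "f \<in> borel_measurable M" "A \<in> sets M" and pos: "AE \<omega> in M. 0 < f \<omega>"
  shows "emeasure M' A = 0 \<longleftrightarrow> emeasure M A = 0"
proof -
  have "emeasure M' A = 0 \<longleftrightarrow> (AE \<omega> in M. indicator A \<omega> * ennreal (f \<omega>) = 0)"
    unfolding assms(1) by (rule nn_integral_0_iff_AE) measurable
  also have "\<dots> \<longleftrightarrow> (AE \<omega> in M. \<omega> \<notin> A)"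
  proof
    assume "AE \<omega> in M. indicator A \<omega> * ennreal (f \<omega>) = 0"
    with pos show "AE \<omega> in M. \<omega> \<notin> A"
      by eventually_elim (auto simp: indicator_def split: if_splits)
  next
    assume "AE \<omega> in M. \<omega> \<notin> A"
    then show "AE \<omega> in M. indicator A \<omega> * ennreal (f \<omega>) = 0" by eventually_elim simp
  qed
  also have "\<dots> \<longleftrightarrow> emeasure M A = 0" using AE_iff_null_sets[of A M] by (auto simp: null_sets_def)
  finally show ?thesis .
qed

lemma measure_eq_set_integral:
  assumes "emeasure M' A = (\<integral>\<^sup>+\<omega>. indicator A \<omega> * ennreal (f \<omega>) \<partial>M)"
    and [measurable]: "f \<in> borel_measurable M" "A \<in> sets M" and nn: "AE \<omega> in M. 0 \<le> f \<omega>"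
  shows "measure M' A = (LINT \<omega>:A|M. f \<omega>)"
proof -
  have "(LINT \<omega>:A|M. f \<omega>) = enn2real (\<integral>\<^sup>+\<omega>. ennreal (indicator A \<omega> *\<^sub>R f \<omega>) \<partial>M)"
    unfolding set_lebesgue_integral_def
    by (rule integral_eq_nn_integral) (measurable, use nn in \<open>auto elim!: eventually_mono\<close>)
  also have "(\<integral>\<^sup>+\<omega>. ennreal (indicator A \<omega> *\<^sub>R f \<omega>) \<partial>M) = emeasure M' A"
    unfolding assms(1) by (intro nn_integral_cong) (simp add: indicator_def)
  finally show ?thesis by (simp add: measure_def)
qed

text \<open>The set on which the density is not positive has measure \<open>0\<close> under the law with this density.\<close>

lemma rn_density_pos:
  assumes rn: "rn_density k m g" and ac: "absolutely_continuous m k"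
  shows "AE w in k. 0 < g w"
proof -
  have [measurable]: "g \<in> borel_measurable k" and e: "m = density k (\<lambda>w. ennreal (g w))"
    using rn by (simp_all add: rn_density_def)
  let ?E = "{w \<in> space k. g w \<le> 0}"
  have E: "?E \<in> sets k" by measurable
  have "emeasure m ?E = (\<integral>\<^sup>+w. ennreal (g w) * indicator ?E w \<partial>k)"
    unfolding e by (rule emeasure_density) measurable
  also have "\<dots> = (\<integral>\<^sup>+w. 0 \<partial>k)"
    by (intro nn_integral_cong) (auto simp: indicator_def ennreal_neg)
  finally have "?E \<in> null_sets m" using E e by auto
  then have "?E \<in> null_sets k" using ac by (auto simp: absolutely_continuous_def)
  then show ?thesis by (rule AE_I') auto
qed

lemma M_tilde_nonneg:
  assumes k: "prob_space k" "sets k = sets pos_borel" and rn: "rn_density k (Exp b) g" and b: "0 < b"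
    and \<omega>: "\<omega> \<in> space (path_space D)" and t: "0 \<le> t" and ne: "\<not> explodes t \<omega>"
  shows "\<forall>j. 0 \<le> g (W j \<omega>) \<Longrightarrow> 0 \<le> M_tilde k b \<gamma> g t \<omega>"
    and "\<forall>j. 0 < g (W j \<omega>) \<Longrightarrow> 0 < M_tilde k b \<gamma> g t \<omega>"
proof -
  have "0 \<le> t - T (N t \<omega>) \<omega>" using T_N(1)[OF path_space_pos(1)[OF \<omega>] t ne] by simp
  then have "dist_fun k (t - T (N t \<omega>) \<omega>) < 1" by (rule tail_Exp_density(2)[OF k rn b])
  then show "\<forall>j. 0 \<le> g (W j \<omega>) \<Longrightarrow> 0 \<le> M_tilde k b \<gamma> g t \<omega>"
    "\<forall>j. 0 < g (W j \<omega>) \<Longrightarrow> 0 < M_tilde k b \<gamma> g t \<omega>"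
    unfolding M_tilde_stage[OF refl] by (auto intro!: mult_nonneg_nonneg prod_nonneg divide_nonneg_pos mult_pos_pos prod_pos divide_pos_pos)
qed

lemma (in renewal_kernel) AE_M_tilde:
  assumes \<theta>: "\<theta> \<in> D" and rn: "rn_density (K \<theta>) (Exp b) g" and b: "0 < b" and t: "0 \<le> t"
  shows "AE \<omega> in PL \<theta>. 0 \<le> M_tilde (K \<theta>) b \<gamma> g t \<omega>"
    and "absolutely_continuous (Exp b) (K \<theta>) \<Longrightarrow> AE \<omega> in PL \<theta>. 0 < M_tilde (K \<theta>) b \<gamma> g t \<omega>"
proof -
  have "AE w in K \<theta>. 0 \<le> g w" using rn by (simp add: rn_density_def)
  from AE_PL_W[OF \<theta> this] AE_not_explodes[OF \<theta>] AE_space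
  show "AE \<omega> in PL \<theta>. 0 \<le> M_tilde (K \<theta>) b \<gamma> g t \<omega>"
  proof eventually_elim
    case (elim \<omega>)
    then show ?case
      using M_tilde_nonneg(1)[OF prob_K[OF \<theta>] sets_K[OF \<theta>] rn b _ t, of \<omega>] by (simp add: space_PL[OF \<theta>])
  qed
  assume "absolutely_continuous (Exp b) (K \<theta>)"
  from AE_PL_W[OF \<theta> rn_density_pos[OF rn this]] AE_not_explodes[OF \<theta>] AE_space
  show "AE \<omega> in PL \<theta>. 0 < M_tilde (K \<theta>) b \<gamma> g t \<omega>"
  proof eventually_elim
    case (elim \<omega>)
    then show ?case
      using M_tilde_nonneg(2)[OF prob_K[OF \<theta>] sets_K[OF \<theta>] rn b _ t, of \<omega>] by (simp add: space_PL[OF \<theta>])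
  qed
qed

lemma (in renewal_kernel) measurable_M_beta:
  assumes \<rho>[measurable]: "\<rho> \<in> borel_measurable (param_borel D)" and \<xi>[measurable]: "\<xi> \<in> borel_measurable (param_borel D)"
    and \<gamma>[measurable]: "\<gamma> \<in> borel_measurable pos_borel"
    and r: "(\<lambda>(\<theta>, w). r \<theta> w) \<in> borel_measurable (param_borel D \<Otimes>\<^sub>M pos_borel)" and t: "0 \<le> t"
  shows "M_beta K \<rho> \<gamma> \<xi> r t \<in> borel_measurable (path_space D)"
proof -
  have rW[measurable]: "(\<lambda>\<omega>. r (Theta \<omega>) (W j \<omega>)) \<in> borel_measurable (path_space D)" for j
    using measurable_compose[OF measurable_Pair[OF measurable_Theta measurable_W] r] by simp
  have "(\<lambda>\<omega>. (\<lambda>n \<omega>. \<xi> (Theta \<omega>) * (exp (- \<rho> (Theta \<omega>) * (t - T n \<omega>)) / (1 - dist_fun (K (Theta \<omega>)) (t - T n \<omega>)) *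
      (\<Prod>j<n. exp (\<gamma> (X j \<omega>)) * r (Theta \<omega>) (W j \<omega>)))) (N t \<omega>) \<omega>) \<in> borel_measurable (path_space D)"
  proof (rule measurable_N_compose[OF t])
    fix n
    have [measurable]: "(\<lambda>\<omega>. dist_fun (K (Theta \<omega>)) (t - T n \<omega>)) \<in> borel_measurable (path_space D)"
      by (rule measurable_dist_fun[OF measurable_Theta]) measurable
    show "(\<lambda>\<omega>. \<xi> (Theta \<omega>) * (exp (- \<rho> (Theta \<omega>) * (t - T n \<omega>)) / (1 - dist_fun (K (Theta \<omega>)) (t - T n \<omega>)) *
      (\<Prod>j<n. exp (\<gamma> (X j \<omega>)) * r (Theta \<omega>) (W j \<omega>)))) \<in> borel_measurable (path_space D)"
      by measurable
  qed
  then show ?thesis unfolding M_beta_def[abs_def] M_tilde_stage[OF refl] .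
qed

text \<open>Integration over the parameter of the likelihood ratio for fixed parameter. Under each component the
  parameter is constant, so that fixed \<open>\<theta>\<close> may be replaced by \<open>Theta\<close> in the likelihood ratio.\<close>

lemma emeasure_mixed_Filt:
  fixes D :: "(real ^ 'd::finite) set"
  assumes P: "mixed_renewal D K R \<mu>" and Q: "mixed_renewal D (\<lambda>\<theta>. Exp (\<rho> \<theta>)) R' \<nu>"
    and \<rho>: "\<rho> \<in> M_plus D" and \<xi>[measurable]: "\<xi> \<in> borel_measurable (param_borel D)"
    and \<xi>nn: "AE \<theta> in \<mu>. 0 \<le> \<xi> \<theta>" and \<nu>: "\<nu> = density \<mu> (\<lambda>\<theta>. ennreal (\<xi> \<theta>))"
    and r: "(\<lambda>(\<theta>, w). r \<theta> w) \<in> borel_measurable (param_borel D \<Otimes>\<^sub>M pos_borel)"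
    and rn: "AE \<theta> in \<mu>. rn_density (K \<theta>) (Exp (\<rho> \<theta>)) (r \<theta>)"
    and \<gamma>: "\<gamma> \<in> borel_measurable pos_borel" and R': "R' = density R (\<lambda>x. ennreal (exp (\<gamma> x)))"
    and t: "0 \<le> t"
  shows "A \<in> sets (Filt D t) \<Longrightarrow> emeasure (mixed_law D \<nu> (\<lambda>\<theta>. Exp (\<rho> \<theta>)) R') A =
      (\<integral>\<^sup>+\<omega>. indicator A \<omega> * ennreal (M_beta K \<rho> \<gamma> \<xi> r t \<omega>) \<partial>mixed_law D \<mu> K R)"
    and "AE \<omega> in mixed_law D \<mu> K R. 0 \<le> M_beta K \<rho> \<gamma> \<xi> r t \<omega>"
    and "AE \<theta> in \<mu>. 0 < \<xi> \<theta> \<Longrightarrow> AE \<theta> in \<mu>. absolutely_continuous (Exp (\<rho> \<theta>)) (K \<theta>) \<Longrightarrow>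
      AE \<omega> in mixed_law D \<mu> K R. 0 < M_beta K \<rho> \<gamma> \<xi> r t \<omega>"
proof -
  interpret P: mixed_renewal D K R \<mu> by (rule P)
  interpret Q: mixed_renewal D "\<lambda>\<theta>. Exp (\<rho> \<theta>)" R' \<nu> by (rule Q)
  have \<rho>m: "\<rho> \<in> borel_measurable (param_borel D)" and \<rho>p: "\<And>\<theta>. \<theta> \<in> D \<Longrightarrow> 0 < \<rho> \<theta>"
    using \<rho> by (auto simp: M_plus_def)
  have M[measurable]: "M_beta K \<rho> \<gamma> \<xi> r t \<in> borel_measurable (path_space D)"
    by (rule P.measurable_M_beta[OF \<rho>m \<xi> \<gamma> r t])
  show "emeasure Q.Q A = (\<integral>\<^sup>+\<omega>. indicator A \<omega> * ennreal (M_beta K \<rho> \<gamma> \<xi> r t \<omega>) \<partial>P.Q)"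
    if A: "A \<in> sets (Filt D t)"
  proof -
    have Ap[measurable]: "A \<in> sets (path_space D)" using subsetD[OF Filt_subset_path A] .
    have m1: "(\<lambda>\<theta>. emeasure (Q.PL \<theta>) A) \<in> borel_measurable \<mu>"
      using measurable_compose[OF Q.measurable_PL_subprob measurable_emeasure_subprob_algebra[OF Ap]]
      by (simp add: P.measurable_\<nu>)
    have m2: "(\<lambda>\<theta>. ennreal (\<xi> \<theta>)) \<in> borel_measurable \<mu>" by (simp add: P.measurable_\<nu>)
    have "emeasure Q.Q A = (\<integral>\<^sup>+\<theta>. emeasure (Q.PL \<theta>) A \<partial>\<nu>)" by (rule Q.emeasure_Q[OF Ap])
    also have "\<dots> = (\<integral>\<^sup>+\<theta>. ennreal (\<xi> \<theta>) * emeasure (Q.PL \<theta>) A \<partial>\<mu>)"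
      unfolding \<nu> by (rule nn_integral_density[OF m2 m1])
    also have "\<dots> = (\<integral>\<^sup>+\<theta>. (\<integral>\<^sup>+\<omega>. indicator A \<omega> * ennreal (M_beta K \<rho> \<gamma> \<xi> r t \<omega>) \<partial>P.PL \<theta>) \<partial>\<mu>)"
    proof (rule nn_integral_cong_AE)
      show "AE \<theta> in \<mu>. ennreal (\<xi> \<theta>) * emeasure (Q.PL \<theta>) A =
          (\<integral>\<^sup>+\<omega>. indicator A \<omega> * ennreal (M_beta K \<rho> \<gamma> \<xi> r t \<omega>) \<partial>P.PL \<theta>)"
        using rn \<xi>nn AE_space
      proof eventually_elim
        case (elim \<theta>)
        then have \<theta>: "\<theta> \<in> D" by (simp add: P.space_\<nu>)
        let ?m = "\<lambda>\<omega>. M_tilde (K \<theta>) (\<rho> \<theta>) \<gamma> (r \<theta>) t \<omega>"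
        have "ennreal (\<xi> \<theta>) * emeasure (Q.PL \<theta>) A =
            ennreal (\<xi> \<theta>) * (\<integral>\<^sup>+\<omega>. indicator A \<omega> * ennreal (?m \<omega>) \<partial>P.PL \<theta>)"
          by (subst emeasure_PL_Filt[OF P.renewal_kernel_axioms Q.renewal_kernel_axioms \<theta> \<rho>p[OF \<theta>] refl elim(1) \<gamma> R' t A]) simp
        also have "\<dots> = (\<integral>\<^sup>+\<omega>. ennreal (\<xi> \<theta>) * (indicator A \<omega> * ennreal (?m \<omega>)) \<partial>P.PL \<theta>)"
        proof (rule nn_integral_cmult[symmetric])
          have "r \<theta> \<in> borel_measurable pos_borel"
            using measurable_compose[OF measurable_Pair1'[of \<theta> "param_borel D" pos_borel] r] \<theta> by simp
          then have "?m \<in> borel_measurable (path_space D)"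
            by (rule P.measurable_M_tilde[OF \<theta> _ \<gamma> t])
          then have "(\<lambda>\<omega>. indicator A \<omega> * ennreal (?m \<omega>)) \<in> borel_measurable (path_space D)" by measurable
          then show "(\<lambda>\<omega>. indicator A \<omega> * ennreal (?m \<omega>)) \<in> borel_measurable (P.PL \<theta>)"
            by (rule P.borel_measurable_PL[OF _ refl \<theta>])
        qed
        also have "\<dots> = (\<integral>\<^sup>+\<omega>. indicator A \<omega> * ennreal (\<xi> \<theta> * ?m \<omega>) \<partial>P.PL \<theta>)"
          using elim(2) by (intro nn_integral_cong) (simp add: ennreal_mult' mult_ac)
        also have "\<dots> = (\<integral>\<^sup>+\<omega>. indicator A \<omega> * ennreal (M_beta K \<rho> \<gamma> \<xi> r t \<omega>) \<partial>P.PL \<theta>)"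
          unfolding M_beta_def
          by (rule P.nn_integral_PL_Theta[OF \<theta>, of "\<lambda>\<theta> \<omega>. indicator A \<omega> * ennreal (\<xi> \<theta> * M_tilde (K \<theta>) (\<rho> \<theta>) \<gamma> (r \<theta>) t \<omega>)", symmetric])
        finally show ?case .
      qed
    qed
    also have "\<dots> = (\<integral>\<^sup>+\<omega>. indicator A \<omega> * ennreal (M_beta K \<rho> \<gamma> \<xi> r t \<omega>) \<partial>P.Q)"
      by (rule P.nn_integral_Q[symmetric]) measurable
    finally show ?thesis .
  qed
  have "AE \<theta> in \<mu>. AE \<omega> in P.PL \<theta>. 0 \<le> M_beta K \<rho> \<gamma> \<xi> r t \<omega>"
    using rn \<xi>nn AE_space
  proof eventually_elim
    case (elim \<theta>)
    then have \<theta>: "\<theta> \<in> D" by (simp add: P.space_\<nu>)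
    from P.AE_M_tilde(1)[OF \<theta> elim(1) \<rho>p[OF \<theta>] t, of \<gamma>] P.AE_PL_Theta[OF \<theta>] show ?case
      by eventually_elim (simp add: M_beta_def elim(2))
  qed
  then show "AE \<omega> in P.Q. 0 \<le> M_beta K \<rho> \<gamma> \<xi> r t \<omega>"
    by (subst P.AE_Q) measurable
  assume "AE \<theta> in \<mu>. 0 < \<xi> \<theta>" "AE \<theta> in \<mu>. absolutely_continuous (Exp (\<rho> \<theta>)) (K \<theta>)"
  then have "AE \<theta> in \<mu>. AE \<omega> in P.PL \<theta>. 0 < M_beta K \<rho> \<gamma> \<xi> r t \<omega>"
    using rn AE_space
  proof eventually_elim
    case (elim \<theta>)
    then have \<theta>: "\<theta> \<in> D" by (simp add: P.space_\<nu>)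
    from P.AE_M_tilde(2)[OF \<theta> elim(3) \<rho>p[OF \<theta>] t elim(2), of \<gamma>] P.AE_PL_Theta[OF \<theta>] show ?case
      by eventually_elim (simp add: M_beta_def elim(1))
  qed
  then show "AE \<omega> in P.Q. 0 < M_beta K \<rho> \<gamma> \<xi> r t \<omega>"
    by (subst P.AE_Q) measurable
qed

section \<open>Martingales under exponential interarrival times\<close>

lemma S_increment:
  assumes \<omega>: "\<omega> \<in> space (path_space D)" and st: "0 \<le> s" "s \<le> t" and ne: "\<not> explodes t \<omega>"
  shows "ennreal (S t \<omega>) = ennreal (S s \<omega>) +
    (\<Sum>n. ennreal (X n \<omega>) * (if s < T (Suc n) \<omega> \<and> T (Suc n) \<omega> \<le> t then 1 else 0))"
proof -
  note pos = path_space_pos[OF \<omega>]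
  have nes: "\<not> explodes s \<omega>" using explodes_mono[of s \<omega> t] st ne by blast
  have t0: "0 \<le> t" using st by simp
  have iff: "s < T (Suc n) \<omega> \<and> T (Suc n) \<omega> \<le> t \<longleftrightarrow> n \<in> {N s \<omega>..<N t \<omega>}" for n
  proof -
    have "s < T (Suc n) \<omega> \<longleftrightarrow> N s \<omega> \<le> n"
      using N_ge_iff[OF pos(1) st(1) nes, of "Suc n"] by (meson not_less not_less_eq_eq)
    moreover have "T (Suc n) \<omega> \<le> t \<longleftrightarrow> n < N t \<omega>"
      using N_ge_iff[OF pos(1) t0 ne, of "Suc n"] by (simp add: Suc_le_eq)
    ultimately show ?thesis by simp
  qed
  have le: "N s \<omega> \<le> N t \<omega>" by (rule N_mono[OF pos(1) st ne])
  have "(\<Sum>n. ennreal (X n \<omega>) * (if s < T (Suc n) \<omega> \<and> T (Suc n) \<omega> \<le> t then 1 else 0)) =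
      (\<Sum>n\<in>{N s \<omega>..<N t \<omega>}. ennreal (X n \<omega>) * (if s < T (Suc n) \<omega> \<and> T (Suc n) \<omega> \<le> t then 1 else 0))"
    by (rule suminf_finite) (simp_all only: iff if_False mult_zero_right finite_atLeastLessThan)
  also have "\<dots> = (\<Sum>n\<in>{N s \<omega>..<N t \<omega>}. ennreal (X n \<omega>))"
    by (intro sum.cong refl) (simp only: iff if_True mult_1_right)
  also have "\<dots> = ennreal (\<Sum>n\<in>{N s \<omega>..<N t \<omega>}. X n \<omega>)"
    using pos(2) by (intro sum_ennreal) (simp add: less_imp_le)
  finally have e: "(\<Sum>n. ennreal (X n \<omega>) * (if s < T (Suc n) \<omega> \<and> T (Suc n) \<omega> \<le> t then 1 else 0)) =
    ennreal (\<Sum>n\<in>{N s \<omega>..<N t \<omega>}. X n \<omega>)" .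
  have nn: "0 \<le> (\<Sum>n\<in>I. X n \<omega>)" for I using pos(2) by (intro sum_nonneg) (simp add: less_imp_le)
  have "S t \<omega> = S s \<omega> + (\<Sum>n\<in>{N s \<omega>..<N t \<omega>}. X n \<omega>)"
    unfolding S_def lessThan_atLeast0 using sum.atLeastLessThan_concat[of 0 "N s \<omega>" "N t \<omega>" "\<lambda>n. X n \<omega>"] le by simp
  then show ?thesis unfolding e using nn[of "{..<N s \<omega>}"] nn by (simp add: S_def)
qed

text \<open>Telescoping of the squares of partial sums. Each increment contains the mixed term, in which the claims
  before the jump multiply the new one, and the square of the new claim; both have the form covered by
  the compensator.\<close>

lemma S_square:
  assumes \<omega>: "\<omega> \<in> space (path_space D)" and t: "0 \<le> t" and ne: "\<not> explodes t \<omega>"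
  shows "ennreal ((S t \<omega>)\<^sup>2) =
    (\<Sum>n. ennreal (2 * (\<Sum>k<n. X k \<omega>)) * ennreal (X n \<omega>) * (if 0 < T (Suc n) \<omega> \<and> T (Suc n) \<omega> \<le> t then 1 else 0) +
      1 * ennreal ((X n \<omega>)\<^sup>2) * (if 0 < T (Suc n) \<omega> \<and> T (Suc n) \<omega> \<le> t then 1 else 0))"
proof -
  note pos = path_space_pos[OF \<omega>]
  let ?Y = "\<lambda>n. \<Sum>k<n. X k \<omega>"
  let ?c = "\<lambda>n. ennreal (2 * ?Y n) * ennreal (X n \<omega>) * (if 0 < T (Suc n) \<omega> \<and> T (Suc n) \<omega> \<le> t then 1 else 0) +
      1 * ennreal ((X n \<omega>)\<^sup>2) * (if 0 < T (Suc n) \<omega> \<and> T (Suc n) \<omega> \<le> t then 1 else 0)"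
  have Y: "0 \<le> ?Y n" for n using pos(2) by (intro sum_nonneg) (simp add: less_imp_le)
  have iff: "0 < T (Suc n) \<omega> \<and> T (Suc n) \<omega> \<le> t \<longleftrightarrow> n < N t \<omega>" for n
    using N_ge_iff[OF pos(1) t ne, of "Suc n"] T_less_iff[OF pos(1), of 0 "Suc n"] by (simp add: Suc_le_eq)
  have "(\<Sum>n. ?c n) = (\<Sum>n<N t \<omega>. ?c n)"
    by (rule suminf_finite) (simp_all only: iff lessThan_iff if_False mult_zero_right finite_lessThan add_0_right)
  also have "\<dots> = (\<Sum>n<N t \<omega>. ennreal ((?Y (Suc n))\<^sup>2 - (?Y n)\<^sup>2))"
  proof (intro sum.cong refl)
    fix n assume "n \<in> {..<N t \<omega>}"
    then have n: "n < N t \<omega>" by simp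
    have x: "0 \<le> X n \<omega>" using pos(2)[of n] by simp
    have "?c n = ennreal (2 * ?Y n * X n \<omega>) + ennreal ((X n \<omega>)\<^sup>2)"
      using n Y x by (simp only: iff if_True mult_1_right mult_1_left ennreal_mult'[symmetric] mult_nonneg_nonneg zero_le_numeral)
    also have "\<dots> = ennreal (2 * ?Y n * X n \<omega> + (X n \<omega>)\<^sup>2)"
      using Y x by (intro ennreal_plus[symmetric] mult_nonneg_nonneg) simp_all
    also have "2 * ?Y n * X n \<omega> + (X n \<omega>)\<^sup>2 = (?Y (Suc n))\<^sup>2 - (?Y n)\<^sup>2"
      by (simp add: power2_eq_square algebra_simps)
    finally show "?c n = ennreal ((?Y (Suc n))\<^sup>2 - (?Y n)\<^sup>2)" .
  qed
  also have "\<dots> = ennreal (\<Sum>n<N t \<omega>. (?Y (Suc n))\<^sup>2 - (?Y n)\<^sup>2)"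
  proof (rule sum_ennreal)
    fix n show "0 \<le> (?Y (Suc n))\<^sup>2 - (?Y n)\<^sup>2"
      using Y[of n] pos(2)[of n] by (simp add: power_mono)
  qed
  also have "(\<Sum>n<N t \<omega>. (?Y (Suc n))\<^sup>2 - (?Y n)\<^sup>2) = (S t \<omega>)\<^sup>2"
    by (subst sum_lessThan_telescope) (simp add: S_def)
  finally show ?thesis ..
qed

context renewal_kernel
begin

context
  fixes \<theta> b assumes \<theta>: "\<theta> \<in> D" and b: "0 < b" and Kb: "K \<theta> = Exp b"
begin

lemmas [measurable_cong] = sets_PL[OF \<theta>] sets_R

text \<open>The compensator applied to the increments of \<open>S\<close> after time \<open>s\<close>. An event of the past becomes a function
  of the first \<open>n\<close> claims by truncation at time \<open>s\<close>, which is legitimate whenever the next claim arrives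
  after \<open>s\<close>.\<close>

lemma nn_integral_S:
  assumes st: "0 \<le> s" "s \<le> t" and A: "A \<in> sets (Filt D s)"
  shows "(\<integral>\<^sup>+\<omega>. indicator A \<omega> * ennreal (S t \<omega>) \<partial>PL \<theta>) =
    (\<integral>\<^sup>+\<omega>. indicator A \<omega> * ennreal (S s \<omega>) \<partial>PL \<theta>) +
    (\<integral>\<^sup>+x. ennreal x \<partial>R) * (ennreal (t - s) * (ennreal b * emeasure (PL \<theta>) A))"
proof -
  have t: "0 \<le> t" using st by simp
  have Ap[measurable]: "A \<in> sets (path_space D)" using subsetD[OF Filt_subset_path A] .
  note [measurable] = borel_measurable_S[OF t, of D] borel_measurable_S[OF st(1), of D] measurable_truncate[OF st(1), where D=D]
  let ?i = "\<lambda>n \<omega>. (if s < T (Suc n) \<omega> \<and> T (Suc n) \<omega> \<le> t then 1 else 0) :: ennreal"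
  \<comment> \<open>The event \<open>A\<close> of the past, as seen from the first \<open>n\<close> claims.\<close>
  let ?H = "\<lambda>n \<omega>. indicator A (truncate n s \<omega>) :: ennreal"
  have H: "?H n \<in> borel_measurable (path_space D)" for n by measurable
  have dep: "depends_on_first n (?H n)" for n
    using depends_on_first_truncate[of n s] unfolding depends_on_first_def by metis
  have "(\<integral>\<^sup>+\<omega>. indicator A \<omega> * ennreal (S t \<omega>) \<partial>PL \<theta>) =
      (\<integral>\<^sup>+\<omega>. indicator A \<omega> * ennreal (S s \<omega>) + (\<Sum>n. ?H n \<omega> * ennreal (X n \<omega>) * ?i n \<omega>) \<partial>PL \<theta>)"
  proof (rule nn_integral_cong_AE)
    show "AE \<omega> in PL \<theta>. indicator A \<omega> * ennreal (S t \<omega>) =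
        indicator A \<omega> * ennreal (S s \<omega>) + (\<Sum>n. ?H n \<omega> * ennreal (X n \<omega>) * ?i n \<omega>)"
      using AE_not_explodes[OF \<theta>] AE_space
    proof eventually_elim
      case (elim \<omega>)
      then have \<omega>: "\<omega> \<in> space (path_space D)" and ne: "\<not> explodes t \<omega>" by (simp_all add: space_PL[OF \<theta>])
      have "?H n \<omega> * ennreal (X n \<omega>) * ?i n \<omega> = indicator A \<omega> * (ennreal (X n \<omega>) * ?i n \<omega>)" for n
        using truncate_Filt[OF A \<omega> st(1), of n] by (simp add: indicator_def)
      then show ?case unfolding S_increment[OF \<omega> st ne] by (simp add: distrib_left)
    qed
  qed
  also have "\<dots> = (\<integral>\<^sup>+\<omega>. indicator A \<omega> * ennreal (S s \<omega>) \<partial>PL \<theta>) +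
      (\<Sum>n. \<integral>\<^sup>+\<omega>. ?H n \<omega> * ennreal (X n \<omega>) * ?i n \<omega> \<partial>PL \<theta>)"
    by (subst nn_integral_add, measurable, subst nn_integral_suminf, measurable)
  also have "(\<Sum>n. \<integral>\<^sup>+\<omega>. ?H n \<omega> * ennreal (X n \<omega>) * ?i n \<omega> \<partial>PL \<theta>) =
      (\<integral>\<^sup>+x. ennreal x \<partial>R) * (\<integral>\<^sup>+u. indicator {s<..t} u * (ennreal b * (\<integral>\<^sup>+\<omega>. indicator A \<omega> \<partial>PL \<theta>)) \<partial>lborel)"
  proof (rule compensator_suminf[OF \<theta> b Kb H dep _ st(1)])
    show "(\<lambda>x. ennreal x) \<in> borel_measurable pos_borel" by measurable
    show "indicator A \<in> borel_measurable (path_space D)" by measurable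
    fix n u \<omega> assume u: "s < u" "u \<le> t" and \<omega>: "\<omega> \<in> space (path_space D)"
    show "?H n \<omega> * stage n u \<omega> = indicator A \<omega> * stage n u \<omega>"
      using truncate_Filt[OF A \<omega> st(1), of n] u by (simp add: stage_def indicator_def)
  qed
  also have "(\<integral>\<^sup>+u. indicator {s<..t} u * (ennreal b * (\<integral>\<^sup>+\<omega>. indicator A \<omega> \<partial>PL \<theta>)) \<partial>lborel) =
      ennreal (t - s) * (ennreal b * emeasure (PL \<theta>) A)"
    using st(2) by (simp add: nn_integral_multc sets_PL[OF \<theta>])
  finally show ?thesis .
qed

lemma nn_integral_S_total:
  assumes "0 \<le> t"
  shows "(\<integral>\<^sup>+\<omega>. ennreal (S t \<omega>) \<partial>PL \<theta>) = (\<integral>\<^sup>+x. ennreal x \<partial>R) * (ennreal t * ennreal b)"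
proof -
  have S0: "S 0 \<omega> = 0" if "\<omega> \<in> space (path_space D)" for \<omega>
  proof -
    have "0 < T (Suc 0) \<omega>" using T_less_iff[OF path_space_pos(1)[OF that], of 0 "Suc 0"] by simp
    then have "N 0 \<omega> = 0" by (intro N_eq[OF path_space_pos(1)[OF that]]) simp_all
    then show ?thesis by (simp add: S_def)
  qed
  have sp: "space (path_space D) \<in> sets (Filt D 0)" using sets.top[of "Filt D 0"] by simp
  have "(\<integral>\<^sup>+\<omega>. ennreal (S t \<omega>) \<partial>PL \<theta>) = (\<integral>\<^sup>+\<omega>. indicator (space (path_space D)) \<omega> * ennreal (S t \<omega>) \<partial>PL \<theta>)"
    by (intro nn_integral_cong) (simp add: space_PL[OF \<theta>])
  also have "\<dots> = (\<integral>\<^sup>+\<omega>. indicator (space (path_space D)) \<omega> * ennreal (S 0 \<omega>) \<partial>PL \<theta>) +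
    (\<integral>\<^sup>+x. ennreal x \<partial>R) * (ennreal (t - 0) * (ennreal b * emeasure (PL \<theta>) (space (path_space D))))"
    by (rule nn_integral_S[OF order_refl assms sp])
  also have "(\<integral>\<^sup>+\<omega>. indicator (space (path_space D)) \<omega> * ennreal (S 0 \<omega>) \<partial>PL \<theta>) = (\<integral>\<^sup>+\<omega>. 0 \<partial>PL \<theta>)"
    by (intro nn_integral_cong) (simp add: space_PL[OF \<theta>] S0)
  also have "emeasure (PL \<theta>) (space (path_space D)) = 1"
    using prob_space.emeasure_space_1[OF prob_PL[OF \<theta>]] by (simp add: space_PL[OF \<theta>])
  finally show ?thesis by simp
qed

text \<open>The mixed terms have intensity \<open>2 * S u * b\<close> times the mean claim, where the expectation of \<open>S u\<close> is
  at most that of \<open>S t\<close>; the squares have intensity \<open>b\<close> times the second moment of a claim.\<close>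

lemma nn_integral_S_square:
  assumes t: "0 \<le> t"
  shows "(\<integral>\<^sup>+\<omega>. ennreal ((S t \<omega>)\<^sup>2) \<partial>PL \<theta>) \<le>
    2 * ((\<integral>\<^sup>+x. ennreal x \<partial>R) * (ennreal t * ennreal b))\<^sup>2 + (\<integral>\<^sup>+x. ennreal (x\<^sup>2) \<partial>R) * (ennreal t * ennreal b)"
proof -
  interpret p: prob_space "PL \<theta>" by (rule prob_PL[OF \<theta>])
  define \<kappa> where "\<kappa> = (\<integral>\<^sup>+x. ennreal x \<partial>R)"
  let ?i = "\<lambda>n \<omega>. (if 0 < T (Suc n) \<omega> \<and> T (Suc n) \<omega> \<le> t then 1 else 0) :: ennreal"
  let ?H = "\<lambda>n \<omega>. ennreal (2 * (\<Sum>k<n. X k \<omega>))"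
  have H[measurable]: "?H n \<in> borel_measurable (path_space D)" for n by measurable
  have dep: "depends_on_first n (?H n)" for n
    unfolding depends_on_first_def by (intro allI impI arg_cong[where f="\<lambda>x. ennreal (2 * x)"] sum.cong) simp_all
  have dep1: "depends_on_first n (\<lambda>_. 1 :: ennreal)" for n by (simp add: depends_on_first_def)
  have "(\<integral>\<^sup>+\<omega>. ennreal ((S t \<omega>)\<^sup>2) \<partial>PL \<theta>) =
      (\<integral>\<^sup>+\<omega>. (\<Sum>n. ?H n \<omega> * ennreal (X n \<omega>) * ?i n \<omega> + 1 * ennreal ((X n \<omega>)\<^sup>2) * ?i n \<omega>) \<partial>PL \<theta>)"
  proof (rule nn_integral_cong_AE)
    show "AE \<omega> in PL \<theta>. ennreal ((S t \<omega>)\<^sup>2) =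
        (\<Sum>n. ?H n \<omega> * ennreal (X n \<omega>) * ?i n \<omega> + 1 * ennreal ((X n \<omega>)\<^sup>2) * ?i n \<omega>)"
      using AE_not_explodes[OF \<theta>] AE_space
      by eventually_elim (rule S_square[OF _ t], simp_all add: space_PL[OF \<theta>])
  qed
  also have "\<dots> = (\<Sum>n. (\<integral>\<^sup>+\<omega>. ?H n \<omega> * ennreal (X n \<omega>) * ?i n \<omega> \<partial>PL \<theta>) +
      (\<integral>\<^sup>+\<omega>. 1 * ennreal ((X n \<omega>)\<^sup>2) * ?i n \<omega> \<partial>PL \<theta>))"
    by (subst nn_integral_suminf, measurable, intro suminf_cong nn_integral_add) measurable
  also have "\<dots> = (\<Sum>n. \<integral>\<^sup>+\<omega>. ?H n \<omega> * ennreal (X n \<omega>) * ?i n \<omega> \<partial>PL \<theta>) +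
      (\<Sum>n. \<integral>\<^sup>+\<omega>. 1 * ennreal ((X n \<omega>)\<^sup>2) * ?i n \<omega> \<partial>PL \<theta>)"
    by (rule suminf_add[symmetric]) simp_all
  also have "(\<Sum>n. \<integral>\<^sup>+\<omega>. 1 * ennreal ((X n \<omega>)\<^sup>2) * ?i n \<omega> \<partial>PL \<theta>) =
      (\<integral>\<^sup>+x. ennreal (x\<^sup>2) \<partial>R) * (\<integral>\<^sup>+u. indicator {0<..t} u * (ennreal b * (\<integral>\<^sup>+\<omega>. 1 \<partial>PL \<theta>)) \<partial>lborel)"
    by (rule compensator_suminf[OF \<theta> b Kb _ dep1 _ order_refl, where Z="\<lambda>_ _. 1"]) measurable
  also have "(\<integral>\<^sup>+u. indicator {0<..t} u * (ennreal b * (\<integral>\<^sup>+\<omega>. 1 \<partial>PL \<theta>)) \<partial>lborel) = ennreal t * ennreal b"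
    using t by (simp add: nn_integral_multc p.emeasure_space_1)
  also have "(\<Sum>n. \<integral>\<^sup>+\<omega>. ?H n \<omega> * ennreal (X n \<omega>) * ?i n \<omega> \<partial>PL \<theta>) =
      \<kappa> * (\<integral>\<^sup>+u. indicator {0<..t} u * (ennreal b * (\<integral>\<^sup>+\<omega>. ennreal (2 * S u \<omega>) \<partial>PL \<theta>)) \<partial>lborel)"
    unfolding \<kappa>_def
  proof (rule compensator_suminf[OF \<theta> b Kb H dep _ order_refl])
    show "(\<lambda>x. ennreal x) \<in> borel_measurable pos_borel" by measurable
    show "(\<lambda>\<omega>. ennreal (2 * S u \<omega>)) \<in> borel_measurable (path_space D)" if "0 < u" for u
    proof -
      have [measurable]: "S u \<in> borel_measurable (path_space D)" using that by (intro borel_measurable_S) simp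
      show ?thesis by measurable
    qed
    fix n u \<omega> assume u: "0 < u" "u \<le> t" and \<omega>: "\<omega> \<in> space (path_space D)"
    show "?H n \<omega> * stage n u \<omega> = ennreal (2 * S u \<omega>) * stage n u \<omega>"
    proof (cases "T n \<omega> \<le> u \<and> u < T (Suc n) \<omega>")
      case True
      then have "N u \<omega> = n" by (intro N_eq[OF path_space_pos(1)[OF \<omega>]]) simp_all
      then show ?thesis by (simp add: S_def)
    next
      case False
      then show ?thesis unfolding stage_def by (simp only: if_False mult_zero_right)
    qed
  qed
  also have "(\<integral>\<^sup>+u. indicator {0<..t} u * (ennreal b * (\<integral>\<^sup>+\<omega>. ennreal (2 * S u \<omega>) \<partial>PL \<theta>)) \<partial>lborel) \<le>
      (\<integral>\<^sup>+u. indicator {0<..t} u * (ennreal b * (2 * (\<kappa> * (ennreal t * ennreal b)))) \<partial>lborel)"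
  proof (intro nn_integral_mono)
    fix u :: real
    show "indicator {0<..t} u * (ennreal b * (\<integral>\<^sup>+\<omega>. ennreal (2 * S u \<omega>) \<partial>PL \<theta>)) \<le>
        indicator {0<..t} u * (ennreal b * (2 * (\<kappa> * (ennreal t * ennreal b))))"
    proof (cases "u \<in> {0<..t}")
      case True
      then have u: "0 \<le> u" "u \<le> t" by auto
      have [measurable]: "S u \<in> borel_measurable (path_space D)" by (rule borel_measurable_S[OF u(1)])
      have "(\<integral>\<^sup>+\<omega>. ennreal (2 * S u \<omega>) \<partial>PL \<theta>) = (\<integral>\<^sup>+\<omega>. 2 * ennreal (S u \<omega>) \<partial>PL \<theta>)"
        by (intro nn_integral_cong) (simp add: ennreal_mult')
      also have "\<dots> = 2 * (\<integral>\<^sup>+\<omega>. ennreal (S u \<omega>) \<partial>PL \<theta>)" by (rule nn_integral_cmult) measurable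
      also have "\<dots> = 2 * (\<kappa> * (ennreal u * ennreal b))" by (simp only: nn_integral_S_total[OF u(1)] \<kappa>_def)
      also have "\<dots> \<le> 2 * (\<kappa> * (ennreal t * ennreal b))" using u by (intro mult_left_mono mult_right_mono ennreal_leI) simp_all
      finally show ?thesis by (intro mult_left_mono) simp_all
    qed simp
  qed
  also have "\<dots> = ennreal t * (ennreal b * (2 * (\<kappa> * (ennreal t * ennreal b))))"
    using t by (simp add: nn_integral_multc)
  finally have "(\<integral>\<^sup>+\<omega>. ennreal ((S t \<omega>)\<^sup>2) \<partial>PL \<theta>) \<le>
      \<kappa> * (ennreal t * (ennreal b * (2 * (\<kappa> * (ennreal t * ennreal b))))) + (\<integral>\<^sup>+x. ennreal (x\<^sup>2) \<partial>R) * (ennreal t * ennreal b)"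
    by (simp add: add_right_mono mult_left_mono)
  also have "\<kappa> * (ennreal t * (ennreal b * (2 * (\<kappa> * (ennreal t * ennreal b))))) = 2 * (\<kappa> * (ennreal t * ennreal b))\<^sup>2"
    by (simp only: power2_eq_square mult_ac)
  finally show ?thesis unfolding \<kappa>_def .
qed

end

end

lemma integrable_iff_nn_integral_finite:
  assumes f[measurable]: "f \<in> borel_measurable M" and nn: "AE x in M. 0 \<le> f x"
  shows "integrable M f \<longleftrightarrow> (\<integral>\<^sup>+x. ennreal (f x) \<partial>M) < \<infinity>"
proof -
  have "(\<integral>\<^sup>+x. ennreal (norm (f x)) \<partial>M) = (\<integral>\<^sup>+x. ennreal (f x) \<partial>M)"
    using nn by (intro nn_integral_cong_AE) (auto elim!: eventually_mono)
  then show ?thesis by (simp add: integrable_iff_bounded)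
qed

lemma nn_integral_finite_of_power:
  fixes f :: "'a \<Rightarrow> real"
  assumes M: "prob_space M" and f[measurable]: "f \<in> borel_measurable M" and l: "l \<in> {1, 2::nat}"
    and fin: "(\<integral>\<^sup>+x. ennreal (f x ^ l) \<partial>M) < \<infinity>"
  shows "(\<integral>\<^sup>+x. ennreal (f x) \<partial>M) < \<infinity>"
proof -
  interpret prob_space M by (rule M)
  have "ennreal (f x) \<le> 1 + ennreal (f x ^ l)" for x
  proof (cases "0 \<le> f x")
    case True
    have "f x \<le> 1 + f x ^ l"
      using l
    proof
      assume "l \<in> {2}"
      moreover have "0 \<le> (f x - 1)\<^sup>2" by simp
      ultimately show ?thesis using True by (simp add: power2_eq_square algebra_simps)
    qed simp
    then have "ennreal (f x) \<le> ennreal (1 + f x ^ l)" by (rule ennreal_leI)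
    also have "\<dots> = 1 + ennreal (f x ^ l)" using True by (simp add: ennreal_plus)
    finally show ?thesis .
  qed (simp add: ennreal_neg)
  then have "(\<integral>\<^sup>+x. ennreal (f x) \<partial>M) \<le> (\<integral>\<^sup>+x. 1 + ennreal (f x ^ l) \<partial>M)"
    by (intro nn_integral_mono)
  also have "\<dots> = 1 + (\<integral>\<^sup>+x. ennreal (f x ^ l) \<partial>M)"
    by (subst nn_integral_add) (simp_all add: emeasure_space_1)
  also have "\<dots> < \<infinity>" using fin by simp
  finally show ?thesis .
qed

lemma S_nonneg: "\<omega> \<in> space (path_space D) \<Longrightarrow> 0 \<le> S t \<omega>"
  unfolding S_def by (intro sum_nonneg) (simp add: path_space_pos(2) less_imp_le)

text \<open>Integrating the formula for the increments over the parameter gives the martingale identity on every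
  event of the past. It is first established for nonnegative integrals; the two moment conditions make all
  terms finite, which permits the subtraction of the drift.\<close>

lemma (in mixed_renewal) martingale_mixed:
  assumes \<rho>: "\<rho> \<in> M_plus D" and K\<rho>: "\<And>\<theta>. \<theta> \<in> D \<Longrightarrow> K \<theta> = Exp (\<rho> \<theta>)" and l: "l \<in> {1, 2}"
    and Rl: "(\<integral>\<^sup>+x. ennreal (x ^ l) \<partial>R) < \<infinity>" and \<rho>l: "(\<integral>\<^sup>+\<theta>. ennreal (\<rho> \<theta> ^ l) \<partial>\<nu>) < \<infinity>"
    and c: "c \<in> borel_measurable (sigma_Theta D)"
    and ce: "AE \<omega> in Q. c \<omega> = enn2real (\<integral>\<^sup>+x. ennreal x \<partial>R) * \<rho> (Theta \<omega>)"
  shows "martingale_measure l D Q (\<lambda>t \<omega>. S t \<omega> - t * c \<omega>)"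
proof -
  interpret q: prob_space Q by (rule prob_Q)
  note [measurable_cong] = sets_Q
  have \<rho>m[measurable]: "\<rho> \<in> borel_measurable (param_borel D)" and \<rho>p: "\<And>\<theta>. \<theta> \<in> D \<Longrightarrow> 0 < \<rho> \<theta>"
    using \<rho> by (auto simp: M_plus_def)
  have cF: "c \<in> borel_measurable (Filt D t)" for t by (rule measurable_sigma_Theta_Filt[OF c])
  have [measurable]: "c \<in> borel_measurable (path_space D)" by (rule measurable_Filt_path[OF cF[of 0]])
  have \<rho>T[measurable]: "(\<lambda>\<omega>. \<rho> (Theta \<omega>)) \<in> borel_measurable (path_space D)" by measurable
  have mR: "(\<lambda>x. x) \<in> borel_measurable R"
    using measurable_cong_sets[OF sets_R refl] measurable_ident_pos_borel by blast
  define \<kappa> where "\<kappa> = (\<integral>\<^sup>+x. ennreal x \<partial>R)"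
  define k where "k = enn2real \<kappa>"
  have "\<kappa> < \<infinity>" unfolding \<kappa>_def by (rule nn_integral_finite_of_power[OF prob_R mR l Rl])
  then have \<kappa>: "\<kappa> = ennreal k" by (simp add: k_def less_top)
  have k0: "0 \<le> k" by (simp add: k_def)
  have ce: "AE \<omega> in Q. c \<omega> = k * \<rho> (Theta \<omega>)" using ce by (simp add: k_def \<kappa>_def)
  have \<rho>1: "(\<integral>\<^sup>+\<theta>. ennreal (\<rho> \<theta>) \<partial>\<nu>) < \<infinity>"
    by (rule nn_integral_finite_of_power[OF prob_\<nu> _ l \<rho>l]) (simp add: measurable_\<nu>)
  have Tpos: "0 < \<rho> (Theta \<omega>)" if "\<omega> \<in> space (path_space D)" for \<omega>
    by (rule \<rho>p[OF path_space_pos(3)[OF that]])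
  have int\<rho>: "integrable Q (\<lambda>\<omega>. \<rho> (Theta \<omega>))"
  proof (subst integrable_iff_nn_integral_finite)
    show "(\<integral>\<^sup>+\<omega>. ennreal (\<rho> (Theta \<omega>)) \<partial>Q) < \<infinity>"
      using \<rho>1 nn_integral_Q_Theta[of "\<lambda>\<theta>. ennreal (\<rho> \<theta>)"] by simp
    show "AE \<omega> in Q. 0 \<le> \<rho> (Theta \<omega>)" by (rule AE_I2) (simp add: space_Q Tpos less_imp_le)
  qed measurable
  have intc: "integrable Q c"
  proof (rule integrable_cong_AE_imp)
    show "integrable Q (\<lambda>\<omega>. k * \<rho> (Theta \<omega>))" using int\<rho> by (rule integrable_mult_right)
    show "AE \<omega> in Q. k * \<rho> (Theta \<omega>) = c \<omega>" using ce by eventually_elim simp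
  qed measurable
  have M1: "(\<integral>\<^sup>+\<omega>. indicator A \<omega> * ennreal (S t \<omega>) \<partial>Q) =
      (\<integral>\<^sup>+\<omega>. indicator A \<omega> * ennreal (S s \<omega>) \<partial>Q) + (\<integral>\<^sup>+\<omega>. indicator A \<omega> * ennreal ((t - s) * (k * \<rho> (Theta \<omega>))) \<partial>Q)"
    if st: "0 \<le> s" "s \<le> t" and A: "A \<in> sets (Filt D s)" for s t A
  proof -
    have t: "0 \<le> t" using st by simp
    have [measurable]: "A \<in> sets (path_space D)" using subsetD[OF Filt_subset_path A] .
    note [measurable] = borel_measurable_S[OF t, of D] borel_measurable_S[OF st(1), of D]
    have [measurable]: "(\<lambda>\<omega>. indicator A \<omega> * ennreal (S s \<omega>)) \<in> borel_measurable (path_space D)"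
      "(\<lambda>\<omega>. indicator A \<omega> * ennreal (S t \<omega>)) \<in> borel_measurable (path_space D)"
      "(\<lambda>\<omega>. indicator A \<omega> * ennreal ((t - s) * (k * \<rho> (Theta \<omega>)))) \<in> borel_measurable (path_space D)"
      by measurable
    have "(\<integral>\<^sup>+\<omega>. indicator A \<omega> * ennreal (S t \<omega>) \<partial>Q) =
        (\<integral>\<^sup>+\<theta>. (\<integral>\<^sup>+\<omega>. indicator A \<omega> * ennreal (S t \<omega>) \<partial>PL \<theta>) \<partial>\<nu>)"
      by (rule nn_integral_Q) measurable
    also have "\<dots> = (\<integral>\<^sup>+\<theta>. (\<integral>\<^sup>+\<omega>. indicator A \<omega> * ennreal (S s \<omega>) \<partial>PL \<theta>) +
        (\<integral>\<^sup>+\<omega>. indicator A \<omega> * ennreal ((t - s) * (k * \<rho> (Theta \<omega>))) \<partial>PL \<theta>) \<partial>\<nu>)"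
    proof (intro nn_integral_cong)
      fix \<theta> assume "\<theta> \<in> space \<nu>"
      then have \<theta>: "\<theta> \<in> D" by (simp add: space_\<nu>)
      have "(\<integral>\<^sup>+\<omega>. indicator A \<omega> * ennreal ((t - s) * (k * \<rho> (Theta \<omega>))) \<partial>PL \<theta>) =
          (\<integral>\<^sup>+\<omega>. indicator A \<omega> * ennreal ((t - s) * (k * \<rho> \<theta>)) \<partial>PL \<theta>)"
        by (rule nn_integral_PL_Theta[OF \<theta>, of "\<lambda>\<theta> \<omega>. indicator A \<omega> * ennreal ((t - s) * (k * \<rho> \<theta>))"])
      also have "\<dots> = emeasure (PL \<theta>) A * ennreal ((t - s) * (k * \<rho> \<theta>))"
        by (subst nn_integral_multc) (simp_all add: sets_PL[OF \<theta>] borel_measurable_PL[OF _ refl \<theta>])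
      also have "ennreal ((t - s) * (k * \<rho> \<theta>)) = ennreal (t - s) * (\<kappa> * ennreal (\<rho> \<theta>))"
        using st k0 by (simp add: \<kappa> ennreal_mult')
      also have "emeasure (PL \<theta>) A * (ennreal (t - s) * (\<kappa> * ennreal (\<rho> \<theta>))) =
          \<kappa> * (ennreal (t - s) * (ennreal (\<rho> \<theta>) * emeasure (PL \<theta>) A))"
        by (simp only: mult_ac)
      finally show "(\<integral>\<^sup>+\<omega>. indicator A \<omega> * ennreal (S t \<omega>) \<partial>PL \<theta>) =
          (\<integral>\<^sup>+\<omega>. indicator A \<omega> * ennreal (S s \<omega>) \<partial>PL \<theta>) +
          (\<integral>\<^sup>+\<omega>. indicator A \<omega> * ennreal ((t - s) * (k * \<rho> (Theta \<omega>))) \<partial>PL \<theta>)"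
        using nn_integral_S[OF \<theta> \<rho>p[OF \<theta>] K\<rho>[OF \<theta>] st A] by (simp add: \<kappa>_def)
    qed
    also have "\<dots> = (\<integral>\<^sup>+\<theta>. (\<integral>\<^sup>+\<omega>. indicator A \<omega> * ennreal (S s \<omega>) \<partial>PL \<theta>) \<partial>\<nu>) +
        (\<integral>\<^sup>+\<theta>. (\<integral>\<^sup>+\<omega>. indicator A \<omega> * ennreal ((t - s) * (k * \<rho> (Theta \<omega>))) \<partial>PL \<theta>) \<partial>\<nu>)"
      by (intro nn_integral_add) (simp_all add: measurable_\<nu> measurable_nn_integral_PL)
    also have "\<dots> = (\<integral>\<^sup>+\<omega>. indicator A \<omega> * ennreal (S s \<omega>) \<partial>Q) + (\<integral>\<^sup>+\<omega>. indicator A \<omega> * ennreal ((t - s) * (k * \<rho> (Theta \<omega>))) \<partial>Q)"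
      by (simp add: nn_integral_Q)
    finally show ?thesis .
  qed
  have finS: "(\<integral>\<^sup>+\<omega>. ennreal (S t \<omega>) \<partial>Q) < \<infinity>" if t: "0 \<le> t" for t
  proof -
    note [measurable] = borel_measurable_S[OF t, of D]
    have "(\<integral>\<^sup>+\<omega>. ennreal (S t \<omega>) \<partial>Q) = (\<integral>\<^sup>+\<theta>. (\<integral>\<^sup>+\<omega>. ennreal (S t \<omega>) \<partial>PL \<theta>) \<partial>\<nu>)"
      by (rule nn_integral_Q) measurable
    also have "\<dots> = (\<integral>\<^sup>+\<theta>. \<kappa> * ennreal t * ennreal (\<rho> \<theta>) \<partial>\<nu>)"
      by (intro nn_integral_cong) (simp add: space_\<nu> nn_integral_S_total[OF _ \<rho>p K\<rho> t] \<kappa>_def mult.assoc)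
    also have "\<dots> = \<kappa> * ennreal t * (\<integral>\<^sup>+\<theta>. ennreal (\<rho> \<theta>) \<partial>\<nu>)"
      by (rule nn_integral_cmult) (simp add: measurable_\<nu>)
    also have "\<dots> < \<infinity>" using \<rho>1 by (simp add: \<kappa> ennreal_mult_less_top)
    finally show ?thesis .
  qed
  have intS: "integrable Q (S t)" if t: "0 \<le> t" for t
  proof (subst integrable_iff_nn_integral_finite)
    show "S t \<in> borel_measurable Q" using borel_measurable_S[OF t] by measurable
    show "AE \<omega> in Q. 0 \<le> S t \<omega>" by (rule AE_I2) (simp add: space_Q S_nonneg)
  qed (rule finS[OF t])
  have intV: "integrable Q (\<lambda>\<omega>. S t \<omega> - t * c \<omega>)" if t: "0 \<le> t" for t
    using intS[OF t] intc by (intro Bochner_Integration.integrable_diff integrable_mult_right)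
  show ?thesis
    unfolding martingale_measure_def
  proof (intro conjI allI impI)
    fix t :: real assume t: "0 \<le> t"
    have SF: "S t \<in> borel_measurable (Filt D t)" by (rule measurable_S_Filt[OF t order_refl])
    show "(\<lambda>\<omega>. S t \<omega> - t * c \<omega>) \<in> borel_measurable (Filt D t)" using SF cF[of t] by measurable
    show "integrable Q (\<lambda>\<omega>. S t \<omega> - t * c \<omega>)" by (rule intV[OF t])
    show "integrable Q (\<lambda>\<omega>. \<bar>S t \<omega> - t * c \<omega>\<bar> ^ l)"
    proof (cases "l = 1")
      case True
      then show ?thesis using integrable_abs[OF intV[OF t]] by simp
    next
      case False
      then have l2: "l = 2" using l by simp
      note [measurable] = borel_measurable_S[OF t, of D]
      have m\<rho>2: "(\<lambda>\<omega>. (\<rho> (Theta \<omega>))\<^sup>2) \<in> borel_measurable Q" and mS2: "(\<lambda>\<omega>. (S t \<omega>)\<^sup>2) \<in> borel_measurable Q"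
        by measurable
      have "integrable Q (\<lambda>\<omega>. (\<rho> (Theta \<omega>))\<^sup>2)"
      proof (subst integrable_iff_nn_integral_finite[OF m\<rho>2])
        show "(\<integral>\<^sup>+\<omega>. ennreal ((\<rho> (Theta \<omega>))\<^sup>2) \<partial>Q) < \<infinity>"
          using \<rho>l nn_integral_Q_Theta[of "\<lambda>\<theta>. ennreal ((\<rho> \<theta>)\<^sup>2)"] by (simp add: l2)
      qed simp
      moreover have "integrable Q (\<lambda>\<omega>. (S t \<omega>)\<^sup>2)"
      proof (subst integrable_iff_nn_integral_finite[OF mS2])
        have "(\<integral>\<^sup>+\<omega>. ennreal ((S t \<omega>)\<^sup>2) \<partial>Q) = (\<integral>\<^sup>+\<theta>. (\<integral>\<^sup>+\<omega>. ennreal ((S t \<omega>)\<^sup>2) \<partial>PL \<theta>) \<partial>\<nu>)"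
          by (rule nn_integral_Q) measurable
        also have "\<dots> \<le> (\<integral>\<^sup>+\<theta>. 2 * (\<kappa> * ennreal t)\<^sup>2 * ennreal ((\<rho> \<theta>)\<^sup>2) +
            (\<integral>\<^sup>+x. ennreal (x\<^sup>2) \<partial>R) * ennreal t * ennreal (\<rho> \<theta>) \<partial>\<nu>)"
        proof (intro nn_integral_mono)
          fix \<theta> assume "\<theta> \<in> space \<nu>"
          then have \<theta>: "\<theta> \<in> D" by (simp add: space_\<nu>)
          have "(\<integral>\<^sup>+\<omega>. ennreal ((S t \<omega>)\<^sup>2) \<partial>PL \<theta>) \<le>
              2 * (\<kappa> * (ennreal t * ennreal (\<rho> \<theta>)))\<^sup>2 + (\<integral>\<^sup>+x. ennreal (x\<^sup>2) \<partial>R) * (ennreal t * ennreal (\<rho> \<theta>))"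
            using nn_integral_S_square[OF \<theta> \<rho>p[OF \<theta>] K\<rho>[OF \<theta>] t] by (simp add: \<kappa>_def)
          also have "2 * (\<kappa> * (ennreal t * ennreal (\<rho> \<theta>)))\<^sup>2 = 2 * (\<kappa> * ennreal t)\<^sup>2 * ennreal ((\<rho> \<theta>)\<^sup>2)"
            using \<rho>p[OF \<theta>] by (simp add: power_mult_distrib ennreal_power mult_ac)
          finally show "(\<integral>\<^sup>+\<omega>. ennreal ((S t \<omega>)\<^sup>2) \<partial>PL \<theta>) \<le> 2 * (\<kappa> * ennreal t)\<^sup>2 * ennreal ((\<rho> \<theta>)\<^sup>2) +
            (\<integral>\<^sup>+x. ennreal (x\<^sup>2) \<partial>R) * ennreal t * ennreal (\<rho> \<theta>)" by (simp add: mult.assoc)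
        qed
        also have "\<dots> = 2 * (\<kappa> * ennreal t)\<^sup>2 * (\<integral>\<^sup>+\<theta>. ennreal ((\<rho> \<theta>)\<^sup>2) \<partial>\<nu>) +
            (\<integral>\<^sup>+x. ennreal (x\<^sup>2) \<partial>R) * ennreal t * (\<integral>\<^sup>+\<theta>. ennreal (\<rho> \<theta>) \<partial>\<nu>)"
          by (subst nn_integral_add) (simp_all add: nn_integral_cmult measurable_\<nu>)
        also have "\<dots> < \<infinity>"
          using \<rho>1 \<rho>l Rl by (simp add: l2 \<kappa> ennreal_mult_less_top power2_eq_square)
        finally show "(\<integral>\<^sup>+\<omega>. ennreal ((S t \<omega>)\<^sup>2) \<partial>Q) < \<infinity>" .
      qed simp
      ultimately have "integrable Q (\<lambda>\<omega>. 2 * (S t \<omega>)\<^sup>2 + 2 * (t * k)\<^sup>2 * (\<rho> (Theta \<omega>))\<^sup>2)"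
        by (intro Bochner_Integration.integrable_add integrable_mult_right)
      then show ?thesis
      proof (rule Bochner_Integration.integrable_bound)
        show "(\<lambda>\<omega>. \<bar>S t \<omega> - t * c \<omega>\<bar> ^ l) \<in> borel_measurable Q" by measurable
        show "AE \<omega> in Q. norm (\<bar>S t \<omega> - t * c \<omega>\<bar> ^ l) \<le> norm (2 * (S t \<omega>)\<^sup>2 + 2 * (t * k)\<^sup>2 * (\<rho> (Theta \<omega>))\<^sup>2)"
          using ce
        proof eventually_elim
          case (elim \<omega>)
          let ?x = "S t \<omega>" and ?y = "t * c \<omega>"
          have "0 \<le> (?x + ?y)\<^sup>2" by simp
          then have "(?x - ?y)\<^sup>2 \<le> 2 * ?x\<^sup>2 + 2 * ?y\<^sup>2" by (simp add: power2_eq_square algebra_simps)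
          also have "2 * ?y\<^sup>2 = 2 * (t * k)\<^sup>2 * (\<rho> (Theta \<omega>))\<^sup>2"
            unfolding elim by (simp add: power_mult_distrib)
          finally show ?case by (simp add: l2)
        qed
      qed
    qed
  next
    fix s t :: real assume "0 \<le> s \<and> s \<le> t"
    then have st: "0 \<le> s" "s \<le> t" and t: "0 \<le> t" by simp_all
    interpret F: finite_measure_subalgebra Q "Filt D s"
      by (intro finite_measure_subalgebraI prob_Q subalgebra_Filt sets_Q)
    note [measurable] = borel_measurable_S[OF t, of D] borel_measurable_S[OF st(1), of D]
    show "AE \<omega> in Q. real_cond_exp Q (Filt D s) (\<lambda>\<omega>. S t \<omega> - t * c \<omega>) \<omega> = S s \<omega> - s * c \<omega>"
    proof (rule F.real_cond_exp_charact[OF _ intV[OF t] intV[OF st(1)]])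
      have "S s \<in> borel_measurable (Filt D s)" by (rule measurable_S_Filt[OF st(1) order_refl])
      with cF[of s] show "(\<lambda>\<omega>. S s \<omega> - s * c \<omega>) \<in> borel_measurable (Filt D s)" by measurable
      fix A assume A: "A \<in> sets (Filt D s)"
      have [measurable]: "A \<in> sets (path_space D)" using subsetD[OF Filt_subset_path A] .
      let ?I = "\<lambda>f. \<integral>\<omega>. indicator A \<omega> * f \<omega> \<partial>Q"
      have intI: "integrable Q (\<lambda>\<omega>. indicator A \<omega> * f \<omega>)" if "integrable Q f" for f :: "'d path \<Rightarrow> real"
        using integrable_mult_indicator[of A Q f] that by (simp add: sets_Q)
      have nnI: "(\<integral>\<^sup>+\<omega>. indicator A \<omega> * ennreal (f \<omega>) \<partial>Q) = ennreal (?I f)"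
        if "integrable Q f" "\<And>\<omega>. \<omega> \<in> space (path_space D) \<Longrightarrow> 0 \<le> f \<omega>" for f :: "'d path \<Rightarrow> real"
      proof -
        have "(\<integral>\<^sup>+\<omega>. indicator A \<omega> * ennreal (f \<omega>) \<partial>Q) = (\<integral>\<^sup>+\<omega>. ennreal (indicator A \<omega> * f \<omega>) \<partial>Q)"
          by (intro nn_integral_cong) (simp add: indicator_def)
        also have "\<dots> = ennreal (?I f)"
          by (rule nn_integral_eq_integral[OF intI[OF that(1)]], rule AE_I2) (simp add: space_Q that(2))
        finally show ?thesis .
      qed
      have I0: "0 \<le> ?I f" if "\<And>\<omega>. \<omega> \<in> space (path_space D) \<Longrightarrow> 0 \<le> f \<omega>" for f :: "'d path \<Rightarrow> real"
        by (rule integral_nonneg_AE, rule AE_I2) (simp add: space_Q that)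
      let ?g = "\<lambda>\<omega>. (t - s) * (k * \<rho> (Theta \<omega>))"
      have g0: "0 \<le> ?g \<omega>" if "\<omega> \<in> space (path_space D)" for \<omega>
        using st k0 Tpos[OF that] by simp
      have intg: "integrable Q ?g" using int\<rho> by simp
      have "ennreal (?I (S t)) = ennreal (?I (S s)) + ennreal (?I ?g)"
        using M1[OF st A] nnI[OF intS[OF t] S_nonneg] nnI[OF intS[OF st(1)] S_nonneg] nnI[OF intg g0] by simp
      moreover have "0 \<le> ?I (S t)" by (rule I0) (rule S_nonneg)
      moreover have "0 \<le> ?I (S s)" by (rule I0) (rule S_nonneg)
      moreover have "0 \<le> ?I ?g" by (rule I0) (rule g0)
      ultimately have e: "?I (S t) = ?I (S s) + ?I ?g"
        by (simp only: ennreal_plus[symmetric] ennreal_inj add_nonneg_nonneg)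
      have "?I ?g = ?I (\<lambda>\<omega>. (t - s) * c \<omega>)"
      proof (rule integral_cong_AE)
        show "AE \<omega> in Q. indicator A \<omega> * ((t - s) * (k * \<rho> (Theta \<omega>))) = indicator A \<omega> * ((t - s) * c \<omega>)"
          using ce by eventually_elim simp
      qed measurable
      also have "\<dots> = (t - s) * ?I c"
        by (subst integral_mult_right_zero[symmetric]) (simp add: mult_ac)
      finally have e2: "?I (S t) = ?I (S s) + (t - s) * ?I c" using e by simp
      have d: "(\<integral>\<omega>\<in>A. (S u \<omega> - u * c \<omega>) \<partial>Q) = ?I (S u) - u * ?I c" if u: "0 \<le> u" for u
      proof -
        have "(\<integral>\<omega>\<in>A. (S u \<omega> - u * c \<omega>) \<partial>Q) = (\<integral>\<omega>. indicator A \<omega> * S u \<omega> - u * (indicator A \<omega> * c \<omega>) \<partial>Q)"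
          unfolding set_lebesgue_integral_def by (intro Bochner_Integration.integral_cong refl) (simp add: algebra_simps)
        also have "\<dots> = ?I (S u) - (\<integral>\<omega>. u * (indicator A \<omega> * c \<omega>) \<partial>Q)"
          by (intro Bochner_Integration.integral_diff intI intS[OF u] integrable_mult_right intc)
        finally show ?thesis by simp
      qed
      show "(\<integral>\<omega>\<in>A. (S t \<omega> - t * c \<omega>) \<partial>Q) = (\<integral>\<omega>\<in>A. (S s \<omega> - s * c \<omega>) \<partial>Q)"
        unfolding d[OF t] d[OF st(1)] e2 by (simp add: algebra_simps)
    qed
  qed
qed

section \<open>Membership in the classes\<close>

context mixed_renewal
begin

lemma integrable_X_power_iff: "integrable Q (\<lambda>\<omega>. X 0 \<omega> ^ l) \<longleftrightarrow> (\<integral>\<^sup>+x. ennreal (x ^ l) \<partial>R) < \<infinity>"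
proof -
  note [measurable_cong] = sets_Q
  have "integrable Q (\<lambda>\<omega>. X 0 \<omega> ^ l) \<longleftrightarrow> (\<integral>\<^sup>+\<omega>. ennreal (X 0 \<omega> ^ l) \<partial>Q) < \<infinity>"
  proof (rule integrable_iff_nn_integral_finite)
    show "AE \<omega> in Q. 0 \<le> X 0 \<omega> ^ l"
      by (rule AE_I2) (simp add: space_Q path_space_pos(2) less_imp_le)
  qed measurable
  also have "(\<integral>\<^sup>+\<omega>. ennreal (X 0 \<omega> ^ l) \<partial>Q) = (\<integral>\<^sup>+x. ennreal (x ^ l) \<partial>R)"
    by (rule nn_integral_Q_X) measurable
  finally show ?thesis .
qed

lemma cexp_W_Q: "AE \<omega> in Q. cexp_W D Q \<omega> = (\<integral>\<^sup>+w. ennreal w \<partial>K (Theta \<omega>))"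
proof -
  have "AE \<omega> in Q. cexp_W D Q \<omega> = (\<integral>\<^sup>+\<omega>'. ennreal (W 0 \<omega>') \<partial>PL (Theta \<omega>))"
    unfolding cexp_W_def by (rule nn_cond_exp_Q) measurable
  with AE_space show ?thesis
  proof eventually_elim
    case (elim \<omega>)
    then have \<theta>: "Theta \<omega> \<in> D" by (simp add: space_Q path_space_pos(3))
    have "(\<integral>\<^sup>+\<omega>'. ennreal (W 0 \<omega>') \<partial>PL (Theta \<omega>)) = (\<integral>\<^sup>+w. ennreal w \<partial>K (Theta \<omega>))"
      by (rule nn_integral_PL_W[OF \<theta>]) measurable
    with elim show ?case by simp
  qed
qed

text \<open>A mixture has the required independence properties by construction.\<close>

lemma M_class_Q_iff:
  assumes "(\<integral>\<^sup>+x. ennreal (x ^ l) \<partial>R) < \<infinity>"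
  shows "Q \<in> M_class l D P K \<longleftrightarrow> prog_equiv D Q P"
  unfolding M_class_def prob_on_def
  using assms cond_indep_W_X indep_Theta_X CMRP_Q prob_Q sets_Q integrable_X_power_iff by simp

lemma measurable_mean: "(\<lambda>\<theta>. \<integral>\<^sup>+w. ennreal w \<partial>K \<theta>) \<in> borel_measurable (param_borel D)"
proof -
  have "(\<lambda>z. ennreal (snd z)) \<in> borel_measurable (param_borel D \<Otimes>\<^sub>M pos_borel)"
    using measurable_compose[OF measurable_snd[of "param_borel D" pos_borel] measurable_ident_pos_borel] by simp
  from measurable_nn_integral_K[OF this] show ?thesis by simp
qed

lemma cexp_W_Q_Exp:
  assumes \<rho>: "\<rho> \<in> M_plus D" and K\<rho>: "\<And>\<theta>. \<theta> \<in> D \<Longrightarrow> K \<theta> = Exp (\<rho> \<theta>)"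
  shows "AE \<omega> in Q. cexp_W D Q \<omega> = ennreal (1 / \<rho> (Theta \<omega>))"
  using cexp_W_Q AE_space
proof eventually_elim
  case (elim \<omega>)
  then have \<theta>: "Theta \<omega> \<in> D" by (simp add: space_Q path_space_pos(3))
  with \<rho> have "0 < \<rho> (Theta \<omega>)" by (simp add: M_plus_def)
  with elim show ?case by (simp add: K\<rho>[OF \<theta>] nn_integral_Exp_ident)
qed

lemma measurable_cexp_W: "cexp_W D Q \<in> borel_measurable (sigma_Theta D)"
  unfolding cexp_W_def by simp

text \<open>Since an exponential law has mean \<open>1 / \<rho>\<close>, the reciprocal of the conditional mean is \<open>\<rho> (Theta)\<close>.\<close>

lemma M_star_conditions_Exp:
  assumes \<rho>: "\<rho> \<in> M_plus D" and K\<rho>: "\<And>\<theta>. \<theta> \<in> D \<Longrightarrow> K \<theta> = Exp (\<rho> \<theta>)"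
  shows "AE \<omega> in Q. cexp_W D Q \<omega> < \<infinity>"
    and "integrable Q (\<lambda>\<omega>. (1 / enn2real (cexp_W D Q \<omega>)) ^ l) \<longleftrightarrow> (\<integral>\<^sup>+\<theta>. ennreal (\<rho> \<theta> ^ l) \<partial>\<nu>) < \<infinity>"
proof -
  note [measurable_cong] = sets_Q
  have \<rho>m[measurable]: "\<rho> \<in> borel_measurable (param_borel D)" and \<rho>p: "\<And>\<theta>. \<theta> \<in> D \<Longrightarrow> 0 < \<rho> \<theta>"
    using \<rho> by (auto simp: M_plus_def)
  have [measurable]: "cexp_W D Q \<in> borel_measurable (path_space D)"
    by (rule measurable_Filt_path[OF measurable_sigma_Theta_Filt[OF measurable_cexp_W]])
  have ce: "AE \<omega> in Q. cexp_W D Q \<omega> = ennreal (1 / \<rho> (Theta \<omega>))"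
    by (rule cexp_W_Q_Exp[OF \<rho>]) (rule K\<rho>)
  from ce show "AE \<omega> in Q. cexp_W D Q \<omega> < \<infinity>" by eventually_elim simp
  have e: "AE \<omega> in Q. (1 / enn2real (cexp_W D Q \<omega>)) ^ l = \<rho> (Theta \<omega>) ^ l"
    using ce AE_space
  proof eventually_elim
    case (elim \<omega>)
    then have "0 < \<rho> (Theta \<omega>)" by (simp add: space_Q path_space_pos(3) \<rho>p)
    with elim show ?case by simp
  qed
  have "integrable Q (\<lambda>\<omega>. (1 / enn2real (cexp_W D Q \<omega>)) ^ l) \<longleftrightarrow> integrable Q (\<lambda>\<omega>. \<rho> (Theta \<omega>) ^ l)"
    by (rule integrable_cong_AE[OF _ _ e]) measurable
  also have "\<dots> \<longleftrightarrow> (\<integral>\<^sup>+\<omega>. ennreal (\<rho> (Theta \<omega>) ^ l) \<partial>Q) < \<infinity>"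
  proof (rule integrable_iff_nn_integral_finite)
    show "AE \<omega> in Q. 0 \<le> \<rho> (Theta \<omega>) ^ l"
      by (rule AE_I2) (simp add: space_Q path_space_pos(3) \<rho>p less_imp_le)
  qed measurable
  also have "(\<integral>\<^sup>+\<omega>. ennreal (\<rho> (Theta \<omega>) ^ l) \<partial>Q) = (\<integral>\<^sup>+\<theta>. ennreal (\<rho> \<theta> ^ l) \<partial>\<nu>)"
    by (rule nn_integral_Q_Theta) measurable
  finally show "integrable Q (\<lambda>\<omega>. (1 / enn2real (cexp_W D Q \<omega>)) ^ l) \<longleftrightarrow> (\<integral>\<^sup>+\<theta>. ennreal (\<rho> \<theta> ^ l) \<partial>\<nu>) < \<infinity>" .
qed

end

text \<open>A real-valued version exists since the Radon-Nikodym derivative of a finite measure is finite almost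
  everywhere.\<close>

lemma equivalent_density:
  assumes k: "prob_space k" and m: "prob_space m" and s: "sets m = sets k"
    and ac: "absolutely_continuous k m" "absolutely_continuous m k"
  obtains h :: "'a \<Rightarrow> real" where "h \<in> borel_measurable k" "AE x in k. 0 < h x" "m = density k (\<lambda>x. ennreal (h x))"
proof -
  interpret k: prob_space k by (rule k)
  interpret m: prob_space m by (rule m)
  define h where "h = (\<lambda>x. enn2real (RN_deriv k m x))"
  have h[measurable]: "h \<in> borel_measurable k" unfolding h_def by measurable
  have fin: "AE x in k. RN_deriv k m x \<noteq> \<infinity>"
    by (rule k.RN_deriv_finite[OF m.sigma_finite_measure_axioms ac(1) s])
  have "m = density k (RN_deriv k m)" by (rule k.density_RN_deriv[OF ac(1) s, symmetric])
  also have "\<dots> = density k (\<lambda>x. ennreal (h x))"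
    using fin by (intro density_cong) (auto elim!: eventually_mono simp: h_def less_top)
  finally have d: "m = density k (\<lambda>x. ennreal (h x))" .
  have "rn_density k m h" unfolding rn_density_def using d by (simp add: h_def)
  from rn_density_pos[OF this ac(2)] h d show ?thesis using that by blast
qed

section \<open>Reference law and the defining conditions\<close>

lemma measure_eqI_Filt:
  assumes M: "M \<in> prob_on (path_space D)" and M': "M' \<in> prob_on (path_space D)"
    and eq: "\<And>t A. 0 \<le> t \<Longrightarrow> A \<in> sets (Filt D t) \<Longrightarrow> measure M A = measure M' A"
  shows "M = M'"
proof -
  interpret m: prob_space M using M by (simp add: prob_on_def)
  interpret m': prob_space M' using M' by (simp add: prob_on_def)
  let ?E = "\<Union>t\<in>{0..}. sets (Filt D t)"
  show ?thesis
  proof (rule measure_eqI_generator_eq[where E="?E" and \<Omega>="space (path_space D)" and A="\<lambda>_. space (path_space D)"])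
    show "Int_stable ?E"
    proof (rule Int_stableI)
      fix a b assume "a \<in> ?E" "b \<in> ?E"
      then obtain s t where st: "0 \<le> s" "a \<in> sets (Filt D s)" "0 \<le> t" "b \<in> sets (Filt D t)" by blast
      then have "a \<in> sets (Filt D (max s t))" "b \<in> sets (Filt D (max s t))"
        using Filt_mono[of s "max s t" D] Filt_mono[of t "max s t" D] by (simp_all add: subset_iff)
      then have "a \<inter> b \<in> sets (Filt D (max s t))" by (rule sets.Int)
      moreover have "max s t \<in> {0..}" using st by simp
      ultimately show "a \<inter> b \<in> ?E" by blast
    qed
    show "?E \<subseteq> Pow (space (path_space D))"
    proof (intro UN_least subsetI PowI)
      fix t A x assume "A \<in> sets (Filt D t)" "x \<in> A"
      then show "x \<in> space (path_space D)" using sets.sets_into_space[of A "Filt D t"] unfolding space_Filt by blast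
    qed
    show "emeasure M A = emeasure M' A" if "A \<in> ?E" for A
      using that eq by (auto simp: m.emeasure_eq_measure m'.emeasure_eq_measure)
    show "sets M = sigma_sets (space (path_space D)) ?E" "sets M' = sigma_sets (space (path_space D)) ?E"
      using M M' by (simp_all only: prob_on_def mem_Collect_eq sets_path_space_Filt[symmetric])
    have "space (path_space D) \<in> sets (Filt D 0)" using sets.top[of "Filt D 0"] by simp
    then show "range (\<lambda>_ :: nat. space (path_space D)) \<subseteq> ?E" by (intro image_subsetI UN_I[of 0]) simp_all
  qed simp_all
qed

locale reference_law = mixed_renewal D K R \<mu>
  for D :: "(real ^ 'd::finite) set" and K :: "real ^ 'd \<Rightarrow> real measure" and R :: "real measure"
    and \<mu> :: "(real ^ 'd) measure" +
  fixes l :: nat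
  assumes l: "l \<in> {1, 2}"
    and finite_mean: "AE \<theta> in \<mu>. (\<integral>\<^sup>+w. ennreal w \<partial>K \<theta>) < \<infinity>"
begin

abbreviation "P \<equiv> mixed_law D \<mu> K R"

definition mean :: "real ^ 'd \<Rightarrow> real" where
  "mean \<theta> = enn2real (\<integral>\<^sup>+w. ennreal w \<partial>K \<theta>)"

lemma borel_measurable_mean [measurable]: "mean \<in> borel_measurable (param_borel D)"
  unfolding mean_def[abs_def] using measurable_mean by measurable

lemma AE_mean: "AE \<theta> in \<mu>. (\<integral>\<^sup>+w. ennreal w \<partial>K \<theta>) = ennreal (mean \<theta>) \<and> 0 < mean \<theta>"
  using finite_mean AE_space
proof eventually_elim
  case (elim \<theta>)
  then have \<theta>: "\<theta> \<in> D" by (simp add: space_\<nu>)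
  interpret k: prob_space "K \<theta>" by (rule prob_K[OF \<theta>])
  note [measurable_cong] = sets_K[OF \<theta>]
  have "(\<integral>\<^sup>+w. ennreal w \<partial>K \<theta>) \<noteq> 0"
  proof
    assume "(\<integral>\<^sup>+w. ennreal w \<partial>K \<theta>) = 0"
    then have "AE w in K \<theta>. ennreal w = 0" by (subst (asm) nn_integral_0_iff_AE) measurable
    then have "AE w in K \<theta>. False" using AE_space
      by eventually_elim (simp add: space_K[OF \<theta>] ennreal_eq_0_iff)
    then show False by simp
  qed
  with elim show ?case by (simp add: mean_def less_top enn2real_positive_iff zero_less_iff_neq_zero)
qed

lemma cexp_W_P: "AE \<omega> in P. cexp_W D P \<omega> = ennreal (mean (Theta \<omega>)) \<and> 0 < mean (Theta \<omega>)"
  using cexp_W_Q AE_Q_of_\<nu>[OF AE_mean] by eventually_elim simp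

text \<open>The conditional mean of an interarrival time is \<open>mean (Theta)\<close>, and an almost sure statement about
  \<open>Theta\<close> is one about its law.\<close>

lemma cond_C_iff:
  assumes \<rho>: "\<rho> \<in> M_plus D" and \<alpha>[measurable]: "\<alpha> \<in> borel_measurable (param_borel D)"
  shows "cond_C D P \<rho> \<alpha> \<longleftrightarrow> (AE \<theta> in \<mu>. \<rho> \<theta> = exp (\<alpha> \<theta>) / mean \<theta>)"
proof -
  have \<rho>m[measurable]: "\<rho> \<in> borel_measurable (param_borel D)" and \<rho>p: "\<And>\<theta>. \<theta> \<in> D \<Longrightarrow> 0 < \<rho> \<theta>"
    using \<rho> by (auto simp: M_plus_def)
  have pt: "AE \<omega> in P. \<alpha> (Theta \<omega>) = ln (\<rho> (Theta \<omega>)) + ln (enn2real (cexp_W D P \<omega>)) \<longleftrightarrow>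
      \<rho> (Theta \<omega>) = exp (\<alpha> (Theta \<omega>)) / mean (Theta \<omega>)"
    using cexp_W_P AE_space
  proof eventually_elim
    case (elim \<omega>)
    then have p: "0 < \<rho> (Theta \<omega>)" "0 < mean (Theta \<omega>)" "enn2real (cexp_W D P \<omega>) = mean (Theta \<omega>)"
      by (simp_all add: \<rho>p path_space_pos(3) space_Q)
    have "\<alpha> (Theta \<omega>) = ln (\<rho> (Theta \<omega>)) + ln (mean (Theta \<omega>)) \<longleftrightarrow>
        exp (\<alpha> (Theta \<omega>)) = \<rho> (Theta \<omega>) * mean (Theta \<omega>)"
      using p by (metis exp_ln exp_add ln_exp ln_mult_pos mult_pos_pos)
    then show ?case using p by (auto simp: field_simps)
  qed
  have eqQ: "(AE \<theta> in \<mu>. \<rho> \<theta> = exp (\<alpha> \<theta>) / mean \<theta>) \<longleftrightarrow>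
      (AE \<omega> in P. \<rho> (Theta \<omega>) = exp (\<alpha> (Theta \<omega>)) / mean (Theta \<omega>))"
    by (rule AE_\<nu>_Q[symmetric]) measurable
  show ?thesis
  proof
    assume "cond_C D P \<rho> \<alpha>"
    from AE_restr_to_subalg[OF subalgebra_sigma_Theta[OF sets_Q] this[unfolded cond_C_def]] pt
    have "AE \<omega> in P. \<rho> (Theta \<omega>) = exp (\<alpha> (Theta \<omega>)) / mean (Theta \<omega>)" by eventually_elim simp
    then show "AE \<theta> in \<mu>. \<rho> \<theta> = exp (\<alpha> \<theta>) / mean \<theta>" using eqQ by simp
  next
    assume "AE \<theta> in \<mu>. \<rho> \<theta> = exp (\<alpha> \<theta>) / mean \<theta>"
    then have "AE \<omega> in P. \<rho> (Theta \<omega>) = exp (\<alpha> (Theta \<omega>)) / mean (Theta \<omega>)" using eqQ by simp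
    with pt have ae: "AE \<omega> in P. \<alpha> (Theta \<omega>) = ln (\<rho> (Theta \<omega>)) + ln (enn2real (cexp_W D P \<omega>))"
      by eventually_elim simp
    note [measurable] = measurable_cexp_W
    show "cond_C D P \<rho> \<alpha>" unfolding cond_C_def by (rule AE_restr_eq[OF ae]) measurable
  qed
qed

lemma F_class_iff:
  "(\<gamma>, \<alpha>) \<in> F_class l D P \<longleftrightarrow> \<gamma> \<in> borel_measurable pos_borel \<and> \<alpha> \<in> borel_measurable (param_borel D) \<and>
    (\<integral>\<^sup>+x. ennreal (exp (\<gamma> x)) \<partial>R) = 1 \<and> (\<integral>\<^sup>+x. ennreal (x ^ l * exp (\<gamma> x)) \<partial>R) < \<infinity>"
proof (cases "\<gamma> \<in> borel_measurable pos_borel")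
  case True
  note [measurable] = True
  note [measurable_cong] = sets_Q
  have e1: "(\<integral>\<^sup>+\<omega>. ennreal (exp (\<gamma> (X 0 \<omega>))) \<partial>P) = (\<integral>\<^sup>+x. ennreal (exp (\<gamma> x)) \<partial>R)"
    by (rule nn_integral_Q_X) measurable
  have e2: "(\<integral>\<^sup>+\<omega>. ennreal (X 0 \<omega> ^ l * exp (\<gamma> (X 0 \<omega>))) \<partial>P) = (\<integral>\<^sup>+x. ennreal (x ^ l * exp (\<gamma> x)) \<partial>R)"
    by (rule nn_integral_Q_X) measurable
  have i1: "integrable P (\<lambda>\<omega>. exp (\<gamma> (X 0 \<omega>))) \<and> (\<integral>\<omega>. exp (\<gamma> (X 0 \<omega>)) \<partial>P) = 1 \<longleftrightarrow>
      (\<integral>\<^sup>+\<omega>. ennreal (exp (\<gamma> (X 0 \<omega>))) \<partial>P) = 1"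
  proof
    assume a: "integrable P (\<lambda>\<omega>. exp (\<gamma> (X 0 \<omega>))) \<and> (\<integral>\<omega>. exp (\<gamma> (X 0 \<omega>)) \<partial>P) = 1"
    then show "(\<integral>\<^sup>+\<omega>. ennreal (exp (\<gamma> (X 0 \<omega>))) \<partial>P) = 1" by (subst nn_integral_eq_integral) simp_all
  next
    assume a: "(\<integral>\<^sup>+\<omega>. ennreal (exp (\<gamma> (X 0 \<omega>))) \<partial>P) = 1"
    have m: "(\<lambda>\<omega>. exp (\<gamma> (X 0 \<omega>))) \<in> borel_measurable P" by measurable
    have nn: "AE \<omega> in P. 0 \<le> exp (\<gamma> (X 0 \<omega>))" by simp
    have "integrable P (\<lambda>\<omega>. exp (\<gamma> (X 0 \<omega>)))"
      using a by (simp add: integrable_iff_nn_integral_finite[OF m nn])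
    moreover have "(\<integral>\<omega>. exp (\<gamma> (X 0 \<omega>)) \<partial>P) = 1"
      using a by (simp add: integral_eq_nn_integral[OF m nn])
    ultimately show "integrable P (\<lambda>\<omega>. exp (\<gamma> (X 0 \<omega>))) \<and> (\<integral>\<omega>. exp (\<gamma> (X 0 \<omega>)) \<partial>P) = 1" by blast
  qed
  have i2: "integrable P (\<lambda>\<omega>. X 0 \<omega> ^ l * exp (\<gamma> (X 0 \<omega>))) \<longleftrightarrow>
      (\<integral>\<^sup>+\<omega>. ennreal (X 0 \<omega> ^ l * exp (\<gamma> (X 0 \<omega>))) \<partial>P) < \<infinity>"
  proof (rule integrable_iff_nn_integral_finite)
    show "AE \<omega> in P. 0 \<le> X 0 \<omega> ^ l * exp (\<gamma> (X 0 \<omega>))"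
      by (rule AE_I2) (simp add: space_Q path_space_pos(2) less_imp_le)
  qed measurable
  show ?thesis unfolding F_class_def using True i1 i2 e1 e2 by auto
qed (simp add: F_class_def)

text \<open>In terms of \<open>\<rho>\<close> the moment condition on \<open>\<xi>\<close> says that \<open>\<rho> ^ l\<close> is integrable with respect to the mixing law
  with density \<open>\<xi>\<close>. This is the condition that the mean interarrival times of the new law satisfy.\<close>

lemma R_star_iff:
  assumes \<rho>: "\<rho> \<in> M_plus D" and \<alpha>[measurable]: "\<alpha> \<in> borel_measurable (param_borel D)"
    and \<rho>\<alpha>: "AE \<theta> in \<mu>. \<rho> \<theta> = exp (\<alpha> \<theta>) / mean \<theta>"
  shows "\<xi> \<in> R_star l D P \<alpha> \<longleftrightarrow> \<xi> \<in> borel_measurable (param_borel D) \<and> (AE \<theta> in \<mu>. 0 < \<xi> \<theta>) \<and>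
    (\<integral>\<^sup>+\<theta>. ennreal (\<xi> \<theta>) \<partial>\<mu>) = 1 \<and> (\<integral>\<^sup>+\<theta>. ennreal (\<xi> \<theta> * \<rho> \<theta> ^ l) \<partial>\<mu>) < \<infinity>"
proof (cases "\<xi> \<in> borel_measurable (param_borel D) \<and> (AE \<theta> in \<mu>. 0 < \<xi> \<theta>)")
  case True
  then have \<xi>[measurable]: "\<xi> \<in> borel_measurable (param_borel D)" and pos: "AE \<theta> in \<mu>. 0 < \<xi> \<theta>" by blast+
  note [measurable_cong] = sets_Q
  have \<rho>m[measurable]: "\<rho> \<in> borel_measurable (param_borel D)" and \<rho>p: "\<And>\<theta>. \<theta> \<in> D \<Longrightarrow> 0 < \<rho> \<theta>"
    using \<rho> by (auto simp: M_plus_def)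
  have posQ: "AE \<omega> in P. 0 < \<xi> (Theta \<omega>)" by (rule AE_Q_of_\<nu>[OF pos])
  then have nnQ: "AE \<omega> in P. 0 \<le> \<xi> (Theta \<omega>)" by eventually_elim simp
  have e1: "(\<integral>\<^sup>+\<omega>. ennreal (\<xi> (Theta \<omega>)) \<partial>P) = (\<integral>\<^sup>+\<theta>. ennreal (\<xi> \<theta>) \<partial>\<mu>)"
    by (rule nn_integral_Q_Theta) measurable
  have e2: "(\<integral>\<^sup>+\<omega>. ennreal (\<xi> (Theta \<omega>) * \<rho> (Theta \<omega>) ^ l) \<partial>P) = (\<integral>\<^sup>+\<theta>. ennreal (\<xi> \<theta> * \<rho> \<theta> ^ l) \<partial>\<mu>)"
    by (rule nn_integral_Q_Theta) measurable
  have i1: "integrable P (\<lambda>\<omega>. \<xi> (Theta \<omega>)) \<and> (\<integral>\<omega>. \<xi> (Theta \<omega>) \<partial>P) = 1 \<longleftrightarrow>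
      (\<integral>\<^sup>+\<omega>. ennreal (\<xi> (Theta \<omega>)) \<partial>P) = 1"
  proof
    assume a: "integrable P (\<lambda>\<omega>. \<xi> (Theta \<omega>)) \<and> (\<integral>\<omega>. \<xi> (Theta \<omega>) \<partial>P) = 1"
    then show "(\<integral>\<^sup>+\<omega>. ennreal (\<xi> (Theta \<omega>)) \<partial>P) = 1"
      using nn_integral_eq_integral[of P "\<lambda>\<omega>. \<xi> (Theta \<omega>)"] nnQ by simp
  next
    assume a: "(\<integral>\<^sup>+\<omega>. ennreal (\<xi> (Theta \<omega>)) \<partial>P) = 1"
    have m: "(\<lambda>\<omega>. \<xi> (Theta \<omega>)) \<in> borel_measurable P" by measurable
    have "integrable P (\<lambda>\<omega>. \<xi> (Theta \<omega>))"
      using a by (simp add: integrable_iff_nn_integral_finite[OF m nnQ])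
    moreover have "(\<integral>\<omega>. \<xi> (Theta \<omega>) \<partial>P) = 1"
      using a by (simp add: integral_eq_nn_integral[OF m nnQ])
    ultimately show "integrable P (\<lambda>\<omega>. \<xi> (Theta \<omega>)) \<and> (\<integral>\<omega>. \<xi> (Theta \<omega>) \<partial>P) = 1" by blast
  qed
  have [measurable]: "cexp_W D P \<in> borel_measurable (path_space D)"
    by (rule measurable_Filt_path[OF measurable_sigma_Theta_Filt[OF measurable_cexp_W]])
  have i2: "integrable P (\<lambda>\<omega>. \<xi> (Theta \<omega>) * (exp (\<alpha> (Theta \<omega>)) / enn2real (cexp_W D P \<omega>)) ^ l) \<longleftrightarrow>
      integrable P (\<lambda>\<omega>. \<xi> (Theta \<omega>) * \<rho> (Theta \<omega>) ^ l)"
  proof (rule integrable_cong_AE)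
    show "AE \<omega> in P. \<xi> (Theta \<omega>) * (exp (\<alpha> (Theta \<omega>)) / enn2real (cexp_W D P \<omega>)) ^ l = \<xi> (Theta \<omega>) * \<rho> (Theta \<omega>) ^ l"
      using AE_Q_of_\<nu>[OF \<rho>\<alpha>] cexp_W_P by eventually_elim (simp add: less_imp_le)
  qed measurable
  have i3: "integrable P (\<lambda>\<omega>. \<xi> (Theta \<omega>) * \<rho> (Theta \<omega>) ^ l) \<longleftrightarrow>
      (\<integral>\<^sup>+\<omega>. ennreal (\<xi> (Theta \<omega>) * \<rho> (Theta \<omega>) ^ l) \<partial>P) < \<infinity>"
  proof (rule integrable_iff_nn_integral_finite)
    show "AE \<omega> in P. 0 \<le> \<xi> (Theta \<omega>) * \<rho> (Theta \<omega>) ^ l"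
      using nnQ AE_space by eventually_elim (simp add: space_Q path_space_pos(3) \<rho>p less_imp_le)
  qed measurable
  show ?thesis
    unfolding R_star_def R_plus_def distr_Q_Theta mem_Collect_eq i2 i3 e2 using True i1[unfolded e1] by blast
next
  case False
  then show ?thesis unfolding R_star_def R_plus_def distr_Q_Theta mem_Collect_eq by blast
qed

lemma cond_A_iff:
  assumes \<gamma>[measurable]: "\<gamma> \<in> borel_measurable pos_borel"
  shows "cond_A P M \<gamma> \<longleftrightarrow> distr M pos_borel (X 0) = density R (\<lambda>x. ennreal (exp (\<gamma> x)))"
proof
  note [measurable_cong] = sets_R
  assume "cond_A P M \<gamma>"
  then obtain f where rn: "rn_density R (distr M pos_borel (X 0)) f" and f: "AE x in R. 0 < f x" "AE x in R. \<gamma> x = ln (f x)"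
    unfolding cond_A_def iid_Q_X(2) by blast
  have [measurable]: "f \<in> borel_measurable R" using rn by (simp add: rn_density_def)
  have "density R (\<lambda>x. ennreal (f x)) = density R (\<lambda>x. ennreal (exp (\<gamma> x)))"
  proof (rule density_cong)
    show "AE x in R. ennreal (f x) = ennreal (exp (\<gamma> x))" using f by eventually_elim simp
  qed measurable
  then show "distr M pos_borel (X 0) = density R (\<lambda>x. ennreal (exp (\<gamma> x)))" using rn by (simp add: rn_density_def)
next
  note [measurable_cong] = sets_R
  assume "distr M pos_borel (X 0) = density R (\<lambda>x. ennreal (exp (\<gamma> x)))"
  then show "cond_A P M \<gamma>"
    unfolding cond_A_def iid_Q_X(2) by (intro exI[of _ "\<lambda>x. exp (\<gamma> x)"]) (simp add: rn_density_def)
qed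

lemma cond_D_mixed:
  assumes Q': "mixed_renewal D (\<lambda>\<theta>. Exp (\<rho> \<theta>)) R' \<nu>"
    and \<rho>: "\<rho> \<in> M_plus D" and \<xi>: "\<xi> \<in> borel_measurable (param_borel D)"
    and \<xi>nn: "AE \<theta> in \<mu>. 0 \<le> \<xi> \<theta>" and \<nu>': "\<nu> = density \<mu> (\<lambda>\<theta>. ennreal (\<xi> \<theta>))"
    and r: "(\<lambda>(\<theta>, w). r \<theta> w) \<in> borel_measurable (param_borel D \<Otimes>\<^sub>M pos_borel)"
    and rn: "AE \<theta> in \<mu>. rn_density (K \<theta>) (Exp (\<rho> \<theta>)) (r \<theta>)"
    and \<gamma>: "\<gamma> \<in> borel_measurable pos_borel" and R': "R' = density R (\<lambda>x. ennreal (exp (\<gamma> x)))"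
    and t: "0 \<le> t" and A: "A \<in> sets (Filt D t)"
  shows "measure (mixed_law D \<nu> (\<lambda>\<theta>. Exp (\<rho> \<theta>)) R') A = (LINT \<omega>:A|P. M_beta K \<rho> \<gamma> \<xi> r t \<omega>)"
proof (rule measure_eq_set_integral)
  note L = emeasure_mixed_Filt[OF mixed_renewal_axioms Q' \<rho> \<xi> \<xi>nn \<nu>' r rn \<gamma> R' t]
  show "emeasure (mixed_law D \<nu> (\<lambda>\<theta>. Exp (\<rho> \<theta>)) R') A = (\<integral>\<^sup>+\<omega>. indicator A \<omega> * ennreal (M_beta K \<rho> \<gamma> \<xi> r t \<omega>) \<partial>P)"
    by (rule L(1)[OF A])
  show "AE \<omega> in P. 0 \<le> M_beta K \<rho> \<gamma> \<xi> r t \<omega>" by (rule L(2))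
  have "\<rho> \<in> borel_measurable (param_borel D)" using \<rho> by (simp add: M_plus_def)
  from measurable_M_beta[OF this \<xi> \<gamma> r t] show "M_beta K \<rho> \<gamma> \<xi> r t \<in> borel_measurable P" by (simp add: measurable_Q)
  show "A \<in> sets P" using subsetD[OF Filt_subset_path A] by (simp add: sets_Q)
qed

text \<open>The process \<open>V\<close> is defined through conditional expectations under the reference law. Its drift is
  identified \<open>P\<close>-almost surely and depends on the parameter only, so absolute continuity of the mixing
  laws suffices to carry the identity over to the new law, although the two laws need not be
  comparable on the full sigma-algebra.\<close>

lemma martingale_V:
  assumes Q': "mixed_renewal D (\<lambda>\<theta>. Exp (\<rho> \<theta>)) R' \<nu>" and \<rho>: "\<rho> \<in> M_plus D"
    and ac: "absolutely_continuous \<mu> \<nu>"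
    and \<gamma>[measurable]: "\<gamma> \<in> borel_measurable pos_borel" and R': "R' = density R (\<lambda>x. ennreal (exp (\<gamma> x)))"
    and \<alpha>[measurable]: "\<alpha> \<in> borel_measurable (param_borel D)"
    and \<rho>\<alpha>: "AE \<theta> in \<mu>. \<rho> \<theta> = exp (\<alpha> \<theta>) / mean \<theta>"
    and Rl: "(\<integral>\<^sup>+x. ennreal (x ^ l) \<partial>R') < \<infinity>" and \<rho>l: "(\<integral>\<^sup>+\<theta>. ennreal (\<rho> \<theta> ^ l) \<partial>\<nu>) < \<infinity>"
  shows "martingale_measure l D (mixed_law D \<nu> (\<lambda>\<theta>. Exp (\<rho> \<theta>)) R') (V D P \<gamma> \<alpha>)"
proof -
  interpret Q: mixed_renewal D "\<lambda>\<theta>. Exp (\<rho> \<theta>)" R' \<nu> by (rule Q')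
  note [measurable_cong] = sets_R
  have \<rho>m[measurable]: "\<rho> \<in> borel_measurable (param_borel D)" using \<rho> by (simp add: M_plus_def)
  let ?h = "\<lambda>\<omega>'. ennreal (X 0 \<omega>' * exp (\<gamma> (X 0 \<omega>') + \<alpha> (Theta \<omega>')))"
  define c where "c = (\<lambda>\<omega>. enn2real (nn_cond_exp P (sigma_Theta D) ?h \<omega>) / enn2real (cexp_W D P \<omega>))"
  have V: "V D P \<gamma> \<alpha> = (\<lambda>t \<omega>. S t \<omega> - t * c \<omega>)" by (intro ext) (simp add: V_def c_def)
  define \<kappa> where "\<kappa> = enn2real (\<integral>\<^sup>+x. ennreal x \<partial>R')"
  note [measurable] = measurable_cexp_W
  have c[measurable]: "c \<in> borel_measurable (sigma_Theta D)" unfolding c_def by measurable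
  have \<kappa>': "(\<integral>\<^sup>+x. ennreal x \<partial>R') = (\<integral>\<^sup>+x. ennreal (exp (\<gamma> x)) * ennreal x \<partial>R)"
    unfolding R' by (rule nn_integral_density) measurable
  have cP: "AE \<omega> in P. c \<omega> = \<kappa> * \<rho> (Theta \<omega>)"
  proof -
    have "AE \<omega> in P. nn_cond_exp P (sigma_Theta D) ?h \<omega> = (\<integral>\<^sup>+\<omega>'. ?h \<omega>' \<partial>PL (Theta \<omega>))"
      by (rule nn_cond_exp_Q) measurable
    then show ?thesis using cexp_W_P AE_Q_of_\<nu>[OF \<rho>\<alpha>] AE_space
    proof eventually_elim
      case (elim \<omega>)
      then have \<theta>: "Theta \<omega> \<in> D" by (simp add: space_Q path_space_pos(3))
      let ?\<theta> = "Theta \<omega>"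
      have "(\<integral>\<^sup>+\<omega>'. ?h \<omega>' \<partial>PL ?\<theta>) = (\<integral>\<^sup>+\<omega>'. ennreal (X 0 \<omega>' * exp (\<gamma> (X 0 \<omega>') + \<alpha> ?\<theta>)) \<partial>PL ?\<theta>)"
        by (rule nn_integral_PL_Theta[OF \<theta>, of "\<lambda>\<theta> \<omega>'. ennreal (X 0 \<omega>' * exp (\<gamma> (X 0 \<omega>') + \<alpha> \<theta>))"])
      also have "\<dots> = (\<integral>\<^sup>+x. ennreal (x * exp (\<gamma> x + \<alpha> ?\<theta>)) \<partial>R)"
        by (rule nn_integral_PL_X[OF \<theta>]) measurable
      also have "\<dots> = (\<integral>\<^sup>+x. ennreal (exp (\<alpha> ?\<theta>)) * (ennreal (exp (\<gamma> x)) * ennreal x) \<partial>R)"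
        by (intro nn_integral_cong) (simp add: space_R ennreal_mult'[symmetric] exp_add mult_ac)
      also have "\<dots> = ennreal (exp (\<alpha> ?\<theta>)) * (\<integral>\<^sup>+x. ennreal x \<partial>R')"
        unfolding \<kappa>' by (rule nn_integral_cmult) measurable
      finally have "enn2real (nn_cond_exp P (sigma_Theta D) ?h \<omega>) = exp (\<alpha> ?\<theta>) * \<kappa>"
        using elim(1) by (simp add: enn2real_mult \<kappa>_def)
      then show ?case using elim(2,3) by (simp add: c_def less_imp_le)
    qed
  qed
  have cQ: "AE \<omega> in Q.Q. c \<omega> = \<kappa> * \<rho> (Theta \<omega>)"
  proof -
    let ?N = "{\<omega> \<in> space (sigma_Theta D). c \<omega> \<noteq> \<kappa> * \<rho> (Theta \<omega>)}"
    have N: "?N \<in> sets (sigma_Theta D)" by measurable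
    then obtain B where B: "?N = Theta -` B \<inter> space (path_space D)" "B \<in> sets (param_borel D)"
      unfolding sets_sigma_Theta by blast
    have Np: "?N \<in> sets (path_space D)" using subsetD[OF sigma_Theta_subset_path N] .
    have eP: "emeasure P ?N = emeasure \<mu> B"
    proof -
      have "emeasure (distr P (param_borel D) Theta) B = emeasure P ?N"
        using B by (subst emeasure_distr) (simp_all add: measurable_Q space_Q)
      then show ?thesis by (simp only: distr_Q_Theta)
    qed
    have eQ: "emeasure Q.Q ?N = emeasure \<nu> B"
    proof -
      have "emeasure (distr Q.Q (param_borel D) Theta) B = emeasure Q.Q ?N"
        using B by (subst emeasure_distr) (simp_all add: Q.measurable_Q Q.space_Q)
      then show ?thesis by (simp only: Q.distr_Q_Theta)
    qed
    have "?N \<in> null_sets P"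
    proof -
      have "AE \<omega> in P. \<omega> \<notin> ?N" using cP by eventually_elim simp
      moreover have "?N \<in> sets P" using Np by (simp only: sets_Q)
      ultimately show ?thesis using AE_iff_null_sets[of ?N P] by blast
    qed
    then have "emeasure P ?N = 0" by (rule null_setsD1)
    then have z: "emeasure \<mu> B = 0" by (simp only: eP)
    have "B \<in> sets \<mu>" using B(2) by (simp only: sets_\<nu>)
    then have "B \<in> null_sets \<mu>" using z by (rule null_setsI[rotated])
    then have "B \<in> null_sets \<nu>" using ac unfolding absolutely_continuous_def by (rule subsetD[rotated])
    then have "emeasure Q.Q ?N = 0" unfolding eQ by (rule null_setsD1)
    moreover have "?N \<in> sets Q.Q" using Np by (simp only: Q.sets_Q)
    ultimately have "?N \<in> null_sets Q.Q" by (rule null_setsI)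
    moreover have "space Q.Q = space (sigma_Theta D)" by (simp only: Q.space_Q space_sigma_Theta)
    ultimately show ?thesis by (intro AE_I'[of ?N]) auto
  qed
  show ?thesis
    unfolding V by (rule Q.martingale_mixed[OF \<rho> refl l Rl \<rho>l c cQ[unfolded \<kappa>_def]])
qed

end

section \<open>Regular conditional probabilities\<close>

text \<open>By consistency, restricting the parameter to \<open>C\<close> amounts to restricting the paths to those with
  parameter in \<open>C\<close>. This turns the defining identity of a regular conditional probability, which
  involves integrals over all parameters, into one over arbitrary sets of parameters.\<close>

lemma rcp_integral:
  assumes M: "sets M = sets (path_space D)" and rcp: "rcp D M Qf" and con: "consistent D M Qf"
    and E: "E \<in> sets (path_space D)" and C: "C \<in> sets (param_borel D)"
  shows "(\<integral>\<^sup>+\<theta>. emeasure (Qf \<theta>) E * indicator C \<theta> \<partial>distr M (param_borel D) Theta) =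
    emeasure M (E \<inter> (Theta -` C \<inter> space (path_space D)))"
proof -
  let ?\<nu> = "distr M (param_borel D) Theta" and ?\<Omega> = "space (path_space D)"
  let ?T = "\<lambda>C. Theta -` C \<inter> ?\<Omega>"
  have T: "?T B \<in> sets (path_space D)" if "B \<in> sets (param_borel D)" for B
    using measurable_sets[OF measurable_Theta that] .
  have C': "D - C \<in> sets (param_borel D)" using sets.compl_sets[OF C] by simp
  have "AE \<theta> in ?\<nu>. \<theta> \<in> B \<longrightarrow> emeasure (Qf \<theta>) (?T B) = 1" if "B \<in> sets (param_borel D)" for B
    using con that unfolding consistent_def by blast
  from this[OF C] this[OF C'] AE_space
  have "AE \<theta> in ?\<nu>. emeasure (Qf \<theta>) E * indicator C \<theta> = emeasure (Qf \<theta>) (E \<inter> ?T C)"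
  proof eventually_elim
    case (elim \<theta>)
    then have \<theta>: "\<theta> \<in> D" by simp
    then have Q: "prob_space (Qf \<theta>)" "sets (Qf \<theta>) = sets (path_space D)"
      using rcp by (simp_all add: rcp_def prob_on_def)
    interpret prob_space "Qf \<theta>" by (rule Q(1))
    note spQ = sets_eq_imp_space_eq[OF Q(2)]
    have ev: "E \<in> events" "?T C \<in> events" "?T (D - C) \<in> events" using E T C C' by (simp_all add: Q(2))
    show ?case
    proof (cases "\<theta> \<in> C")
      case True
      with elim(1) have "AE \<omega> in Qf \<theta>. \<omega> \<in> ?T C"
        using ev(2) by (intro AE_prob_1) (simp add: emeasure_eq_measure)
      then have "AE \<omega> in Qf \<theta>. \<omega> \<in> E \<inter> ?T C \<longleftrightarrow> \<omega> \<in> E" by eventually_elim blast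
      then have "emeasure (Qf \<theta>) (E \<inter> ?T C) = emeasure (Qf \<theta>) E"
        by (rule emeasure_eq_AE) (use ev in blast)+
      with True show ?thesis by simp
    next
      case False
      with elim(2) \<theta> have "AE \<omega> in Qf \<theta>. \<omega> \<in> ?T (D - C)"
        using ev(3) by (intro AE_prob_1) (simp add: emeasure_eq_measure)
      then have "AE \<omega> in Qf \<theta>. \<omega> \<in> E \<inter> ?T C \<longleftrightarrow> \<omega> \<in> {}" by eventually_elim blast
      then have "emeasure (Qf \<theta>) (E \<inter> ?T C) = emeasure (Qf \<theta>) {}"
        by (rule emeasure_eq_AE) (use ev in blast)+
      with False show ?thesis by simp
    qed
  qed
  then have "(\<integral>\<^sup>+\<theta>. emeasure (Qf \<theta>) E * indicator C \<theta> \<partial>?\<nu>) = (\<integral>\<^sup>+\<theta>. emeasure (Qf \<theta>) (E \<inter> ?T C) \<partial>?\<nu>)"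
    by (rule nn_integral_cong_AE)
  also have "\<dots> = emeasure M (E \<inter> ?T C)"
    using rcp sets.Int[OF E T[OF C]] unfolding rcp_def by blast
  finally show ?thesis .
qed

lemma rcp_unique:
  assumes M: "prob_space M" "sets M = sets (path_space D)"
    and rcp: "rcp D M Qf" "rcp D M Qf'" and con: "consistent D M Qf" "consistent D M Qf'"
  shows "AE \<theta> in distr M (param_borel D) Theta. Qf \<theta> = Qf' \<theta>"
proof (rule kernel_AE_eq[where \<Omega>="space (path_space D)"])
  let ?\<nu> = "distr M (param_borel D) Theta"
  interpret prob_space M by (rule M(1))
  have mT: "Theta \<in> M \<rightarrow>\<^sub>M param_borel D"
    using measurable_Theta measurable_cong_sets[OF M(2) refl] by blast
  show "finite_measure ?\<nu>" by (rule prob_space.finite_measure[OF prob_space_distr[OF mT]])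
  have m\<nu>: "borel_measurable ?\<nu> = borel_measurable (param_borel D)" by (rule measurable_cong_sets) simp_all
  note b = sets_path_space_borel[of D]
  show "prob_space (Qf \<theta>) \<and> sets (Qf \<theta>) = sets (restrict_space borel (space (path_space D)))"
    if "\<theta> \<in> space ?\<nu>" for \<theta>
    using that rcp(1) b by (simp add: rcp_def prob_on_def)
  show "sets (Qf' \<theta>) = sets (restrict_space borel (space (path_space D)))" if "\<theta> \<in> space ?\<nu>" for \<theta>
    using that rcp(2) b by (simp add: rcp_def prob_on_def)
  fix E assume "E \<in> sets (restrict_space borel (space (path_space D)))"
  then have E: "E \<in> sets (path_space D)" by (simp only: b)
  show "(\<lambda>\<theta>. emeasure (Qf \<theta>) E) \<in> borel_measurable ?\<nu>" "(\<lambda>\<theta>. emeasure (Qf' \<theta>) E) \<in> borel_measurable ?\<nu>"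
    using rcp E unfolding m\<nu> rcp_def by blast+
  fix C assume "C \<in> sets ?\<nu>"
  then have C: "C \<in> sets (param_borel D)" by simp
  show "(\<integral>\<^sup>+\<theta>. emeasure (Qf \<theta>) E * indicator C \<theta> \<partial>?\<nu>) = (\<integral>\<^sup>+\<theta>. emeasure (Qf' \<theta>) E * indicator C \<theta> \<partial>?\<nu>)"
    by (simp only: rcp_integral[OF M(2) rcp(1) con(1) E C] rcp_integral[OF M(2) rcp(2) con(2) E C])
qed

context mixed_renewal
begin

lemma rcp_PL: "rcp D Q PL"
  unfolding rcp_def distr_Q_Theta
proof (intro conjI ballI)
  show "PL \<theta> \<in> prob_on (path_space D)" if "\<theta> \<in> D" for \<theta>
    using that prob_PL sets_PL by (simp add: prob_on_def)
  fix E assume E: "E \<in> sets (path_space D)"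
  show "(\<lambda>\<theta>. emeasure (PL \<theta>) E) \<in> borel_measurable (param_borel D)"
    using measurable_compose[OF measurable_PL_subprob measurable_emeasure_subprob_algebra[OF E]] by simp
  show "(\<integral>\<^sup>+\<theta>. emeasure (PL \<theta>) E \<partial>\<nu>) = emeasure Q E" by (rule emeasure_Q[OF E, symmetric])
qed

lemma consistent_PL: "consistent D Q PL"
  unfolding consistent_def distr_Q_Theta
proof (intro ballI AE_I2 impI)
  fix B \<theta> assume B: "B \<in> sets (param_borel D)" and \<theta>': "\<theta> \<in> space \<nu>" and \<theta>B: "\<theta> \<in> B"
  have \<theta>: "\<theta> \<in> D" using \<theta>' by (simp add: space_\<nu>)
  interpret prob_space "PL \<theta>" by (rule prob_PL[OF \<theta>])
  have ev: "Theta -` B \<inter> space (path_space D) \<in> events"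
    using measurable_sets[OF measurable_Theta B] by (simp add: sets_PL[OF \<theta>])
  have "AE \<omega> in PL \<theta>. \<omega> \<in> Theta -` B \<inter> space (path_space D)"
    using AE_PL_Theta[OF \<theta>] AE_space by eventually_elim (simp add: \<theta>B space_PL[OF \<theta>])
  then show "emeasure (PL \<theta>) (Theta -` B \<inter> space (path_space D)) = 1"
    using ev by (subst emeasure_eq_1_AE) simp_all
qed

end

section \<open>The correspondence between parameters and laws\<close>

context reference_law
begin

text \<open>A member of the class has the form of a mixture by the structure theorem, and equivalence up to every
  time is transferred to the data in both directions.\<close>

lemma exponential_structure:
  assumes \<rho>: "\<rho> \<in> M_plus D" and M: "M \<in> M_star l D P (\<lambda>\<theta>. Exp (\<rho> \<theta>))"
  defines "\<nu> \<equiv> distr M (param_borel D) Theta" and "R' \<equiv> distr M pos_borel (X 0)"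
  shows "mixed_renewal D (\<lambda>\<theta>. Exp (\<rho> \<theta>)) R' \<nu>" and "M = mixed_law D \<nu> (\<lambda>\<theta>. Exp (\<rho> \<theta>)) R'"
    and "absolutely_continuous \<mu> \<nu>" "absolutely_continuous \<nu> \<mu>"
    and "absolutely_continuous R R'" "absolutely_continuous R' R"
    and "AE \<theta> in \<mu>. absolutely_continuous (Exp (\<rho> \<theta>)) (K \<theta>)"
    and "\<exists>r. (\<lambda>(\<theta>, w). r \<theta> w) \<in> borel_measurable (param_borel D \<Otimes>\<^sub>M pos_borel) \<and>
      (AE \<theta> in \<mu>. rn_density (K \<theta>) (Exp (\<rho> \<theta>)) (r \<theta>))"
    and "(\<integral>\<^sup>+x. ennreal (x ^ l) \<partial>R') < \<infinity>" and "(\<integral>\<^sup>+\<theta>. ennreal (\<rho> \<theta> ^ l) \<partial>\<nu>) < \<infinity>"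
proof -
  have \<rho>m: "\<rho> \<in> borel_measurable (param_borel D)" and \<rho>p: "\<And>\<theta>. \<theta> \<in> D \<Longrightarrow> 0 < \<rho> \<theta>"
    using \<rho> by (auto simp: M_plus_def)
  have KE: "(\<lambda>\<theta>. Exp (\<rho> \<theta>)) \<in> param_borel D \<rightarrow>\<^sub>M prob_algebra pos_borel"
    by (rule measurable_Exp[OF \<rho>m]) (simp add: \<rho>p)
  have Mc: "M \<in> prob_on (path_space D)" "cond_indep_sets M (sigma_Theta D) (case_bool (sets (sigma_W D)) (sets (sigma_X D))) UNIV"
    "prob_space.indep_set M (sets (sigma_Theta D)) (sets (sigma_X D))" "prog_equiv D M P" "CMRP D M (\<lambda>\<theta>. Exp (\<rho> \<theta>))"
    "integrable M (\<lambda>\<omega>. X 0 \<omega> ^ l)" "integrable M (\<lambda>\<omega>. (1 / enn2real (cexp_W D M \<omega>)) ^ l)"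
    using M by (simp_all add: M_star_def M_class_def)
  show mQ: "mixed_renewal D (\<lambda>\<theta>. Exp (\<rho> \<theta>)) R' \<nu>" and Meq: "M = mixed_law D \<nu> (\<lambda>\<theta>. Exp (\<rho> \<theta>)) R'"
    unfolding \<nu>_def R'_def using mixed_law_unique[OF Mc(1) KE Mc(2,3,5)] by blast+
  interpret Q: mixed_renewal D "\<lambda>\<theta>. Exp (\<rho> \<theta>)" R' \<nu> by (rule mQ)
  interpret E: mixed_renewal D "\<lambda>\<theta>. Exp (\<rho> \<theta>)" R \<mu>
    by (simp add: mixed_renewal_def mixed_renewal_axioms_def renewal_kernel_def KE R local.\<nu>)
  have eq: "emeasure Q.Q A = 0 \<longleftrightarrow> emeasure P A = 0" if "0 \<le> t" "A \<in> sets (Filt D t)" for t A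
    using Mc(4) that unfolding prog_equiv_iff[OF Q.sets_Q[folded Meq] sets_Q] Meq[symmetric] by blast
  have ac1: "\<And>t A. 0 \<le> t \<Longrightarrow> A \<in> sets (Filt D t) \<Longrightarrow> emeasure P A = 0 \<Longrightarrow> emeasure Q.Q A = 0"
    and ac2: "\<And>t A. 0 \<le> t \<Longrightarrow> A \<in> sets (Filt D t) \<Longrightarrow> emeasure Q.Q A = 0 \<Longrightarrow> emeasure P A = 0"
    using eq by blast+
  have r1: "AE \<theta> in \<nu>. emeasure (Exp (\<rho> \<theta>)) {w \<in> {0<..}. (\<theta>, w) \<in> C} = 0"
    if "C \<in> sets (param_borel D \<Otimes>\<^sub>M pos_borel)" "AE \<theta> in \<mu>. emeasure (K \<theta>) {w \<in> {0<..}. (\<theta>, w) \<in> C} = 0" for C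
    by (rule filtration_ac_imp_data_ac(3)[OF mixed_renewal_axioms mQ _ that]) (rule ac1)
  have r2: "AE \<theta> in \<mu>. emeasure (K \<theta>) {w \<in> {0<..}. (\<theta>, w) \<in> C} = 0"
    if "C \<in> sets (param_borel D \<Otimes>\<^sub>M pos_borel)" "AE \<theta> in \<nu>. emeasure (Exp (\<rho> \<theta>)) {w \<in> {0<..}. (\<theta>, w) \<in> C} = 0" for C
    by (rule filtration_ac_imp_data_ac(3)[OF mQ mixed_renewal_axioms _ that]) (rule ac2)
  show \<mu>\<nu>: "absolutely_continuous \<mu> \<nu>"
    by (rule filtration_ac_imp_data_ac(1)[OF mixed_renewal_axioms mQ]) (rule ac1)
  show \<nu>\<mu>: "absolutely_continuous \<nu> \<mu>"
    by (rule filtration_ac_imp_data_ac(1)[OF mQ mixed_renewal_axioms]) (rule ac2)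
  show "absolutely_continuous R R'"
    by (rule filtration_ac_imp_data_ac(2)[OF mixed_renewal_axioms mQ]) (rule ac1)
  show "absolutely_continuous R' R"
    by (rule filtration_ac_imp_data_ac(2)[OF mQ mixed_renewal_axioms]) (rule ac2)
  have s\<nu>: "sets \<nu> = sets \<mu>" by (simp add: Q.sets_\<nu> local.sets_\<nu>)
  have AE1: "AE \<theta> in \<mu>. p \<theta>" if "AE \<theta> in \<nu>. p \<theta>" for p
    by (rule absolutely_continuous_AE[OF s\<nu>[symmetric] \<nu>\<mu> that])
  have AE2: "AE \<theta> in \<nu>. p \<theta>" if "AE \<theta> in \<mu>. p \<theta>" for p
    by (rule absolutely_continuous_AE[OF s\<nu> \<mu>\<nu> that])
  obtain r where "(\<lambda>(\<theta>, w). r \<theta> w) \<in> borel_measurable (param_borel D \<Otimes>\<^sub>M pos_borel)"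
    "AE \<theta> in \<mu>. rn_density (K \<theta>) (Exp (\<rho> \<theta>)) (r \<theta>)"
    by (rule kernel_density[OF mixed_renewal_axioms E.mixed_renewal_axioms AE1[OF r1]])
  then show "\<exists>r. (\<lambda>(\<theta>, w). r \<theta> w) \<in> borel_measurable (param_borel D \<Otimes>\<^sub>M pos_borel) \<and>
      (AE \<theta> in \<mu>. rn_density (K \<theta>) (Exp (\<rho> \<theta>)) (r \<theta>))" by blast
  obtain r' where r': "AE \<theta> in \<mu>. rn_density (Exp (\<rho> \<theta>)) (K \<theta>) (r' \<theta>)"
    by (rule kernel_density[OF E.mixed_renewal_axioms mixed_renewal_axioms r2[OF _ AE2]])
  then show "AE \<theta> in \<mu>. absolutely_continuous (Exp (\<rho> \<theta>)) (K \<theta>)"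
  proof eventually_elim
    case (elim \<theta>)
    then have e: "K \<theta> = density (Exp (\<rho> \<theta>)) (\<lambda>w. ennreal (r' \<theta> w))" and m: "r' \<theta> \<in> borel_measurable (Exp (\<rho> \<theta>))"
      by (simp_all only: rn_density_def)
    have "absolutely_continuous (Exp (\<rho> \<theta>)) (density (Exp (\<rho> \<theta>)) (\<lambda>w. ennreal (r' \<theta> w)))"
      by (rule absolutely_continuousI_density) (use m in simp)
    then show ?case by (simp only: e[symmetric])
  qed
  show "(\<integral>\<^sup>+x. ennreal (x ^ l) \<partial>R') < \<infinity>" using Mc(6) Q.integrable_X_power_iff[of l] by (simp only: Meq[symmetric])
  show "(\<integral>\<^sup>+\<theta>. ennreal (\<rho> \<theta> ^ l) \<partial>\<nu>) < \<infinity>"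
    using Mc(7) Q.M_star_conditions_Exp(2)[OF \<rho> refl, of l] by (simp only: Meq[symmetric])
qed

lemma exponential_change_exists:
  assumes \<rho>: "\<rho> \<in> M_plus D" and M: "M \<in> M_star l D P (\<lambda>\<theta>. Exp (\<rho> \<theta>))"
  shows "\<exists>\<gamma> \<alpha> \<xi>. (\<gamma>, \<alpha>) \<in> F_class l D P \<and> \<xi> \<in> R_star l D P \<alpha> \<and>
    cond_A P M \<gamma> \<and> cond_B D P M \<xi> \<and> cond_C D P \<rho> \<alpha> \<and> cond_D D K P M \<rho> \<gamma> \<xi> \<and>
    martingale_measure l D M (V D P \<gamma> \<alpha>)"
proof -
  have \<rho>m[measurable]: "\<rho> \<in> borel_measurable (param_borel D)" and \<rho>p: "\<And>\<theta>. \<theta> \<in> D \<Longrightarrow> 0 < \<rho> \<theta>"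
    using \<rho> by (auto simp: M_plus_def)
  define \<nu>' where "\<nu>' = distr M (param_borel D) Theta"
  define R' where "R' = distr M pos_borel (X 0)"
  note st = exponential_structure[OF \<rho> M, folded \<nu>'_def R'_def]
  interpret Q: mixed_renewal D "\<lambda>\<theta>. Exp (\<rho> \<theta>)" R' \<nu>' by (rule st(1))
  obtain r where r: "(\<lambda>(\<theta>, w). r \<theta> w) \<in> borel_measurable (param_borel D \<Otimes>\<^sub>M pos_borel)"
    and rn: "AE \<theta> in \<mu>. rn_density (K \<theta>) (Exp (\<rho> \<theta>)) (r \<theta>)" using st(8) by blast
  obtain f where f: "f \<in> borel_measurable R" "AE x in R. 0 < f x" "R' = density R (\<lambda>x. ennreal (f x))"
    by (rule equivalent_density[OF prob_R Q.prob_R _ st(5,6)]) (simp_all add: Q.sets_R sets_R)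
  obtain \<xi> where \<xi>': "\<xi> \<in> borel_measurable \<mu>" and \<xi>p: "AE \<theta> in \<mu>. 0 < \<xi> \<theta>" and \<nu>\<xi>: "\<nu>' = density \<mu> (\<lambda>\<theta>. ennreal (\<xi> \<theta>))"
    by (rule equivalent_density[OF local.prob_\<nu> Q.prob_\<nu> _ st(3,4)]) (simp_all add: Q.sets_\<nu> local.sets_\<nu>)
  have \<xi>[measurable]: "\<xi> \<in> borel_measurable (param_borel D)" using \<xi>' by (simp only: local.measurable_\<nu>)
  have \<xi>nn: "AE \<theta> in \<mu>. 0 \<le> \<xi> \<theta>" using \<xi>p by eventually_elim simp
  have fm[measurable]: "f \<in> borel_measurable pos_borel"
    using f(1) measurable_cong_sets[OF sets_R refl] by blast
  define \<gamma> where "\<gamma> = (\<lambda>x. ln (f x))"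
  have \<gamma>[measurable]: "\<gamma> \<in> borel_measurable pos_borel" unfolding \<gamma>_def by measurable
  note [measurable_cong] = sets_R
  have R': "R' = density R (\<lambda>x. ennreal (exp (\<gamma> x)))"
    unfolding f(3)
  proof (rule density_cong)
    show "AE x in R. ennreal (f x) = ennreal (exp (\<gamma> x))" using f(2) by eventually_elim (simp add: \<gamma>_def)
  qed measurable
  define \<alpha> where "\<alpha> = (\<lambda>\<theta>. ln (\<rho> \<theta>) + ln (mean \<theta>))"
  have \<alpha>[measurable]: "\<alpha> \<in> borel_measurable (param_borel D)" unfolding \<alpha>_def by measurable
  have \<rho>\<alpha>: "AE \<theta> in \<mu>. \<rho> \<theta> = exp (\<alpha> \<theta>) / mean \<theta>"
    using AE_mean AE_space by eventually_elim (simp add: \<alpha>_def exp_add \<rho>p local.space_\<nu>)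
  have one: "(\<integral>\<^sup>+x. ennreal (exp (\<gamma> x)) \<partial>R) = 1"
  proof -
    have "emeasure R' (space R') = (\<integral>\<^sup>+x. ennreal (exp (\<gamma> x)) * indicator (space R) x \<partial>R)"
      unfolding R' by (subst emeasure_density) simp_all
    also have "\<dots> = (\<integral>\<^sup>+x. ennreal (exp (\<gamma> x)) \<partial>R)" by (intro nn_integral_cong) simp
    finally show ?thesis using prob_space.emeasure_space_1[OF Q.prob_R] by simp
  qed
  have mom: "(\<integral>\<^sup>+x. ennreal (x ^ l * exp (\<gamma> x)) \<partial>R) = (\<integral>\<^sup>+x. ennreal (x ^ l) \<partial>R')"
  proof -
    have "(\<integral>\<^sup>+x. ennreal (x ^ l) \<partial>R') = (\<integral>\<^sup>+x. ennreal (exp (\<gamma> x)) * ennreal (x ^ l) \<partial>R)"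
      unfolding R' by (rule nn_integral_density) measurable
    also have "\<dots> = (\<integral>\<^sup>+x. ennreal (x ^ l * exp (\<gamma> x)) \<partial>R)"
      by (intro nn_integral_cong) (simp add: ennreal_mult'' mult.commute)
    finally show ?thesis ..
  qed
  have \<xi>1: "(\<integral>\<^sup>+\<theta>. ennreal (\<xi> \<theta>) \<partial>\<mu>) = 1"
  proof -
    have "emeasure \<nu>' (space \<nu>') = (\<integral>\<^sup>+\<theta>. ennreal (\<xi> \<theta>) * indicator (space \<mu>) \<theta> \<partial>\<mu>)"
      unfolding \<nu>\<xi> using \<xi>' by (subst emeasure_density) simp_all
    also have "\<dots> = (\<integral>\<^sup>+\<theta>. ennreal (\<xi> \<theta>) \<partial>\<mu>)" by (intro nn_integral_cong) simp
    finally show ?thesis using prob_space.emeasure_space_1[OF Q.prob_\<nu>] by simp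
  qed
  have \<xi>\<rho>: "(\<integral>\<^sup>+\<theta>. ennreal (\<xi> \<theta> * \<rho> \<theta> ^ l) \<partial>\<mu>) = (\<integral>\<^sup>+\<theta>. ennreal (\<rho> \<theta> ^ l) \<partial>\<nu>')"
  proof -
    have "(\<integral>\<^sup>+\<theta>. ennreal (\<rho> \<theta> ^ l) \<partial>\<nu>') = (\<integral>\<^sup>+\<theta>. ennreal (\<xi> \<theta>) * ennreal (\<rho> \<theta> ^ l) \<partial>\<mu>)"
      unfolding \<nu>\<xi> by (rule nn_integral_density) (simp_all add: local.measurable_\<nu>)
    also have "\<dots> = (\<integral>\<^sup>+\<theta>. ennreal (\<xi> \<theta> * \<rho> \<theta> ^ l) \<partial>\<mu>)"
      using \<xi>nn by (intro nn_integral_cong_AE) (auto elim!: eventually_mono simp: ennreal_mult')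
    finally show ?thesis ..
  qed
  have F: "(\<gamma>, \<alpha>) \<in> F_class l D P" using one mom st(9) by (simp add: F_class_iff)
  have Rs: "\<xi> \<in> R_star l D P \<alpha>" using \<xi>p \<xi>1 \<xi>\<rho> st(10) by (simp add: R_star_iff[OF \<rho> \<alpha> \<rho>\<alpha>])
  have cA: "cond_A P M \<gamma>" using R' by (simp add: cond_A_iff[OF \<gamma>] R'_def)
  have cB: "cond_B D P M \<xi>"
    using \<nu>\<xi> \<xi>' \<xi>nn unfolding cond_B_def local.distr_Q_Theta \<nu>'_def[symmetric] rn_density_def by blast
  have cC: "cond_C D P \<rho> \<alpha>" by (simp add: cond_C_iff[OF \<rho> \<alpha>] \<rho>\<alpha>)
  have cD: "cond_D D K P M \<rho> \<gamma> \<xi>"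
    unfolding cond_D_def local.distr_Q_Theta
  proof (intro exI[of _ r] conjI allI impI ballI r rn)
    fix s t A assume "0 \<le> s \<and> s \<le> t" and A: "A \<in> sets (Filt D s)"
    then have s: "s \<le> t" and t: "0 \<le> t" by simp_all
    show "measure M A = (LINT \<omega>:A|P. M_beta K \<rho> \<gamma> \<xi> r t \<omega>)"
      unfolding st(2)
      by (rule cond_D_mixed[OF st(1) \<rho> \<xi> \<xi>nn \<nu>\<xi> r rn \<gamma> R' t subsetD[OF Filt_mono[OF s] A]])
  qed
  have mg: "martingale_measure l D M (V D P \<gamma> \<alpha>)"
    unfolding st(2) by (rule martingale_V[OF st(1) \<rho> st(3) \<gamma> R' \<alpha> \<rho>\<alpha> st(9,10)])
  from F Rs cA cB cC cD mg show ?thesis by blast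
qed

lemma exponential_change_unique:
  assumes \<rho>: "\<rho> \<in> M_plus D"
    and 1: "(\<gamma>, \<alpha>) \<in> F_class l D P" "cond_A P M \<gamma>" "cond_B D P M \<xi>" "cond_C D P \<rho> \<alpha>"
    and 2: "(\<gamma>', \<alpha>') \<in> F_class l D P" "cond_A P M \<gamma>'" "cond_B D P M \<xi>'" "cond_C D P \<rho> \<alpha>'"
  shows "AE x in distr P pos_borel (X 0). \<gamma>' x = \<gamma> x"
    and "AE \<theta> in distr P (param_borel D) Theta. \<alpha>' \<theta> = \<alpha> \<theta>"
    and "AE \<theta> in distr P (param_borel D) Theta. \<xi>' \<theta> = \<xi> \<theta>"
proof -
  have g: "\<gamma> \<in> borel_measurable pos_borel" "\<gamma>' \<in> borel_measurable pos_borel"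
    and a: "\<alpha> \<in> borel_measurable (param_borel D)" "\<alpha>' \<in> borel_measurable (param_borel D)"
    using 1(1) 2(1) by (simp_all add: F_class_iff)
  note [measurable] = g
  note [measurable_cong] = sets_R
  interpret r: prob_space R by (rule prob_R)
  interpret m: prob_space \<mu> by (rule local.prob_\<nu>)
  have "density R (\<lambda>x. ennreal (exp (\<gamma>' x))) = density R (\<lambda>x. ennreal (exp (\<gamma> x)))"
    using 1(2) 2(2) by (simp only: cond_A_iff[OF g(1)] cond_A_iff[OF g(2)])
  then have "AE x in R. ennreal (exp (\<gamma>' x)) = ennreal (exp (\<gamma> x))"
    by (subst (asm) r.density_unique_iff) measurable
  then show "AE x in distr P pos_borel (X 0). \<gamma>' x = \<gamma> x"
    unfolding iid_Q_X(2) by eventually_elim simp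
  show "AE \<theta> in distr P (param_borel D) Theta. \<alpha>' \<theta> = \<alpha> \<theta>"
    using 1(4)[unfolded cond_C_iff[OF \<rho> a(1)]] 2(4)[unfolded cond_C_iff[OF \<rho> a(2)]] AE_mean
    unfolding local.distr_Q_Theta by eventually_elim simp
  have x: "\<xi> \<in> borel_measurable \<mu>" "\<xi>' \<in> borel_measurable \<mu>" "AE \<theta> in \<mu>. 0 \<le> \<xi> \<theta>" "AE \<theta> in \<mu>. 0 \<le> \<xi>' \<theta>"
    "density \<mu> (\<lambda>\<theta>. ennreal (\<xi>' \<theta>)) = density \<mu> (\<lambda>\<theta>. ennreal (\<xi> \<theta>))"
    using 1(3) 2(3) unfolding cond_B_def local.distr_Q_Theta rn_density_def by simp_all
  have "AE \<theta> in \<mu>. ennreal (\<xi>' \<theta>) = ennreal (\<xi> \<theta>)"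
    using x(5) by (subst (asm) m.density_unique_iff) (use x(1,2) in simp_all)
  then show "AE \<theta> in distr P (param_borel D) Theta. \<xi>' \<theta> = \<xi> \<theta>"
    using x(3,4) unfolding local.distr_Q_Theta by eventually_elim simp
qed

text \<open>The rate is forced by (C) and the law by the data \<open>(\<nu>', R')\<close> with densities \<open>\<xi>\<close> and \<open>exp \<circ> \<gamma>\<close>. Equivalence
  of \<open>K \<theta>\<close> to exponential laws makes the likelihood ratio available and positive, so that the law is
  progressively equivalent to the reference law. A competitor satisfies the same density formula with
  a rate that agrees almost everywhere, hence coincides on the filtration.\<close>

lemma exponential_law_exists:
  assumes equiv: "AE \<theta> in \<mu>. \<forall>b>0. equiv_measure (K \<theta>) (Exp b)"
    and F: "(\<gamma>, \<alpha>) \<in> F_class l D P" and Rs: "\<xi> \<in> R_star l D P \<alpha>"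
  shows "\<exists>\<rho> M. \<rho> \<in> M_plus D \<and> M \<in> M_star l D P (\<lambda>\<theta>. Exp (\<rho> \<theta>)) \<and>
    cond_C D P \<rho> \<alpha> \<and> cond_D D K P M \<rho> \<gamma> \<xi> \<and> cond_A P M \<gamma> \<and> cond_B D P M \<xi> \<and>
    martingale_measure l D M (V D P \<gamma> \<alpha>) \<and>
    (\<forall>\<rho>' M'. \<rho>' \<in> M_plus D \<and> M' \<in> prob_on (path_space D) \<and>
      cond_C D P \<rho>' \<alpha> \<and> cond_D D K P M' \<rho>' \<gamma> \<xi> \<longrightarrow>
      (AE \<theta> in distr P (param_borel D) Theta. \<rho>' \<theta> = \<rho> \<theta>) \<and> M' = M)"
proof -
  have \<gamma>[measurable]: "\<gamma> \<in> borel_measurable pos_borel" and \<alpha>[measurable]: "\<alpha> \<in> borel_measurable (param_borel D)"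
    and one: "(\<integral>\<^sup>+x. ennreal (exp (\<gamma> x)) \<partial>R) = 1" and mom: "(\<integral>\<^sup>+x. ennreal (x ^ l * exp (\<gamma> x)) \<partial>R) < \<infinity>"
    using F by (simp_all add: F_class_iff)
  note [measurable_cong] = sets_R
  have mexp: "(\<lambda>x. ennreal (exp (\<gamma> x))) \<in> borel_measurable R" and mpow: "(\<lambda>x. ennreal (x ^ l)) \<in> borel_measurable R"
    by measurable
  \<comment> \<open>The rate solving (C). On the null set of infinite means, where \<open>mean\<close> is \<open>0\<close>, the value \<open>1\<close> keeps it
    positive, as a member of \<open>M_plus\<close> has to be positive everywhere.\<close>
  define \<rho> where "\<rho> = (\<lambda>\<theta>. if 0 < mean \<theta> then exp (\<alpha> \<theta>) / mean \<theta> else 1)"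
  have \<rho>m[measurable]: "\<rho> \<in> borel_measurable (param_borel D)" unfolding \<rho>_def by measurable
  have \<rho>p: "0 < \<rho> \<theta>" for \<theta> by (simp add: \<rho>_def)
  have \<rho>: "\<rho> \<in> M_plus D" by (simp add: M_plus_def \<rho>p)
  have \<rho>\<alpha>: "AE \<theta> in \<mu>. \<rho> \<theta> = exp (\<alpha> \<theta>) / mean \<theta>" using AE_mean by eventually_elim (simp add: \<rho>_def)
  have \<xi>[measurable]: "\<xi> \<in> borel_measurable (param_borel D)" and \<xi>p: "AE \<theta> in \<mu>. 0 < \<xi> \<theta>"
    and \<xi>1: "(\<integral>\<^sup>+\<theta>. ennreal (\<xi> \<theta>) \<partial>\<mu>) = 1" and \<xi>\<rho>: "(\<integral>\<^sup>+\<theta>. ennreal (\<xi> \<theta> * \<rho> \<theta> ^ l) \<partial>\<mu>) < \<infinity>"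
    using Rs by (simp_all add: R_star_iff[OF \<rho> \<alpha> \<rho>\<alpha>])
  have \<xi>nn: "AE \<theta> in \<mu>. 0 \<le> \<xi> \<theta>" using \<xi>p by eventually_elim simp
  have \<xi>': "\<xi> \<in> borel_measurable \<mu>" by (simp add: local.measurable_\<nu>)
  define \<nu>' where "\<nu>' = density \<mu> (\<lambda>\<theta>. ennreal (\<xi> \<theta>))"
  define R' where "R' = density R (\<lambda>x. ennreal (exp (\<gamma> x)))"
  have KE: "(\<lambda>\<theta>. Exp (\<rho> \<theta>)) \<in> param_borel D \<rightarrow>\<^sub>M prob_algebra pos_borel"
    by (rule measurable_Exp[OF \<rho>m]) (rule \<rho>p)
  have pR': "R' \<in> space (prob_algebra pos_borel)"
  proof -
    have "emeasure R' (space R') = (\<integral>\<^sup>+x. ennreal (exp (\<gamma> x)) * indicator (space R) x \<partial>R)"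
      unfolding R'_def by (subst emeasure_density) simp_all
    also have "\<dots> = (\<integral>\<^sup>+x. ennreal (exp (\<gamma> x)) \<partial>R)" by (intro nn_integral_cong) simp
    finally have "prob_space R'" using one by (intro prob_spaceI) simp
    then show ?thesis by (simp add: space_prob_algebra) (simp add: R'_def sets_R)
  qed
  have p\<nu>': "\<nu>' \<in> space (prob_algebra (param_borel D))"
  proof -
    have "emeasure \<nu>' (space \<nu>') = (\<integral>\<^sup>+\<theta>. ennreal (\<xi> \<theta>) * indicator (space \<mu>) \<theta> \<partial>\<mu>)"
      unfolding \<nu>'_def using \<xi>' by (subst emeasure_density) simp_all
    also have "\<dots> = (\<integral>\<^sup>+\<theta>. ennreal (\<xi> \<theta>) \<partial>\<mu>)" by (intro nn_integral_cong) simp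
    finally have "prob_space \<nu>'" using \<xi>1 by (intro prob_spaceI) simp
    then show ?thesis by (simp add: space_prob_algebra) (simp add: \<nu>'_def local.sets_\<nu>)
  qed
  have mQ: "mixed_renewal D (\<lambda>\<theta>. Exp (\<rho> \<theta>)) R' \<nu>'"
    by (simp add: mixed_renewal_def mixed_renewal_axioms_def renewal_kernel_def KE pR' p\<nu>')
  interpret Q: mixed_renewal D "\<lambda>\<theta>. Exp (\<rho> \<theta>)" R' \<nu>' by (rule mQ)
  interpret E: mixed_renewal D "\<lambda>\<theta>. Exp (\<rho> \<theta>)" R \<mu>
    by (simp add: mixed_renewal_def mixed_renewal_axioms_def renewal_kernel_def KE R local.\<nu>)
  have acK: "AE \<theta> in \<mu>. absolutely_continuous (K \<theta>) (Exp (\<rho> \<theta>)) \<and> absolutely_continuous (Exp (\<rho> \<theta>)) (K \<theta>)"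
    using equiv by eventually_elim (simp add: equiv_measure_def \<rho>p)
  obtain r where r: "(\<lambda>(\<theta>, w). r \<theta> w) \<in> borel_measurable (param_borel D \<Otimes>\<^sub>M pos_borel)"
    and rn: "AE \<theta> in \<mu>. rn_density (K \<theta>) (Exp (\<rho> \<theta>)) (r \<theta>)"
  proof (rule kernel_density[OF mixed_renewal_axioms E.mixed_renewal_axioms])
    fix C assume C: "C \<in> sets (param_borel D \<Otimes>\<^sub>M pos_borel)"
      and z: "AE \<theta> in \<mu>. emeasure (K \<theta>) {w \<in> {0<..}. (\<theta>, w) \<in> C} = 0"
    show "AE \<theta> in \<mu>. emeasure (Exp (\<rho> \<theta>)) {w \<in> {0<..}. (\<theta>, w) \<in> C} = 0"
      using z acK AE_space
    proof eventually_elim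
      case (elim \<theta>)
      then have \<theta>: "\<theta> \<in> D" by (simp add: local.space_\<nu>)
      have "Pair \<theta> -` C \<inter> space pos_borel \<in> sets pos_borel"
        by (rule measurable_sets[OF measurable_Pair1' C]) (use \<theta> in simp)
      moreover have "Pair \<theta> -` C \<inter> space pos_borel = {w \<in> {0<..}. (\<theta>, w) \<in> C}" by auto
      ultimately have "{w \<in> {0<..}. (\<theta>, w) \<in> C} \<in> null_sets (K \<theta>)"
        using elim(1) by (intro null_setsI) (simp_all only: sets_K[OF \<theta>])
      then have "{w \<in> {0<..}. (\<theta>, w) \<in> C} \<in> null_sets (Exp (\<rho> \<theta>))"
        using elim(2) unfolding absolutely_continuous_def by blast
      then show ?case by (rule null_setsD1)
    qed
  qed
  have acX: "AE \<theta> in \<mu>. absolutely_continuous (Exp (\<rho> \<theta>)) (K \<theta>)" using acK by eventually_elim simp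
  note L = emeasure_mixed_Filt[OF mixed_renewal_axioms mQ \<rho> \<xi> \<xi>nn \<nu>'_def r rn \<gamma> R'_def]
  have pe: "prog_equiv D Q.Q P"
    unfolding prog_equiv_iff[OF Q.sets_Q sets_Q]
  proof (intro allI impI ballI)
    fix t :: real and A assume t: "0 \<le> t" and A: "A \<in> sets (Filt D t)"
    show "emeasure Q.Q A = 0 \<longleftrightarrow> emeasure P A = 0"
    proof (rule emeasure_density_null_iff[OF L(1)[OF t A]])
      show "M_beta K \<rho> \<gamma> \<xi> r t \<in> borel_measurable P"
        using measurable_M_beta[OF \<rho>m \<xi> \<gamma> r t] by (simp add: measurable_Q)
      show "A \<in> sets P" using subsetD[OF Filt_subset_path A] by (simp add: sets_Q)
      show "AE \<omega> in P. 0 < M_beta K \<rho> \<gamma> \<xi> r t \<omega>" by (rule L(3)[OF t \<xi>p acX])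
    qed
  qed
  have Rl: "(\<integral>\<^sup>+x. ennreal (x ^ l) \<partial>R') < \<infinity>"
  proof -
    have "(\<integral>\<^sup>+x. ennreal (x ^ l) \<partial>R') = (\<integral>\<^sup>+x. ennreal (exp (\<gamma> x)) * ennreal (x ^ l) \<partial>R)"
      unfolding R'_def by (rule nn_integral_density[OF mexp mpow])
    also have "\<dots> = (\<integral>\<^sup>+x. ennreal (x ^ l * exp (\<gamma> x)) \<partial>R)"
      by (intro nn_integral_cong) (simp add: ennreal_mult'' mult.commute)
    finally show ?thesis using mom by simp
  qed
  have \<rho>l: "(\<integral>\<^sup>+\<theta>. ennreal (\<rho> \<theta> ^ l) \<partial>\<nu>') < \<infinity>"
  proof -
    have "(\<integral>\<^sup>+\<theta>. ennreal (\<rho> \<theta> ^ l) \<partial>\<nu>') = (\<integral>\<^sup>+\<theta>. ennreal (\<xi> \<theta>) * ennreal (\<rho> \<theta> ^ l) \<partial>\<mu>)"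
      unfolding \<nu>'_def by (rule nn_integral_density) (simp_all add: local.measurable_\<nu>)
    also have "\<dots> = (\<integral>\<^sup>+\<theta>. ennreal (\<xi> \<theta> * \<rho> \<theta> ^ l) \<partial>\<mu>)"
      using \<xi>nn by (intro nn_integral_cong_AE) (auto elim!: eventually_mono simp: ennreal_mult')
    finally show ?thesis using \<xi>\<rho> by simp
  qed
  have Ms: "Q.Q \<in> M_star l D P (\<lambda>\<theta>. Exp (\<rho> \<theta>))"
    unfolding M_star_def
    using pe Q.M_class_Q_iff[OF Rl] Q.M_star_conditions_Exp[OF \<rho> refl] \<rho>l by simp
  have cC: "cond_C D P \<rho> \<alpha>" by (simp add: cond_C_iff[OF \<rho> \<alpha>] \<rho>\<alpha>)
  have cDr: "measure Q.Q A = (LINT \<omega>:A|P. M_beta K \<rho> \<gamma> \<xi> r' t \<omega>)"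
    if "(\<lambda>(\<theta>, w). r' \<theta> w) \<in> borel_measurable (param_borel D \<Otimes>\<^sub>M pos_borel)"
      "AE \<theta> in \<mu>. rn_density (K \<theta>) (Exp (\<rho> \<theta>)) (r' \<theta>)" "0 \<le> t" "A \<in> sets (Filt D t)" for r' t A
    by (rule cond_D_mixed[OF mQ \<rho> \<xi> \<xi>nn \<nu>'_def that(1,2) \<gamma> R'_def that(3,4)])
  have cD: "cond_D D K P Q.Q \<rho> \<gamma> \<xi>"
    unfolding cond_D_def local.distr_Q_Theta
  proof (intro exI[of _ r] conjI allI impI ballI r rn)
    fix s t A assume "0 \<le> s \<and> s \<le> t" and A: "A \<in> sets (Filt D s)"
    then have s: "s \<le> t" and t: "0 \<le> t" by simp_all
    show "measure Q.Q A = (LINT \<omega>:A|P. M_beta K \<rho> \<gamma> \<xi> r t \<omega>)"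
      by (rule cDr[OF r rn t subsetD[OF Filt_mono[OF s] A]])
  qed
  have cA: "cond_A P Q.Q \<gamma>" unfolding cond_A_iff[OF \<gamma>] Q.iid_Q_X(2) by (rule R'_def)
  have cB: "cond_B D P Q.Q \<xi>"
    using \<xi>' \<xi>nn \<nu>'_def unfolding cond_B_def local.distr_Q_Theta Q.distr_Q_Theta rn_density_def by blast
  have \<mu>\<nu>: "absolutely_continuous \<mu> \<nu>'"
    unfolding \<nu>'_def by (rule absolutely_continuousI_density) (use \<xi>' in simp)
  have mg: "martingale_measure l D Q.Q (V D P \<gamma> \<alpha>)"
    by (rule martingale_V[OF mQ \<rho> \<mu>\<nu> \<gamma> R'_def \<alpha> \<rho>\<alpha> Rl \<rho>l])
  have un: "(AE \<theta> in distr P (param_borel D) Theta. \<rho>' \<theta> = \<rho> \<theta>) \<and> M' = Q.Q"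
    if \<rho>': "\<rho>' \<in> M_plus D" and M': "M' \<in> prob_on (path_space D)" and C': "cond_C D P \<rho>' \<alpha>"
      and D': "cond_D D K P M' \<rho>' \<gamma> \<xi>" for \<rho>' M'
  proof
    have \<rho>'m[measurable]: "\<rho>' \<in> borel_measurable (param_borel D)" using \<rho>' by (simp add: M_plus_def)
    have ae: "AE \<theta> in \<mu>. \<rho>' \<theta> = \<rho> \<theta>"
      using C'[unfolded cond_C_iff[OF \<rho>' \<alpha>]] \<rho>\<alpha> by eventually_elim simp
    then show "AE \<theta> in distr P (param_borel D) Theta. \<rho>' \<theta> = \<rho> \<theta>" by (simp only: local.distr_Q_Theta)
    obtain r' where r': "(\<lambda>(\<theta>, w). r' \<theta> w) \<in> borel_measurable (param_borel D \<Otimes>\<^sub>M pos_borel)"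
      and rn': "AE \<theta> in \<mu>. rn_density (K \<theta>) (Exp (\<rho>' \<theta>)) (r' \<theta>)"
      and D': "\<And>s t A. 0 \<le> s \<Longrightarrow> s \<le> t \<Longrightarrow> A \<in> sets (Filt D s) \<Longrightarrow>
        measure M' A = (LINT \<omega>:A|P. M_beta K \<rho>' \<gamma> \<xi> r' t \<omega>)"
      using D' unfolding cond_D_def local.distr_Q_Theta by blast
    have rn'': "AE \<theta> in \<mu>. rn_density (K \<theta>) (Exp (\<rho> \<theta>)) (r' \<theta>)"
      using rn' ae by eventually_elim simp
    show "M' = Q.Q"
    proof (rule measure_eqI_Filt[OF M'])
      show "Q.Q \<in> prob_on (path_space D)" using Q.prob_Q Q.sets_Q by (simp add: prob_on_def)
      fix t :: real and A assume t: "0 \<le> t" and A: "A \<in> sets (Filt D t)"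
      note m1[measurable] = measurable_M_beta[OF \<rho>m \<xi> \<gamma> r' t] and m2[measurable] = measurable_M_beta[OF \<rho>'m \<xi> \<gamma> r' t]
      note [measurable_cong] = sets_Q
      have [measurable]: "A \<in> sets (path_space D)" using subsetD[OF Filt_subset_path A] .
      have "measure M' A = (LINT \<omega>:A|P. M_beta K \<rho>' \<gamma> \<xi> r' t \<omega>)" by (rule D'[OF t order_refl A])
      also have "\<dots> = (LINT \<omega>:A|P. M_beta K \<rho> \<gamma> \<xi> r' t \<omega>)"
        unfolding set_lebesgue_integral_def
      proof (rule integral_cong_AE)
        show "AE \<omega> in P. indicator A \<omega> *\<^sub>R M_beta K \<rho>' \<gamma> \<xi> r' t \<omega> = indicator A \<omega> *\<^sub>R M_beta K \<rho> \<gamma> \<xi> r' t \<omega>"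
          using AE_Q_of_\<nu>[OF ae] by eventually_elim (simp add: M_beta_def)
      qed measurable
      also have "\<dots> = measure Q.Q A" by (rule cDr[OF r' rn'' t A, symmetric])
      finally show "measure M' A = measure Q.Q A" .
    qed
  qed
  show ?thesis
    using \<rho> Ms cC cD cA cB mg un by blast
qed

text \<open>The conditional laws are the components of the mixture. For almost every \<open>\<theta>\<close> all conditions reduce to
  the results for renewal laws with fixed parameter, and the martingale property is the one for
  mixtures, applied to the point mass at \<open>\<theta>\<close>.\<close>

lemma exponential_disintegration:
  assumes \<rho>: "\<rho> \<in> M_plus D" and M: "M \<in> M_star l D P (\<lambda>\<theta>. Exp (\<rho> \<theta>))"
    and F: "(\<gamma>, \<alpha>) \<in> F_class l D P" and A: "cond_A P M \<gamma>" and C: "cond_C D P \<rho> \<alpha>"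
  shows "\<exists>Qf. rcp D M Qf \<and> consistent D M Qf \<and>
    (\<forall>Qf'. rcp D M Qf' \<and> consistent D M Qf' \<longrightarrow>
      (\<exists>L'\<in>null_sets (distr M (param_borel D) Theta). \<forall>\<theta>\<in>D - L'. Qf' \<theta> = Qf \<theta>)) \<and>
    (\<exists>L\<in>null_sets (distr P (param_borel D) Theta). \<forall>\<theta>\<in>D - L.
      Qf \<theta> \<in> M_star_at l D (distr M (param_borel D) Theta) Qf (path_law D K R \<theta>) (Exp (\<rho> \<theta>)) \<and>
      cond_A P M \<gamma> \<and>
      \<rho> \<theta> = exp (\<alpha> \<theta>) / (\<integral>\<omega>. W 0 \<omega> \<partial>path_law D K R \<theta>) \<and>
      cond_D_at D (K \<theta>) (path_law D K R \<theta>) (Qf \<theta>) (\<rho> \<theta>) \<gamma> \<and>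
      martingale_measure l D (Qf \<theta>) (V_at (path_law D K R \<theta>) \<gamma> \<alpha> \<theta>))"
proof -
  have \<rho>m[measurable]: "\<rho> \<in> borel_measurable (param_borel D)" and \<rho>p: "\<And>\<theta>. \<theta> \<in> D \<Longrightarrow> 0 < \<rho> \<theta>"
    using \<rho> by (auto simp: M_plus_def)
  have \<gamma>[measurable]: "\<gamma> \<in> borel_measurable pos_borel" and \<alpha>[measurable]: "\<alpha> \<in> borel_measurable (param_borel D)"
    using F by (simp_all add: F_class_iff)
  define \<nu>' where "\<nu>' = distr M (param_borel D) Theta"
  define R' where "R' = distr M pos_borel (X 0)"
  note st = exponential_structure[OF \<rho> M, folded \<nu>'_def R'_def]
  interpret Q: mixed_renewal D "\<lambda>\<theta>. Exp (\<rho> \<theta>)" R' \<nu>' by (rule st(1))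
  note Meq = st(2)
  obtain r where rn: "AE \<theta> in \<mu>. rn_density (K \<theta>) (Exp (\<rho> \<theta>)) (r \<theta>)" using st(8) by blast
  have R': "R' = density R (\<lambda>x. ennreal (exp (\<gamma> x)))" using A unfolding cond_A_iff[OF \<gamma>] R'_def .
  have \<rho>\<alpha>: "AE \<theta> in \<mu>. \<rho> \<theta> = exp (\<alpha> \<theta>) / mean \<theta>" using C unfolding cond_C_iff[OF \<rho> \<alpha>] .
  have rc: "rcp D M Q.PL" and co: "consistent D M Q.PL"
    unfolding Meq by (rule Q.rcp_PL, rule Q.consistent_PL)
  have pM: "prob_space M" "sets M = sets (path_space D)"
    unfolding Meq by (rule Q.prob_Q, rule Q.sets_Q)
  have un: "\<exists>L'\<in>null_sets \<nu>'. \<forall>\<theta>\<in>D - L'. Qf' \<theta> = Q.PL \<theta>" if "rcp D M Qf'" "consistent D M Qf'" for Qf'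
  proof -
    have "AE \<theta> in \<nu>'. Q.PL \<theta> = Qf' \<theta>"
      unfolding \<nu>'_def by (rule rcp_unique[OF pM rc that(1) co that(2)])
    then obtain L' where L': "{\<theta> \<in> space \<nu>'. Q.PL \<theta> \<noteq> Qf' \<theta>} \<subseteq> L'" "emeasure \<nu>' L' = 0" "L' \<in> sets \<nu>'"
      by (rule AE_E)
    then have "L' \<in> null_sets \<nu>'" by (intro null_setsI)
    moreover have "\<forall>\<theta>\<in>D - L'. Qf' \<theta> = Q.PL \<theta>" using L'(1) by (auto simp: Q.space_\<nu>)
    ultimately show ?thesis by blast
  qed
  have W0: "(\<integral>\<^sup>+\<omega>. ennreal (W 0 \<omega>) \<partial>Q.PL \<theta>) = ennreal (1 / \<rho> \<theta>)" if \<theta>: "\<theta> \<in> D" for \<theta>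
  proof -
    have "(\<integral>\<^sup>+\<omega>. ennreal (W 0 \<omega>) \<partial>Q.PL \<theta>) = (\<integral>\<^sup>+w. ennreal w \<partial>Exp (\<rho> \<theta>))"
      by (rule Q.nn_integral_PL_W[OF \<theta>]) measurable
    then show ?thesis by (simp add: nn_integral_Exp_ident[OF \<rho>p[OF \<theta>]])
  qed
  have fam1: "AE \<theta> in \<nu>'. (\<integral>\<^sup>+\<omega>. ennreal (W 0 \<omega>) \<partial>Q.PL \<theta>) < \<infinity>"
    by (rule AE_I2) (simp add: Q.space_\<nu> W0)
  have fam2: "integrable \<nu>' (\<lambda>\<theta>. (1 / enn2real (\<integral>\<^sup>+\<omega>. ennreal (W 0 \<omega>) \<partial>Q.PL \<theta>)) ^ l)"
  proof -
    have m: "(\<lambda>\<theta>. \<rho> \<theta> ^ l) \<in> borel_measurable \<nu>'" by (simp add: Q.measurable_\<nu>)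
    have "integrable \<nu>' (\<lambda>\<theta>. \<rho> \<theta> ^ l)"
    proof (subst integrable_iff_nn_integral_finite[OF m])
      show "AE \<theta> in \<nu>'. 0 \<le> \<rho> \<theta> ^ l" by (rule AE_I2) (simp add: Q.space_\<nu> \<rho>p less_imp_le)
    qed (rule st(10))
    then show ?thesis
      by (rule Bochner_Integration.integrable_cong[THEN iffD1, OF refl, rotated])
        (simp add: Q.space_\<nu> W0 \<rho>p less_imp_le)
  qed
  have "AE \<theta> in \<mu>. Q.PL \<theta> \<in> M_star_at l D \<nu>' Q.PL (PL \<theta>) (Exp (\<rho> \<theta>)) \<and> cond_A P M \<gamma> \<and>
      \<rho> \<theta> = exp (\<alpha> \<theta>) / (\<integral>\<omega>. W 0 \<omega> \<partial>PL \<theta>) \<and> cond_D_at D (K \<theta>) (PL \<theta>) (Q.PL \<theta>) (\<rho> \<theta>) \<gamma> \<and>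
      martingale_measure l D (Q.PL \<theta>) (V_at (PL \<theta>) \<gamma> \<alpha> \<theta>)"
    using rn st(7) \<rho>\<alpha> AE_mean AE_space
  proof eventually_elim
    case (elim \<theta>)
    then have \<theta>: "\<theta> \<in> D" by (simp add: local.space_\<nu>)
    note rn\<theta> = elim(1) and ac\<theta> = elim(2)
    note [measurable_cong] = sets_PL[OF \<theta>] sets_R
    have "r \<theta> \<in> borel_measurable (K \<theta>)" using rn\<theta> unfolding rn_density_def by blast
    then have g: "r \<theta> \<in> borel_measurable pos_borel"
      using measurable_cong_sets[OF sets_K[OF \<theta>] refl] by blast
    have Mt: "M_tilde (K \<theta>) (\<rho> \<theta>) \<gamma> (r \<theta>) t \<in> borel_measurable (PL \<theta>)" if "0 \<le> t" for t
      by (rule borel_measurable_PL[OF measurable_M_tilde[OF \<theta> g \<gamma> that] refl \<theta>])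
    note L = emeasure_PL_Filt[OF renewal_kernel_axioms Q.renewal_kernel_axioms \<theta> \<rho>p[OF \<theta>] refl rn\<theta> \<gamma> R']
    have Ap: "B \<in> sets (PL \<theta>)" if "B \<in> sets (Filt D t)" for B t
      using subsetD[OF Filt_subset_path that] by (simp add: sets_PL[OF \<theta>])
    have pe: "prog_equiv D (Q.PL \<theta>) (PL \<theta>)"
      unfolding prog_equiv_iff[OF Q.sets_PL[OF \<theta>] sets_PL[OF \<theta>]]
    proof (intro allI impI ballI)
      fix t :: real and B assume t: "0 \<le> t" and B: "B \<in> sets (Filt D t)"
      show "emeasure (Q.PL \<theta>) B = 0 \<longleftrightarrow> emeasure (PL \<theta>) B = 0"
        by (rule emeasure_density_null_iff[OF L[OF t B] Mt[OF t] Ap[OF B] AE_M_tilde(2)[OF \<theta> rn\<theta> \<rho>p[OF \<theta>] t ac\<theta>]])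
    qed
    interpret Q\<theta>: mixed_renewal D "\<lambda>\<theta>. Exp (\<rho> \<theta>)" R' "return (param_borel D) \<theta>"
      by (rule Q.mixed_renewal_return[OF \<theta>])
    have ret: "Q\<theta>.Q = Q.PL \<theta>" by (rule Q.mixed_return[OF \<theta>])
    have cls: "Q.PL \<theta> \<in> M_class_at l D (PL \<theta>) (Exp (\<rho> \<theta>))"
      unfolding M_class_at_def prob_on_def
      using Q.prob_PL[OF \<theta>] Q.sets_PL[OF \<theta>] pe Q.CRP_PL[OF \<theta>] Q\<theta>.integrable_X_power_iff[of l] st(9) ret by simp
    have m\<theta>: "(\<integral>\<omega>. W 0 \<omega> \<partial>PL \<theta>) = mean \<theta>"
    proof -
      have "(\<integral>\<omega>. W 0 \<omega> \<partial>PL \<theta>) = enn2real (\<integral>\<^sup>+\<omega>. ennreal (W 0 \<omega>) \<partial>PL \<theta>)"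
      proof (rule integral_eq_nn_integral)
        show "AE \<omega> in PL \<theta>. 0 \<le> W 0 \<omega>"
          by (rule AE_I2) (simp add: space_PL[OF \<theta>] path_space_pos(1) less_imp_le)
      qed measurable
      also have "(\<integral>\<^sup>+\<omega>. ennreal (W 0 \<omega>) \<partial>PL \<theta>) = (\<integral>\<^sup>+w. ennreal w \<partial>K \<theta>)"
        by (rule nn_integral_PL_W[OF \<theta>]) measurable
      finally show ?thesis by (simp add: mean_def)
    qed
    have dat: "cond_D_at D (K \<theta>) (PL \<theta>) (Q.PL \<theta>) (\<rho> \<theta>) \<gamma>"
      unfolding cond_D_at_def
    proof (intro exI[of _ "r \<theta>"] conjI rn\<theta> allI impI ballI)
      fix s t B assume "0 \<le> s \<and> s \<le> t" and B': "B \<in> sets (Filt D s)"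
      then have s: "s \<le> t" and t: "0 \<le> t" by simp_all
      have B: "B \<in> sets (Filt D t)" by (rule subsetD[OF Filt_mono[OF s] B'])
      show "measure (Q.PL \<theta>) B = (LINT \<omega>:B|PL \<theta>. M_tilde (K \<theta>) (\<rho> \<theta>) \<gamma> (r \<theta>) t \<omega>)"
        by (rule measure_eq_set_integral[OF L[OF t B] Mt[OF t] Ap[OF B] AE_M_tilde(1)[OF \<theta> rn\<theta> \<rho>p[OF \<theta>] t]])
    qed
    have mg: "martingale_measure l D (Q.PL \<theta>) (V_at (PL \<theta>) \<gamma> \<alpha> \<theta>)"
    proof -
      define c where "c = (\<integral>\<omega>'. X 0 \<omega>' * exp (\<gamma> (X 0 \<omega>') + \<alpha> \<theta>) \<partial>PL \<theta>) / (\<integral>\<omega>'. W 0 \<omega>' \<partial>PL \<theta>)"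
      have V: "V_at (PL \<theta>) \<gamma> \<alpha> \<theta> = (\<lambda>t \<omega>. S t \<omega> - t * c)" by (intro ext) (simp add: V_at_def c_def)
      have "(\<integral>\<omega>'. X 0 \<omega>' * exp (\<gamma> (X 0 \<omega>') + \<alpha> \<theta>) \<partial>PL \<theta>) =
          enn2real (\<integral>\<^sup>+\<omega>'. ennreal (X 0 \<omega>' * exp (\<gamma> (X 0 \<omega>') + \<alpha> \<theta>)) \<partial>PL \<theta>)"
      proof (rule integral_eq_nn_integral)
        show "AE \<omega> in PL \<theta>. 0 \<le> X 0 \<omega> * exp (\<gamma> (X 0 \<omega>) + \<alpha> \<theta>)"
          by (rule AE_I2) (simp add: space_PL[OF \<theta>] path_space_pos(2) less_imp_le)
      qed measurable
      also have "(\<integral>\<^sup>+\<omega>'. ennreal (X 0 \<omega>' * exp (\<gamma> (X 0 \<omega>') + \<alpha> \<theta>)) \<partial>PL \<theta>) =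
          (\<integral>\<^sup>+x. ennreal (x * exp (\<gamma> x + \<alpha> \<theta>)) \<partial>R)"
        by (rule nn_integral_PL_X[OF \<theta>]) measurable
      also have "\<dots> = (\<integral>\<^sup>+x. ennreal (exp (\<alpha> \<theta>)) * (ennreal (exp (\<gamma> x)) * ennreal x) \<partial>R)"
        by (intro nn_integral_cong) (simp add: space_R ennreal_mult'[symmetric] exp_add mult_ac)
      also have "\<dots> = ennreal (exp (\<alpha> \<theta>)) * (\<integral>\<^sup>+x. ennreal (exp (\<gamma> x)) * ennreal x \<partial>R)"
        by (rule nn_integral_cmult) measurable
      also have "(\<integral>\<^sup>+x. ennreal (exp (\<gamma> x)) * ennreal x \<partial>R) = (\<integral>\<^sup>+x. ennreal x \<partial>R')"
        unfolding R' by (rule nn_integral_density[symmetric]) measurable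
      finally have c: "c = enn2real (\<integral>\<^sup>+x. ennreal x \<partial>R') * \<rho> \<theta>"
        unfolding c_def m\<theta> using elim(3) by (simp add: enn2real_mult)
      have "martingale_measure l D Q\<theta>.Q (\<lambda>t \<omega>. S t \<omega> - t * c)"
      proof (rule Q\<theta>.martingale_mixed[OF \<rho> refl l st(9)])
        have "(\<integral>\<^sup>+\<theta>'. ennreal (\<rho> \<theta>' ^ l) \<partial>return (param_borel D) \<theta>) = ennreal (\<rho> \<theta> ^ l)"
          using \<theta> by (intro nn_integral_return) simp_all
        then show "(\<integral>\<^sup>+\<theta>'. ennreal (\<rho> \<theta>' ^ l) \<partial>return (param_borel D) \<theta>) < \<infinity>" by simp
        show "AE \<omega> in Q\<theta>.Q. c = enn2real (\<integral>\<^sup>+x. ennreal x \<partial>R') * \<rho> (Theta \<omega>)"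
          unfolding ret using Q.AE_PL_Theta[OF \<theta>] by eventually_elim (simp add: c)
      qed simp
      then show ?thesis by (simp only: V ret)
    qed
    have "Q.PL \<theta> \<in> M_star_at l D \<nu>' Q.PL (PL \<theta>) (Exp (\<rho> \<theta>))"
      unfolding M_star_at_def using cls fam1 fam2 \<theta> by blast
    then show ?case using A elim(3) m\<theta> dat mg by simp
  qed
  then obtain L where L: "{\<theta> \<in> space \<mu>. \<not> (Q.PL \<theta> \<in> M_star_at l D \<nu>' Q.PL (PL \<theta>) (Exp (\<rho> \<theta>)) \<and> cond_A P M \<gamma> \<and>
      \<rho> \<theta> = exp (\<alpha> \<theta>) / (\<integral>\<omega>. W 0 \<omega> \<partial>PL \<theta>) \<and> cond_D_at D (K \<theta>) (PL \<theta>) (Q.PL \<theta>) (\<rho> \<theta>) \<gamma> \<and>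
      martingale_measure l D (Q.PL \<theta>) (V_at (PL \<theta>) \<gamma> \<alpha> \<theta>))} \<subseteq> L" "emeasure \<mu> L = 0" "L \<in> sets \<mu>"
    by (rule AE_E)
  then have Ln: "L \<in> null_sets (distr P (param_borel D) Theta)"
    unfolding local.distr_Q_Theta by (intro null_setsI)
  show ?thesis
    unfolding \<nu>'_def[symmetric]
  proof (intro exI[of _ "Q.PL"] conjI allI impI rc co)
    fix Qf' assume "rcp D M Qf' \<and> consistent D M Qf'"
    then show "\<exists>L'\<in>null_sets \<nu>'. \<forall>\<theta>\<in>D - L'. Qf' \<theta> = Q.PL \<theta>" using un by blast
  next
    show "\<exists>L\<in>null_sets (distr P (param_borel D) Theta). \<forall>\<theta>\<in>D - L.
      Q.PL \<theta> \<in> M_star_at l D \<nu>' Q.PL (PL \<theta>) (Exp (\<rho> \<theta>)) \<and> cond_A P M \<gamma> \<and>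
      \<rho> \<theta> = exp (\<alpha> \<theta>) / (\<integral>\<omega>. W 0 \<omega> \<partial>PL \<theta>) \<and> cond_D_at D (K \<theta>) (PL \<theta>) (Q.PL \<theta>) (\<rho> \<theta>) \<gamma> \<and>
      martingale_measure l D (Q.PL \<theta>) (V_at (PL \<theta>) \<gamma> \<alpha> \<theta>)"
    proof (rule bexI[OF _ Ln], rule ballI)
      fix \<theta> assume "\<theta> \<in> D - L"
      then have "\<theta> \<in> space \<mu>" "\<theta> \<notin> L" by (simp_all add: local.space_\<nu>)
      with L(1) show "Q.PL \<theta> \<in> M_star_at l D \<nu>' Q.PL (PL \<theta>) (Exp (\<rho> \<theta>)) \<and> cond_A P M \<gamma> \<and>
        \<rho> \<theta> = exp (\<alpha> \<theta>) / (\<integral>\<omega>. W 0 \<omega> \<partial>PL \<theta>) \<and> cond_D_at D (K \<theta>) (PL \<theta>) (Q.PL \<theta>) (\<rho> \<theta>) \<gamma> \<and>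
        martingale_measure l D (Q.PL \<theta>) (V_at (PL \<theta>) \<gamma> \<alpha> \<theta>)" by blast
    qed
  qed
qed

end

theorem theorem3p4:
  fixes D :: "(real ^ 'd::finite) set" and \<mu> :: "(real ^ 'd) measure" and R :: "real measure"
    and K :: "real ^ 'd \<Rightarrow> real measure" and P :: "'d path measure" and l :: nat
  assumes "\<mu> \<in> space (prob_algebra (param_borel D))"
    and "R \<in> space (prob_algebra pos_borel)"
    and "K \<in> param_borel D \<rightarrow>\<^sub>M prob_algebra pos_borel"
    and "P = mixed_law D \<mu> K R"
    and "l \<in> {1, 2}"
    and "P \<in> M_star l D P K"
  shows
    "(\<forall>\<rho> Q. \<rho> \<in> M_plus D \<and> Q \<in> M_star l D P (\<lambda>\<theta>. Exp (\<rho> \<theta>)) \<longrightarrow>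
        (\<exists>\<gamma> \<alpha> \<xi>. (\<gamma>, \<alpha>) \<in> F_class l D P \<and> \<xi> \<in> R_star l D P \<alpha> \<and>
           cond_A P Q \<gamma> \<and> cond_B D P Q \<xi> \<and> cond_C D P \<rho> \<alpha> \<and> cond_D D K P Q \<rho> \<gamma> \<xi> \<and>
           martingale_measure l D Q (V D P \<gamma> \<alpha>) \<and>
           (\<forall>\<gamma>' \<alpha>' \<xi>'. (\<gamma>', \<alpha>') \<in> F_class l D P \<and> \<xi>' \<in> R_star l D P \<alpha>' \<and>
              cond_A P Q \<gamma>' \<and> cond_B D P Q \<xi>' \<and> cond_C D P \<rho> \<alpha>' \<and> cond_D D K P Q \<rho> \<gamma>' \<xi>' \<longrightarrow>
              (AE x in distr P pos_borel (X 0). \<gamma>' x = \<gamma> x) \<and>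
              (AE \<theta> in distr P (param_borel D) Theta. \<alpha>' \<theta> = \<alpha> \<theta>) \<and>
              (AE \<theta> in distr P (param_borel D) Theta. \<xi>' \<theta> = \<xi> \<theta>))))
     \<and>
     ((AE \<theta> in distr P (param_borel D) Theta. \<forall>b>0. equiv_measure (K \<theta>) (Exp b)) \<longrightarrow>
      (\<forall>\<gamma> \<alpha> \<xi>. (\<gamma>, \<alpha>) \<in> F_class l D P \<and> \<xi> \<in> R_star l D P \<alpha> \<longrightarrow>
        (\<exists>\<rho> Q. \<rho> \<in> M_plus D \<and> Q \<in> M_star l D P (\<lambda>\<theta>. Exp (\<rho> \<theta>)) \<and>
           cond_C D P \<rho> \<alpha> \<and> cond_D D K P Q \<rho> \<gamma> \<xi> \<and> cond_A P Q \<gamma> \<and> cond_B D P Q \<xi> \<and>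
           martingale_measure l D Q (V D P \<gamma> \<alpha>) \<and>
           (\<forall>\<rho>' Q'. \<rho>' \<in> M_plus D \<and> Q' \<in> prob_on (path_space D) \<and>
              cond_C D P \<rho>' \<alpha> \<and> cond_D D K P Q' \<rho>' \<gamma> \<xi> \<longrightarrow>
              (AE \<theta> in distr P (param_borel D) Theta. \<rho>' \<theta> = \<rho> \<theta>) \<and> Q' = Q))))
     \<and>
     (\<forall>\<rho> Q \<gamma> \<alpha> \<xi>. \<rho> \<in> M_plus D \<and> Q \<in> M_star l D P (\<lambda>\<theta>. Exp (\<rho> \<theta>)) \<and>
        (\<gamma>, \<alpha>) \<in> F_class l D P \<and> \<xi> \<in> R_star l D P \<alpha> \<and>
        cond_A P Q \<gamma> \<and> cond_B D P Q \<xi> \<and> cond_C D P \<rho> \<alpha> \<and> cond_D D K P Q \<rho> \<gamma> \<xi> \<longrightarrow>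
        (\<exists>Qf. rcp D Q Qf \<and> consistent D Q Qf \<and>
           (\<forall>Qf'. rcp D Q Qf' \<and> consistent D Q Qf' \<longrightarrow>
              (\<exists>L'\<in>null_sets (distr Q (param_borel D) Theta). \<forall>\<theta>\<in>D - L'. Qf' \<theta> = Qf \<theta>)) \<and>
           (\<exists>L\<in>null_sets (distr P (param_borel D) Theta). \<forall>\<theta>\<in>D - L.
              Qf \<theta> \<in> M_star_at l D (distr Q (param_borel D) Theta) Qf
                       (path_law D K R \<theta>) (Exp (\<rho> \<theta>)) \<and>
              cond_A P Q \<gamma> \<and>
              \<rho> \<theta> = exp (\<alpha> \<theta>) / (\<integral>\<omega>. W 0 \<omega> \<partial>path_law D K R \<theta>) \<and>
              cond_D_at D (K \<theta>) (path_law D K R \<theta>) (Qf \<theta>) (\<rho> \<theta>) \<gamma> \<and>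
              martingale_measure l D (Qf \<theta>) (V_at (path_law D K R \<theta>) \<gamma> \<alpha> \<theta>))))"
proof -
  interpret mr: mixed_renewal D K R \<mu>
    by (simp add: mixed_renewal_def mixed_renewal_axioms_def renewal_kernel_def assms(1-3))
  note P = assms(4)
  have "AE \<omega> in mr.Q. cexp_W D mr.Q \<omega> < \<infinity>" using assms(6) by (simp add: M_star_def P)
  then have "AE \<omega> in mr.Q. (\<integral>\<^sup>+w. ennreal w \<partial>K (Theta \<omega>)) < \<infinity>"
    using mr.cexp_W_Q by eventually_elim simp
  moreover have "Measurable.pred (param_borel D) (\<lambda>\<theta>. (\<integral>\<^sup>+w. ennreal w \<partial>K \<theta>) < \<infinity>)"
    using mr.measurable_mean by measurable
  ultimately have "AE \<theta> in \<mu>. (\<integral>\<^sup>+w. ennreal w \<partial>K \<theta>) < \<infinity>"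
    using mr.AE_\<nu>_Q by blast
  then interpret reference_law D K R \<mu> l
    by unfold_locales (use assms(5) in simp_all)
  show ?thesis
    unfolding P
  proof (intro conjI allI impI, goal_cases)
    case (1 \<rho> M)
    then have \<rho>: "\<rho> \<in> M_plus D" and M: "M \<in> M_star l D mr.Q (\<lambda>\<theta>. Exp (\<rho> \<theta>))" by blast+
    obtain \<gamma> \<alpha> \<xi> where e: "(\<gamma>, \<alpha>) \<in> F_class l D mr.Q" "\<xi> \<in> R_star l D mr.Q \<alpha>" "cond_A mr.Q M \<gamma>"
      "cond_B D mr.Q M \<xi>" "cond_C D mr.Q \<rho> \<alpha>" "cond_D D K mr.Q M \<rho> \<gamma> \<xi>"
      "martingale_measure l D M (V D mr.Q \<gamma> \<alpha>)"
      using exponential_change_exists[OF \<rho> M] by blast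
    note u = exponential_change_unique[OF \<rho> e(1,3-5)]
    show ?case
    proof (rule exI[of _ \<gamma>], rule exI[of _ \<alpha>], rule exI[of _ \<xi>], intro conjI e allI impI, goal_cases)
      case (1 \<gamma>' \<alpha>' \<xi>')
      then show ?case by (elim conjE) (rule u(1))
    next
      case (2 \<gamma>' \<alpha>' \<xi>')
      then show ?case by (elim conjE) (rule u(2))
    next
      case (3 \<gamma>' \<alpha>' \<xi>')
      then show ?case by (elim conjE) (rule u(3))
    qed
  next
    case (2 \<gamma> \<alpha> \<xi>)
    have "AE \<theta> in \<mu>. \<forall>b>0. equiv_measure (K \<theta>) (Exp b)" using 2(1) by (simp only: mr.distr_Q_Theta)
    moreover have "(\<gamma>, \<alpha>) \<in> F_class l D mr.Q" "\<xi> \<in> R_star l D mr.Q \<alpha>" using 2(2) by blast+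
    ultimately show ?case by (rule exponential_law_exists)
  next
    case (3 \<rho> M \<gamma> \<alpha> \<xi>)
    then have "\<rho> \<in> M_plus D" "M \<in> M_star l D mr.Q (\<lambda>\<theta>. Exp (\<rho> \<theta>))" "(\<gamma>, \<alpha>) \<in> F_class l D mr.Q"
      "cond_A mr.Q M \<gamma>" "cond_C D mr.Q \<rho> \<alpha>" by blast+
    then show ?case by (rule exponential_disintegration)
  qed
qed

end
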